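(* Let $\mathbf{C}\subset[0,1]$ be the middle-third Cantor set, let $\mathcal{R}:=\bigcup\{\mathbf{C}+\frac{k}{3^n} : k,n\in\mathbb{Z}\}$, let $\mathcal{H}^s$ be the Hausdorff measure of dimension $s=\log_3 2$ restricted to $\mathcal{R}$, and let $\mathcal{H}:=L^2(\mathcal{R},\mathcal{H}^s)$. Define the unitary operators on $\mathcal{H}$ $$Uf(x)=\frac{1}{\sqrt2}f\left(\frac{x}{3}\right),\qquad Tf(x)=f(x-1),$$ and define the representation $\pi$ of $L^\infty(\mathbb{T})$ on $\mathcal{H}$ by Borel functional calculus, $\pi(f)=f(T)$ for $f\in L^\infty(\mathbb{T})$. Then this representation, which with $\varphi:=\chi_{\mathbf{C}}$ is the wavelet representation associated to the map $r(z)=z^3$ on $\mathbb{T}$ with Haar measure and the QMF filter $m_0(z)=(1+z^2)/\sqrt2$, is not irreducible (i.e. it is reducible).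
   Context: $\mathbb{T}=\{z\in\mathbb{C}:|z|=1\}$ is the unit circle with Haar measure $\mu$, and $L^\infty(\mathbb{T})=L^\infty(\mathbb{T},\mu)$. A function $m_0\in L^\infty(\mathbb{T})$ is a QMF filter for $r(z)=z^3$ if $\frac13\sum_{w^3=z}|m_0(w)|^2=1$ for $\mu$-a.e. $z\in\mathbb{T}$. The wavelet representation associated to $m_0$ is the quadruple $(\mathcal{H},U,\pi,\varphi)$, unique up to isomorphism, consisting of a Hilbert space $\mathcal{H}$, a unitary $U$ on $\mathcal{H}$, a representation $\pi$ of $L^\infty(\mathbb{T})$ on $\mathcal{H}$ and $\varphi\in\mathcal{H}$ such that: $U\pi(f)U^{-1}=\pi(f\circ r)$ for all $f\in L^\infty(\mathbb{T})$; $U\varphi=\pi(m_0)\varphi$; $\langle\pi(f)\varphi,\varphi\rangle=\int f\,d\mu$ for all $f\in L^\infty(\mathbb{T})$; and $\{U^{-n}\pi(f)\varphi: n\in\mathbb{N}, f\in L^\infty(\mathbb{T})\}$ is dense in $\mathcal{H}$. It is known that the quadruple on $L^2(\mathcal{R},\mathcal{H}^s)$ described in the claim is the wavelet representation for $m_0(z)=(1+z^2)/\sqrt2$. The representation is irreducible if the only closed subspaces of $\mathcal{H}$ invariant under $U$, $U^{-1}$ and all $\pi(f)$, $f\in L^\infty(\mathbb{T})$, are $\{0\}$ and $\mathcal{H}$ (equivalently, the commutant of $\{U,\pi(f)\}$ is $\mathbb{C}I$); otherwise it is reducible. *)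

theory Defs
  imports "HOL-Analysis.Analysis"
begin

section \<open>Hausdorff measure\<close>

text \<open>
  The unnormalised Hausdorff measure of dimension \<open>s > 0\<close> (the convention \<open>0 powr 0 = 0\<close> makes
  the definition unsuitable for \<open>s = 0\<close>). Covering sets are required to be bounded because
  \<^const>\<open>diameter\<close> is only meaningful for bounded sets; an infimum over no covers is \<open>\<infinity>\<close>.
\<close>

definition hausdorff_content :: "real \<Rightarrow> real \<Rightarrow> 'a::metric_space set \<Rightarrow> ennreal" where
  "hausdorff_content s \<delta> A =
     (INF B \<in> {B :: nat \<Rightarrow> 'a set. A \<subseteq> (\<Union>i. B i) \<and> (\<forall>i. bounded (B i) \<and> diameter (B i) \<le> \<delta>)}.
        \<Sum>i. ennreal (diameter (B i) powr s))"

definition hausdorff_outer :: "real \<Rightarrow> 'a::metric_space set \<Rightarrow> ennreal" where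
  "hausdorff_outer s A = (SUP \<delta> \<in> {0<..}. hausdorff_content s \<delta> A)"

definition hausdorff_measure :: "real \<Rightarrow> 'a::metric_space measure" where
  "hausdorff_measure s = measure_of UNIV (sets borel) (hausdorff_outer s)"


section \<open>The Hilbert space of square-integrable functions\<close>

text \<open>
  Elements of \<open>L\<^sup>2(M)\<close> are represented by functions, and equality in \<open>L\<^sup>2(M)\<close> is equality almost
  everywhere. Accordingly, an operator is a map on representatives, and all identities between
  vectors (including linearity) are required almost everywhere only; boundedness together with
  linearity forces an operator to respect almost everywhere equality. Subspaces are sets of
  representatives, and closedness in the seminorm includes closure under almost everywhere equality.
\<close>

definition L2 :: "'a measure \<Rightarrow> ('a \<Rightarrow> complex) set" where
  "L2 M = {f \<in> borel_measurable M. integrable M (\<lambda>x. (cmod (f x))\<^sup>2)}"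

definition L2_eq :: "'a measure \<Rightarrow> ('a \<Rightarrow> complex) \<Rightarrow> ('a \<Rightarrow> complex) \<Rightarrow> bool" where
  "L2_eq M f g \<longleftrightarrow> (AE x in M. f x = g x)"

definition L2_inner :: "'a measure \<Rightarrow> ('a \<Rightarrow> complex) \<Rightarrow> ('a \<Rightarrow> complex) \<Rightarrow> complex" where
  "L2_inner M f g = (LINT x|M. f x * cnj (g x))"

definition L2_norm :: "'a measure \<Rightarrow> ('a \<Rightarrow> complex) \<Rightarrow> real" where
  "L2_norm M f = sqrt (LINT x|M. (cmod (f x))\<^sup>2)"

type_synonym 'a L2_map = "('a \<Rightarrow> complex) \<Rightarrow> ('a \<Rightarrow> complex)"

definition L2_operator :: "'a measure \<Rightarrow> 'a L2_map \<Rightarrow> bool" where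
  "L2_operator M A \<longleftrightarrow>
     (\<forall>f\<in>L2 M. A f \<in> L2 M) \<and>
     (\<forall>f\<in>L2 M. \<forall>g\<in>L2 M. \<forall>a. L2_eq M (A (\<lambda>x. a * f x + g x)) (\<lambda>x. a * A f x + A g x)) \<and>
     (\<exists>K. \<forall>f\<in>L2 M. L2_norm M (A f) \<le> K * L2_norm M f)"

definition L2_unitary :: "'a measure \<Rightarrow> 'a L2_map \<Rightarrow> bool" where
  "L2_unitary M U \<longleftrightarrow>
     L2_operator M U \<and>
     (\<forall>f\<in>L2 M. \<forall>g\<in>L2 M. L2_inner M (U f) (U g) = L2_inner M f g) \<and>
     (\<forall>g\<in>L2 M. \<exists>f\<in>L2 M. L2_eq M (U f) g)"

definition L2_inv :: "'a measure \<Rightarrow> 'a L2_map \<Rightarrow> 'a L2_map" where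
  "L2_inv M U g = (SOME f. f \<in> L2 M \<and> L2_eq M (U f) g)"

definition L2_closed_subspace :: "'a measure \<Rightarrow> ('a \<Rightarrow> complex) set \<Rightarrow> bool" where
  "L2_closed_subspace M S \<longleftrightarrow>
     S \<subseteq> L2 M \<and> (\<lambda>x. 0) \<in> S \<and>
     (\<forall>f\<in>S. \<forall>g\<in>S. \<forall>a. (\<lambda>x. a * f x + g x) \<in> S) \<and>
     (\<forall>F f. (\<forall>n. F n \<in> S) \<and> f \<in> L2 M \<and> (\<lambda>n. L2_norm M (\<lambda>x. F n x - f x)) \<longlonglongrightarrow> 0 \<longrightarrow> f \<in> S)"


section \<open>The circle\<close>

definition circle_borel :: "complex measure" where
  "circle_borel = restrict_space borel (sphere 0 1)"

definition circle_haar :: "complex measure" where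
  "circle_haar = distr (uniform_measure lborel {0..<1}) circle_borel (\<lambda>t. cis (2 * pi * t))"

definition circle_Linf :: "(complex \<Rightarrow> complex) set" where
  "circle_Linf = {f \<in> borel_measurable circle_haar. \<exists>c. AE z in circle_haar. cmod (f z) \<le> c}"


section \<open>Borel functional calculus of a unitary operator\<close>

text \<open>
  The spectral measure of a unitary \<open>T\<close> at a vector \<open>\<xi>\<close> is the finite Borel measure \<open>\<nu>\<close> on the
  circle with \<open>\<integral> z\<^sup>n d\<nu> = \<langle>T\<^sup>n \<xi>, \<xi>\<rangle>\<close>. The condition for negative \<open>n\<close> is the complex conjugate of
  the one for positive \<open>n\<close>, so it suffices to impose it for natural numbers. The operator \<open>f(T)\<close> is
  then given by \<open>\<langle>f(T) \<xi>, \<xi>\<rangle> = \<integral> f d\<nu>\<close> for all \<open>\<xi>\<close>, which by polarisation determines it almost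
  everywhere; the choice made by \<open>L2_calculus\<close> is between almost everywhere equal representatives.
\<close>

definition is_spectral_measure_at ::
    "'a measure \<Rightarrow> 'a L2_map \<Rightarrow> ('a \<Rightarrow> complex) \<Rightarrow> complex measure \<Rightarrow> bool" where
  "is_spectral_measure_at M T \<xi> \<nu> \<longleftrightarrow>
     finite_measure \<nu> \<and> sets \<nu> = sets circle_borel \<and>
     (\<forall>n::nat. (LINT z|\<nu>. z ^ n) = L2_inner M ((T ^^ n) \<xi>) \<xi>)"

definition is_L2_calculus ::
    "'a measure \<Rightarrow> 'a L2_map \<Rightarrow> (complex \<Rightarrow> complex) \<Rightarrow> 'a L2_map \<Rightarrow> bool" where
  "is_L2_calculus M T f A \<longleftrightarrow>
     L2_operator M A \<and>
     (\<forall>\<xi>\<in>L2 M. \<exists>\<nu>. is_spectral_measure_at M T \<xi> \<nu> \<and> integrable \<nu> f \<and>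
        L2_inner M (A \<xi>) \<xi> = (LINT z|\<nu>. f z))"

definition L2_calculus :: "'a measure \<Rightarrow> 'a L2_map \<Rightarrow> (complex \<Rightarrow> complex) \<Rightarrow> 'a L2_map" where
  "L2_calculus M T f = (SOME A. is_L2_calculus M T f A)"


section \<open>Wavelet representations for the map \<open>z \<mapsto> z\<^sup>3\<close>\<close>

definition qmf_filter :: "(complex \<Rightarrow> complex) \<Rightarrow> bool" where
  "qmf_filter m0 \<longleftrightarrow>
     m0 \<in> circle_Linf \<and>
     (AE z in circle_haar. (1/3) * (\<Sum>w\<in>{w. w ^ 3 = z}. (cmod (m0 w))\<^sup>2) = 1)"

definition Linf_representation ::
    "'a measure \<Rightarrow> ((complex \<Rightarrow> complex) \<Rightarrow> 'a L2_map) \<Rightarrow> bool" where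
  "Linf_representation M \<pi> \<longleftrightarrow>
     (\<forall>f\<in>circle_Linf. L2_operator M (\<pi> f)) \<and>
     (\<forall>f\<in>circle_Linf. \<forall>g\<in>circle_Linf. \<forall>\<xi>\<in>L2 M.
        (AE z in circle_haar. f z = g z) \<longrightarrow> L2_eq M (\<pi> f \<xi>) (\<pi> g \<xi>)) \<and>
     (\<forall>\<xi>\<in>L2 M. L2_eq M (\<pi> (\<lambda>z. 1) \<xi>) \<xi>) \<and>
     (\<forall>f\<in>circle_Linf. \<forall>g\<in>circle_Linf. \<forall>a. \<forall>\<xi>\<in>L2 M.
        L2_eq M (\<pi> (\<lambda>z. a * f z + g z) \<xi>) (\<lambda>x. a * \<pi> f \<xi> x + \<pi> g \<xi> x)) \<and>
     (\<forall>f\<in>circle_Linf. \<forall>g\<in>circle_Linf. \<forall>\<xi>\<in>L2 M.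
        L2_eq M (\<pi> (\<lambda>z. f z * g z) \<xi>) (\<pi> f (\<pi> g \<xi>))) \<and>
     (\<forall>f\<in>circle_Linf. \<forall>\<xi>\<in>L2 M. \<forall>\<eta>\<in>L2 M.
        L2_inner M (\<pi> f \<xi>) \<eta> = L2_inner M \<xi> (\<pi> (\<lambda>z. cnj (f z)) \<eta>))"

definition wavelet_representation ::
    "(complex \<Rightarrow> complex) \<Rightarrow> 'a measure \<Rightarrow> 'a L2_map \<Rightarrow>
     ((complex \<Rightarrow> complex) \<Rightarrow> 'a L2_map) \<Rightarrow> ('a \<Rightarrow> complex) \<Rightarrow> bool" where
  "wavelet_representation m0 M U \<pi> \<phi> \<longleftrightarrow>
     qmf_filter m0 \<and> L2_unitary M U \<and> Linf_representation M \<pi> \<and> \<phi> \<in> L2 M \<and>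
     (\<forall>f\<in>circle_Linf. \<forall>\<xi>\<in>L2 M. L2_eq M (U (\<pi> f (L2_inv M U \<xi>))) (\<pi> (\<lambda>z. f (z ^ 3)) \<xi>)) \<and>
     L2_eq M (U \<phi>) (\<pi> m0 \<phi>) \<and>
     (\<forall>f\<in>circle_Linf. L2_inner M (\<pi> f \<phi>) \<phi> = (LINT z|circle_haar. f z)) \<and>
     (\<forall>\<xi>\<in>L2 M. \<forall>\<epsilon>>0. \<exists>n::nat. \<exists>f\<in>circle_Linf.
        L2_norm M (\<lambda>x. (L2_inv M U ^^ n) (\<pi> f \<phi>) x - \<xi> x) < \<epsilon>)"

definition irreducible_representation ::
    "'a measure \<Rightarrow> 'a L2_map \<Rightarrow> ((complex \<Rightarrow> complex) \<Rightarrow> 'a L2_map) \<Rightarrow> bool" where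
  "irreducible_representation M U \<pi> \<longleftrightarrow>
     (\<forall>S. L2_closed_subspace M S \<and>
        (\<forall>\<xi>\<in>S. U \<xi> \<in> S \<and> L2_inv M U \<xi> \<in> S \<and> (\<forall>f\<in>circle_Linf. \<pi> f \<xi> \<in> S)) \<longrightarrow>
        S = {\<xi> \<in> L2 M. L2_eq M \<xi> (\<lambda>x. 0)} \<or> S = L2 M)"


section \<open>The representation on the Cantor set\<close>

fun cantor_stage :: "nat \<Rightarrow> real set" where
  "cantor_stage 0 = {0..1}"
| "cantor_stage (Suc n) =
     (\<lambda>x. x / 3) ` cantor_stage n \<union> (\<lambda>x. 2/3 + x / 3) ` cantor_stage n"

definition cantor_set :: "real set" where
  "cantor_set = (\<Inter>n. cantor_stage n)"

definition triadic_cantor :: "real set" where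
  "triadic_cantor =
     (\<Union>k::int. \<Union>n::int. (\<lambda>x. x + of_int k / 3 powi n) ` cantor_set)"

definition cantor_measure :: "real measure" where
  "cantor_measure = restrict_space (hausdorff_measure (log 3 2)) triadic_cantor"

definition cantor_U :: "real L2_map" where
  "cantor_U f = (\<lambda>x. of_real (1 / sqrt 2) * f (x / 3))"

definition cantor_T :: "real L2_map" where
  "cantor_T f = (\<lambda>x. f (x - 1))"

definition cantor_rep :: "(complex \<Rightarrow> complex) \<Rightarrow> real L2_map" where
  "cantor_rep f = L2_calculus cantor_measure cantor_T f"

end

theory Submission
  imports Defs
begin

text \<open>
  Write \<open>H = L\<^sup>2(R, \<mu>)\<close> with \<open>\<mu>\<close> the Hausdorff measure, \<open>\<phi>\<close> for the indicator of the Cantor set \<open>C\<close> and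
  \<open>m\<close> for the filter. The claim has two halves: the data form the wavelet representation of \<open>m\<close>, and
  this representation has a nontrivial closed invariant subspace.

  \<^bold>\<open>The representation.\<close> Borel sets of the line are Caratheodory measurable for the Hausdorff outer
  measure (\<open>hausdorff_outer_split\<close>), integer translations preserve \<open>\<mu>\<close> and tripling doubles it
  (\<open>hausdorff_outer_affine\<close>), and \<open>\<mu>(C) = 1\<close>, the lower bound because the Cantor function maps \<open>C\<close>
  onto the unit interval and is Hoelder continuous with exponent \<open>log 3 2\<close> and constant one
  (\<open>cantor_outer_ge\<close>). Hence \<open>U\<close> and \<open>T\<close> are unitary. The functional calculus of \<open>T\<close> is built from
  trigonometric polynomials. For such a polynomial \<open>p\<close> the operator \<open>p(T)\<close> is a finite combination of
  translations. For \<open>\<xi>\<close> with bounded support, \<open>\<langle>p(T) \<xi>, \<xi>\<rangle>\<close> is the Haar integral of \<open>p\<close> against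
  a trigonometric polynomial (\<open>bsupp_spectral_density\<close>), because far translates of \<open>\<xi>\<close> are orthogonal
  to \<open>\<xi>\<close>. This gives the contraction estimate \<open>trig_op_norm_le\<close> and shows that \<open>p(T) \<xi>\<close> depends
  continuously on \<open>p\<close> in the norm of \<open>L\<^sup>2\<close>(Haar) as long as \<open>p\<close> stays bounded, so that
  \<open>f(T)\<close> can be defined by bounded approximation in \<open>L\<^sup>2\<close>(Haar). The numbers \<open>\<parallel>1\<^sub>B(T) \<xi>\<parallel>\<^sup>2\<close> form the spectral
  measure, which is determined by its moments (\<open>circle_measure_eqI\<close>). All relations between
  \<open>U\<close> and \<open>f(T)\<close> are inherited from trigonometric polynomials. Finally \<open>\<phi>\<close> is cyclic: by
  self-similarity the indicators of \<open>C \<inter> {..a}\<close> can be approximated with geometric speed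
  (\<open>cantor_set_cut_approx\<close>), so every function on \<open>C\<close> is in the cyclic space, and
  dilations and translations of \<open>C\<close> exhaust \<open>R\<close>.

  \<^bold>\<open>Reducibility.\<close> Iterating \<open>U \<phi> = m(T) \<phi>\<close> and \<open>U f(T) = f\<^sup>*(T) U\<close> with \<open>f\<^sup>*(z) = f(z\<^sup>3)\<close> shows that
  \<open>f(T) U\<^sup>n \<phi>\<close> has norm square \<open>\<integral> \<bar>f\<bar>\<^sup>2 R\<^sub>n\<close>, where \<open>R\<^sub>n\<close> is the Riesz product of the factors
  \<open>\<bar>m(z^(3^i))\<bar>\<^sup>2\<close>, \<open>i < n\<close>. Thus \<open>H\<close> is the \<open>L\<^sup>2\<close> space of a measure on the two-sided orbits of
  \<open>z \<mapsto> z\<^sup>3\<close> (the solenoid) on which \<open>U\<close> is a weighted shift, and shift-invariant sets of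
  orbits give invariant subspaces. The square roots of the Riesz products have integrals decaying like
  \<open>(23/24)^n\<close> (\<open>abs_filter_decay\<close>), which makes the shift dissipative: along almost every orbit the
  Riesz density attains its maximum, and the position of the maximum picks one point from the
  orbit. The set of these points meets every orbit in at most one point, so the orbits of each of its
  subsets form a shift-invariant set. The symmetry \<open>z \<mapsto> -z\<close>, which preserves \<open>R\<^sub>n\<close>
  because the filter is a function of \<open>z\<^sup>2\<close>, cuts it into two halves of equal mass. The orbits of
  the two halves are disjoint invariant sets of positive measure.

  The argument is carried out without the solenoid. The set of maxima is replaced by the
  sets \<open>peak N\<close> of those \<open>z\<close> at which \<open>n \<mapsto> R\<^sub>n(z)\<close> has at time \<open>N\<close> a maximum over a window of radius \<open>N\<close>.
  Their mass \<open>\<integral> 1\<^sub>P R\<^sub>N\<close> stays above a positive constant (\<open>peak_mass_lower\<close>).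
  The invariant subspace \<open>inv_space\<close> consists of the vectors whose orbit under \<open>U\<close> has asymptotically no
  component in one of the halves of these sets. It does not contain \<open>\<phi>\<close>, whose component in either half
  has norm bounded from below. It contains the limit of the vectors \<open>peak_vec N\<close>, which are the
  components of \<open>\<phi>\<close> in the other half, and this limit is not zero, for the same reason.
\<close>

section \<open>Square-integrable functions\<close>

lemma L2_measurable: "f \<in> L2 M \<Longrightarrow> f \<in> borel_measurable M"
  by (simp add: L2_def)

lemma L2_integrable: "f \<in> L2 M \<Longrightarrow> integrable M (\<lambda>x. (cmod (f x))\<^sup>2)"
  by (simp add: L2_def)

lemma mult_cmod_le: "cmod z * cmod w \<le> (cmod z)\<^sup>2 + (cmod w)\<^sup>2"
proof -
  have "0 \<le> (cmod z - cmod w)\<^sup>2 + (cmod z)\<^sup>2 + (cmod w)\<^sup>2" by simp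
  then show ?thesis by (simp add: power2_eq_square algebra_simps)
qed

lemma L2_mult_integrable:
  assumes f: "f \<in> L2 M" and g: "g \<in> L2 M"
  shows "integrable M (\<lambda>x. f x * cnj (g x))"
proof (rule Bochner_Integration.integrable_bound)
  show "integrable M (\<lambda>x. (cmod (f x))\<^sup>2 + (cmod (g x))\<^sup>2)"
    using L2_integrable[OF f] L2_integrable[OF g] by simp
  have [measurable]: "f \<in> borel_measurable M" "g \<in> borel_measurable M"
    using f g by (simp_all add: L2_measurable)
  show "(\<lambda>x. f x * cnj (g x)) \<in> borel_measurable M"
    by (intro borel_measurable_times measurable_compose[OF L2_measurable[OF g]] L2_measurable[OF f])
       (intro borel_measurable_continuous_onI continuous_intros)
  show "AE x in M. norm (f x * cnj (g x)) \<le> norm ((cmod (f x))\<^sup>2 + (cmod (g x))\<^sup>2)"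
    by (auto simp: norm_mult intro!: AE_I2 order_trans[OF mult_cmod_le])
qed

lemma L2_lincomb:
  assumes f: "f \<in> L2 M" and g: "g \<in> L2 M"
  shows "(\<lambda>x. a * f x + g x) \<in> L2 M"
proof -
  have [measurable]: "f \<in> borel_measurable M" "g \<in> borel_measurable M"
    using f g by (simp_all add: L2_measurable)
  have *: "(cmod (a * z + w))\<^sup>2 \<le> 2 * (cmod a)\<^sup>2 * (cmod z)\<^sup>2 + 2 * (cmod w)\<^sup>2" for z w
  proof -
    have "(cmod (a * z + w))\<^sup>2 \<le> (cmod (a * z) + cmod w)\<^sup>2"
      by (intro power_mono norm_triangle_ineq) auto
    also have "\<dots> \<le> (cmod (a * z) + cmod w)\<^sup>2 + (cmod (a * z) - cmod w)\<^sup>2" by simp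
    also have "\<dots> = 2 * (cmod a)\<^sup>2 * (cmod z)\<^sup>2 + 2 * (cmod w)\<^sup>2"
      by (simp add: norm_mult power2_eq_square algebra_simps)
    finally show ?thesis .
  qed
  have "integrable M (\<lambda>x. (cmod (a * f x + g x))\<^sup>2)"
  proof (rule Bochner_Integration.integrable_bound)
    show "integrable M (\<lambda>x. 2 * (cmod a)\<^sup>2 * (cmod (f x))\<^sup>2 + 2 * (cmod (g x))\<^sup>2)"
      using L2_integrable[OF f] L2_integrable[OF g] by simp
  qed (use * in auto)
  then show ?thesis by (simp add: L2_def)
qed

lemma L2_zero: "(\<lambda>x. 0) \<in> L2 M"
  by (simp add: L2_def)

lemma L2_scale: "f \<in> L2 M \<Longrightarrow> (\<lambda>x. a * f x) \<in> L2 M"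
  using L2_lincomb[OF _ L2_zero, of f M a] by simp

lemma L2_add: "f \<in> L2 M \<Longrightarrow> g \<in> L2 M \<Longrightarrow> (\<lambda>x. f x + g x) \<in> L2 M"
  using L2_lincomb[of f M g 1] by simp

lemma L2_diff: "f \<in> L2 M \<Longrightarrow> g \<in> L2 M \<Longrightarrow> (\<lambda>x. f x - g x) \<in> L2 M"
  using L2_lincomb[of g M f "-1"] by simp

lemma L2_cut:
  assumes "f \<in> L2 M" "h \<in> borel_measurable M" "\<And>x. x \<in> space M \<Longrightarrow> cmod (h x) \<le> 1"
  shows "(\<lambda>x. h x * f x) \<in> L2 M"
proof -
  have "f \<in> borel_measurable M" using assms L2_measurable by auto
  note [measurable] = this assms(2)
  have "integrable M (\<lambda>x. (cmod (h x * f x))\<^sup>2)"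
  proof (rule Bochner_Integration.integrable_bound[OF L2_integrable[OF assms(1)]])
    show "AE x in M. norm ((cmod (h x * f x))\<^sup>2) \<le> norm ((cmod (f x))\<^sup>2)"
      using assms(3) by (auto simp: norm_mult power_mult_distrib intro!: AE_I2 mult_left_le_one_le power_le_one)
  qed measurable
  then show ?thesis by (simp add: L2_def)
qed

lemma L2_eq_refl: "L2_eq M f f" by (simp add: L2_eq_def)

lemma L2_eq_sym: "L2_eq M f g \<Longrightarrow> L2_eq M g f"
  by (simp add: L2_eq_def eq_commute)

lemma L2_eq_trans: "L2_eq M f g \<Longrightarrow> L2_eq M g h \<Longrightarrow> L2_eq M f h"
  unfolding L2_eq_def by (auto elim: eventually_elim2)

lemma L2_eq_lincomb:
  "L2_eq M f f' \<Longrightarrow> L2_eq M g g' \<Longrightarrow> L2_eq M (\<lambda>x. a * f x + g x) (\<lambda>x. a * f' x + g' x)"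
  unfolding L2_eq_def by (auto elim: eventually_elim2)

lemma L2_eq_diff:
  "L2_eq M f f' \<Longrightarrow> L2_eq M g g' \<Longrightarrow> L2_eq M (\<lambda>x. f x - g x) (\<lambda>x. f' x - g' x)"
  unfolding L2_eq_def by (auto elim: eventually_elim2)

lemma L2_inner_cong:
  assumes "f \<in> L2 M" "g \<in> L2 M" "f' \<in> L2 M" "g' \<in> L2 M" "L2_eq M f f'" "L2_eq M g g'"
  shows "L2_inner M f g = L2_inner M f' g'"
  unfolding L2_inner_def
proof (rule integral_cong_AE)
  show "AE x in M. f x * cnj (g x) = f' x * cnj (g' x)"
    using assms(5,6) unfolding L2_eq_def by eventually_elim auto
qed (intro borel_measurable_integrable L2_mult_integrable assms)+

lemma L2_norm_cong:
  assumes "f \<in> L2 M" "f' \<in> L2 M" "L2_eq M f f'"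
  shows "L2_norm M f = L2_norm M f'"
proof -
  have "(LINT x|M. (cmod (f x))\<^sup>2) = (LINT x|M. (cmod (f' x))\<^sup>2)"
    by (rule integral_cong_AE)
       (use assms in \<open>auto simp: L2_def L2_eq_def elim!: eventually_mono\<close>)
  then show ?thesis by (simp add: L2_norm_def)
qed

lemma L2_inner_lincomb_left:
  assumes "f \<in> L2 M" "g \<in> L2 M" "h \<in> L2 M"
  shows "L2_inner M (\<lambda>x. a * f x + g x) h = a * L2_inner M f h + L2_inner M g h"
proof -
  have "L2_inner M (\<lambda>x. a * f x + g x) h = (LINT x|M. a * (f x * cnj (h x)) + g x * cnj (h x))"
    unfolding L2_inner_def by (simp add: algebra_simps)
  also have "\<dots> = a * L2_inner M f h + L2_inner M g h"
    unfolding L2_inner_def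
    using assms by (subst Bochner_Integration.integral_add) (auto intro: L2_mult_integrable)
  finally show ?thesis .
qed

lemma L2_inner_commute: "L2_inner M g f = cnj (L2_inner M f g)"
proof -
  have "cnj (L2_inner M f g) = (LINT x|M. cnj (f x * cnj (g x)))"
    unfolding L2_inner_def by (rule Bochner_Integration.integral_cnj[symmetric])
  then show ?thesis by (simp add: L2_inner_def mult.commute)
qed

lemma L2_inner_lincomb_right:
  assumes "f \<in> L2 M" "g \<in> L2 M" "h \<in> L2 M"
  shows "L2_inner M h (\<lambda>x. a * f x + g x) = cnj a * L2_inner M h f + L2_inner M h g"
  by (subst (1 2 3) L2_inner_commute) (simp add: L2_inner_lincomb_left[OF assms])

lemma L2_inner_zero_left: "L2_inner M (\<lambda>x. 0) f = 0"
  by (simp add: L2_inner_def)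

lemma L2_inner_zero_right: "L2_inner M f (\<lambda>x. 0) = 0"
  by (simp add: L2_inner_def)

lemma L2_inner_add_left:
  assumes "f \<in> L2 M" "g \<in> L2 M" "h \<in> L2 M"
  shows "L2_inner M (\<lambda>x. f x + g x) h = L2_inner M f h + L2_inner M g h"
  using L2_inner_lincomb_left[OF assms, of 1] by simp

lemma L2_inner_diff_left:
  assumes "f \<in> L2 M" "g \<in> L2 M" "h \<in> L2 M"
  shows "L2_inner M (\<lambda>x. f x - g x) h = L2_inner M f h - L2_inner M g h"
  using L2_inner_lincomb_left[OF assms(2,1,3), of "-1"] by simp

lemma L2_inner_diff_right:
  assumes "f \<in> L2 M" "g \<in> L2 M" "h \<in> L2 M"
  shows "L2_inner M h (\<lambda>x. f x - g x) = L2_inner M h f - L2_inner M h g"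
  using L2_inner_lincomb_right[OF assms(2,1,3), of "-1"] by simp

lemma L2_norm_nonneg: "0 \<le> L2_norm M f"
  by (simp add: L2_norm_def)

lemma L2_norm_power2: "(L2_norm M f)\<^sup>2 = (LINT x|M. (cmod (f x))\<^sup>2)"
  by (simp add: L2_norm_def integral_nonneg_AE)

lemma L2_inner_self: "L2_inner M f f = of_real ((L2_norm M f)\<^sup>2)"
  by (simp only: L2_norm_power2 L2_inner_def complex_norm_square[symmetric] of_real_power[symmetric]
        integral_complex_of_real)

lemma L2_norm_zero: "L2_norm M (\<lambda>x. 0) = 0" by (simp add: L2_norm_def)

lemma L2_norm_scale: "L2_norm M (\<lambda>x. a * f x) = cmod a * L2_norm M f"
  by (simp add: L2_norm_def norm_mult power_mult_distrib real_sqrt_mult)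

lemma L2_norm_minus_commute: "L2_norm M (\<lambda>x. f x - g x) = L2_norm M (\<lambda>x. g x - f x)"
  by (simp add: L2_norm_def norm_minus_commute)

lemma L2_norm_eq_0_iff:
  assumes "f \<in> L2 M" shows "L2_norm M f = 0 \<longleftrightarrow> L2_eq M f (\<lambda>x. 0)"
  using integral_nonneg_eq_0_iff_AE[OF L2_integrable[OF assms]]
  by (simp add: L2_norm_def L2_eq_def)

lemma L2_eq_iff_norm_diff:
  assumes "f \<in> L2 M" "g \<in> L2 M"
  shows "L2_eq M f g \<longleftrightarrow> L2_norm M (\<lambda>x. f x - g x) = 0"
  by (subst L2_norm_eq_0_iff[OF L2_diff[OF assms]]) (simp add: L2_eq_def)

text \<open>
  The nonnegative quadratic \<open>t \<mapsto> \<parallel>f - t c g\<parallel>\<^sup>2\<close>, \<open>c = \<langle>f, g\<rangle>\<close>, is evaluated at its minimum; if \<open>\<parallel>g\<parallel> = 0\<close>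
  it is affine in \<open>t\<close>, so its slope vanishes.
\<close>

lemma L2_Cauchy_Schwarz:
  assumes f: "f \<in> L2 M" and g: "g \<in> L2 M"
  shows "cmod (L2_inner M f g) \<le> L2_norm M f * L2_norm M g"
proof -
  define c where "c = L2_inner M f g"
  define F where "F = (L2_norm M f)\<^sup>2"
  define G where "G = (L2_norm M g)\<^sup>2"
  have quad: "0 \<le> F - 2 * t * (cmod c)\<^sup>2 + t\<^sup>2 * (cmod c)\<^sup>2 * G" for t :: real
  proof -
    define a where "a = - of_real t * c"
    have h: "(\<lambda>x. a * g x + f x) \<in> L2 M" by (rule L2_lincomb[OF g f])
    have cc: "c * cnj c = (cmod c)\<^sup>2" using complex_norm_square[of c] by simp
    have "complex_of_real ((L2_norm M (\<lambda>x. a * g x + f x))\<^sup>2) = a * (cnj a * G + cnj c) + (cnj a * c + F)"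
      by (simp only: L2_inner_self[symmetric] L2_inner_lincomb_left[OF g f h]
            L2_inner_lincomb_right[OF g f g] L2_inner_lincomb_right[OF g f f] c_def F_def G_def
            L2_inner_commute[of M g f])
    also have "\<dots> = of_real (t\<^sup>2 * G) * (c * cnj c) - of_real (2 * t) * (c * cnj c) + F"
      by (simp add: a_def power2_eq_square algebra_simps)
    also have "\<dots> = of_real (F - 2 * t * (cmod c)\<^sup>2 + t\<^sup>2 * (cmod c)\<^sup>2 * G)"
      by (simp only: cc) (simp add: algebra_simps)
    finally have "(L2_norm M (\<lambda>x. a * g x + f x))\<^sup>2 = F - 2 * t * (cmod c)\<^sup>2 + t\<^sup>2 * (cmod c)\<^sup>2 * G"
      using of_real_eq_iff by blast
    then show ?thesis by (metis zero_le_power2)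
  qed
  have "(cmod c)\<^sup>2 \<le> F * G"
  proof (cases "G = 0")
    case True
    have "(cmod c)\<^sup>2 = 0"
    proof (rule ccontr)
      assume "(cmod c)\<^sup>2 \<noteq> 0"
      then have "(cmod c)\<^sup>2 > 0" by simp
      moreover have Fnn: "F \<ge> 0" by (simp add: F_def)
      ultimately show False using quad[of "(F + 1) / (cmod c)\<^sup>2"] True by simp
    qed
    then show ?thesis using True by simp
  next
    case False
    then have G: "G > 0" by (simp add: G_def)
    show ?thesis using quad[of "1 / G"] G by (simp add: field_simps power2_eq_square)
  qed
  then have "cmod c \<le> sqrt (F * G)" by (simp add: real_le_rsqrt)
  then show ?thesis by (simp add: c_def F_def G_def real_sqrt_mult L2_norm_nonneg)
qed

lemma L2_norm_triangle:
  assumes f: "f \<in> L2 M" and g: "g \<in> L2 M"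
  shows "L2_norm M (\<lambda>x. f x + g x) \<le> L2_norm M f + L2_norm M g"
proof -
  have h: "(\<lambda>x. f x + g x) \<in> L2 M" by (rule L2_add[OF f g])
  have "complex_of_real ((L2_norm M (\<lambda>x. f x + g x))\<^sup>2)
      = of_real ((L2_norm M f)\<^sup>2) + (L2_inner M f g + cnj (L2_inner M f g)) + of_real ((L2_norm M g)\<^sup>2)"
    using L2_inner_lincomb_right[OF f g f, of 1] L2_inner_lincomb_right[OF f g g, of 1]
    by (simp only: L2_inner_self[symmetric] L2_inner_add_left[OF f g h])
       (simp add: L2_inner_commute[of M g f])
  also have "\<dots> = of_real ((L2_norm M f)\<^sup>2 + 2 * Re (L2_inner M f g) + (L2_norm M g)\<^sup>2)"
    by (simp add: complex_add_cnj)
  finally have "(L2_norm M (\<lambda>x. f x + g x))\<^sup>2 = (L2_norm M f)\<^sup>2 + 2 * Re (L2_inner M f g) + (L2_norm M g)\<^sup>2"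
    using of_real_eq_iff by blast
  also have "\<dots> \<le> (L2_norm M f + L2_norm M g)\<^sup>2"
    using complex_Re_le_cmod[of "L2_inner M f g"] L2_Cauchy_Schwarz[OF f g]
    by (simp add: power2_sum)
  finally show ?thesis
    by (rule power2_le_imp_le) (simp add: L2_norm_nonneg)
qed

lemma L2_norm_triangle_diff:
  assumes "f \<in> L2 M" "g \<in> L2 M" "h \<in> L2 M"
  shows "L2_norm M (\<lambda>x. f x - h x) \<le> L2_norm M (\<lambda>x. f x - g x) + L2_norm M (\<lambda>x. g x - h x)"
  using L2_norm_triangle[OF L2_diff[OF assms(1,2)] L2_diff[OF assms(2,3)]] by simp

lemma L2_norm_le_diff:
  assumes "f \<in> L2 M" "g \<in> L2 M"
  shows "L2_norm M f \<le> L2_norm M g + L2_norm M (\<lambda>x. f x - g x)"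
  using L2_norm_triangle[OF assms(2) L2_diff[OF assms]] by simp

lemma L2_norm_lincomb:
  assumes "f \<in> L2 M" "g \<in> L2 M"
  shows "L2_norm M (\<lambda>x. a * f x + g x) \<le> cmod a * L2_norm M f + L2_norm M g"
  using L2_norm_triangle[OF L2_scale[OF assms(1)] assms(2)] by (simp add: L2_norm_scale)

definition L2_lim :: "'a measure \<Rightarrow> (nat \<Rightarrow> 'a \<Rightarrow> complex) \<Rightarrow> ('a \<Rightarrow> complex) \<Rightarrow> bool" where
  "L2_lim M F f \<longleftrightarrow> (\<lambda>n. L2_norm M (\<lambda>x. F n x - f x)) \<longlonglongrightarrow> 0"

lemma L2_lim_sandwich:
  assumes "\<And>n. L2_norm M (\<lambda>x. F n x - f x) \<le> b n" "b \<longlonglongrightarrow> 0"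
  shows "L2_lim M F f"
  unfolding L2_lim_def
  by (rule tendsto_sandwich[OF _ _ tendsto_const assms(2)])
     (simp_all add: assms(1) L2_norm_nonneg)

lemma L2_lim_norm:
  assumes "\<And>n. F n \<in> L2 M" "f \<in> L2 M" "L2_lim M F f"
  shows "(\<lambda>n. L2_norm M (F n)) \<longlonglongrightarrow> L2_norm M f"
proof (rule LIM_zero_cancel, rule tendsto_rabs_zero_cancel, rule tendsto_sandwich[where f="\<lambda>n. 0"])
  show "(\<lambda>n. L2_norm M (\<lambda>x. F n x - f x)) \<longlonglongrightarrow> 0" using assms(3) by (simp add: L2_lim_def)
  show "\<forall>\<^sub>F n in sequentially. \<bar>L2_norm M (F n) - L2_norm M f\<bar> \<le> L2_norm M (\<lambda>x. F n x - f x)"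
  proof (rule always_eventually, rule allI)
    fix n
    show "\<bar>L2_norm M (F n) - L2_norm M f\<bar> \<le> L2_norm M (\<lambda>x. F n x - f x)"
      using L2_norm_le_diff[OF assms(1)[of n] assms(2)] L2_norm_le_diff[OF assms(2) assms(1)[of n]]
      by (simp add: L2_norm_minus_commute[of M f])
  qed
qed auto

lemma L2_lim_inner:
  assumes "\<And>n. F n \<in> L2 M" "f \<in> L2 M" "L2_lim M F f" "\<And>n. G n \<in> L2 M" "g \<in> L2 M" "L2_lim M G g"
  shows "(\<lambda>n. L2_inner M (F n) (G n)) \<longlonglongrightarrow> L2_inner M f g"
proof (rule LIM_zero_cancel, rule tendsto_norm_zero_cancel, rule tendsto_sandwich[where f="\<lambda>n. 0"])
  let ?b = "\<lambda>n. L2_norm M (\<lambda>x. F n x - f x) * L2_norm M (G n) + L2_norm M f * L2_norm M (\<lambda>x. G n x - g x)"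
  have "?b \<longlonglongrightarrow> 0 * L2_norm M g + L2_norm M f * 0"
    using assms(3,6) L2_lim_norm[OF assms(4-6)] unfolding L2_lim_def by (intro tendsto_intros)
  then show "?b \<longlonglongrightarrow> 0" by simp
  show "\<forall>\<^sub>F n in sequentially. norm (L2_inner M (F n) (G n) - L2_inner M f g) \<le> ?b n"
  proof (rule always_eventually, rule allI)
    fix n
    note m = assms(1)[of n] assms(2) assms(4)[of n] assms(5)
    have "L2_inner M (F n) (G n) - L2_inner M f g
      = L2_inner M (\<lambda>x. F n x - f x) (G n) + L2_inner M f (\<lambda>x. G n x - g x)"
      by (simp add: L2_inner_diff_left[OF m(1,2,3)] L2_inner_diff_right[OF m(3,4,2)])
    also have "norm \<dots> \<le> ?b n"
      by (intro order_trans[OF norm_triangle_ineq] add_mono L2_Cauchy_Schwarz L2_diff m)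
    finally show "norm (L2_inner M (F n) (G n) - L2_inner M f g) \<le> ?b n" .
  qed
qed auto

lemma L2_lim_const: "L2_lim M (\<lambda>n. f) f"
  by (simp add: L2_lim_def L2_norm_zero)

lemma L2_lim_unique:
  assumes "\<And>n. F n \<in> L2 M" "f \<in> L2 M" "g \<in> L2 M" "L2_lim M F f" "L2_lim M F g"
  shows "L2_eq M f g"
proof -
  have "(\<lambda>n. L2_norm M (\<lambda>x. F n x - f x) + L2_norm M (\<lambda>x. F n x - g x)) \<longlonglongrightarrow> 0 + 0"
    using assms(4,5) unfolding L2_lim_def by (rule tendsto_add)
  moreover have "L2_norm M (\<lambda>x. f x - g x) \<le> L2_norm M (\<lambda>x. F n x - f x) + L2_norm M (\<lambda>x. F n x - g x)" for n
    using L2_norm_triangle_diff[OF assms(2) assms(1)[of n] assms(3)] by (simp add: L2_norm_minus_commute[of M f])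
  ultimately have "L2_norm M (\<lambda>x. f x - g x) \<le> 0 + 0"
    by (intro LIMSEQ_le_const) auto
  then show ?thesis using L2_norm_nonneg[of M "\<lambda>x. f x - g x"] by (simp add: L2_eq_iff_norm_diff assms(2,3))
qed

lemma L2_lim_lincomb:
  assumes "\<And>n. F n \<in> L2 M" "f \<in> L2 M" "L2_lim M F f" "\<And>n. G n \<in> L2 M" "g \<in> L2 M" "L2_lim M G g"
  shows "L2_lim M (\<lambda>n x. a * F n x + G n x) (\<lambda>x. a * f x + g x)"
  unfolding L2_lim_def
proof (rule tendsto_sandwich[where f="\<lambda>n. 0"])
  let ?b = "\<lambda>n. cmod a * L2_norm M (\<lambda>x. F n x - f x) + L2_norm M (\<lambda>x. G n x - g x)"
  have "?b \<longlonglongrightarrow> cmod a * 0 + 0"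
    using assms(3,6) unfolding L2_lim_def by (intro tendsto_intros)
  then show "?b \<longlonglongrightarrow> 0" by simp
  show "\<forall>\<^sub>F n in sequentially. L2_norm M (\<lambda>x. a * F n x + G n x - (a * f x + g x)) \<le> ?b n"
  proof (rule always_eventually, rule allI)
    fix n
    show "L2_norm M (\<lambda>x. a * F n x + G n x - (a * f x + g x)) \<le> ?b n"
      using L2_norm_lincomb[OF L2_diff[OF assms(1)[of n] assms(2)] L2_diff[OF assms(4)[of n] assms(5)], of a]
      by (simp add: algebra_simps)
  qed
qed (auto simp: L2_norm_nonneg)

lemma L2_operator_mem: "L2_operator M A \<Longrightarrow> f \<in> L2 M \<Longrightarrow> A f \<in> L2 M"
  by (simp add: L2_operator_def)

lemma L2_operator_lincomb:
  "L2_operator M A \<Longrightarrow> f \<in> L2 M \<Longrightarrow> g \<in> L2 M \<Longrightarrow> L2_eq M (A (\<lambda>x. a * f x + g x)) (\<lambda>x. a * A f x + A g x)"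
  by (simp add: L2_operator_def)

lemma L2_operator_diff:
  assumes "L2_operator M A" "f \<in> L2 M" "g \<in> L2 M"
  shows "L2_eq M (A (\<lambda>x. f x - g x)) (\<lambda>x. A f x - A g x)"
  using L2_operator_lincomb[OF assms(1,3,2), of "-1"] by simp

lemma L2_operator_bound:
  assumes "L2_operator M A"
  shows "\<exists>K\<ge>0. \<forall>f\<in>L2 M. L2_norm M (A f) \<le> K * L2_norm M f"
proof -
  obtain K where K: "\<forall>f\<in>L2 M. L2_norm M (A f) \<le> K * L2_norm M f"
    using assms unfolding L2_operator_def by blast
  have "L2_norm M (A f) \<le> \<bar>K\<bar> * L2_norm M f" if f: "f \<in> L2 M" for f
  proof -
    have "K * L2_norm M f \<le> \<bar>K\<bar> * L2_norm M f" by (intro mult_right_mono L2_norm_nonneg) auto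
    then show ?thesis using K f by force
  qed
  then show ?thesis by (intro exI[of _ "\<bar>K\<bar>"]) auto
qed

lemma L2_operator_norm_diff:
  assumes "L2_operator M A" "f \<in> L2 M" "g \<in> L2 M"
  shows "L2_norm M (\<lambda>x. A f x - A g x) = L2_norm M (A (\<lambda>x. f x - g x))"
  by (intro L2_norm_cong[OF _ _ L2_eq_sym] L2_diff L2_operator_mem[OF assms(1)] L2_operator_diff assms)

lemma L2_operator_cong:
  assumes A: "L2_operator M A" and fg: "f \<in> L2 M" "g \<in> L2 M" "L2_eq M f g"
  shows "L2_eq M (A f) (A g)"
proof -
  obtain K where K: "\<And>f. f \<in> L2 M \<Longrightarrow> L2_norm M (A f) \<le> K * L2_norm M f"
    using L2_operator_bound[OF A] by blast
  have "L2_norm M (\<lambda>x. A f x - A g x) \<le> K * L2_norm M (\<lambda>x. f x - g x)"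
    using K[OF L2_diff[OF fg(1,2)]] L2_operator_norm_diff[OF A fg(1,2)] by simp
  also have "L2_norm M (\<lambda>x. f x - g x) = 0" using fg by (simp add: L2_eq_iff_norm_diff)
  finally show ?thesis
    using L2_norm_nonneg[of M "\<lambda>x. A f x - A g x"] by (simp add: L2_eq_iff_norm_diff L2_operator_mem[OF A] fg)
qed

lemma L2_operator_lim:
  assumes A: "L2_operator M A" and F: "\<And>n. F n \<in> L2 M" "f \<in> L2 M" "L2_lim M F f"
  shows "L2_lim M (\<lambda>n. A (F n)) (A f)"
proof -
  obtain K where K: "\<And>f. f \<in> L2 M \<Longrightarrow> L2_norm M (A f) \<le> K * L2_norm M f"
    using L2_operator_bound[OF A] by blast
  have "L2_norm M (\<lambda>x. A (F n) x - A f x) \<le> K * L2_norm M (\<lambda>x. F n x - f x)" for n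
    using K[OF L2_diff[OF F(1)[of n] F(2)]] L2_operator_norm_diff[OF A F(1)[of n] F(2)] by simp
  moreover have "(\<lambda>n. K * L2_norm M (\<lambda>x. F n x - f x)) \<longlonglongrightarrow> K * 0"
    using F(3) unfolding L2_lim_def by (intro tendsto_intros)
  ultimately show ?thesis
    by (rule L2_lim_sandwich[OF _ tendsto_eq_rhs]) simp
qed

lemma L2_operator_comp:
  assumes A: "L2_operator M A" and B: "L2_operator M B"
  shows "L2_operator M (\<lambda>f. A (B f))"
  unfolding L2_operator_def
proof (intro conjI ballI allI)
  fix f assume "f \<in> L2 M" then show "A (B f) \<in> L2 M" by (intro L2_operator_mem[OF A] L2_operator_mem[OF B])
next
  fix f g a assume fg: "f \<in> L2 M" "g \<in> L2 M"
  have "L2_eq M (A (B (\<lambda>x. a * f x + g x))) (A (\<lambda>x. a * B f x + B g x))"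
    by (intro L2_operator_cong[OF A] L2_operator_lincomb[OF B] fg L2_lincomb L2_operator_mem[OF B])
  also have "L2_eq M \<dots> (\<lambda>x. a * A (B f) x + A (B g) x)"
    by (intro L2_operator_lincomb[OF A] L2_operator_mem[OF B] fg)
  finally (L2_eq_trans) show "L2_eq M (A (B (\<lambda>x. a * f x + g x))) (\<lambda>x. a * A (B f) x + A (B g) x)" .
next
  obtain K where K: "K \<ge> 0" "\<And>f. f \<in> L2 M \<Longrightarrow> L2_norm M (A f) \<le> K * L2_norm M f"
    using L2_operator_bound[OF A] by blast
  obtain L where L: "L \<ge> 0" "\<And>f. f \<in> L2 M \<Longrightarrow> L2_norm M (B f) \<le> L * L2_norm M f"
    using L2_operator_bound[OF B] by blast
  show "\<exists>K. \<forall>f\<in>L2 M. L2_norm M (A (B f)) \<le> K * L2_norm M f"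
  proof (rule exI[of _ "K * L"], rule ballI)
    fix f assume f: "f \<in> L2 M"
    have "L2_norm M (A (B f)) \<le> K * L2_norm M (B f)" by (intro K L2_operator_mem[OF B] f)
    also have "\<dots> \<le> K * (L * L2_norm M f)" by (intro mult_left_mono L K f)
    finally show "L2_norm M (A (B f)) \<le> K * L * L2_norm M f" by (simp add: mult.assoc)
  qed
qed

text \<open>
  Polarisation: a sesquilinear form is determined by its diagonal, so bounded operators with the
  same quadratic form agree.
\<close>

lemma L2_operator_eqI:
  assumes A: "L2_operator M A" and B: "L2_operator M B"
    and eq: "\<And>\<xi>. \<xi> \<in> L2 M \<Longrightarrow> L2_inner M (A \<xi>) \<xi> = L2_inner M (B \<xi>) \<xi>" and f: "f \<in> L2 M"
  shows "L2_eq M (A f) (B f)"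
proof -
  have pol: "a * D f g + cnj a * D g f = 0" if "f \<in> L2 M" "g \<in> L2 M"
    "D = (\<lambda>f g. L2_inner M (A f) g - L2_inner M (B f) g)" for a f g D
  proof -
    note m = that(1,2)
    have e: "L2_inner M (Z (\<lambda>x. a * f x + g x)) (\<lambda>x. a * f x + g x)
        = a * (cnj a * L2_inner M (Z f) f + L2_inner M (Z f) g) + (cnj a * L2_inner M (Z g) f + L2_inner M (Z g) g)"
      if Z: "L2_operator M Z" for Z
    proof -
      have "L2_inner M (Z (\<lambda>x. a * f x + g x)) (\<lambda>x. a * f x + g x)
          = L2_inner M (\<lambda>x. a * Z f x + Z g x) (\<lambda>x. a * f x + g x)"
        by (intro L2_inner_cong L2_operator_mem[OF Z] L2_lincomb m L2_operator_lincomb[OF Z] L2_eq_refl)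
      then show ?thesis
        by (simp add: L2_inner_lincomb_left L2_inner_lincomb_right L2_lincomb m L2_operator_mem[OF Z])
    qed
    show ?thesis
      using e[OF A] e[OF B] eq[OF L2_lincomb[OF m, of a]] eq[OF m(1)] eq[OF m(2)]
      by (simp add: that(3) algebra_simps)
  qed
  define D where "D = (\<lambda>f g. L2_inner M (A f) g - L2_inner M (B f) g)"
  define d where "d = (\<lambda>x. A f x - B f x)"
  have d: "d \<in> L2 M" unfolding d_def by (intro L2_diff L2_operator_mem[OF A] L2_operator_mem[OF B] f)
  have "D f d + D d f = 0" using pol[OF f d D_def, of 1] by simp
  moreover have "\<i> * D f d - \<i> * D d f = 0" using pol[OF f d D_def, of \<i>] by simp
  ultimately have "D f d = 0" by (simp add: right_diff_distrib[symmetric])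
  then have "L2_inner M d d = 0"
    unfolding D_def by (subst (1) d_def) (simp add: L2_inner_diff_left L2_operator_mem[OF A] L2_operator_mem[OF B] f d)
  then have "L2_norm M d = 0" by (simp add: L2_inner_self)
  then show ?thesis unfolding d_def
    by (simp add: L2_eq_iff_norm_diff L2_operator_mem[OF A] L2_operator_mem[OF B] f)
qed

section \<open>Completeness and density\<close>

lemma L2_norm_nn_integral:
  assumes "h \<in> L2 M"
  shows "(\<integral>\<^sup>+x. ennreal ((cmod (h x))\<^sup>2) \<partial>M) = ennreal ((L2_norm M h)\<^sup>2)"
  by (simp add: nn_integral_eq_integral[OF L2_integrable[OF assms]] L2_norm_power2)

lemma L2_norm_leI:
  assumes h: "h \<in> borel_measurable M" and le: "(\<integral>\<^sup>+x. ennreal ((cmod (h x))\<^sup>2) \<partial>M) \<le> ennreal (c\<^sup>2)" and c: "0 \<le> c"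
  shows "h \<in> L2 M" "L2_norm M h \<le> c"
proof -
  note [measurable] = h
  have "(\<integral>\<^sup>+x. ennreal (norm ((cmod (h x))\<^sup>2)) \<partial>M) < \<infinity>"
    using le by (simp add: le_less_trans[OF _ ennreal_less_top])
  then have "integrable M (\<lambda>x. (cmod (h x))\<^sup>2)" by (intro integrableI_bounded) auto
  then show *: "h \<in> L2 M" by (simp add: L2_def)
  show "L2_norm M h \<le> c"
  proof (rule power2_le_imp_le[OF _ c])
    show "(L2_norm M h)\<^sup>2 \<le> c\<^sup>2" using le by (simp add: L2_norm_nn_integral[OF *] ennreal_le_iff)
  qed
qed

text \<open>
  Along a subsequence with differences below \<open>4\<^sup>-\<^sup>k\<close> the series \<open>\<Sum>k. 2\<^sup>k \<bar>g\<^sub>k\<^sub>+\<^sub>1 - g\<^sub>k\<bar>\<^sup>2\<close> has a finite integral,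
  hence is finite almost everywhere, and the subsequence converges there geometrically; the lemma of
  Fatou identifies the pointwise limit as the limit in norm.
\<close>

lemma L2_complete:
  assumes F: "\<And>n. F n \<in> L2 M"
    and Cauchy: "\<And>e. e > 0 \<Longrightarrow> \<exists>N. \<forall>m\<ge>N. \<forall>n\<ge>N. L2_norm M (\<lambda>x. F m x - F n x) < e"
  shows "\<exists>f\<in>L2 M. L2_lim M F f"
proof -
  have "\<forall>k. \<exists>N. \<forall>m\<ge>N. \<forall>n\<ge>N. L2_norm M (\<lambda>x. F m x - F n x) < (1/4)^k"
    using Cauchy by simp
  then obtain N where N: "\<And>k m n. m \<ge> N k \<Longrightarrow> n \<ge> N k \<Longrightarrow> L2_norm M (\<lambda>x. F m x - F n x) < (1/4)^k"
    by metis
  define r where "r k = (\<Sum>i\<le>k. N i)" for k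
  have rN: "N k \<le> r k" for k unfolding r_def by (rule member_le_sum) auto
  have rm: "r k \<le> r m" if "k \<le> m" for k m unfolding r_def using that by (intro sum_mono2) auto
  define g where "g k = F (r k)" for k
  have g: "g k \<in> L2 M" for k by (simp add: g_def F)
  have [measurable]: "g k \<in> borel_measurable M" for k by (rule L2_measurable[OF g])
  have gF: "L2_norm M (\<lambda>x. F n x - g k x) < (1/4)^k" if "n \<ge> r k" for n k
    unfolding g_def using that rN[of k] by (intro N) auto
  have gg: "L2_norm M (\<lambda>x. g m x - g k x) < (1/4)^k" if "m \<ge> k" for m k
    using gF[OF rm[OF that]] by (simp add: g_def)
  \<comment> \<open>the weight still leaves a summable series of integrals and gives pointwise differences of order
      (1/sqrt 2)^k\<close>
  define d where "d k x = ennreal (2^k * (cmod (g (Suc k) x - g k x))\<^sup>2)" for k x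
  have "(\<integral>\<^sup>+x. (\<Sum>k. d k x) \<partial>M) = (\<Sum>k. \<integral>\<^sup>+x. d k x \<partial>M)"
    unfolding d_def by (rule nn_integral_suminf) measurable
  also have "\<dots> \<le> (\<Sum>k. ennreal ((1/8)^k))"
  proof (rule suminf_le)
    fix k
    have "(\<integral>\<^sup>+x. d k x \<partial>M) = ennreal (2^k) * ennreal ((L2_norm M (\<lambda>x. g (Suc k) x - g k x))\<^sup>2)"
      unfolding d_def by (simp add: ennreal_mult nn_integral_cmult L2_norm_nn_integral[OF L2_diff[OF g g], symmetric])
    also have "\<dots> \<le> ennreal (2^k) * ennreal (((1/4)^k)\<^sup>2)"
      by (intro mult_left_mono ennreal_leI power_mono L2_norm_nonneg less_imp_le[OF gg]) auto
    also have "\<dots> = ennreal ((1/8)^k)"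
    proof -
      have "2^k * ((1/4)^k)\<^sup>2 = (1/8::real)^k"
        by (simp add: power2_eq_square flip: power_mult_distrib)
      then show ?thesis by (simp flip: ennreal_mult)
    qed
    finally show "(\<integral>\<^sup>+x. d k x \<partial>M) \<le> ennreal ((1/8)^k)" .
  qed auto
  also have "\<dots> = ennreal (\<Sum>k. (1/8)^k)"
    by (rule suminf_ennreal2) (auto intro: summable_geometric)
  also have "\<dots> < \<infinity>" by simp
  finally have "AE x in M. (\<Sum>k. d k x) \<noteq> \<infinity>"
    by (intro nn_integral_PInf_AE) (auto simp: d_def)
  then have conv: "AE x in M. convergent (\<lambda>k. g k x)"
  proof eventually_elim
    fix x assume fin: "(\<Sum>k. d k x) \<noteq> \<infinity>"
    then obtain C where C: "(\<Sum>k. d k x) = ennreal C" "C \<ge> 0"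
      by (cases "\<Sum>k. d k x") auto
    have b: "norm (g (Suc k) x - g k x) \<le> sqrt C * (1 / sqrt 2)^k" for k
    proof -
      have "d k x \<le> (\<Sum>k. d k x)"
        using sum_le_suminf[of "\<lambda>k. d k x" "{k}"] by auto
      then have "2^k * (cmod (g (Suc k) x - g k x))\<^sup>2 \<le> C"
        unfolding C(1) by (simp add: d_def C ennreal_le_iff)
      then have "(cmod (g (Suc k) x - g k x))\<^sup>2 \<le> C * (1/2)^k" by (simp add: field_simps)
      then have "cmod (g (Suc k) x - g k x) \<le> sqrt (C * (1/2)^k)" by (simp add: real_le_rsqrt)
      then show ?thesis by (simp add: real_sqrt_mult real_sqrt_power real_sqrt_divide)
    qed
    have "summable (\<lambda>k. sqrt C * (1 / sqrt 2)^k)"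
      by (intro summable_mult summable_geometric) auto
    then have "summable (\<lambda>k. g (Suc k) x - g k x)"
      by (rule summable_comparison_test'[of _ 0]) (use b in auto)
    then have "convergent (\<lambda>n. \<Sum>k<n. g (Suc k) x - g k x)"
      by (simp add: summable_iff_convergent)
    then have "convergent (\<lambda>n. g n x - g 0 x)" using sum_lessThan_telescope[of "\<lambda>k. g k x"] by simp
    then show "convergent (\<lambda>k. g k x)" using convergent_add[OF _ convergent_const[of "g 0 x"]] by fastforce
  qed
  define f where "f x = lim (\<lambda>k. g k x)" for x
  have [measurable]: "f \<in> borel_measurable M" unfolding f_def by measurable
  have lim: "AE x in M. (\<lambda>k. g k x) \<longlonglongrightarrow> f x"
    using conv by eventually_elim (simp add: f_def convergent_LIMSEQ_iff)
  have bound: "(\<integral>\<^sup>+x. ennreal ((cmod (f x - g k x))\<^sup>2) \<partial>M) \<le> ennreal (((1/4)^k)\<^sup>2)" for k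
  proof -
    have "(\<integral>\<^sup>+x. ennreal ((cmod (f x - g k x))\<^sup>2) \<partial>M)
        = (\<integral>\<^sup>+x. liminf (\<lambda>m. ennreal ((cmod (g m x - g k x))\<^sup>2)) \<partial>M)"
    proof (rule nn_integral_cong_AE, use lim in eventually_elim)
      fix x assume "(\<lambda>k. g k x) \<longlonglongrightarrow> f x"
      then have "(\<lambda>m. ennreal ((cmod (g m x - g k x))\<^sup>2)) \<longlonglongrightarrow> ennreal ((cmod (f x - g k x))\<^sup>2)"
        by (intro tendsto_intros tendsto_ennrealI)
      then show "ennreal ((cmod (f x - g k x))\<^sup>2) = liminf (\<lambda>m. ennreal ((cmod (g m x - g k x))\<^sup>2))"
        using lim_imp_Liminf[OF sequentially_bot] by metis
    qed
    also have "\<dots> \<le> liminf (\<lambda>m. \<integral>\<^sup>+x. ennreal ((cmod (g m x - g k x))\<^sup>2) \<partial>M)"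
      by (rule nn_integral_liminf) measurable
    also have "\<dots> \<le> liminf (\<lambda>m. ennreal (((1/4)^k)\<^sup>2))"
    proof (rule Liminf_mono, rule eventually_sequentiallyI[of k])
      fix m assume "k \<le> m"
      show "(\<integral>\<^sup>+x. ennreal ((cmod (g m x - g k x))\<^sup>2) \<partial>M) \<le> ennreal (((1/4)^k)\<^sup>2)"
        unfolding L2_norm_nn_integral[OF L2_diff[OF g g]]
        by (intro ennreal_leI power_mono less_imp_le[OF gg] \<open>k \<le> m\<close> L2_norm_nonneg)
    qed
    also have "\<dots> = ennreal (((1/4)^k)\<^sup>2)" by (simp add: Liminf_const)
    finally show ?thesis .
  qed
  have fg: "(\<lambda>x. f x - g k x) \<in> L2 M" "L2_norm M (\<lambda>x. f x - g k x) \<le> (1/4)^k" for k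
    by (rule L2_norm_leI[OF _ bound]; simp)+
  have f: "f \<in> L2 M" using L2_add[OF fg(1)[of 0] g[of 0]] by simp
  have "L2_lim M F f" unfolding L2_lim_def
  proof (rule LIMSEQ_I)
    fix e :: real assume "e > 0"
    then obtain k where k: "(1/4::real)^k < e / 2" using real_arch_pow_inv[of "e/2" "1/4"] by auto
    have "norm (L2_norm M (\<lambda>x. F n x - f x) - 0) < e" if "n \<ge> r k" for n
      using L2_norm_triangle_diff[OF F[of n] g[of k] f] gF[OF that] fg(2)[of k] k L2_norm_nonneg[of M "\<lambda>x. F n x - f x"]
        L2_norm_minus_commute[of M f "g k"] by simp
    then show "\<exists>no. \<forall>n\<ge>no. norm (L2_norm M (\<lambda>x. F n x - f x) - 0) < e" by blast
  qed
  with f show ?thesis by blast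
qed

lemma L2_lim_dominated:
  assumes "\<And>n. F n \<in> L2 M" "f \<in> L2 M" "integrable M w"
    and "\<And>n. AE x in M. (cmod (F n x - f x))\<^sup>2 \<le> w x"
    and "AE x in M. (\<lambda>n. F n x) \<longlonglongrightarrow> f x"
  shows "L2_lim M F f"
proof -
  have [measurable]: "F n \<in> borel_measurable M" "f \<in> borel_measurable M" for n
    using assms L2_measurable by auto
  have "(\<lambda>n. LINT x|M. (cmod (F n x - f x))\<^sup>2) \<longlonglongrightarrow> (LINT x|M. 0)"
  proof (rule integral_dominated_convergence[OF _ _ assms(3)])
    show "AE x in M. (\<lambda>n. (cmod (F n x - f x))\<^sup>2) \<longlonglongrightarrow> 0"
      using assms(5)
    proof eventually_elim
      fix x assume "(\<lambda>n. F n x) \<longlonglongrightarrow> f x"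
      then have "(\<lambda>n. (cmod (F n x - f x))\<^sup>2) \<longlonglongrightarrow> (cmod (f x - f x))\<^sup>2"
        by (intro tendsto_intros)
      then show "(\<lambda>n. (cmod (F n x - f x))\<^sup>2) \<longlonglongrightarrow> 0" by simp
    qed
  qed (use assms(4) in auto)
  then have "(\<lambda>n. sqrt (LINT x|M. (cmod (F n x - f x))\<^sup>2)) \<longlonglongrightarrow> sqrt 0"
    by (intro tendsto_real_sqrt) simp
  then show ?thesis by (simp add: L2_lim_def L2_norm_def)
qed

lemma L2_closed_subspaceD:
  assumes "L2_closed_subspace M V"
  shows "f \<in> V \<Longrightarrow> f \<in> L2 M" "(\<lambda>x. 0) \<in> V"
    "f \<in> V \<Longrightarrow> g \<in> V \<Longrightarrow> (\<lambda>x. a * f x + g x) \<in> V"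
    "(\<And>n. F n \<in> V) \<Longrightarrow> f \<in> L2 M \<Longrightarrow> L2_lim M F f \<Longrightarrow> f \<in> V"
  using assms unfolding L2_closed_subspace_def L2_lim_def by blast+

lemma L2_closed_subspace_eq:
  assumes V: "L2_closed_subspace M V" and "f \<in> V" "g \<in> L2 M" "L2_eq M f g"
  shows "g \<in> V"
proof (rule L2_closed_subspaceD(4)[OF V, of "\<lambda>n. f"])
  show "L2_lim M (\<lambda>n. f) g"
    using assms L2_closed_subspaceD(1)[OF V] by (simp add: L2_lim_def L2_eq_iff_norm_diff)
qed (use assms in auto)

lemma L2_closed_subspace_sum:
  assumes V: "L2_closed_subspace M V" and "\<And>i. i \<in> I \<Longrightarrow> F i \<in> V"
  shows "(\<lambda>x. \<Sum>i\<in>I. a i * F i x) \<in> V"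
  using assms(2)
  by (induction I rule: infinite_finite_induct) (auto intro: L2_closed_subspaceD(2,3)[OF V])

lemma L2_indicator:
  assumes "A \<in> sets M" "emeasure M A < \<infinity>"
  shows "indicator A \<in> L2 M"
proof -
  have "(\<lambda>x. (cmod (indicator A x))\<^sup>2) = indicat_real A"
    by (auto simp: indicator_def)
  then show ?thesis using assms by (simp add: L2_def integrable_indicator_iff)
qed

text \<open>
  The sets whose trace on \<open>Y\<close> has its indicator in a closed subspace form a Dynkin system.
\<close>

lemma L2_closed_subspace_indicator:
  assumes V: "L2_closed_subspace M V" and Y: "Y \<in> sets M" "emeasure M Y < \<infinity>"
    and G: "Int_stable G" "G \<subseteq> Pow (space M)" "sets M = sigma_sets (space M) G"
    and YV: "indicator Y \<in> V" and GV: "\<And>B. B \<in> G \<Longrightarrow> indicator (B \<inter> Y) \<in> V"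
    and A: "A \<in> sets M"
  shows "indicator (A \<inter> Y) \<in> V"
proof -
  have fin: "indicator (A \<inter> Y) \<in> L2 M" if "A \<in> sets M" for A
    using that Y by (intro L2_indicator) (auto intro: le_less_trans[OF emeasure_mono])
  from A have "A \<in> sigma_sets (space M) G" by (simp add: G)
  then show ?thesis
  proof (induction rule: sigma_sets_induct_disjoint[OF G(1,2), consumes 1, case_names basic empty compl union])
    case (basic A) then show ?case by (rule GV)
  next
    case empty
    have "indicator ({} \<inter> Y) = (\<lambda>x::'a. 0::complex)" by auto
    then show ?case using L2_closed_subspaceD(2)[OF V] by simp
  next
    case (compl A)
    have "indicator ((space M - A) \<inter> Y) = (\<lambda>x. (-1) * indicator (A \<inter> Y) x + (indicator Y x :: complex))"
      using sets.sets_into_space[OF Y(1)] by (auto simp: indicator_def fun_eq_iff)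
    then show ?case using L2_closed_subspaceD(3)[OF V compl(2) YV, of "-1"] by metis
  next
    case (union A)
    then have As: "A i \<in> sets M" for i by (auto simp: G)
    show ?case
    proof (rule L2_closed_subspaceD(4)[OF V])
      fix n
      have "(\<lambda>x. \<Sum>i\<in>{..<n}. 1 * indicator (A i \<inter> Y) x) = (indicator (\<Union>i<n. A i \<inter> Y) :: _ \<Rightarrow> complex)"
        using union(1)
        by (intro ext) (subst indicator_UN_disjoint, auto simp: disjoint_family_on_def)
      then show "indicator (\<Union>i<n. A i \<inter> Y) \<in> V"
        using L2_closed_subspace_sum[OF V, of "{..<n}" "\<lambda>i. indicator (A i \<inter> Y)" "\<lambda>i. 1"] union(3) by simp
    next
      show "indicator ((\<Union>i. A i) \<inter> Y) \<in> L2 M" by (rule fin) (use As in auto)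
      show "L2_lim M (\<lambda>n. indicator (\<Union>i<n. A i \<inter> Y)) (indicator ((\<Union>i. A i) \<inter> Y))"
      proof (rule L2_lim_dominated[where w="indicator Y"])
        show "indicator (\<Union>i<n. A i \<inter> Y) \<in> L2 M" for n
        proof -
          have "(\<Union>i<n. A i \<inter> Y) = (\<Union>i<n. A i) \<inter> Y" by blast
          moreover have "(\<Union>i<n. A i) \<in> sets M" using As by auto
          ultimately show ?thesis using fin by metis
        qed
        show "indicator ((\<Union>i. A i) \<inter> Y) \<in> L2 M" by (rule fin) (use As in auto)
        show "integrable M (indicat_real Y)" using Y by (simp add: integrable_indicator_iff)
        show "AE x in M. (cmod (indicator (\<Union>i<n. A i \<inter> Y) x - indicator ((\<Union>i. A i) \<inter> Y) x))\<^sup>2 \<le> indicat_real Y x" for n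
          by (auto simp: indicator_def)
        show "AE x in M. (\<lambda>n. indicator (\<Union>i<n. A i \<inter> Y) x) \<longlonglongrightarrow> (indicator ((\<Union>i. A i) \<inter> Y) x :: complex)"
        proof -
          have "(\<Union>i. A i) \<inter> Y = (\<Union>i. A i \<inter> Y)" by blast
          then show ?thesis by (simp only:) (intro AE_I2 LIMSEQ_indicator_UN)
        qed
      qed
    qed
  qed
qed

text \<open>
  Simple functions supported in \<open>Y\<close> that are dominated by \<open>2 \<bar>f\<bar>\<close> converge to \<open>f\<close> pointwise, hence in norm.
\<close>

lemma L2_closed_subspace_full:
  assumes V: "L2_closed_subspace M V" and Y: "Y \<in> sets M" "emeasure M Y < \<infinity>"
    and G: "Int_stable G" "G \<subseteq> Pow (space M)" "sets M = sigma_sets (space M) G"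
    and YV: "indicator Y \<in> V" and GV: "\<And>B. B \<in> G \<Longrightarrow> indicator (B \<inter> Y) \<in> V"
    and f: "f \<in> L2 M" "\<And>x. x \<in> space M - Y \<Longrightarrow> f x = 0"
  shows "f \<in> V"
proof -
  note ind = L2_closed_subspace_indicator[OF V Y G YV GV]
  have [measurable]: "f \<in> borel_measurable M" by (rule L2_measurable[OF f(1)])
  obtain s where s: "\<And>i. simple_function M (s i)" "\<And>x. x \<in> space M \<Longrightarrow> (\<lambda>i. s i x) \<longlonglongrightarrow> f x"
    "\<And>i x. x \<in> space M \<Longrightarrow> dist (s i x) 0 \<le> 2 * dist (f x) 0"
    using borel_measurable_implies_sequence_metric[of f M 0] by fastforce
  have [measurable]: "s i \<in> borel_measurable M" for i using s(1) by (rule borel_measurable_simple_function)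
  have sL: "s i \<in> L2 M" for i
  proof -
    have "integrable M (\<lambda>x. (cmod (s i x))\<^sup>2)"
    proof (rule Bochner_Integration.integrable_bound)
      show "integrable M (\<lambda>x. 4 * (cmod (f x))\<^sup>2)" using L2_integrable[OF f(1)] by simp
      have "(cmod (s i x))\<^sup>2 \<le> 4 * (cmod (f x))\<^sup>2" if "x \<in> space M" for x
        using power_mono[OF s(3)[OF that, of i], of 2] by (simp add: power_mult_distrib)
      then show "AE x in M. norm ((cmod (s i x))\<^sup>2) \<le> norm (4 * (cmod (f x))\<^sup>2)" by auto
    qed measurable
    then show ?thesis by (simp add: L2_def)
  qed
  have sV: "s i \<in> V" for i
  proof (rule L2_closed_subspace_eq[OF V _ sL])
    let ?S = "\<lambda>y. s i -` {y} \<inter> space M"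
    show "(\<lambda>x. \<Sum>y\<in>s i ` space M. y * indicator (?S y \<inter> Y) x) \<in> V"
      by (intro L2_closed_subspace_sum[OF V] ind) (auto intro: simple_functionD[OF s(1)])
    have "s i x = (\<Sum>y\<in>s i ` space M. y * indicator (?S y \<inter> Y) x)" if x: "x \<in> space M" for x
    proof (cases "x \<in> Y")
      case True
      then show ?thesis
        using x simple_functionD(1)[OF s(1)]
        by (subst sum.remove[of _ "s i x"]) (auto simp: indicator_def intro!: sum.neutral)
    next
      case False
      then have "s i x = 0" using s(3)[OF x, of i] f(2)[of x] x by simp
      then show ?thesis using False by (auto intro!: sum.neutral)
    qed
    then show "L2_eq M (\<lambda>x. \<Sum>y\<in>s i ` space M. y * indicator (?S y \<inter> Y) x) (s i)"
      unfolding L2_eq_def by (intro AE_I2) (rule sym)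
  qed
  show ?thesis
  proof (rule L2_closed_subspaceD(4)[OF V sV f(1)], rule L2_lim_dominated[OF sL f(1)])
    show "integrable M (\<lambda>x. 9 * (cmod (f x))\<^sup>2)" using L2_integrable[OF f(1)] by simp
    have "(cmod (s n x - f x))\<^sup>2 \<le> 9 * (cmod (f x))\<^sup>2" if "x \<in> space M" for n x
    proof -
      have "cmod (s n x - f x) \<le> 3 * cmod (f x)"
        using norm_triangle_ineq4[of "s n x" "f x"] s(3)[OF that, of n] by simp
      from power_mono[OF this, of 2] show ?thesis by (simp add: power_mult_distrib)
    qed
    then show "AE x in M. (cmod (s n x - f x))\<^sup>2 \<le> 9 * (cmod (f x))\<^sup>2" for n by auto
    show "AE x in M. (\<lambda>n. s n x) \<longlonglongrightarrow> f x" using s(2) by auto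
  qed
qed

section \<open>Hausdorff measure on the line\<close>

definition hcover :: "real \<Rightarrow> 'a::metric_space set \<Rightarrow> (nat \<Rightarrow> 'a set) \<Rightarrow> bool" where
  "hcover \<delta> A B \<longleftrightarrow> A \<subseteq> (\<Union>i. B i) \<and> (\<forall>i. bounded (B i) \<and> diameter (B i) \<le> \<delta>)"

lemma hausdorff_content_alt:
  "hausdorff_content s \<delta> A = (INF B \<in> Collect (hcover \<delta> A). \<Sum>i. ennreal (diameter (B i) powr s))"
  unfolding hausdorff_content_def hcover_def by simp

lemma hausdorff_content_le:
  "hcover \<delta> A B \<Longrightarrow> hausdorff_content s \<delta> A \<le> (\<Sum>i. ennreal (diameter (B i) powr s))"
  unfolding hausdorff_content_alt by (rule INF_lower) simp

lemma hausdorff_content_greatest: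
  "(\<And>B. hcover \<delta> A B \<Longrightarrow> c \<le> (\<Sum>i. ennreal (diameter (B i) powr s))) \<Longrightarrow> c \<le> hausdorff_content s \<delta> A"
  unfolding hausdorff_content_alt by (rule INF_greatest) simp

lemma hausdorff_content_mono:
  assumes "A \<subseteq> A'" "\<delta>' \<le> \<delta>"
  shows "hausdorff_content s \<delta> A \<le> hausdorff_content s \<delta>' A'"
proof (rule hausdorff_content_greatest, rule hausdorff_content_le)
  fix B assume "hcover \<delta>' A' B"
  then show "hcover \<delta> A B" using assms order_trans[OF _ assms(2)] unfolding hcover_def by blast
qed

lemma hausdorff_content_UN:
  fixes A :: "nat \<Rightarrow> 'a::metric_space set"
  shows "hausdorff_content s \<delta> (\<Union>i. A i) \<le> (\<Sum>i. hausdorff_content s \<delta> (A i))"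
proof (rule ennreal_le_epsilon)
  fix e :: real assume fin: "(\<Sum>i. hausdorff_content s \<delta> (A i)) < top" and e: "0 < e"
  have "\<exists>B. hcover \<delta> (A i) B \<and> (\<Sum>j. ennreal (diameter (B j) powr s)) \<le> hausdorff_content s \<delta> (A i) + ennreal (e * (1/2)^Suc i)" for i
  proof -
    have "hausdorff_content s \<delta> (A i) \<le> (\<Sum>i. hausdorff_content s \<delta> (A i))"
      using sum_le_suminf[of "\<lambda>i. hausdorff_content s \<delta> (A i)" "{i}"] by auto
    then have "hausdorff_content s \<delta> (A i) \<noteq> \<infinity>" using fin by (auto simp: top_unique)
    then have "\<exists>B\<in>Collect (hcover \<delta> (A i)). (\<Sum>j. ennreal (diameter (B j) powr s)) < hausdorff_content s \<delta> (A i) + ennreal (e * (1/2)^Suc i)"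
      by (intro INF_approx_ennreal[OF _ hausdorff_content_alt]) (use e in auto)
    then show ?thesis by (auto intro: less_imp_le)
  qed
  then obtain B where B: "\<And>i. hcover \<delta> (A i) (B i)"
    "\<And>i. (\<Sum>j. ennreal (diameter (B i j) powr s)) \<le> hausdorff_content s \<delta> (A i) + ennreal (e * (1/2)^Suc i)"
    by metis
  define C where "C n = (case prod_decode n of (i, j) \<Rightarrow> B i j)" for n
  have "hcover \<delta> (\<Union>i. A i) C"
    unfolding hcover_def
  proof (intro conjI allI subsetI)
    fix x assume "x \<in> (\<Union>i. A i)"
    then obtain i j where "x \<in> B i j" using B(1) unfolding hcover_def by blast
    then have "x \<in> C (prod_encode (i, j))" by (simp add: C_def)
    then show "x \<in> (\<Union>i. C i)" by blast
  qed (use B(1) in \<open>auto simp: C_def hcover_def split: prod.splits\<close>)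
  then have "hausdorff_content s \<delta> (\<Union>i. A i) \<le> (\<Sum>n. ennreal (diameter (C n) powr s))"
    by (rule hausdorff_content_le)
  also have "\<dots> = (\<Sum>n. (\<lambda>(i,j). ennreal (diameter (B i j) powr s)) (prod_decode n))"
    by (simp add: C_def split_beta)
  also have "\<dots> = (\<Sum>i. \<Sum>j. ennreal (diameter (B i j) powr s))"
    by (rule suminf_ennreal_2dimen) simp
  also have "\<dots> \<le> (\<Sum>i. hausdorff_content s \<delta> (A i) + ennreal (e * (1/2)^Suc i))"
    by (intro suminf_le B) auto
  also have "\<dots> = (\<Sum>i. hausdorff_content s \<delta> (A i)) + (\<Sum>i. ennreal (e * (1/2)^Suc i))"
    by (rule suminf_add[symmetric]) auto
  also have "(\<Sum>i. ennreal (e * (1/2)^Suc i)) = ennreal e"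
    using sums_mult[OF power_half_series, of e] e
    by (subst suminf_ennreal_eq[of _ e]) auto
  finally show "hausdorff_content s \<delta> (\<Union>i. A i) \<le> (\<Sum>i. hausdorff_content s \<delta> (A i)) + ennreal e" .
qed

lemma hausdorff_outer_ge: "\<delta> > 0 \<Longrightarrow> hausdorff_content s \<delta> A \<le> hausdorff_outer s A"
  unfolding hausdorff_outer_def by (rule SUP_upper) simp

lemma hausdorff_outer_leI: "(\<And>\<delta>. \<delta> > 0 \<Longrightarrow> hausdorff_content s \<delta> A \<le> c) \<Longrightarrow> hausdorff_outer s A \<le> c"
  unfolding hausdorff_outer_def by (rule SUP_least) simp

lemma hausdorff_outer_mono: "A \<subseteq> A' \<Longrightarrow> hausdorff_outer s A \<le> hausdorff_outer s A'"
  by (rule hausdorff_outer_leI) (meson hausdorff_content_mono hausdorff_outer_ge order_refl order_trans)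

lemma hausdorff_outer_UN:
  fixes A :: "nat \<Rightarrow> 'a::metric_space set"
  shows "hausdorff_outer s (\<Union>i. A i) \<le> (\<Sum>i. hausdorff_outer s (A i))"
  by (rule hausdorff_outer_leI, rule order_trans[OF hausdorff_content_UN])
     (intro suminf_le hausdorff_outer_ge, auto)

lemma hausdorff_outer_singleton: "hausdorff_outer s {x} = 0"
proof -
  have "hausdorff_outer s {x} \<le> 0"
  proof (rule hausdorff_outer_leI)
    fix \<delta> :: real assume "\<delta> > 0"
    then have "hcover \<delta> {x} (\<lambda>i. {x})" by (simp add: hcover_def)
    from hausdorff_content_le[OF this, of s] show "hausdorff_content s \<delta> {x} \<le> 0" by simp
  qed
  then show ?thesis by simp
qed

lemma hausdorff_outer_empty: "hausdorff_outer s {} = 0"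
  using hausdorff_outer_mono[of "{}" "{undefined}" s] by (simp add: hausdorff_outer_singleton)

lemma hausdorff_content_Un:
  assumes "0 \<le> \<delta>"
  shows "hausdorff_content s \<delta> (A \<union> B) \<le> hausdorff_content s \<delta> A + hausdorff_content s \<delta> B"
proof -
  have "hcover \<delta> ({} :: 'a set) (\<lambda>i. {})" using assms by (simp add: hcover_def)
  from hausdorff_content_le[OF this, of s] have e: "hausdorff_content s \<delta> ({} :: 'a set) = 0" by simp
  define C where "C i = (if i = 0 then A else if i = 1 then B else {})" for i :: nat
  have "A \<union> B = (\<Union>i. C i)" by (auto simp: C_def split: if_splits)
  then have "hausdorff_content s \<delta> (A \<union> B) \<le> (\<Sum>i. hausdorff_content s \<delta> (C i))"
    by (simp add: hausdorff_content_UN)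
  also have "\<dots> = (\<Sum>i\<in>{0,1}. hausdorff_content s \<delta> (C i))"
    by (rule suminf_finite) (auto simp: C_def e)
  finally show ?thesis by (simp add: C_def)
qed

lemma hausdorff_outer_Un: "hausdorff_outer s (A \<union> B) \<le> hausdorff_outer s A + hausdorff_outer s B"
  by (rule hausdorff_outer_leI, rule order_trans[OF hausdorff_content_Un])
     (auto intro: add_mono hausdorff_outer_ge)

lemma hausdorff_outer_seq:
  assumes "r > 0"
  shows "hausdorff_outer s A = (SUP n. hausdorff_content s (r / real (Suc n)) A)"
proof (rule antisym)
  show "hausdorff_outer s A \<le> (SUP n. hausdorff_content s (r / real (Suc n)) A)"
  proof (rule hausdorff_outer_leI)
    fix \<delta> :: real assume "\<delta> > 0"
    then obtain n where "r / \<delta> < real (Suc n)" using reals_Archimedean2 less_trans of_nat_less_iff lessI by metis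
    then have "r / real (Suc n) \<le> \<delta>" using \<open>\<delta> > 0\<close> by (simp add: field_simps)
    then show "hausdorff_content s \<delta> A \<le> (SUP n. hausdorff_content s (r / real (Suc n)) A)"
      by (intro SUP_upper2[of n] hausdorff_content_mono) auto
  qed
  show "(SUP n. hausdorff_content s (r / real (Suc n)) A) \<le> hausdorff_outer s A"
    using assms by (intro SUP_least hausdorff_outer_ge) auto
qed

text \<open>
  A set of diameter at most \<open>\<delta>\<close> cannot meet both \<open>A\<close> and \<open>B\<close>, so every cover of the union
  falls apart into a cover of \<open>A\<close> and a cover of \<open>B\<close>.
\<close>

lemma hausdorff_content_separated:
  fixes A B :: "'a::metric_space set"
  assumes sep: "\<And>x y. x \<in> A \<Longrightarrow> y \<in> B \<Longrightarrow> dist x y > \<delta>"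
  shows "hausdorff_content s \<delta> A + hausdorff_content s \<delta> B \<le> hausdorff_content s \<delta> (A \<union> B)"
proof (rule hausdorff_content_greatest)
  fix C assume C: "hcover \<delta> (A \<union> B) C"
  define CA where "CA i = (if C i \<inter> A \<noteq> {} then C i else {})" for i
  define CB where "CB i = (if C i \<inter> A \<noteq> {} then {} else C i)" for i
  have d0: "0 \<le> \<delta>" using C diameter_ge_0[of "C 0"] unfolding hcover_def by (meson order_trans)
  have "hcover \<delta> A CA"
    unfolding hcover_def
  proof (intro conjI allI subsetI)
    fix x assume "x \<in> A"
    then obtain i where "x \<in> C i" using C unfolding hcover_def by blast
    then show "x \<in> (\<Union>i. CA i)" using \<open>x \<in> A\<close> by (auto simp: CA_def)
  qed (use C d0 in \<open>auto simp: CA_def hcover_def\<close>)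
  moreover have "hcover \<delta> B CB"
    unfolding hcover_def
  proof (intro conjI allI subsetI)
    fix x assume x: "x \<in> B"
    then obtain i where i: "x \<in> C i" using C unfolding hcover_def by blast
    have "C i \<inter> A = {}"
    proof (rule ccontr)
      assume "C i \<inter> A \<noteq> {}"
      then obtain y where y: "y \<in> C i" "y \<in> A" by blast
      have "dist y x \<le> diameter (C i)" using C y i unfolding hcover_def by (intro diameter_bounded_bound) auto
      also have "\<dots> \<le> \<delta>" using C unfolding hcover_def by blast
      finally show False using sep[OF y(2) x] by simp
    qed
    then show "x \<in> (\<Union>i. CB i)" using i by (auto simp: CB_def)
  qed (use C d0 in \<open>auto simp: CB_def hcover_def\<close>)
  ultimately have "hausdorff_content s \<delta> A + hausdorff_content s \<delta> B
      \<le> (\<Sum>i. ennreal (diameter (CA i) powr s)) + (\<Sum>i. ennreal (diameter (CB i) powr s))"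
    by (intro add_mono hausdorff_content_le)
  also have "\<dots> = (\<Sum>i. ennreal (diameter (CA i) powr s) + ennreal (diameter (CB i) powr s))"
    by (rule suminf_add) auto
  also have "\<dots> = (\<Sum>i. ennreal (diameter (C i) powr s))"
    by (intro arg_cong[of _ _ suminf] ext) (auto simp: CA_def CB_def)
  finally show "hausdorff_content s \<delta> A + hausdorff_content s \<delta> B \<le> (\<Sum>i. ennreal (diameter (C i) powr s))" .
qed

lemma hausdorff_outer_separated:
  fixes A B :: "'a::metric_space set"
  assumes r: "r > 0" and sep: "\<And>x y. x \<in> A \<Longrightarrow> y \<in> B \<Longrightarrow> dist x y \<ge> r"
  shows "hausdorff_outer s A + hausdorff_outer s B \<le> hausdorff_outer s (A \<union> B)"
proof -
  have inc: "incseq (\<lambda>n. hausdorff_content s (r/2 / real (Suc n)) X)" for X :: "'a set"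
    using r by (intro incseq_SucI hausdorff_content_mono) (auto simp: field_simps)
  have "hausdorff_outer s A + hausdorff_outer s B
    = (SUP n. hausdorff_content s (r/2 / real (Suc n)) A + hausdorff_content s (r/2 / real (Suc n)) B)"
    unfolding hausdorff_outer_seq[OF half_gt_zero[OF r]] by (rule ennreal_SUP_add[OF inc inc, symmetric])
  also have "\<dots> \<le> hausdorff_outer s (A \<union> B)"
  proof (rule SUP_least)
    fix n
    have "hausdorff_content s (r/2 / real (Suc n)) A + hausdorff_content s (r/2 / real (Suc n)) B
        \<le> hausdorff_content s (r/2 / real (Suc n)) (A \<union> B)"
    proof (rule hausdorff_content_separated)
      fix x y assume "x \<in> A" "y \<in> B"
      have "r/2 / real (Suc n) \<le> r / 2 / 1" using r by (intro divide_left_mono) auto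
      also have "\<dots> < dist x y" using sep[OF \<open>x \<in> A\<close> \<open>y \<in> B\<close>] r by linarith
      finally show "r/2 / real (Suc n) < dist x y" .
    qed
    also have "\<dots> \<le> hausdorff_outer s (A \<union> B)" using r by (intro hausdorff_outer_ge) auto
    finally show "hausdorff_content s (r/2 / real (Suc n)) A + hausdorff_content s (r/2 / real (Suc n)) B \<le> hausdorff_outer s (A \<union> B)" .
  qed
  finally show ?thesis .
qed

text \<open>
  Splitting the open half-line into the annuli \<open>a + 1/(n+2) \<le> t < a + 1/(n+1)\<close>, those with even
  (odd) index are pairwise separated, so their outer measures are summable; this bounds the part of
  the open half-line that is not separated from \<open>a\<close>.
\<close>

lemma hausdorff_outer_split:
  fixes x :: "real set"
  shows "hausdorff_outer s (x \<inter> {..a}) + hausdorff_outer s (x - {..a}) \<le> hausdorff_outer s x"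
proof (cases "hausdorff_outer s x = \<infinity>")
  case False
  let ?H = "hausdorff_outer s :: real set \<Rightarrow> ennreal"
  define t where "t n = a + 1 / real (Suc n)" for n
  define E where "E n = x \<inter> {t n..}" for n
  define D where "D n = x \<inter> {t (Suc n)..<t n}" for n
  have t: "t m < t n" if "n < m" for m n using that by (simp add: t_def frac_less2)
  have le: "?H A \<le> ?H x" if "A \<subseteq> x" for A by (rule hausdorff_outer_mono[OF that])
  \<comment> \<open>the part of x that contains the first m annuli of parity p; for m = 0 it has to be empty\<close>
  define W where "W p m = x \<inter> {y. m > 0 \<and> t (2*m+p-1) \<le> y}" for p m :: nat
  have ev: "(\<Sum>k<m. ?H (D (2*k+p))) \<le> ?H (W p m)" for m p
  proof (induction m)
    case 0
    show ?case by simp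
  next
    case (Suc m)
    have t1: "t (Suc (2*m+p)) < t (2*m+p-1)" by (rule t) simp
    have "(\<Sum>k<Suc m. ?H (D (2*k+p))) \<le> ?H (W p m) + ?H (D (2*m+p))"
      using Suc by (simp add: add_mono)
    also have "\<dots> \<le> ?H (W p m \<union> D (2*m+p))"
    proof (rule hausdorff_outer_separated)
      show "0 < (if m = 0 then 1 else t (2*m+p-1) - t (2*m+p))" using t[of "2*m+p-1" "2*m+p"] by auto
      show "(if m = 0 then 1 else t (2*m+p-1) - t (2*m+p)) \<le> dist u v" if "u \<in> W p m" "v \<in> D (2*m+p)" for u v
        using that by (auto simp: W_def D_def dist_real_def)
    qed
    also have "\<dots> \<le> ?H (W p (Suc m))"
    proof (rule hausdorff_outer_mono, rule subsetI)
      fix y assume "y \<in> W p m \<union> D (2*m+p)"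
      then show "y \<in> W p (Suc m)"
        using t1 by (auto simp: W_def D_def split: if_splits)
    qed
    finally show ?case .
  qed
  have dbl: "(\<Sum>k<2*m. ?H (D k)) = (\<Sum>k<m. ?H (D (2*k+0))) + (\<Sum>k<m. ?H (D (2*k+1)))" for m
    by (induction m) (simp_all add: algebra_simps)
  have bound: "(\<Sum>k. ?H (D k)) \<le> ?H x + ?H x"
  proof (rule suminf_le_const)
    fix n
    have "(\<Sum>k<n. ?H (D k)) \<le> (\<Sum>k<2*n. ?H (D k))" by (rule sum_mono2) auto
    also have "\<dots> \<le> ?H x + ?H x"
      unfolding dbl by (intro add_mono order_trans[OF ev] le) (auto simp: W_def)
    finally show "(\<Sum>k<n. ?H (D k)) \<le> ?H x + ?H x" .
  qed auto
  have R: "x - {..a} = E n \<union> (\<Union>k. D (k + n))" for n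
  proof (intro equalityI subsetI)
    fix y assume y: "y \<in> x - {..a}"
    show "y \<in> E n \<union> (\<Union>k. D (k + n))"
    proof (cases "t n \<le> y")
      case False
      obtain m where "1 / (y - a) < real (Suc m)" using reals_Archimedean2 less_trans of_nat_less_iff lessI by metis
      then have "t m \<le> y" using y by (simp add: t_def field_simps)
      then have ex: "\<exists>m. t m \<le> y" by blast
      define m where "m = (LEAST m. t m \<le> y)"
      have m: "t m \<le> y" unfolding m_def using ex by (rule LeastI_ex)
      have lm: "y < t k" if "k < m" for k using not_less_Least[OF that[unfolded m_def]] by simp
      have "n < m" using m False t[of m n] by (cases m n rule: linorder_cases) auto
      then obtain k where k: "m = Suc (k + n)" by (metis less_iff_Suc_add add.commute)
      have "y \<in> D (k + n)" using y m lm[of "k+n"] by (auto simp: D_def k)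
      then show ?thesis by blast
    qed (use y in \<open>auto simp: E_def\<close>)
  next
    fix y assume "y \<in> E n \<union> (\<Union>k. D (k + n))"
    then obtain m where "t m \<le> y" "y \<in> x" by (auto simp: E_def D_def)
    moreover have "a < t m" by (simp add: t_def)
    ultimately show "y \<in> x - {..a}" by auto
  qed
  define S where "S = (\<Sum>k. ?H (D k))"
  have "?H (x \<inter> {..a}) + ?H (x - {..a}) + (\<Sum>k<n. ?H (D k)) \<le> ?H x + S" for n
  proof -
    have "?H (x - {..a}) \<le> ?H (E n) + (\<Sum>k. ?H (D (k + n)))"
      unfolding R[of n] by (intro order_trans[OF hausdorff_outer_Un] add_mono hausdorff_outer_UN order_refl)
    then have "?H (x \<inter> {..a}) + ?H (x - {..a}) + (\<Sum>k<n. ?H (D k))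
       \<le> ?H (x \<inter> {..a}) + (?H (E n) + (\<Sum>k. ?H (D (k + n)))) + (\<Sum>k<n. ?H (D k))"
      by (intro add_mono) auto
    also have "\<dots> = (?H (x \<inter> {..a}) + ?H (E n)) + S"
      unfolding S_def by (subst suminf_offset[of "\<lambda>k. ?H (D k)" n]) (auto simp: add_ac)
    also have "?H (x \<inter> {..a}) + ?H (E n) \<le> ?H (x \<inter> {..a} \<union> E n)"
      by (rule hausdorff_outer_separated[of "1 / real (Suc n)"]) (auto simp: E_def t_def dist_real_def)
    also have "\<dots> \<le> ?H x" by (rule le) (auto simp: E_def)
    finally show ?thesis by (simp add: add_mono)
  qed
  moreover have "(\<lambda>n. ?H (x \<inter> {..a}) + ?H (x - {..a}) + (\<Sum>k<n. ?H (D k))) \<longlonglongrightarrow> ?H (x \<inter> {..a}) + ?H (x - {..a}) + S"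
    unfolding S_def by (intro tendsto_add tendsto_const summable_LIMSEQ) auto
  ultimately have "?H (x \<inter> {..a}) + ?H (x - {..a}) + S \<le> ?H x + S"
    by (intro LIMSEQ_le_const2) auto
  moreover have "S < \<infinity>" using bound False by (simp add: S_def le_less_trans less_top)
  ultimately show ?thesis by (auto simp: add.commute[of _ S] ennreal_add_left_cancel_le)
qed simp

lemma hausdorff_outer_measure_space:
  "measure_space UNIV (sets borel) (hausdorff_outer s :: real set \<Rightarrow> ennreal)"
proof -
  let ?H = "hausdorff_outer s :: real set \<Rightarrow> ennreal"
  let ?L = "lambda_system UNIV (Pow UNIV) ?H"
  interpret P: sigma_algebra UNIV "Pow UNIV :: real set set" by (rule sigma_algebra_Pow)
  have "outer_measure_space (Pow UNIV) ?H"
    by (auto simp: outer_measure_space_def positive_def increasing_def countably_subadditive_def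
        hausdorff_outer_empty hausdorff_outer_mono hausdorff_outer_UN)
  then have L: "measure_space UNIV ?L ?H" by (rule P.caratheodory_lemma)
  have ha: "{..a} \<in> ?L" for a
    unfolding P.lambda_system_eq
  proof (intro CollectI conjI ballI antisym hausdorff_outer_split)
    fix x :: "real set"
    have "?H x = ?H (x \<inter> {..a} \<union> (x - {..a}))" by (simp add: Int_Diff_Un)
    then show "?H x \<le> ?H (x \<inter> {..a}) + ?H (x - {..a})" by (simp add: hausdorff_outer_Un del: Int_Diff_Un)
  qed simp
  interpret L: sigma_algebra UNIV ?L using L by (simp add: measure_space_def)
  have "sigma_sets UNIV (range (\<lambda>a::real. {..a})) \<subseteq> ?L"
    by (rule L.sigma_sets_subset) (use ha in blast)
  then have "sets borel \<subseteq> ?L" by (subst borel_eq_atMost) simp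
  then show ?thesis using L sets.sigma_algebra_axioms[of "borel :: real measure"]
    unfolding measure_space_def countably_additive_def positive_def by (auto simp: subset_iff)
qed

lemma sets_hausdorff_measure: "sets (hausdorff_measure s :: real measure) = sets borel"
  unfolding hausdorff_measure_def by (metis sets.sigma_sets_eq sets_measure_of space_borel sets.space_closed)

lemma emeasure_hausdorff_measure:
  assumes "A \<in> sets borel"
  shows "emeasure (hausdorff_measure s) (A :: real set) = hausdorff_outer s A"
  unfolding hausdorff_measure_def
  using hausdorff_outer_measure_space[of s] assms
  by (intro emeasure_measure_of_sigma) (auto simp: measure_space_def)

lemma diameter_affine:
  fixes B :: "real set"
  assumes r: "r > 0" and b: "bounded B"
  shows "diameter ((\<lambda>x. r * x + c) ` B) = r * diameter B"
proof -
  have *: "diameter ((\<lambda>x. r * x + c) ` B) \<le> r * diameter B" if r: "r > 0" and b: "bounded B" for B :: "real set" and r c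
  proof (rule diameter_le)
    fix x y assume "x \<in> (\<lambda>x. r * x + c) ` B" "y \<in> (\<lambda>x. r * x + c) ` B"
    then obtain u v where uv: "u \<in> B" "v \<in> B" "x = r * u + c" "y = r * v + c" by blast
    have "norm (x - y) = r * dist u v"
      using r by (simp add: uv dist_real_def abs_mult flip: right_diff_distrib)
    then show "norm (x - y) \<le> r * diameter B"
      using diameter_bounded_bound[OF b uv(1,2)] r by simp
  qed (use r b in \<open>auto intro: diameter_ge_0\<close>)
  have "bounded ((\<lambda>x. r * x + c) ` B)"
    using bounded_translation[OF bounded_scaling[OF b, of r], of c] by (simp add: image_image add.commute)
  from *[OF _ this, of "1/r" "-c/r"] have "diameter B \<le> diameter ((\<lambda>x. r * x + c) ` B) / r"
    using r by (simp add: image_image field_simps add_divide_distrib)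
  then have "r * diameter B \<le> diameter ((\<lambda>x. r * x + c) ` B)" using r by (simp add: field_simps)
  with *[OF r b, of c] show ?thesis by simp
qed

text \<open>
  Multiplied by the inverse factor \<open>r powr (-s)\<close>, the claim becomes a lower bound for the infimum that defines
  the content of \<open>A\<close>.
\<close>

lemma hausdorff_content_affine:
  fixes A :: "real set"
  assumes r: "r > 0"
  shows "hausdorff_content s (r * \<delta>) ((\<lambda>x. r * x + c) ` A) \<le> ennreal (r powr s) * hausdorff_content s \<delta> A"
proof -
  let ?f = "\<lambda>x. r * x + c"
  have *: "hausdorff_content s (r * \<delta>) (?f ` A) \<le> ennreal (r powr s) * (\<Sum>i. ennreal (diameter (B i) powr s))"
    if s: "hcover \<delta> A B" for B
  proof -
    have bB: "bounded (B i)" for i using s by (simp add: hcover_def)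
    have b: "bounded (?f ` B i)" for i
      using bounded_translation[OF bounded_scaling[OF bB, of r], of c] by (simp add: image_image add.commute)
    have "?f ` A \<subseteq> (\<Union>i. ?f ` B i)" using s unfolding hcover_def by blast
    then have "hcover (r * \<delta>) (?f ` A) (\<lambda>i. ?f ` B i)"
      using s b r bB unfolding hcover_def by (simp add: diameter_affine)
    then have "hausdorff_content s (r * \<delta>) (?f ` A) \<le> (\<Sum>i. ennreal (diameter (?f ` B i) powr s))"
      by (rule hausdorff_content_le)
    also have "\<dots> = (\<Sum>i. ennreal (r powr s) * ennreal (diameter (B i) powr s))"
      using r by (simp add: diameter_affine bB powr_mult diameter_ge_0 ennreal_mult)
    finally show ?thesis by simp
  qed
  have k: "ennreal (r powr s) * ennreal (r powr (-s)) = 1"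
    using r by (simp flip: ennreal_mult powr_add)
  have "ennreal (r powr (-s)) * hausdorff_content s (r * \<delta>) (?f ` A) \<le> hausdorff_content s \<delta> A"
  proof (rule hausdorff_content_greatest)
    fix B assume B: "hcover \<delta> A B"
    have "ennreal (r powr (-s)) * hausdorff_content s (r * \<delta>) (?f ` A)
       \<le> ennreal (r powr (-s)) * (ennreal (r powr s) * (\<Sum>i. ennreal (diameter (B i) powr s)))"
      by (intro mult_left_mono * B) auto
    also have "\<dots> = (\<Sum>i. ennreal (diameter (B i) powr s))"
      using k by (simp flip: mult.assoc add: mult.commute)
    finally show "ennreal (r powr (-s)) * hausdorff_content s (r * \<delta>) (?f ` A) \<le> (\<Sum>i. ennreal (diameter (B i) powr s))" .
  qed
  then have "ennreal (r powr s) * (ennreal (r powr (-s)) * hausdorff_content s (r * \<delta>) (?f ` A)) \<le> ennreal (r powr s) * hausdorff_content s \<delta> A"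
    by (intro mult_left_mono) auto
  then show ?thesis using k by (simp flip: mult.assoc)
qed

lemma hausdorff_outer_affine:
  fixes A :: "real set"
  assumes r: "r > 0"
  shows "hausdorff_outer s ((\<lambda>x. r * x + c) ` A) = ennreal (r powr s) * hausdorff_outer s A"
proof -
  have le: "hausdorff_outer s ((\<lambda>x. r * x + c) ` A) \<le> ennreal (r powr s) * hausdorff_outer s A"
    if r: "r > 0" for r c and A :: "real set"
  proof (rule hausdorff_outer_leI)
    fix \<delta> :: real assume "\<delta> > 0"
    have "hausdorff_content s \<delta> ((\<lambda>x. r * x + c) ` A) \<le> ennreal (r powr s) * hausdorff_content s (\<delta> / r) A"
      using hausdorff_content_affine[OF r, of s "\<delta> / r" c A] r by simp
    also have "\<dots> \<le> ennreal (r powr s) * hausdorff_outer s A"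
      using \<open>\<delta> > 0\<close> r by (intro mult_left_mono hausdorff_outer_ge) auto
    finally show "hausdorff_content s \<delta> ((\<lambda>x. r * x + c) ` A) \<le> ennreal (r powr s) * hausdorff_outer s A" .
  qed
  show ?thesis
  proof (rule antisym[OF le[OF r]])
    have "A = (\<lambda>x. (1/r) * x + (-c/r)) ` (\<lambda>x. r * x + c) ` A"
      using r by (simp add: image_image field_simps)
    then have "hausdorff_outer s A \<le> ennreal ((1/r) powr s) * hausdorff_outer s ((\<lambda>x. r * x + c) ` A)"
      using le[of "1/r" "-c/r" "(\<lambda>x. r * x + c) ` A"] r by simp
    then have "ennreal (r powr s) * hausdorff_outer s A \<le> ennreal (r powr s) * (ennreal ((1/r) powr s) * hausdorff_outer s ((\<lambda>x. r * x + c) ` A))"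
      by (intro mult_left_mono) auto
    also have "\<dots> = hausdorff_outer s ((\<lambda>x. r * x + c) ` A)"
      using r by (simp flip: mult.assoc ennreal_mult powr_mult)
    finally show "ennreal (r powr s) * hausdorff_outer s A \<le> hausdorff_outer s ((\<lambda>x. r * x + c) ` A)" .
  qed
qed

section \<open>The Cantor set\<close>

lemma cantor_stage_Suc_iff: "x \<in> cantor_stage (Suc n) \<longleftrightarrow> 3 * x \<in> cantor_stage n \<or> 3 * x - 2 \<in> cantor_stage n"
proof -
  have "x \<in> (\<lambda>x. x / 3) ` A \<longleftrightarrow> 3 * x \<in> A" for A
    by (auto intro!: image_eqI[of _ _ "3 * x"])
  moreover have "x \<in> (\<lambda>x. 2/3 + x / 3) ` A \<longleftrightarrow> 3 * x - 2 \<in> A" for A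
    by (auto intro!: image_eqI[of _ _ "3 * x - 2"] simp: field_simps)
  ultimately show ?thesis by simp
qed

declare cantor_stage.simps(2) [simp del]

lemma cantor_stage_Suc_subset: "cantor_stage (Suc n) \<subseteq> cantor_stage n"
proof (induction n)
  case 0
  show ?case by (auto simp: cantor_stage_Suc_iff)
next
  case (Suc n)
  show ?case
  proof
    fix x assume "x \<in> cantor_stage (Suc (Suc n))"
    then have "3 * x \<in> cantor_stage (Suc n) \<or> 3 * x - 2 \<in> cantor_stage (Suc n)"
      by (simp only: cantor_stage_Suc_iff[of _ "Suc n"])
    then show "x \<in> cantor_stage (Suc n)" using Suc by (subst cantor_stage_Suc_iff) blast
  qed
qed

lemma cantor_stage_antimono: "m \<le> n \<Longrightarrow> cantor_stage n \<subseteq> cantor_stage m"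
  by (rule lift_Suc_antimono_le[of cantor_stage, OF cantor_stage_Suc_subset])

lemma cantor_stage_unit: "cantor_stage n \<subseteq> {0..1}"
  using cantor_stage_antimono[of 0 n] by simp

lemma compact_cantor_stage: "compact (cantor_stage n)"
proof (induction n)
  case (Suc n)
  show ?case unfolding cantor_stage.simps(2)
    by (intro compact_Un compact_continuous_image continuous_intros Suc) auto
qed auto

lemma cantor_set_unit: "cantor_set \<subseteq> {0..1}"
  using cantor_stage_unit[of 0] unfolding cantor_set_def by blast

lemma compact_cantor_set: "compact cantor_set"
  unfolding cantor_set_def by (intro compact_Inter) (auto intro: compact_cantor_stage)

lemma cantor_set_borel [measurable]: "cantor_set \<in> sets borel"
  by (intro borel_closed compact_imp_closed compact_cantor_set)

lemma cantor_set_iff: "x \<in> cantor_set \<longleftrightarrow> 3 * x \<in> cantor_set \<or> 3 * x - 2 \<in> cantor_set"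
proof
  assume x: "x \<in> cantor_set"
  then have st: "3 * x \<in> cantor_stage n \<or> 3 * x - 2 \<in> cantor_stage n" for n
    by (metis INT_iff UNIV_I cantor_set_def cantor_stage_Suc_iff)
  show "3 * x \<in> cantor_set \<or> 3 * x - 2 \<in> cantor_set"
  proof (cases "x < 1/2")
    case True
    then have "3 * x \<in> cantor_stage n" for n using st[of n] cantor_stage_unit[of n] by force
    then show ?thesis by (simp add: cantor_set_def)
  next
    case False
    then have "3 * x - 2 \<in> cantor_stage n" for n using st[of n] cantor_stage_unit[of n] by force
    then show ?thesis by (simp add: cantor_set_def)
  qed
next
  assume "3 * x \<in> cantor_set \<or> 3 * x - 2 \<in> cantor_set"
  then have "x \<in> cantor_stage (Suc n)" for n
    by (auto simp: cantor_set_def cantor_stage_Suc_iff)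
  then show "x \<in> cantor_set" unfolding cantor_set_def using cantor_stage_Suc_subset by blast
qed

abbreviation cdim :: real where "cdim \<equiv> log 3 2"

lemma three_powr_cdim: "3 powr cdim = 2" "(1/3) powr cdim = 1/2"
  by (simp_all add: powr_divide)

lemma cdim_bounds: "0 < cdim" "cdim < 1"
  by (simp_all add: log_less_one_cancel_iff zero_less_log_cancel_iff)

text \<open>
  The two copies of the Cantor set in the next stage carry the factor \<open>(1/3) powr (log 3 2) = 1/2\<close>.
\<close>

lemma cantor_content_le: "hausdorff_content cdim ((1/3)^n) cantor_set \<le> 1"
proof (induction n)
  case 0
  have "bounded cantor_set" using cantor_set_unit bounded_subset bounded_closed_interval by blast
  moreover have d: "diameter cantor_set \<le> 1"
    using diameter_subset[OF cantor_set_unit bounded_closed_interval] by simp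
  ultimately have "hcover 1 cantor_set (\<lambda>i. if i = 0 then cantor_set else {})"
    by (auto simp: hcover_def split: if_splits)
  then have "hausdorff_content cdim 1 cantor_set \<le> (\<Sum>i. ennreal (diameter (if i = (0::nat) then cantor_set else {}) powr cdim))"
    by (rule hausdorff_content_le)
  also have "\<dots> = (\<Sum>i\<in>{0::nat}. ennreal (diameter (if i = (0::nat) then cantor_set else {}) powr cdim))"
    by (rule suminf_finite) auto
  also have "\<dots> \<le> ennreal (1 powr cdim)"
    using d cdim_bounds \<open>bounded cantor_set\<close> by (simp add: ennreal_leI powr_le1 diameter_ge_0)
  finally show ?case by simp
next
  case (Suc n)
  let ?h = "hausdorff_content cdim ((1/3)^Suc n)"
  have C: "cantor_set \<subseteq> (\<lambda>x. (1/3) * x + 0) ` cantor_set \<union> (\<lambda>x. (1/3) * x + 2/3) ` cantor_set" (is "_ \<subseteq> ?A \<union> ?B")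
  proof
    fix x assume "x \<in> cantor_set"
    then consider "3 * x \<in> cantor_set" | "3 * x - 2 \<in> cantor_set" using cantor_set_iff by blast
    then show "x \<in> ?A \<union> ?B"
    proof cases
      case 1 then have "x \<in> ?A" by (intro image_eqI[of _ _ "3 * x"]) auto
      then show ?thesis ..
    next
      case 2 then have "x \<in> ?B" by (intro image_eqI[of _ _ "3 * x - 2"]) (auto simp: field_simps)
      then show ?thesis ..
    qed
  qed
  have half: "?h ((\<lambda>x. (1/3) * x + c) ` cantor_set) \<le> ennreal (1/2)" for c
  proof -
    have "?h ((\<lambda>x. (1/3) * x + c) ` cantor_set) \<le> ennreal ((1/3) powr cdim) * hausdorff_content cdim ((1/3)^n) cantor_set"
      using hausdorff_content_affine[of "1/3" cdim "(1/3)^n" c cantor_set] by simp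
    also have "\<dots> \<le> ennreal (1/2) * 1" unfolding three_powr_cdim by (intro mult_left_mono Suc) auto
    finally show ?thesis by simp
  qed
  have "?h cantor_set \<le> ?h (?A \<union> ?B)" by (rule hausdorff_content_mono[OF C]) simp
  also have "\<dots> \<le> ?h ?A + ?h ?B" by (rule hausdorff_content_Un) simp
  also have "\<dots> \<le> ennreal (1/2) + ennreal (1/2)" by (intro add_mono half)
  also have "\<dots> = ennreal (1/2 + 1/2)" by (rule ennreal_plus[symmetric]) auto
  also have "\<dots> = 1" by simp
  finally show ?case .
qed

lemma cantor_outer_le: "hausdorff_outer cdim cantor_set \<le> 1"
proof (rule hausdorff_outer_leI)
  fix \<delta> :: real assume "\<delta> > 0"
  then obtain n where "(1/3)^n < \<delta>" using real_arch_pow_inv[of \<delta> "1/3"] by auto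
  then have "hausdorff_content cdim \<delta> cantor_set \<le> hausdorff_content cdim ((1/3)^n) cantor_set"
    by (intro hausdorff_content_mono) auto
  also note cantor_content_le
  finally show "hausdorff_content cdim \<delta> cantor_set \<le> 1" .
qed

subsection \<open>The Cantor function\<close>

text \<open>
  Iterating the self-similarity \<open>F(x) = (F(3x) + F(3x-2)) / 2\<close> converges to the Cantor function, extended by
  constants outside the unit interval.
\<close>

fun cantor_iter :: "nat \<Rightarrow> real \<Rightarrow> real" where
  "cantor_iter 0 x = max 0 (min 1 x)"
| "cantor_iter (Suc n) x = (cantor_iter n (3 * x) + cantor_iter n (3 * x - 2)) / 2"

definition cantor_fun :: "real \<Rightarrow> real" where
  "cantor_fun x = lim (\<lambda>n. cantor_iter n x)"

lemma cantor_iter_low: "x \<le> 0 \<Longrightarrow> cantor_iter n x = 0"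
  by (induction n arbitrary: x) auto

lemma cantor_iter_high: "1 \<le> x \<Longrightarrow> cantor_iter n x = 1"
  by (induction n arbitrary: x) auto

lemma cantor_iter_bounds: "0 \<le> cantor_iter n x" "cantor_iter n x \<le> 1"
proof -
  have "0 \<le> cantor_iter n x \<and> cantor_iter n x \<le> 1"
  proof (induction n arbitrary: x)
    case (Suc n)
    show ?case using Suc[of "3*x"] Suc[of "3*x-2"] by (auto intro: add_mono[of _ 1 _ 1, simplified])
  qed auto
  then show "0 \<le> cantor_iter n x" "cantor_iter n x \<le> 1" by auto
qed

text \<open>
  By concavity the left side is at most twice the value at the mean, \<open>2 m\<^sup>s = (3m)\<^sup>s\<close>, and
  \<open>3 m \<le> 1 + a + b\<close> because \<open>m = (a + b) / 2 \<le> 1\<close>. Concavity enters as the inequality of Young, that is,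
  as the tangent of \<open>x\<^sup>s\<close> at \<open>m\<close>.
\<close>

lemma powr_sum_le:
  fixes a b s :: real
  assumes s: "0 < s" "s < 1" and ab: "0 \<le> a" "a \<le> 1" "0 \<le> b" "b \<le> 1" and s3: "3 powr s = 2"
  shows "a powr s + b powr s \<le> (1 + a + b) powr s"
proof (cases "a + b = 0")
  case False
  define m where "m = (a + b) / 2"
  have m: "m > 0" using ab False by (simp add: m_def)
  \<comment> \<open>the tangent of x powr s at m\<close>
  have conc: "x powr s \<le> m powr s * (s * (x / m) + (1 - s))" if "0 \<le> x" for x
  proof (cases "x = 0")
    case True then show ?thesis using s m by simp
  next
    case False
    then have "(x / m) powr s * 1 powr (1 - s) \<le> s * (x / m) + (1 - s) * 1"
      using that m s by (intro Youngs_inequality_0) auto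
    moreover have "x powr s = m powr s * (x / m) powr s"
      using m that by (simp flip: powr_mult)
    moreover have "m powr s * (x / m) powr s \<le> m powr s * (s * (x / m) + (1 - s))" if "(x / m) powr s \<le> s * (x / m) + (1 - s)"
      using that by (rule mult_left_mono) simp
    ultimately show ?thesis by simp
  qed
  have "a powr s + b powr s \<le> m powr s * (s * (a / m) + (1 - s)) + m powr s * (s * (b / m) + (1 - s))"
    using conc[of a] conc[of b] ab by simp
  also have "\<dots> = m powr s * (s * ((a + b) / m) + 2 * (1 - s))" by (simp add: algebra_simps add_divide_distrib)
  also have "(a + b) / m = 2"
  proof -
    have "a + b = 2 * m" by (simp add: m_def)
    then show ?thesis using m by simp
  qed
  also have "m powr s * (s * 2 + 2 * (1 - s)) = (3 * m) powr s"
    using m by (simp add: powr_mult s3)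
  also have "\<dots> \<le> (1 + a + b) powr s" using ab s m by (intro powr_mono2) (auto simp: m_def field_simps)
  finally show ?thesis .
next
  case True
  then have "a = 0" "b = 0" using ab by linarith+
  then show ?thesis by simp
qed

text \<open>
  Only the middle case uses more than self-similarity: across the central gap the increment splits
  as \<open>a powr s + b powr s\<close> with \<open>1 + a + b\<close> the triple of the distance.
\<close>

lemma cantor_iter_Hoelder:
  assumes "x \<le> y"
  shows "cantor_iter n y - cantor_iter n x \<le> (y - x) powr cdim"
  using assms
proof (induction n arbitrary: x y)
  case 0
  show ?case
  proof (cases "y - x \<le> 1")
    case True
    then have "(y - x) powr 1 \<le> (y - x) powr cdim" using cdim_bounds 0 by (intro powr_mono') auto
    then show ?thesis using 0 by auto
  next
    case False
    then have "1 \<le> (y - x) powr cdim" using cdim_bounds by (intro ge_one_powr_ge_zero) auto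
    then show ?thesis by auto
  qed
next
  case (Suc n)
  let ?F = "cantor_iter n"
  define u where "u = ?F (3*y) - ?F (3*x)"
  define v where "v = ?F (3*y-2) - ?F (3*x-2)"
  have sc: "(3*y - 3*x) powr cdim = 2 * (y - x) powr cdim"
    using powr_mult[of 3 "y - x" cdim] Suc.prems three_powr_cdim(1) by (simp add: right_diff_distrib)
  have u: "u \<le> (3*y - 3*x) powr cdim" unfolding u_def using Suc by auto
  have v: "v \<le> (3*y - 3*x) powr cdim" unfolding v_def using Suc.IH[of "3*x-2" "3*y-2"] Suc.prems by auto
  have "u + v \<le> (3*y - 3*x) powr cdim"
  proof -
    consider "3*y \<le> 2" | "3*x \<ge> 1" | "3*y > 2" "3*x < 1" by linarith
    then show ?thesis
    proof cases
      case 1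
      then have "v = 0" using Suc.prems by (simp add: v_def cantor_iter_low)
      then show ?thesis using u by simp
    next
      case 2
      then have "u = 0" using Suc.prems by (simp add: u_def cantor_iter_high)
      then show ?thesis using v by simp
    next
      case 3
      define a where "a = 1 - max 0 (3*x)"
      define b where "b = min 1 (3*y-2)"
      have ab: "0 \<le> a" "a \<le> 1" "0 \<le> b" "b \<le> 1" using 3 by (auto simp: a_def b_def)
      have "u = ?F 1 - ?F (max 0 (3*x))"
        using 3 by (auto simp: u_def cantor_iter_high cantor_iter_low max_def)
      also have "\<dots> \<le> a powr cdim" unfolding a_def using 3 by (intro Suc.IH) auto
      finally have ua: "u \<le> a powr cdim" .
      have "v = ?F b - ?F 0" using 3 by (auto simp: v_def b_def cantor_iter_high cantor_iter_low min_def)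
      also have "\<dots> \<le> (b - 0) powr cdim" using ab by (intro Suc.IH) auto
      finally have "u + v \<le> a powr cdim + b powr cdim" using ua by simp
      also have "\<dots> \<le> (1 + a + b) powr cdim" by (intro powr_sum_le cdim_bounds ab three_powr_cdim)
      also have "\<dots> \<le> (3*y - 3*x) powr cdim"
        using ab cdim_bounds by (intro powr_mono2) (auto simp: a_def b_def)
      finally show ?thesis .
    qed
  qed
  then have "(u + v) / 2 \<le> (y - x) powr cdim" by (simp add: sc)
  also have "(u + v) / 2 = cantor_iter (Suc n) y - cantor_iter (Suc n) x"
    by (simp add: u_def v_def field_simps)
  finally show ?case .
qed

lemma cantor_iter_mono: "x \<le> y \<Longrightarrow> cantor_iter n x \<le> cantor_iter n y"
  by (induction n arbitrary: x y) (auto intro!: add_mono)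

lemma cantor_iter_diff: "\<bar>cantor_iter (Suc n) x - cantor_iter n x\<bar> \<le> (1/2)^n"
proof (induction n arbitrary: x)
  case 0
  show ?case
    using cantor_iter_bounds[of 0 x] cantor_iter_bounds[of "Suc 0" x]
    by (simp del: cantor_iter.simps)
next
  case (Suc n)
  define d where "d t = cantor_iter (Suc n) t - cantor_iter n t" for t
  have out: "d t = 0" if "t \<le> 0 \<or> 1 \<le> t" for t
    unfolding d_def using that by (metis cantor_iter_low cantor_iter_high diff_self)
  have eq: "cantor_iter (Suc (Suc n)) x - cantor_iter (Suc n) x = (d (3*x) + d (3*x-2)) / 2"
    by (simp add: d_def field_simps)
  have "\<bar>d (3*x) + d (3*x-2)\<bar> \<le> (1/2)^n"
    using Suc[of "3*x", folded d_def] Suc[of "3*x-2", folded d_def] out[of "3*x"] out[of "3*x-2"] by (cases "3*x \<ge> 1") auto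
  then show ?case unfolding eq by (simp add: abs_divide)
qed

lemma cantor_iter_LIMSEQ: "(\<lambda>n. cantor_iter n x) \<longlonglongrightarrow> cantor_fun x"
proof -
  have "summable (\<lambda>n. cantor_iter (Suc n) x - cantor_iter n x)"
    by (rule summable_comparison_test'[of "\<lambda>n. (1/2)^n" 0])
       (use cantor_iter_diff in \<open>auto intro: summable_geometric simp del: cantor_iter.simps\<close>)
  then have "convergent (\<lambda>n. \<Sum>k<n. cantor_iter (Suc k) x - cantor_iter k x)"
    by (simp add: summable_iff_convergent del: cantor_iter.simps)
  then have "convergent (\<lambda>n. cantor_iter n x - cantor_iter 0 x)"
    using sum_lessThan_telescope[of "\<lambda>k. cantor_iter k x"] by (simp del: cantor_iter.simps)
  from convergent_add[OF this convergent_const[of "cantor_iter 0 x"]]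
  show ?thesis by (simp add: cantor_fun_def convergent_LIMSEQ_iff del: cantor_iter.simps)
qed

lemma cantor_fun_self: "cantor_fun x = (cantor_fun (3*x) + cantor_fun (3*x-2)) / 2"
proof (rule LIMSEQ_unique)
  show "(\<lambda>n. cantor_iter (Suc n) x) \<longlonglongrightarrow> cantor_fun x"
    using cantor_iter_LIMSEQ by (rule LIMSEQ_Suc)
  show "(\<lambda>n. cantor_iter (Suc n) x) \<longlonglongrightarrow> (cantor_fun (3*x) + cantor_fun (3*x-2)) / 2"
    by (auto intro!: tendsto_intros cantor_iter_LIMSEQ)
qed

lemma cantor_fun_low: "x \<le> 0 \<Longrightarrow> cantor_fun x = 0"
  using LIMSEQ_unique[OF cantor_iter_LIMSEQ] by (simp add: cantor_iter_low)

lemma cantor_fun_high: "1 \<le> x \<Longrightarrow> cantor_fun x = 1"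
  using LIMSEQ_unique[OF cantor_iter_LIMSEQ] by (simp add: cantor_iter_high)

lemma cantor_fun_Hoelder: "\<bar>cantor_fun y - cantor_fun x\<bar> \<le> \<bar>y - x\<bar> powr cdim"
proof -
  have *: "\<bar>cantor_fun y - cantor_fun x\<bar> \<le> \<bar>y - x\<bar> powr cdim" if "x \<le> y" for x y
  proof -
    have "cantor_fun y - cantor_fun x \<le> (y - x) powr cdim"
      by (rule LIMSEQ_le_const2[OF tendsto_diff[OF cantor_iter_LIMSEQ cantor_iter_LIMSEQ]])
         (use cantor_iter_Hoelder[OF that] in auto)
    moreover have "cantor_fun x \<le> cantor_fun y"
      by (rule LIMSEQ_le[OF cantor_iter_LIMSEQ cantor_iter_LIMSEQ]) (use cantor_iter_mono[OF that] in auto)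
    ultimately show ?thesis using that by simp
  qed
  show ?thesis using *[of x y] *[of y x] by (cases "x \<le> y") (auto simp: abs_minus_commute)
qed

lemma continuous_on_cantor_fun: "continuous_on A cantor_fun"
proof (rule continuous_at_imp_continuous_on, rule ballI)
  fix x
  have "((\<lambda>y. \<bar>y - x\<bar> powr cdim) \<longlongrightarrow> \<bar>x - x\<bar> powr cdim) (at x)"
    using cdim_bounds by (intro tendsto_powr2 tendsto_intros) auto
  then have "((\<lambda>y. \<bar>y - x\<bar> powr cdim) \<longlongrightarrow> 0) (at x)" by simp
  then have "((\<lambda>y. cantor_fun y - cantor_fun x) \<longlongrightarrow> 0) (at x)"
    by (rule Lim_null_comparison[rotated]) (simp add: cantor_fun_Hoelder)
  then show "isCont cantor_fun x" by (simp add: isCont_def LIM_zero_cancel)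
qed

text \<open>
  Every stage contains a solution, obtained by following the ternary expansion; the
  solutions in the stages form a decreasing sequence of compact sets.
\<close>

lemma cantor_fun_surj:
  assumes "t \<in> {0..1}"
  shows "\<exists>x\<in>cantor_set. cantor_fun x = t"
proof -
  have st: "\<exists>x\<in>cantor_stage n. cantor_fun x = t" if "t \<in> {0..1}" for n t
    using that
  proof (induction n arbitrary: t)
    case 0
    then have "\<exists>x\<ge>0. x \<le> 1 \<and> cantor_fun x = t"
      by (intro IVT' continuous_on_cantor_fun) (auto simp: cantor_fun_low cantor_fun_high)
    then show ?case by auto
  next
    case (Suc n)
    show ?case
    proof (cases "t \<le> 1/2")
      case True
      then obtain x where x: "x \<in> cantor_stage n" "cantor_fun x = 2 * t" using Suc.IH[of "2*t"] Suc.prems by auto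
      have e: "3 * (x/3) = x" "3 * (x/3) - 2 \<le> 0" using x cantor_stage_unit[of n] by auto
      have "cantor_fun (x/3) = t"
        using e(2) x(2) cantor_fun_low[of "x - 2"] cantor_fun_self[of "x/3"] by simp
      moreover have "x/3 \<in> cantor_stage (Suc n)" unfolding cantor_stage_Suc_iff e(1) using x by blast
      ultimately have "cantor_fun (x/3) = t" "x/3 \<in> cantor_stage (Suc n)" by auto
      then show ?thesis by blast
    next
      case False
      then obtain x where x: "x \<in> cantor_stage n" "cantor_fun x = 2 * t - 1" using Suc.IH[of "2*t-1"] Suc.prems by auto
      have e: "3 * ((x+2)/3) - 2 = x" by (simp add: field_simps)
      have e2: "3 * ((x+2)/3) \<ge> 1" using x cantor_stage_unit[of n] by (auto simp: field_simps)
      have "cantor_fun ((x+2)/3) = t"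
        by (subst cantor_fun_self) (simp only: e cantor_fun_high[OF e2] x, simp)
      moreover have "(x+2)/3 \<in> cantor_stage (Suc n)" unfolding cantor_stage_Suc_iff e using x by blast
      ultimately have "cantor_fun ((x+2)/3) = t" "(x+2)/3 \<in> cantor_stage (Suc n)" by auto
      then show ?thesis by blast
    qed
  qed
  define K where "K n = cantor_stage n \<inter> cantor_fun -` {t}" for n
  have "\<Inter>(range K) \<noteq> {}"
  proof (rule compact_nest)
    fix n
    have "closed (cantor_fun -` {t})" using continuous_on_cantor_fun[of UNIV]
      by (intro continuous_closed_vimage) (auto simp: continuous_on_eq_continuous_at)
    then show "compact (K n)" unfolding K_def by (intro compact_Int_closed compact_cantor_stage)
    show "K n \<noteq> {}" using st[OF assms, of n] by (auto simp: K_def)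
  next
    fix m n :: nat assume "m \<le> n" then show "K n \<subseteq> K m" using cantor_stage_antimono by (auto simp: K_def)
  qed
  then show ?thesis by (auto simp: K_def cantor_set_def)
qed

text \<open>
  A cover of the Cantor set is mapped by the Cantor function, which is Hoelder with constant one,
  to a cover of the unit interval by sets no longer than the \<open>s\<close>-th powers of the diameters.
\<close>

lemma cantor_outer_ge: "1 \<le> hausdorff_outer cdim cantor_set"
proof -
  have "1 \<le> hausdorff_content cdim 1 cantor_set"
  proof (rule hausdorff_content_greatest)
    fix B assume B: "hcover 1 cantor_set B"
    have "\<exists>J\<in>sets lborel. cantor_fun ` B i \<subseteq> J \<and> emeasure lborel J \<le> ennreal (diameter (B i) powr cdim)" for i
    proof (cases "B i = {}")
      case False
      let ?d = "diameter (B i) powr cdim"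
      have bB: "bounded (B i)" using B by (simp add: hcover_def)
      have d: "\<bar>cantor_fun y - cantor_fun x\<bar> \<le> ?d" if "x \<in> B i" "y \<in> B i" for x y
      proof (rule order_trans[OF cantor_fun_Hoelder], rule powr_mono2)
        show "\<bar>y - x\<bar> \<le> diameter (B i)" using diameter_bounded_bound[OF bB that] by (simp add: dist_real_def abs_minus_commute)
      qed (use cdim_bounds in auto)
      define Z where "Z = cantor_fun ` B i"
      obtain z where z: "z \<in> Z" using False by (auto simp: Z_def)
      have Zd: "\<bar>v - u\<bar> \<le> ?d" if "u \<in> Z" "v \<in> Z" for u v using that d by (auto simp: Z_def)
      have below: "bdd_below Z" using Zd[OF _ z] by (intro bdd_belowI[of _ "z - ?d"]) (force simp: abs_le_iff)
      \<comment> \<open>an image of diameter at most ?d fits into an interval of that length\<close>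
      have "Z \<subseteq> {Inf Z..Inf Z + ?d}"
      proof
        fix v assume v: "v \<in> Z"
        have "v - ?d \<le> u" if "u \<in> Z" for u using Zd[OF that v] by (simp add: abs_le_iff)
        then have "v - ?d \<le> Inf Z" using z by (intro cInf_greatest) auto
        then show "v \<in> {Inf Z..Inf Z + ?d}" using cInf_lower[OF v below] by auto
      qed
      then show ?thesis unfolding Z_def by (intro bexI[of _ "{Inf Z..Inf Z + ?d}"]) (auto simp: Z_def)
    qed auto
    then obtain J where J: "\<And>i. J i \<in> sets lborel" "\<And>i. cantor_fun ` B i \<subseteq> J i"
      "\<And>i. emeasure lborel (J i) \<le> ennreal (diameter (B i) powr cdim)" by metis
    have "{0..1} \<subseteq> (\<Union>i. J i)"
    proof
      fix t :: real assume "t \<in> {0..1}"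
      then obtain x where "x \<in> cantor_set" "cantor_fun x = t" using cantor_fun_surj by blast
      moreover obtain i where "x \<in> B i" using B \<open>x \<in> cantor_set\<close> unfolding hcover_def by blast
      ultimately show "t \<in> (\<Union>i. J i)" using J(2)[of i] by blast
    qed
    then have "emeasure lborel {0..1::real} \<le> emeasure lborel (\<Union>i. J i)" using J(1) by (intro emeasure_mono) auto
    also have "\<dots> \<le> (\<Sum>i. emeasure lborel (J i))" using J(1) by (intro emeasure_subadditive_countably) auto
    also have "\<dots> \<le> (\<Sum>i. ennreal (diameter (B i) powr cdim))" by (intro suminf_le J) auto
    finally show "1 \<le> (\<Sum>i. ennreal (diameter (B i) powr cdim))" by simp
  qed
  also have "\<dots> \<le> hausdorff_outer cdim cantor_set" by (rule hausdorff_outer_ge) simp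
  finally show ?thesis .
qed

lemma cantor_outer: "hausdorff_outer cdim cantor_set = 1"
  using cantor_outer_le cantor_outer_ge by (rule antisym)

section \<open>The measure space of triadic translates\<close>

lemma cantor_set_scale_up: "3^n * x - of_int k \<in> cantor_set \<Longrightarrow> \<exists>k'::int. 3^(Suc n) * x - of_int k' \<in> cantor_set"
proof -
  assume "3^n * x - of_int k \<in> cantor_set"
  then consider "3 * (3^n * x - of_int k) \<in> cantor_set" | "3 * (3^n * x - of_int k) - 2 \<in> cantor_set"
    using cantor_set_iff by blast
  then show ?thesis
  proof cases
    case 1
    then have "3^(Suc n) * x - of_int (3 * k) \<in> cantor_set" by (simp add: algebra_simps)
    then show ?thesis by blast
  next
    case 2
    then have "3^(Suc n) * x - of_int (3 * k + 2) \<in> cantor_set" by (simp add: algebra_simps)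
    then show ?thesis by blast
  qed
qed

lemma cantor_set_scale_down: "x \<in> cantor_set \<Longrightarrow> x / 3^n \<in> cantor_set"
proof (induction n)
  case (Suc n)
  then show ?case using cantor_set_iff[of "x / 3^Suc n"] by simp
qed simp

text \<open>
  The definition takes translates of the full Cantor set \<open>C\<close>, the right side those of its small copies \<open>3\<^sup>-\<^sup>n C\<close>.
  These are contained in \<open>C\<close>, and \<open>3\<^sup>n C\<close> is contained in a union of integer translates of \<open>C\<close>.
\<close>

lemma triadic_cantor_iff:
  "x \<in> triadic_cantor \<longleftrightarrow> (\<exists>n::nat. \<exists>k::int. 3^n * x - of_int k \<in> cantor_set)"
proof
  assume "x \<in> triadic_cantor"
  then obtain k n :: int and c where c: "c \<in> cantor_set" "x = c + of_int k / 3 powi n"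
    unfolding triadic_cantor_def by blast
  show "\<exists>n::nat. \<exists>k::int. 3^n * x - of_int k \<in> cantor_set"
  proof (cases "n \<ge> 0")
    case True
    define m where "m = nat n"
    have x: "x = c + of_int k / 3 ^ m" using c True by (simp add: m_def power_int_def)
    have "\<exists>j::int. 3^m * c - of_int j \<in> cantor_set" for m
    proof (induction m)
      case 0
      show ?case using c by (intro exI[of _ 0]) simp
    qed (use cantor_set_scale_up in blast)
    then obtain j :: int where "3^m * c - of_int j \<in> cantor_set" by blast
    then have "3^m * x - of_int (k + j) \<in> cantor_set" by (simp add: x distrib_left)
    then show ?thesis by blast
  next
    case False
    then have "x = c + of_int (k * 3 ^ nat (-n))" using c by (simp add: power_int_def field_simps)
    then have "3^0 * x - of_int (k * 3 ^ nat (-n)) \<in> cantor_set" using c by simp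
    then show ?thesis by blast
  qed
next
  assume "\<exists>n::nat. \<exists>k::int. 3^n * x - of_int k \<in> cantor_set"
  then obtain n :: nat and k :: int where c: "3^n * x - of_int k \<in> cantor_set" by blast
  have "x = (3^n * x - of_int k) / 3^n + of_int k / 3 powi (int n)" by (simp add: field_simps)
  then show "x \<in> triadic_cantor" using cantor_set_scale_down[OF c, of n] unfolding triadic_cantor_def by blast
qed

lemma cantor_set_triadic: "cantor_set \<subseteq> triadic_cantor"
proof
  fix x assume "x \<in> cantor_set"
  then have "3^0 * x - of_int 0 \<in> cantor_set" by simp
  then show "x \<in> triadic_cantor" unfolding triadic_cantor_iff by blast
qed

lemma triadic_cantor_shift: "x - of_int j \<in> triadic_cantor \<longleftrightarrow> x \<in> triadic_cantor"
proof -
  have *: "x - of_int j \<in> triadic_cantor" if x: "x \<in> triadic_cantor" for x and j :: int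
  proof -
    obtain n :: nat and k :: int where "3^n * x - of_int k \<in> cantor_set" using x triadic_cantor_iff by blast
    then have "3^n * (x - of_int j) - of_int (k - 3^n * j) \<in> cantor_set" by (simp add: algebra_simps)
    then show ?thesis unfolding triadic_cantor_iff by blast
  qed
  show ?thesis using *[of x j] *[of "x - of_int j" "-j"] by auto
qed

lemma triadic_cantor_third: "x / 3 \<in> triadic_cantor \<longleftrightarrow> x \<in> triadic_cantor"
proof
  assume "x \<in> triadic_cantor"
  then obtain n :: nat and k :: int where "3^n * x - of_int k \<in> cantor_set" using triadic_cantor_iff by blast
  then have "3^(Suc n) * (x/3) - of_int k \<in> cantor_set" by simp
  then show "x / 3 \<in> triadic_cantor" unfolding triadic_cantor_iff by blast
next
  assume "x / 3 \<in> triadic_cantor"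
  then obtain n :: nat and k :: int where "3^n * (x/3) - of_int k \<in> cantor_set" using triadic_cantor_iff by blast
  then obtain k' :: int where "3^(Suc n) * (x/3) - of_int k' \<in> cantor_set" using cantor_set_scale_up by blast
  then have "3^n * x - of_int k' \<in> cantor_set" by simp
  then show "x \<in> triadic_cantor" unfolding triadic_cantor_iff by blast
qed

lemma affine_vimage_borel:
  fixes r c :: real
  assumes "A \<in> sets borel" shows "{x. r * x + c \<in> A} \<in> sets borel"
proof -
  have "(\<lambda>x. r * x + c) -` A \<inter> space borel \<in> sets borel"
    using assms by (intro measurable_sets[of _ borel borel]) auto
  then show ?thesis by (simp add: vimage_def)
qed

lemma triadic_cantor_borel [measurable]: "triadic_cantor \<in> sets borel"
proof -
  have "triadic_cantor = (\<Union>n::nat. \<Union>k::int. {x. 3^n * x + (- of_int k) \<in> cantor_set})"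
    using triadic_cantor_iff by auto
  also have "\<dots> \<in> sets borel"
    by (intro sets.countable_UN'' affine_vimage_borel cantor_set_borel) auto
  finally show ?thesis .
qed

lemma space_cantor_measure: "space cantor_measure = triadic_cantor"
  using sets_eq_imp_space_eq[OF sets_hausdorff_measure[of cdim]]
  by (simp add: cantor_measure_def space_restrict_space)

lemma sets_cantor_measure: "sets cantor_measure = sets (restrict_space borel triadic_cantor)"
  unfolding cantor_measure_def by (rule sets_restrict_space_cong) (rule sets_hausdorff_measure)

lemma sets_cantor_measure_iff: "A \<in> sets cantor_measure \<longleftrightarrow> A \<subseteq> triadic_cantor \<and> A \<in> sets borel"
  unfolding sets_cantor_measure by (subst sets_restrict_space_iff) auto

lemma emeasure_cantor_measure:
  assumes "A \<in> sets cantor_measure"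
  shows "emeasure cantor_measure A = hausdorff_outer cdim A"
proof -
  have A: "A \<subseteq> triadic_cantor" "A \<in> sets borel" using assms sets_cantor_measure_iff by auto
  then show ?thesis unfolding cantor_measure_def
    by (subst emeasure_restrict_space) (auto simp: sets_hausdorff_measure emeasure_hausdorff_measure)
qed

lemma measurable_cantor_measure_borel:
  fixes f :: "real \<Rightarrow> 'b::topological_space"
  assumes "f \<in> borel_measurable borel" shows "f \<in> borel_measurable cantor_measure"
proof -
  have "f \<in> borel_measurable (restrict_space borel triadic_cantor)"
    using assms by (rule measurable_restrict_space1)
  then show ?thesis by (simp cong: measurable_cong_sets add: sets_cantor_measure)
qed

lemma measurable_cantor_measure_affine:
  assumes "\<And>x. x \<in> triadic_cantor \<Longrightarrow> r * x + c \<in> triadic_cantor"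
  shows "(\<lambda>x. r * x + c) \<in> measurable cantor_measure cantor_measure"
proof -
  have "(\<lambda>x. r * x + c) \<in> measurable (restrict_space borel triadic_cantor) (restrict_space borel triadic_cantor)"
    using assms by (intro measurable_restrict_space3) auto
  then show ?thesis by (simp cong: measurable_cong_sets add: sets_cantor_measure)
qed

lemma emeasure_cantor_measure_affine:
  assumes r: "r > 0" and inv: "\<And>x. r * x + c \<in> triadic_cantor \<longleftrightarrow> x \<in> triadic_cantor" and A: "A \<in> sets cantor_measure"
  shows "emeasure cantor_measure ((\<lambda>x. r * x + c) -` A \<inter> triadic_cantor) = ennreal ((1/r) powr cdim) * emeasure cantor_measure A"
proof -
  have "(\<lambda>x. r * x + c) \<in> measurable cantor_measure cantor_measure"
    by (rule measurable_cantor_measure_affine) (simp add: inv)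
  from measurable_sets[OF this A]
  have m: "(\<lambda>x. r * x + c) -` A \<inter> triadic_cantor \<in> sets cantor_measure" by (simp add: space_cantor_measure)
  have "(\<lambda>x. r * x + c) -` A \<inter> triadic_cantor = (\<lambda>x. (1/r) * x + (-c/r)) ` A"
  proof (intro equalityI subsetI)
    fix x assume "x \<in> (\<lambda>x. r * x + c) -` A \<inter> triadic_cantor"
    then show "x \<in> (\<lambda>x. (1/r) * x + (-c/r)) ` A" using r by (intro image_eqI[of _ _ "r * x + c"]) (auto simp: field_simps)
  next
    fix x assume "x \<in> (\<lambda>x. (1/r) * x + (-c/r)) ` A"
    then obtain y where y: "y \<in> A" "x = (1/r) * y + (-c/r)" by blast
    then have "r * x + c = y" using r by (simp add: field_simps)
    then show "x \<in> (\<lambda>x. r * x + c) -` A \<inter> triadic_cantor" using y(1) A inv[of x] by (auto simp: sets_cantor_measure_iff)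
  qed
  then show ?thesis unfolding emeasure_cantor_measure[OF m] emeasure_cantor_measure[OF A]
    using r by (simp only:) (rule hausdorff_outer_affine, simp)
qed

lemma distr_cantor_measure_shift: "distr cantor_measure cantor_measure (\<lambda>x. x - of_int k) = cantor_measure"
  and measurable_cantor_measure_shift: "(\<lambda>x. x - of_int k) \<in> measurable cantor_measure cantor_measure"
proof -
  show m: "(\<lambda>x. x - of_int k) \<in> measurable cantor_measure cantor_measure"
    using measurable_cantor_measure_affine[of 1 "- of_int k"] by (simp add: triadic_cantor_shift)
  show "distr cantor_measure cantor_measure (\<lambda>x. x - of_int k) = cantor_measure"
  proof (rule measure_eqI)
    fix A assume "A \<in> sets (distr cantor_measure cantor_measure (\<lambda>x. x - of_int k))"
    then have A: "A \<in> sets cantor_measure" by simp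
    show "emeasure (distr cantor_measure cantor_measure (\<lambda>x. x - of_int k)) A = emeasure cantor_measure A"
      using emeasure_cantor_measure_affine[of 1 "- of_int k", OF _ _ A]
      by (simp add: emeasure_distr[OF m A] space_cantor_measure triadic_cantor_shift)
  qed simp
qed

lemma distr_cantor_measure_third: "distr cantor_measure cantor_measure (\<lambda>x. x / 3) = density cantor_measure (\<lambda>_. ennreal 2)"
  and measurable_cantor_measure_third: "(\<lambda>x. x / 3) \<in> measurable cantor_measure cantor_measure"
  and measurable_cantor_measure_triple: "(\<lambda>x. 3 * x) \<in> measurable cantor_measure cantor_measure"
proof -
  show m: "(\<lambda>x. x / 3) \<in> measurable cantor_measure cantor_measure"
    using measurable_cantor_measure_affine[of "1/3" 0] by (simp add: triadic_cantor_third)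
  show "(\<lambda>x. 3 * x) \<in> measurable cantor_measure cantor_measure"
    using measurable_cantor_measure_affine[of 3 0] triadic_cantor_third[of "3 * _"] by simp
  show "distr cantor_measure cantor_measure (\<lambda>x. x / 3) = density cantor_measure (\<lambda>_. ennreal 2)"
  proof (rule measure_eqI)
    fix A assume "A \<in> sets (distr cantor_measure cantor_measure (\<lambda>x. x / 3))"
    then have A: "A \<in> sets cantor_measure" by simp
    show "emeasure (distr cantor_measure cantor_measure (\<lambda>x. x / 3)) A = emeasure (density cantor_measure (\<lambda>_. ennreal 2)) A"
      using emeasure_cantor_measure_affine[of "1/3" 0, OF _ _ A]
      by (simp add: emeasure_distr[OF m A] emeasure_density_const[OF A] space_cantor_measure triadic_cantor_third)
  qed simp
qed

lemma cantor_set_sets: "cantor_set \<in> sets cantor_measure"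
  by (simp add: sets_cantor_measure_iff cantor_set_triadic cantor_set_borel)

lemma emeasure_cantor_set: "emeasure cantor_measure cantor_set = 1"
  by (simp add: emeasure_cantor_measure[OF cantor_set_sets] cantor_outer)

text \<open>
  A positive dimension makes points null sets. This disposes of the common endpoints of neighbouring integer
  translates of the Cantor set.
\<close>

lemma cantor_measure_AE_neq: "AE x in cantor_measure. x \<noteq> c"
proof (rule AE_I')
  show "{c} \<inter> triadic_cantor \<in> null_sets cantor_measure"
  proof (rule null_setsI)
    show s: "{c} \<inter> triadic_cantor \<in> sets cantor_measure" by (simp add: sets_cantor_measure_iff)
    have "hausdorff_outer cdim ({c} \<inter> triadic_cantor) \<le> hausdorff_outer cdim {c}"
      by (rule hausdorff_outer_mono) simp
    then show "emeasure cantor_measure ({c} \<inter> triadic_cantor) = 0"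
      by (simp add: emeasure_cantor_measure[OF s] hausdorff_outer_singleton)
  qed
qed (auto simp: space_cantor_measure)

section \<open>Trigonometric polynomials on the circle\<close>

lemma space_circle_borel: "space circle_borel = sphere 0 1"
  by (simp add: circle_borel_def space_restrict_space)

lemma sets_circle_borel_iff: "A \<in> sets circle_borel \<longleftrightarrow> A \<subseteq> sphere 0 1 \<and> A \<in> sets borel"
  unfolding circle_borel_def by (subst sets_restrict_space_iff) auto

lemma measurable_circle_borel:
  fixes f :: "complex \<Rightarrow> 'b::topological_space"
  shows "f \<in> borel_measurable borel \<Longrightarrow> f \<in> borel_measurable circle_borel"
  unfolding circle_borel_def by (rule measurable_restrict_space1)

lemma sets_circle_haar [measurable_cong]: "sets circle_haar = sets circle_borel"
  by (simp add: circle_haar_def)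

lemma space_circle_haar: "space circle_haar = sphere 0 1"
  by (simp add: circle_haar_def space_circle_borel)

lemma circle_generator:
  "sets circle_borel = sigma_sets (sphere 0 1) {F. closed F \<and> F \<subseteq> sphere 0 1}"
  "Int_stable {F :: complex set. closed F \<and> F \<subseteq> sphere 0 1}"
proof -
  have b: "sets (borel :: complex measure) = sigma_sets UNIV (Collect closed)"
    by (subst borel_eq_closed) simp
  have "(sphere 0 1 :: complex set) \<in> sigma_sets UNIV (Collect closed)"
    by (intro sigma_sets.Basic) simp
  then have "(\<inter>) (sphere 0 1) ` sigma_sets UNIV (Collect closed) = sigma_sets (sphere 0 1) ((\<inter>) (sphere 0 1) ` Collect (closed :: complex set \<Rightarrow> bool))"
    by (rule sigma_sets_Int) simp
  moreover have "(\<inter>) (sphere 0 1) ` Collect closed = {F :: complex set. closed F \<and> F \<subseteq> sphere 0 1}"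
    by (auto intro!: image_eqI)
  ultimately show "sets circle_borel = sigma_sets (sphere 0 1) {F. closed F \<and> F \<subseteq> sphere 0 1}"
    by (simp add: circle_borel_def sets_restrict_space b)
qed (auto simp: Int_stable_def)

lemma measurable_cis_circle: "(\<lambda>t. cis (2 * pi * t)) \<in> measurable lborel circle_borel"
  unfolding circle_borel_def
proof (rule measurable_restrict_space2)
  have "(\<lambda>t. cis (2 * pi * t)) \<in> borel_measurable borel"
    by (intro borel_measurable_continuous_onI continuous_intros)
  then show "(\<lambda>t. cis (2 * pi * t)) \<in> measurable lborel borel" by simp
qed auto

lemma emeasure_circle_haar: "emeasure circle_haar (sphere 0 1) = 1"
proof -
  have "(\<lambda>t. cis (2 * pi * t)) -` sphere 0 1 \<inter> space (uniform_measure lborel {0..<1}) = UNIV" by auto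
  then show ?thesis unfolding circle_haar_def
    using measurable_cis_circle
    by (subst emeasure_distr) (auto simp: sets_circle_borel_iff)
qed

lemma finite_measure_circle_haar: "finite_measure circle_haar"
  by (rule finite_measureI) (simp add: space_circle_haar emeasure_circle_haar)

lemma measure_circle_haar: "measure circle_haar (sphere 0 1) = 1"
  by (simp add: measure_def emeasure_circle_haar)

lemma cis_powi: "cis a powi k = cis (of_int k * a)"
  by (cases "k \<ge> 0") (simp_all add: power_int_def Complex.DeMoivre)

lemma borel_measurable_powi [measurable]: "(\<lambda>z::complex. z powi k) \<in> borel_measurable borel"
  by (cases "k \<ge> 0") (simp_all add: power_int_def)

lemma integral_circle_haar_powi: "(LINT z|circle_haar. z powi k) = (if k = 0 then 1 else 0)"
proof (cases "k = 0")
  case True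
  then show ?thesis using measure_circle_haar by (simp add: space_circle_haar)
next
  case False
  define w where "w = 2 * pi * real_of_int k"
  have w: "w \<noteq> 0" using False by (simp add: w_def)
  have meas: "(\<lambda>z::complex. z powi k) \<in> borel_measurable circle_borel"
    by (rule measurable_circle_borel) measurable
  have "(\<lambda>t. cis (w * t)) \<in> borel_measurable borel"
    by (intro borel_measurable_continuous_onI continuous_intros)
  then have cis_meas: "(\<lambda>t. cis (w * t)) \<in> borel_measurable lborel" by simp
  have e: "{0..<1::real} \<in> sets lborel" "emeasure lborel {0..<1::real} = 1" by auto
  have "(LINT z|circle_haar. z powi k) = (LINT t|uniform_measure lborel {0..<1}. cis (2 * pi * t) powi k)"
    unfolding circle_haar_def using measurable_cis_circle meas by (intro integral_distr) auto
  also have "\<dots> = (LINT t|uniform_measure lborel {0..<1}. cis (w * t))"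
    by (simp add: cis_powi w_def mult_ac)
  also have "uniform_measure lborel {0..<1::real} = density lborel (\<lambda>t. ennreal (indicator {0..<1} t))"
    by (simp add: uniform_measure_def divide_ennreal_def ennreal_indicator)
  also have "(LINT t|density lborel (\<lambda>t. ennreal (indicator {0..<1} t)). cis (w * t))
     = (LBINT t. indicator {0..<1} t *\<^sub>R cis (w * t))"
    using cis_meas by (intro integral_density) auto
  also have "\<dots> = (LBINT t. indicator {0..1} t *\<^sub>R cis (w * t))"
  proof (rule integral_cong_AE)
    show "AE t in lborel. indicator {0..<1} t *\<^sub>R cis (w * t) = indicator {0..1} t *\<^sub>R cis (w * t)"
      using AE_lborel_singleton[of "1::real"] by eventually_elim (auto simp: indicator_def)
  qed (use cis_meas in measurable)
  also have "\<dots> = cis (w * 1) / (\<i> * w) - cis (w * 0) / (\<i> * w)"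
  proof (rule has_bochner_integral_integral_eq, rule has_bochner_integral_FTC_Icc)
    fix t :: real
    have "((\<lambda>t. exp (\<i> * complex_of_real (w * t)) / (\<i> * w)) has_vector_derivative exp (\<i> * complex_of_real (w * t))) (at t within {0..1})"
      using w by (auto intro!: derivative_eq_intros has_vector_derivative_real_field simp: field_simps)
    then show "((\<lambda>t. cis (w * t) / (\<i> * w)) has_vector_derivative cis (w * t)) (at t within {0..1})"
      by (simp add: cis_conv_exp)
  qed (auto intro!: continuous_intros)
  also have "cis (w * 1) = 1" unfolding w_def using cis_multiple_2pi[of "of_int k"] by (simp add: mult.commute)
  finally show ?thesis using False by simp
qed

text \<open>
  \<open>trig_op p A\<close> pairs a trigonometric polynomial \<open>p\<close>, as a function on the circle, with the operator
  \<open>p(T)\<close> for the shift \<open>T f(x) = f(x - 1)\<close>, which is defined pointwise on all functions.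
\<close>

inductive trig_op :: "(complex \<Rightarrow> complex) \<Rightarrow> real L2_map \<Rightarrow> bool" where
  trig_zero: "(\<And>z. cmod z = 1 \<Longrightarrow> p z = 0) \<Longrightarrow> trig_op p (\<lambda>\<xi> x. 0)"
| trig_step: "trig_op q B \<Longrightarrow> (\<And>z. cmod z = 1 \<Longrightarrow> p z = a * z powi k + q z) \<Longrightarrow>
    trig_op p (\<lambda>\<xi> x. a * \<xi> (x - of_int k) + B \<xi> x)"

lemma trig_op_cong:
  assumes "trig_op p A" "\<And>z. cmod z = 1 \<Longrightarrow> p' z = p z" shows "trig_op p' A"
  using assms(1)
proof cases
  case trig_zero then show ?thesis using assms(2) trig_op.trig_zero[of p'] by simp
next
  case (trig_step q B a k)
  then show ?thesis using assms(2) trig_op.trig_step[of q B p' a k] by simp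
qed

lemma trig_op_monom: "trig_op (\<lambda>z. a * z powi k) (\<lambda>\<xi> x. a * \<xi> (x - of_int k))"
  using trig_step[OF trig_zero[of "\<lambda>z. 0"], of "\<lambda>z. a * z powi k" a k] by simp

lemma trig_op_add:
  assumes "trig_op p A" "trig_op q B"
  shows "trig_op (\<lambda>z. p z + q z) (\<lambda>\<xi> x. A \<xi> x + B \<xi> x)"
  using assms
proof (induction rule: trig_op.induct)
  case (trig_zero p)
  then show ?case using trig_op_cong[of q B "\<lambda>z. p z + q z"] by simp
next
  case (trig_step q' B' p a k)
  have "trig_op (\<lambda>z. p z + q z) (\<lambda>\<xi> x. a * \<xi> (x - of_int k) + (B' \<xi> x + B \<xi> x))"
    by (rule trig_op.trig_step[OF trig_step.IH[OF trig_step.prems]]) (simp add: trig_step.hyps)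
  then show ?case by (simp add: add.assoc)
qed

lemma powi_add_circle: "cmod z = 1 \<Longrightarrow> z powi (j + k) = z powi j * z powi k"
  by (rule power_int_add) auto

lemma trig_op_shift:
  assumes "trig_op p A"
  shows "trig_op (\<lambda>z. a * z powi k * p z) (\<lambda>\<xi> x. a * A \<xi> (x - of_int k))"
  using assms
proof (induction rule: trig_op.induct)
  case (trig_zero p)
  then show ?case using trig_op.trig_zero[of "\<lambda>z. a * z powi k * p z"] by simp
next
  case (trig_step q B p b j)
  have "trig_op (\<lambda>z. a * z powi k * p z) (\<lambda>\<xi> x. a * b * \<xi> (x - of_int (k + j)) + a * B \<xi> (x - of_int k))"
    by (rule trig_op.trig_step[OF trig_step.IH]) (simp add: trig_step.hyps powi_add_circle algebra_simps)
  then show ?case by (simp add: algebra_simps)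
qed

lemma trig_op_scale: "trig_op p A \<Longrightarrow> trig_op (\<lambda>z. a * p z) (\<lambda>\<xi> x. a * A \<xi> x)"
  using trig_op_shift[of p A a 0] by simp

lemma trig_op_lincomb:
  "trig_op p A \<Longrightarrow> trig_op q B \<Longrightarrow> trig_op (\<lambda>z. a * p z + q z) (\<lambda>\<xi> x. a * A \<xi> x + B \<xi> x)"
  by (rule trig_op_add[OF trig_op_scale])

lemma trig_op_diff:
  "trig_op p A \<Longrightarrow> trig_op q B \<Longrightarrow> trig_op (\<lambda>z. p z - q z) (\<lambda>\<xi> x. A \<xi> x - B \<xi> x)"
  using trig_op_lincomb[of q B p A "-1"] by simp

lemma trig_op_mult:
  assumes "trig_op p A" "trig_op q B"
  shows "trig_op (\<lambda>z. p z * q z) (\<lambda>\<xi> x. A (B \<xi>) x)"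
  using assms
proof (induction rule: trig_op.induct)
  case (trig_zero p)
  then show ?case using trig_op.trig_zero[of "\<lambda>z. p z * q z"] by simp
next
  case (trig_step q' B' p a k)
  have "trig_op (\<lambda>z. a * z powi k * q z + q' z * q z) (\<lambda>\<xi> x. a * B \<xi> (x - of_int k) + B' (B \<xi>) x)"
    by (intro trig_op_add trig_op_shift trig_step)
  then show ?case by (rule trig_op_cong) (simp add: trig_step.hyps algebra_simps)
qed

lemma cnj_circle: "cmod z = 1 \<Longrightarrow> cnj z = inverse z"
  using complex_norm_square[of z] inverse_unique[of z "cnj z"] by simp

lemma cnj_powi_circle: "cmod z = 1 \<Longrightarrow> cnj (z powi k) = z powi (-k)"
  by (cases "k > 0"; cases "k = 0") (simp_all add: power_int_def cnj_circle)

lemma trig_op_cnj: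
  assumes "trig_op p A" shows "\<exists>B. trig_op (\<lambda>z. cnj (p z)) B"
  using assms
proof (induction rule: trig_op.induct)
  case (trig_zero p)
  then show ?case using trig_op.trig_zero[of "\<lambda>z. cnj (p z)"] by auto
next
  case (trig_step q B p a k)
  then obtain C where "trig_op (\<lambda>z. cnj (q z)) C" by blast
  then have "trig_op (\<lambda>z. cnj (p z)) (\<lambda>\<xi> x. cnj a * \<xi> (x - of_int (-k)) + C \<xi> x)"
    by (rule trig_op.trig_step) (simp add: trig_step.hyps cnj_powi_circle del: complex_cnj_power_int)
  then show ?case by blast
qed

lemma trig_op_measurable:
  assumes "trig_op p A" shows "p \<in> borel_measurable circle_borel"
  using assms
proof (induction rule: trig_op.induct)
  case (trig_zero p)
  have "(\<lambda>z. 0) \<in> borel_measurable circle_borel" by simp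
  then show ?case by (rule measurable_cong[THEN iffD2, rotated]) (simp add: space_circle_borel trig_zero)
next
  case (trig_step q B p a k)
  have [measurable]: "(\<lambda>z::complex. z powi k) \<in> borel_measurable circle_borel"
    by (rule measurable_circle_borel) measurable
  note [measurable] = trig_step.IH
  have "(\<lambda>z. a * z powi k + q z) \<in> borel_measurable circle_borel" by measurable
  then show ?case by (rule measurable_cong[THEN iffD2, rotated]) (simp add: space_circle_borel trig_step.hyps)
qed

lemma trig_op_bounded:
  assumes "trig_op p A" shows "\<exists>C\<ge>0. \<forall>z. cmod z = 1 \<longrightarrow> cmod (p z) \<le> C"
  using assms
proof (induction rule: trig_op.induct)
  case (trig_step q B p a k)
  then obtain C where C: "C \<ge> 0" "\<And>z. cmod z = 1 \<Longrightarrow> cmod (q z) \<le> C" by blast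
  have "cmod (p z) \<le> cmod a + C" if "cmod z = 1" for z
    using norm_triangle_ineq[of "a * z powi k" "q z"] C(2)[OF that] that
    by (simp add: trig_step.hyps norm_mult norm_power_int)
  then show ?case using C(1) by (intro exI[of _ "cmod a + C"]) auto
qed auto

lemma circle_bounded_integrable:
  assumes "finite_measure \<nu>" "sets \<nu> = sets circle_borel" "f \<in> borel_measurable circle_borel"
    and "\<And>z. cmod z = 1 \<Longrightarrow> norm (f z) \<le> C"
  shows "integrable \<nu> (f :: complex \<Rightarrow> 'b::{banach,second_countable_topology})"
proof -
  interpret finite_measure \<nu> by fact
  have "f \<in> borel_measurable \<nu>" using assms(2,3) by (simp cong: measurable_cong_sets)
  then show ?thesis
    using assms(4) sets_eq_imp_space_eq[OF assms(2)]
    by (intro integrable_const_bound[of _ C]) (auto simp: space_circle_borel)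
qed

lemma trig_op_integrable:
  assumes "finite_measure \<nu>" "sets \<nu> = sets circle_borel" "trig_op p A"
  shows "integrable \<nu> p"
  using circle_bounded_integrable[OF assms(1,2) trig_op_measurable[OF assms(3)]] trig_op_bounded[OF assms(3)] by blast

text \<open>
  On the circle \<open>Re z\<close> and \<open>Im z\<close> are combinations of \<open>z\<close> and its inverse.
\<close>

lemma trig_op_real_polynomial:
  assumes "real_polynomial_function r"
  shows "\<exists>A. trig_op (\<lambda>z. of_real (r z)) A"
  using assms
proof (induction rule: real_polynomial_function.induct)
  case (linear f)
  define u v where "u = f 1" and "v = f \<i>"
  have f: "f z = Re z * u + Im z * v" for z
  proof -
    have "f z = f (Re z *\<^sub>R 1 + Im z *\<^sub>R \<i>)" by (intro arg_cong[of _ _ f]) (simp add: complex_eq_iff)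
    also have "\<dots> = Re z * u + Im z * v"
      by (simp only: linear_add[OF bounded_linear.linear[OF linear]] linear_scale[OF bounded_linear.linear[OF linear]] u_def v_def) simp
    finally show ?thesis .
  qed
  have "trig_op (\<lambda>z. Complex (u/2) (-v/2) * z powi 1 + Complex (u/2) (v/2) * z powi (-1)) (\<lambda>\<xi> x. Complex (u/2) (-v/2) * \<xi> (x - of_int 1) + Complex (u/2) (v/2) * \<xi> (x - of_int (-1)))"
    by (intro trig_op_add trig_op_monom)
  then have "trig_op (\<lambda>z. of_real (f z)) (\<lambda>\<xi> x. Complex (u/2) (-v/2) * \<xi> (x - of_int 1) + Complex (u/2) (v/2) * \<xi> (x - of_int (-1)))"
  proof (rule trig_op_cong)
    fix z :: complex assume "cmod z = 1"
    then have "z powi (-1) = cnj z" by (simp add: cnj_circle power_int_minus)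
    then show "of_real (f z) = Complex (u/2) (-v/2) * z powi 1 + Complex (u/2) (v/2) * z powi (-1)"
      by (simp add: f complex_eq_iff algebra_simps)
  qed
  then show ?case by blast
next
  case (const c)
  show ?case using trig_op_monom[of "of_real c" 0] by auto
next
  case (add f g)
  then show ?case using trig_op_add by fastforce
next
  case (mult f g)
  then show ?case using trig_op_mult by fastforce
qed

lemma trig_op_dense:
  assumes g: "continuous_on (sphere 0 1) g" and e: "e > 0"
  shows "\<exists>p A. trig_op p A \<and> (\<forall>z. cmod z = 1 \<longrightarrow> cmod (p z - g z) < e)"
proof -
  obtain h where h: "polynomial_function h" "\<And>z. z \<in> sphere 0 1 \<Longrightarrow> norm (g z - h z) < e"
    using Stone_Weierstrass_polynomial_function[OF _ g e] by auto
  have "real_polynomial_function (Re \<circ> h)" "real_polynomial_function (Im \<circ> h)"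
    using h(1) bounded_linear_Re bounded_linear_Im unfolding polynomial_function_def by blast+
  then obtain A B where "trig_op (\<lambda>z. of_real (Re (h z))) A" "trig_op (\<lambda>z. of_real (Im (h z))) B"
    using trig_op_real_polynomial by fastforce
  then have "trig_op (\<lambda>z. \<i> * of_real (Im (h z)) + of_real (Re (h z))) (\<lambda>\<xi> x. \<i> * B \<xi> x + A \<xi> x)"
    by (intro trig_op_lincomb)
  then have "trig_op h (\<lambda>\<xi> x. \<i> * B \<xi> x + A \<xi> x)"
    by (rule trig_op_cong) (simp add: complex_eq_iff)
  then show ?thesis using h(2) by (auto simp: norm_minus_commute)
qed

section \<open>Measures and square-integrable functions on the circle\<close>

text \<open>
  Closed sets generate the Borel sets, so this transfers statements from continuous functions to Borel
  functions.
\<close>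

lemma closed_indicator_approx:
  fixes F :: "'a::metric_space set"
  assumes "closed F"
  shows "\<exists>G :: nat \<Rightarrow> 'a \<Rightarrow> real. (\<forall>n. continuous_on UNIV (G n)) \<and> (\<forall>n x. 0 \<le> G n x \<and> G n x \<le> 1) \<and>
     (\<forall>x. (\<lambda>n. G n x) \<longlonglongrightarrow> indicator F x)"
proof (cases "F = {}")
  case True
  then show ?thesis by (intro exI[of _ "\<lambda>n x. 0"]) auto
next
  case False
  define G where "G n x = max 0 (1 - real n * infdist x F)" for n x
  have "(\<lambda>n. G n x) \<longlonglongrightarrow> indicator F x" for x
  proof (cases "x \<in> F")
    case True
    then show ?thesis by (simp add: G_def)
  next
    case out: False
    then have p: "infdist x F > 0" using assms False by (simp add: infdist_pos_not_in_closed)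
    obtain N where N: "real N > 1 / infdist x F" using reals_Archimedean2 by blast
    have "G n x = 0" if "n \<ge> N" for n
    proof -
      have "1 < real N * infdist x F" using N p by (simp add: field_simps)
      also have "\<dots> \<le> real n * infdist x F" using that p by (intro mult_right_mono) auto
      finally show ?thesis by (simp add: G_def)
    qed
    then have "\<forall>\<^sub>F n in sequentially. G n x = indicator F x" using out by (intro eventually_sequentiallyI[of N]) auto
    then show ?thesis by (rule tendsto_eventually)
  qed
  moreover have "continuous_on UNIV (G n)" for n
    unfolding G_def by (intro continuous_intros)
  moreover have "0 \<le> G n x \<and> G n x \<le> 1" for n x by (auto simp: G_def infdist_nonneg)
  ultimately show ?thesis by blast
qed

lemma continuous_circle_bound:
  fixes g :: "complex \<Rightarrow> complex"
  assumes g: "continuous_on UNIV g"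
  shows "\<exists>C. \<forall>z. cmod z = 1 \<longrightarrow> cmod (g z) \<le> C"
proof -
  have "compact (g ` sphere 0 1)" by (intro compact_continuous_image continuous_on_subset[OF g]) auto
  then have "bounded (g ` sphere 0 1)" by (rule compact_imp_bounded)
  then show ?thesis unfolding bounded_iff by force
qed

text \<open>
  Moments of negative order are conjugates of those of positive order on the circle, so the measures agree on
  trigonometric polynomials, by the theorem of Stone and Weierstrass on continuous functions, and hence on
  closed sets.
\<close>

lemma circle_measure_eqI:
  assumes fin: "finite_measure \<nu>" "finite_measure \<nu>'"
    and sets: "sets \<nu> = sets circle_borel" "sets \<nu>' = sets circle_borel"
    and mom: "\<And>n::nat. (LINT z|\<nu>. z ^ n) = (LINT z|\<nu>'. z ^ n)"
  shows "\<nu> = \<nu>'"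
proof -
  have sp: "space \<nu> = sphere 0 1" "space \<nu>' = sphere 0 1"
    using sets sets_eq_imp_space_eq space_circle_borel by metis+
  have powi: "(LINT z|\<nu>. z powi k) = (LINT z|\<nu>'. z powi k)" for k
  proof (cases "k \<ge> 0")
    case True then show ?thesis using mom[of "nat k"] by (simp add: power_int_def)
  next
    case False
    have *: "(LINT z|N. z powi k) = cnj (LINT z|N. z ^ nat (-k))" if "space N = sphere 0 1" for N
    proof -
      have "(LINT z|N. z powi k) = (LINT z|N. cnj (z ^ nat (-k)))"
        by (rule Bochner_Integration.integral_cong)
           (use False that in \<open>auto simp: power_int_def cnj_circle\<close>)
      then show ?thesis by (simp only: Bochner_Integration.integral_cnj)
    qed
    show ?thesis using *[OF sp(1)] *[OF sp(2)] mom by simp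
  qed
  have trig: "(LINT z|\<nu>. p z) = (LINT z|\<nu>'. p z)" if "trig_op p A" for p A
    using that
  proof (induction rule: trig_op.induct)
    case (trig_zero p)
    have "(LINT z|N. p z) = 0" if "space N = sphere 0 1" for N
      using that trig_zero by (subst Bochner_Integration.integral_cong[of N N p "\<lambda>z. 0"]) auto
    then show ?case using sp by simp
  next
    case (trig_step q B p a k)
    have i: "integrable N (\<lambda>z. a * z powi k)" "integrable N q" if "finite_measure N" "sets N = sets circle_borel" for N
      using trig_op_integrable[OF that trig_op_monom] trig_op_integrable[OF that trig_step.hyps(1)] by auto
    have "(LINT z|N. p z) = a * (LINT z|N. z powi k) + (LINT z|N. q z)"
      if "finite_measure N" "sets N = sets circle_borel" "space N = sphere 0 1" for N
    proof -
      have "(LINT z|N. p z) = (LINT z|N. a * z powi k + q z)"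
        by (rule Bochner_Integration.integral_cong) (use that trig_step.hyps in auto)
      also have "\<dots> = a * (LINT z|N. z powi k) + (LINT z|N. q z)"
        by (subst Bochner_Integration.integral_add[OF i(1)[OF that(1,2)] i(2)[OF that(1,2)]]) simp
      finally show ?thesis .
    qed
    then show ?case using fin sets sp powi trig_step.IH by simp
  qed
  have cont: "(LINT z|\<nu>. g z) = (LINT z|\<nu>'. g z)" if g: "continuous_on UNIV g" for g :: "complex \<Rightarrow> complex"
  proof -
    define K where "K = measure \<nu> (sphere 0 1) + measure \<nu>' (sphere 0 1)"
    have K: "K \<ge> 0" by (simp add: K_def)
    have gm: "g \<in> borel_measurable circle_borel" by (intro measurable_circle_borel borel_measurable_continuous_onI g)
    obtain C where C: "\<And>z. cmod z = 1 \<Longrightarrow> cmod (g z) \<le> C"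
      using continuous_circle_bound[OF g] by blast
    have le: "norm ((LINT z|\<nu>. g z) - (LINT z|\<nu>'. g z)) \<le> 0 + e" if e: "e > 0" for e
    proof -
      define d where "d = e / (K + 1)"
      have d: "d > 0" using e K by (simp add: d_def)
      obtain p A where p: "trig_op p A" "\<And>z. cmod z = 1 \<Longrightarrow> cmod (p z - g z) < d"
        using trig_op_dense[OF continuous_on_subset[OF g] d] by auto
      have *: "norm ((LINT z|N. p z) - (LINT z|N. g z)) \<le> d * measure N (sphere 0 1)"
        if N: "finite_measure N" "sets N = sets circle_borel" "space N = sphere 0 1" for N
      proof -
        interpret finite_measure N by fact
        have i: "integrable N p" "integrable N g"
          using trig_op_integrable[OF N(1,2) p(1)] circle_bounded_integrable[OF N(1,2) gm C] by auto
        have "norm ((LINT z|N. p z) - (LINT z|N. g z)) = norm (LINT z|N. p z - g z)"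
          using i by simp
        also have "\<dots> \<le> (LINT z|N. norm (p z - g z))" by (rule integral_norm_bound)
        also have "\<dots> \<le> (LINT z|N. d)"
          using i p(2) N(3) by (intro integral_mono) (auto intro: less_imp_le)
        finally show ?thesis using N(3) by (simp add: mult.commute)
      qed
      have "norm ((LINT z|\<nu>. g z) - (LINT z|\<nu>'. g z)) \<le> norm ((LINT z|\<nu>. p z) - (LINT z|\<nu>. g z)) + norm ((LINT z|\<nu>'. p z) - (LINT z|\<nu>'. g z))"
        using norm_triangle_ineq4[of "(LINT z|\<nu>'. p z) - (LINT z|\<nu>'. g z)" "(LINT z|\<nu>. p z) - (LINT z|\<nu>. g z)"] trig[OF p(1)] by simp
      also have "\<dots> \<le> d * K" using *[OF fin(1) sets(1) sp(1)] *[OF fin(2) sets(2) sp(2)] by (simp add: K_def distrib_left)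
      also have "\<dots> \<le> d * (K + 1)" using d by simp
      also have "\<dots> = 0 + e" using K by (simp add: d_def)
      finally show ?thesis .
    qed
    have "norm ((LINT z|\<nu>. g z) - (LINT z|\<nu>'. g z)) \<le> 0" by (rule field_le_epsilon[OF le])
    then show ?thesis by simp
  qed
  show ?thesis
  proof (rule measure_eqI_generator_eq[OF circle_generator(2), of "sphere 0 1" _ _ "\<lambda>_. sphere 0 1"])
    fix F :: "complex set" assume "F \<in> {F. closed F \<and> F \<subseteq> sphere 0 1}"
    then have F: "closed F" "F \<subseteq> sphere 0 1" by auto
    obtain G :: "nat \<Rightarrow> complex \<Rightarrow> real" where G: "\<And>n. continuous_on UNIV (G n)"
        "\<And>n x. 0 \<le> G n x \<and> G n x \<le> 1" "\<And>x. (\<lambda>n. G n x) \<longlonglongrightarrow> indicator F x"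
      using closed_indicator_approx[OF F(1)] by blast
    have lim: "(\<lambda>n. LINT z|N. complex_of_real (G n z)) \<longlonglongrightarrow> of_real (measure N F)"
      if N: "finite_measure N" "sets N = sets circle_borel" "space N = sphere 0 1" for N
    proof -
      interpret finite_measure N by fact
      have Fs: "F \<in> sets N" using F N(2) by (simp add: sets_circle_borel_iff)
      have [measurable]: "G n \<in> borel_measurable N" for n
        using measurable_circle_borel[OF borel_measurable_continuous_onI[OF G(1)], of n] N(2) by (simp cong: measurable_cong_sets)
      have "(\<lambda>n. LINT z|N. complex_of_real (G n z)) \<longlonglongrightarrow> (LINT z|N. complex_of_real (indicator F z))"
      proof (rule integral_dominated_convergence[where w="\<lambda>z. 1"])
        show "AE z in N. (\<lambda>n. complex_of_real (G n z)) \<longlonglongrightarrow> complex_of_real (indicator F z)"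
          by (intro AE_I2 tendsto_of_real G)
        show "AE z in N. norm (complex_of_real (G n z)) \<le> 1" for n using G(2)[of n] by auto
      qed (use Fs in auto)
      also have "(LINT z|N. complex_of_real (indicator F z)) = of_real (measure N F)"
        using Fs F(2) N(3) by (simp add: Int_absorb2)
      finally show ?thesis .
    qed
    have "complex_of_real (measure \<nu> F) = of_real (measure \<nu>' F)"
      using lim[OF fin(1) sets(1) sp(1)] lim[OF fin(2) sets(2) sp(2)]
      unfolding cont[OF continuous_on_of_real[OF G(1)]] by (rule LIMSEQ_unique)
    then show "emeasure \<nu> F = emeasure \<nu>' F"
      using fin by (simp add: finite_measure.emeasure_eq_measure)
  next
    show "emeasure \<nu> (sphere 0 1) \<noteq> \<infinity>" for i :: nat
      using finite_measure.emeasure_finite[OF fin(1)] by simp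
  qed (use sets circle_generator(1) in auto)
qed

lemma circle_Linf_measurable: "f \<in> circle_Linf \<Longrightarrow> f \<in> borel_measurable circle_haar"
  by (simp add: circle_Linf_def)

lemma circle_Linf_bound: "f \<in> circle_Linf \<Longrightarrow> \<exists>c\<ge>0. AE z in circle_haar. cmod (f z) \<le> c"
proof -
  assume "f \<in> circle_Linf"
  then obtain c where "AE z in circle_haar. cmod (f z) \<le> c" by (auto simp: circle_Linf_def)
  then have "AE z in circle_haar. cmod (f z) \<le> \<bar>c\<bar>" by eventually_elim auto
  then show ?thesis by (intro exI[of _ "\<bar>c\<bar>"]) auto
qed

lemma circle_LinfI:
  "f \<in> borel_measurable circle_haar \<Longrightarrow> (\<And>z. cmod z = 1 \<Longrightarrow> cmod (f z) \<le> c) \<Longrightarrow> f \<in> circle_Linf"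
  unfolding circle_Linf_def by (auto simp: space_circle_haar intro!: AE_I2 exI[of _ c])

lemma circle_Linf_L2:
  assumes "f \<in> circle_Linf" shows "f \<in> L2 circle_haar"
proof -
  interpret finite_measure circle_haar by (rule finite_measure_circle_haar)
  obtain c where c: "AE z in circle_haar. cmod (f z) \<le> c" using assms by (auto simp: circle_Linf_def)
  note [measurable] = circle_Linf_measurable[OF assms]
  have "integrable circle_haar (\<lambda>z. (cmod (f z))\<^sup>2)"
    by (rule integrable_const_bound[of _ "c\<^sup>2"]) (use c in \<open>auto elim!: eventually_mono intro!: power_mono\<close>)
  then show ?thesis by (simp add: L2_def)
qed

lemma continuous_circle_Linf:
  assumes g: "continuous_on UNIV g" shows "g \<in> circle_Linf"
proof -
  obtain C where C: "\<And>z. cmod z = 1 \<Longrightarrow> cmod (g z) \<le> C"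
    using continuous_circle_bound[OF g] by blast
  have "g \<in> borel_measurable circle_haar"
    using measurable_circle_borel[OF borel_measurable_continuous_onI[OF g]] by (simp cong: measurable_cong_sets add: sets_circle_haar)
  then show ?thesis using C by (rule circle_LinfI)
qed

lemma trig_op_Linf: "trig_op p A \<Longrightarrow> p \<in> circle_Linf"
  using trig_op_bounded[of p A] trig_op_measurable[of p A] circle_LinfI[of p]
  by (auto simp: sets_circle_haar cong: measurable_cong_sets)

text \<open>
  The closure of the continuous functions is a closed subspace that contains the indicators of closed sets.
\<close>

lemma circle_continuous_dense:
  assumes f: "f \<in> L2 circle_haar" and e: "e > 0"
  shows "\<exists>g. continuous_on UNIV g \<and> L2_norm circle_haar (\<lambda>z. g z - f z) < e"
proof -
  interpret finite_measure circle_haar by (rule finite_measure_circle_haar)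
  let ?L = "L2 circle_haar" and ?N = "L2_norm circle_haar"
  note cL = circle_Linf_L2[OF continuous_circle_Linf]
  define V where "V = {f \<in> ?L. \<forall>e>0. \<exists>g. continuous_on UNIV g \<and> ?N (\<lambda>z. g z - f z) < e}"
  have contV: "g \<in> V" if "continuous_on UNIV g" for g
    using that cL[OF that] by (auto simp: V_def L2_norm_zero intro!: exI[of _ g])
  have sub: "L2_closed_subspace circle_haar V"
    unfolding L2_closed_subspace_def
  proof (intro conjI ballI allI impI)
    show "V \<subseteq> ?L" by (auto simp: V_def)
    show "(\<lambda>x. 0) \<in> V" by (rule contV) simp
  next
    fix f g a assume f: "f \<in> V" and g: "g \<in> V"
    have "\<exists>h. continuous_on UNIV h \<and> ?N (\<lambda>z. h z - (a * f z + g z)) < e" if e: "e > 0" for e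
    proof -
      define d where "d = e / (cmod a + 1)"
      have c: "cmod a + 1 > 0" using norm_ge_zero[of a] by linarith
      have d: "d > 0" using e c by (simp add: d_def)
      obtain f' where f': "continuous_on UNIV f'" "?N (\<lambda>z. f' z - f z) < d" using f d by (auto simp: V_def)
      obtain g' where g': "continuous_on UNIV g'" "?N (\<lambda>z. g' z - g z) < d" using g d by (auto simp: V_def)
      have fL: "(\<lambda>z. f' z - f z) \<in> ?L" "(\<lambda>z. g' z - g z) \<in> ?L"
        using f g cL[OF f'(1)] cL[OF g'(1)] by (auto simp: V_def intro!: L2_diff)
      have "?N (\<lambda>z. a * f' z + g' z - (a * f z + g z)) \<le> cmod a * ?N (\<lambda>z. f' z - f z) + ?N (\<lambda>z. g' z - g z)"
        using L2_norm_lincomb[OF fL, of a] by (simp add: algebra_simps)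
      also have "\<dots> < cmod a * d + d" using f'(2) g'(2) by (intro add_le_less_mono mult_left_mono) auto
      also have "\<dots> = (cmod a + 1) * d" by (simp add: distrib_right)
      also have "\<dots> = e" using c by (simp add: d_def)
      finally show ?thesis using f'(1) g'(1) by (intro exI[of _ "\<lambda>z. a * f' z + g' z"]) (auto intro!: continuous_intros)
    qed
    then show "(\<lambda>x. a * f x + g x) \<in> V" using f g by (auto simp: V_def intro: L2_lincomb)
  next
    fix F f assume "(\<forall>n. F n \<in> V) \<and> f \<in> ?L \<and> (\<lambda>n. ?N (\<lambda>x. F n x - f x)) \<longlonglongrightarrow> 0"
    then have F: "\<And>n. F n \<in> V" "f \<in> ?L" "(\<lambda>n. ?N (\<lambda>x. F n x - f x)) \<longlonglongrightarrow> 0" by auto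
    have "\<exists>h. continuous_on UNIV h \<and> ?N (\<lambda>z. h z - f z) < e" if e: "e > 0" for e
    proof -
      have "\<forall>\<^sub>F n in sequentially. ?N (\<lambda>x. F n x - f x) < e / 2"
        using order_tendstoD(2)[OF F(3), of "e/2"] e by simp
      then obtain n where n: "?N (\<lambda>x. F n x - f x) < e / 2" by (auto simp: eventually_sequentially)
      obtain h where h: "continuous_on UNIV h" "?N (\<lambda>z. h z - F n z) < e / 2"
        using F(1)[of n] half_gt_zero[OF e] unfolding V_def by blast
      have "F n \<in> ?L" using F(1)[of n] by (simp add: V_def)
      then show ?thesis using L2_norm_triangle_diff[OF cL[OF h(1)] _ F(2), of "F n"] h n by fastforce
    qed
    then show "f \<in> V" using F by (auto simp: V_def)
  qed
  have "f \<in> V"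
  proof (rule L2_closed_subspace_full[OF sub])
    show "sphere 0 1 \<in> sets circle_haar" by (simp add: sets_circle_haar sets_circle_borel_iff)
    show "emeasure circle_haar (sphere 0 1) < \<infinity>" by (simp add: emeasure_circle_haar)
    show "Int_stable {F :: complex set. closed F \<and> F \<subseteq> sphere 0 1}" by (rule circle_generator)
    show "sets circle_haar = sigma_sets (space circle_haar) {F. closed F \<and> F \<subseteq> sphere 0 1}"
      by (simp add: sets_circle_haar circle_generator(1) space_circle_haar)
    have ind: "indicator F \<in> V" if F: "closed F" "F \<subseteq> sphere 0 1" for F :: "complex set"
    proof -
      obtain G :: "nat \<Rightarrow> complex \<Rightarrow> real" where G: "\<And>n. continuous_on UNIV (G n)"
        "\<And>n x. 0 \<le> G n x \<and> G n x \<le> 1" "\<And>x. (\<lambda>n. G n x) \<longlonglongrightarrow> indicator F x"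
        using closed_indicator_approx[OF F(1)] by blast
      have GV: "(\<lambda>z. complex_of_real (G n z)) \<in> V" for n
        by (intro contV continuous_on_of_real G)
      have FL: "indicator F \<in> ?L" using F emeasure_finite[of F]
        by (intro L2_indicator) (auto simp: sets_circle_haar sets_circle_borel_iff less_top[symmetric])
      show ?thesis
      proof (rule L2_closed_subspaceD(4)[OF sub GV FL], rule L2_lim_dominated[where w="\<lambda>z. 1"])
        show "(\<lambda>z. complex_of_real (G n z)) \<in> ?L" for n using GV[of n] by (simp add: V_def)
        have "(cmod (complex_of_real (G n x) - indicator F x))\<^sup>2 \<le> 1" for n x
        proof -
          have "cmod (complex_of_real (G n x) - 1) = \<bar>G n x - 1\<bar>"
            by (metis norm_of_real of_real_1 of_real_diff)
          then have "cmod (complex_of_real (G n x) - indicator F x) \<le> 1"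
            using G(2)[of n x] by (cases "x \<in> F") auto
          then show ?thesis by (rule power_le_one[OF norm_ge_zero])
        qed
        then show "AE x in circle_haar. (cmod (complex_of_real (G n x) - indicator F x))\<^sup>2 \<le> 1" for n by simp
        have "(\<lambda>n. complex_of_real (G n x)) \<longlonglongrightarrow> indicator F x" for x
          using tendsto_of_real[OF G(3)[of x], where 'a=complex] by (cases "x \<in> F") simp_all
        then show "AE x in circle_haar. (\<lambda>n. complex_of_real (G n x)) \<longlonglongrightarrow> indicator F x" by simp
      qed (use FL in auto)
    qed
    show "indicator (sphere 0 1) \<in> V" by (rule ind) auto
    show "indicator (B \<inter> sphere 0 1) \<in> V" if "B \<in> {F. closed F \<and> F \<subseteq> sphere 0 1}" for B
      by (rule ind) (use that in auto)
  qed (use f in \<open>auto simp: space_circle_haar\<close>)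
  then show ?thesis using e by (simp add: V_def)
qed

text \<open>
  Projecting a continuous approximation onto the disc of radius \<open>c\<close> keeps it continuous and does not
  move it away from a function bounded by \<open>c\<close>.
\<close>

lemma circle_trig_dense:
  assumes f: "f \<in> circle_Linf" and c: "AE z in circle_haar. cmod (f z) \<le> c" "c \<ge> 0" and e: "e > 0"
  shows "\<exists>p A. trig_op p A \<and> (\<forall>z. cmod z = 1 \<longrightarrow> cmod (p z) \<le> c + 1) \<and> L2_norm circle_haar (\<lambda>z. p z - f z) < e"
proof -
  interpret finite_measure circle_haar by (rule finite_measure_circle_haar)
  let ?L = "L2 circle_haar" and ?N = "L2_norm circle_haar"
  note fL = circle_Linf_L2[OF f]
  obtain g where g: "continuous_on UNIV g" "?N (\<lambda>z. g z - f z) < e / 2"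
    using circle_continuous_dense[OF fL, of "e/2"] e by auto
  define h where "h z = closest_point (cball 0 c) (g z)" for z
  have ne: "cball (0::complex) c \<noteq> {}" using c by auto
  have h: "continuous_on UNIV h"
    unfolding h_def
    by (rule continuous_on_compose2[OF continuous_on_closest_point[OF convex_cball closed_cball ne, of UNIV] g(1)]) auto
  have hc: "cmod (h z) \<le> c" for z
    using closest_point_in_set[OF closed_cball ne, of "g z"] by (simp add: h_def)
  have hL: "h \<in> ?L" and gL: "g \<in> ?L" using h g by (auto intro!: circle_Linf_L2 continuous_circle_Linf)
  have hN: "?N (\<lambda>z. h z - f z) < e / 2"
  proof -
    have "(LINT z|circle_haar. (cmod (h z - f z))\<^sup>2) \<le> (LINT z|circle_haar. (cmod (g z - f z))\<^sup>2)"
    proof (rule integral_mono_AE)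
      show "AE z in circle_haar. (cmod (h z - f z))\<^sup>2 \<le> (cmod (g z - f z))\<^sup>2"
        using c(1)
      proof eventually_elim
        fix z assume "cmod (f z) \<le> c"
        then have "closest_point (cball 0 c) (f z) = f z" by (intro closest_point_self) simp
        then have "cmod (h z - f z) \<le> cmod (g z - f z)"
          using closest_point_lipschitz[OF convex_cball closed_cball ne, of "g z" "f z"] by (simp add: h_def dist_norm)
        then show "(cmod (h z - f z))\<^sup>2 \<le> (cmod (g z - f z))\<^sup>2" by (intro power_mono) auto
      qed
    qed (intro L2_integrable L2_diff hL gL fL)+
    then have "?N (\<lambda>z. h z - f z) \<le> ?N (\<lambda>z. g z - f z)" by (simp add: L2_norm_def)
    then show ?thesis using g(2) by simp
  qed
  define d where "d = min 1 (e/2)"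
  have d: "d > 0" "d \<le> 1" "d \<le> e / 2" using e by (auto simp: d_def)
  obtain p A where p: "trig_op p A" "\<And>z. cmod z = 1 \<Longrightarrow> cmod (p z - h z) < d"
    using trig_op_dense[OF continuous_on_subset[OF h] d(1)] by auto
  note pL = circle_Linf_L2[OF trig_op_Linf[OF p(1)]]
  have "(LINT z|circle_haar. (cmod (p z - h z))\<^sup>2) \<le> (LINT z|circle_haar. d\<^sup>2)"
    using p(2) by (intro integral_mono L2_integrable L2_diff pL hL power_mono less_imp_le[OF p(2)])
       (auto simp: space_circle_haar)
  also have "\<dots> = d\<^sup>2" by (simp add: space_circle_haar measure_circle_haar)
  finally have "?N (\<lambda>z. p z - h z) \<le> d" using d by (simp add: L2_norm_def real_le_lsqrt)
  then have "?N (\<lambda>z. p z - f z) < e" using L2_norm_triangle_diff[OF pL hL fL] hN d by simp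
  moreover have "cmod (p z) \<le> c + 1" if "cmod z = 1" for z
    using norm_triangle_ineq[of "p z - h z" "h z"] p(2)[OF that] hc[of z] d(2) by simp
  ultimately show ?thesis using p(1) by blast
qed

lemma trig_op_continuous:
  assumes "trig_op p A" shows "continuous_on (sphere 0 1) p"
  using assms
proof (induction rule: trig_op.induct)
  case (trig_zero p)
  have "continuous_on (sphere 0 1) (\<lambda>z. 0::complex)" by simp
  then show ?case by (rule continuous_on_cong[THEN iffD1, OF refl, rotated]) (simp add: trig_zero)
next
  case (trig_step q B p a k)
  have "continuous_on (sphere 0 1) (\<lambda>z. a * z powi k + q z)"
    by (intro continuous_intros trig_step.IH) auto
  then show ?case by (rule continuous_on_cong[THEN iffD1, OF refl, rotated]) (simp add: trig_step.hyps)
qed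

lemma trig_op_sum:
  "finite J \<Longrightarrow> \<exists>A. trig_op (\<lambda>z. \<Sum>j\<in>J. c j * z powi (d j)) A"
proof (induction J rule: finite_induct)
  case empty
  show ?case using trig_zero[of "\<lambda>z. 0"] by auto
next
  case (insert i J)
  then obtain A where "trig_op (\<lambda>z. \<Sum>j\<in>J. c j * z powi (d j)) A" by blast
  from trig_op_add[OF trig_op_monom[of "c i" "d i"] this] insert show ?case by auto
qed

lemma trig_op_linear:
  assumes "trig_op p A" shows "A (\<lambda>x. a * \<xi> x + \<eta> x) = (\<lambda>x. a * A \<xi> x + A \<eta> x)"
  using assms
proof (induction rule: trig_op.induct)
  case (trig_step q B p b k)
  then show ?case by (simp add: algebra_simps)
qed simp

section \<open>Functional calculus of a measure-preserving integer shift\<close>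

text \<open>
  For \<open>k = 1\<close> the translation is the operator \<open>T\<close>. Measurability of the identity serves to truncate
  vectors to bounded intervals.
\<close>

locale shift_measure =
  fixes M :: "real measure"
  assumes id_meas: "(\<lambda>x. x) \<in> borel_measurable M"
    and shift_meas: "\<And>k::int. (\<lambda>x. x - of_int k) \<in> measurable M M"
    and shift_distr: "\<And>k::int. distr M M (\<lambda>x. x - of_int k) = M"
begin

lemma shift_integrable:
  fixes f :: "real \<Rightarrow> 'b::{banach,second_countable_topology}"
  assumes "integrable M f" shows "integrable M (\<lambda>x. f (x - of_int k))"
  using integrable_distr[OF shift_meas[of k], of f] assms by (simp add: shift_distr)

lemma shift_integral:
  fixes f :: "real \<Rightarrow> 'b::{banach,second_countable_topology}"
  assumes "f \<in> borel_measurable M" shows "(LINT x|M. f (x - of_int k)) = (LINT x|M. f x)"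
  using integral_distr[OF shift_meas[of k] assms] by (simp add: shift_distr)

lemma shift_L2:
  assumes "\<xi> \<in> L2 M" shows "(\<lambda>x. \<xi> (x - of_int k)) \<in> L2 M"
  using measurable_compose[OF shift_meas[of k] L2_measurable[OF assms]] shift_integrable[OF L2_integrable[OF assms]]
  by (simp add: L2_def)

lemma shift_inner:
  assumes "\<xi> \<in> L2 M" "\<eta> \<in> L2 M"
  shows "L2_inner M (\<lambda>x. \<xi> (x - of_int k)) (\<lambda>x. \<eta> (x - of_int k)) = L2_inner M \<xi> \<eta>"
  using shift_integral[OF borel_measurable_integrable[OF L2_mult_integrable[OF assms]], of k]
  by (simp add: L2_inner_def)

lemma shift_inner_left:
  assumes "\<xi> \<in> L2 M" "\<eta> \<in> L2 M"
  shows "L2_inner M (\<lambda>x. \<xi> (x - of_int k)) \<eta> = L2_inner M \<xi> (\<lambda>x. \<eta> (x - of_int (-k)))"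
  using shift_inner[OF assms(1) shift_L2[OF assms(2), of "-k"], of k] by simp

lemma trig_op_L2:
  assumes "trig_op p A" "\<xi> \<in> L2 M" shows "A \<xi> \<in> L2 M"
  using assms by (induction rule: trig_op.induct) (auto intro: L2_zero L2_lincomb shift_L2)

lemma trig_op_operator:
  assumes "trig_op p A" shows "L2_operator M A"
  unfolding L2_operator_def
proof (intro conjI ballI allI)
  show "A f \<in> L2 M" if "f \<in> L2 M" for f by (rule trig_op_L2[OF assms that])
  show "L2_eq M (A (\<lambda>x. a * f x + g x)) (\<lambda>x. a * A f x + A g x)" for f g a
    by (simp add: trig_op_linear[OF assms] L2_eq_refl)
  have "\<exists>K. \<forall>f\<in>L2 M. L2_norm M (A f) \<le> K * L2_norm M f"
    using assms
  proof (induction rule: trig_op.induct)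
    case (trig_zero p)
    then show ?case by (intro exI[of _ 0]) (simp add: L2_norm_zero)
  next
    case (trig_step q B p a k)
    then obtain K where K: "\<forall>f\<in>L2 M. L2_norm M (B f) \<le> K * L2_norm M f" by blast
    have "L2_norm M (\<lambda>x. a * f (x - of_int k) + B f x) \<le> (cmod a + K) * L2_norm M f" if f: "f \<in> L2 M" for f
    proof -
      have "L2_norm M (\<lambda>x. f (x - of_int k)) = L2_norm M f"
        using shift_integral[of "\<lambda>x. (cmod (f x))\<^sup>2" k] L2_integrable[OF f] by (simp add: L2_norm_def)
      then show ?thesis
        using L2_norm_lincomb[OF shift_L2[OF f, of k] trig_op_L2[OF trig_step.hyps(1) f], of a] K f
        by (simp add: distrib_right) (meson add_left_mono order_trans)
    qed
    then show ?case by blast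
  qed
  then show "\<exists>K. \<forall>f\<in>L2 M. L2_norm M (A f) \<le> K * L2_norm M f" .
qed

lemma trig_op_adjoint:
  assumes "trig_op p A"
  shows "\<exists>B. trig_op (\<lambda>z. cnj (p z)) B \<and> (\<forall>\<xi>\<in>L2 M. \<forall>\<eta>\<in>L2 M. L2_inner M (A \<xi>) \<eta> = L2_inner M \<xi> (B \<eta>))"
  using assms
proof (induction rule: trig_op.induct)
  case (trig_zero p)
  then show ?case
    using trig_op.trig_zero[of "\<lambda>z. cnj (p z)"] by (intro exI) (auto simp: L2_inner_zero_left L2_inner_zero_right)
next
  case (trig_step q B p a k)
  then obtain C where C: "trig_op (\<lambda>z. cnj (q z)) C"
    "\<And>\<xi> \<eta>. \<xi> \<in> L2 M \<Longrightarrow> \<eta> \<in> L2 M \<Longrightarrow> L2_inner M (B \<xi>) \<eta> = L2_inner M \<xi> (C \<eta>)" by blast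
  have "trig_op (\<lambda>z. cnj (p z)) (\<lambda>\<xi> x. cnj a * \<xi> (x - of_int (-k)) + C \<xi> x)"
    by (rule trig_op.trig_step[OF C(1)]) (simp add: trig_step.hyps cnj_powi_circle del: complex_cnj_power_int)
  moreover have "L2_inner M (\<lambda>x. a * \<xi> (x - of_int k) + B \<xi> x) \<eta>
      = L2_inner M \<xi> (\<lambda>x. cnj a * \<eta> (x - of_int (-k)) + C \<eta> x)"
    if m: "\<xi> \<in> L2 M" "\<eta> \<in> L2 M" for \<xi> \<eta>
    by (simp only: L2_inner_lincomb_left[OF shift_L2[OF m(1)] trig_op_L2[OF trig_step.hyps(1) m(1)] m(2)]
        L2_inner_lincomb_right[OF shift_L2[OF m(2)] trig_op_L2[OF C(1) m(2)] m(1)]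
        shift_inner_left[OF m] C(2)[OF m] complex_cnj_cnj)
  ultimately show ?case by blast
qed

definition bsupp :: "(real \<Rightarrow> complex) \<Rightarrow> bool" where
  "bsupp \<xi> \<longleftrightarrow> \<xi> \<in> L2 M \<and> (\<exists>N::nat. \<forall>x. real N < \<bar>x\<bar> \<longrightarrow> \<xi> x = 0)"

lemma bsupp_L2: "bsupp \<xi> \<Longrightarrow> \<xi> \<in> L2 M" by (simp add: bsupp_def)

lemma bsupp_dense:
  assumes "\<xi> \<in> L2 M"
  shows "\<exists>F. (\<forall>n. bsupp (F n)) \<and> L2_lim M F \<xi>"
proof -
  note [measurable] = id_meas L2_measurable[OF assms]
  define F where "F n x = indicator {y. \<bar>y\<bar> \<le> real n} x * \<xi> x" for n x
  have i: "(\<lambda>x. indicator {y. \<bar>y\<bar> \<le> real n} x :: complex) \<in> borel_measurable M" for n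
  proof -
    have "(indicator {y. \<bar>y\<bar> \<le> real n} :: real \<Rightarrow> complex) \<in> borel_measurable borel" by measurable
    from measurable_compose[OF id_meas this] show ?thesis .
  qed
  have L: "F n \<in> L2 M" for n unfolding F_def
    by (rule L2_cut[OF assms i]) (simp add: indicator_def)
  have "L2_lim M F \<xi>"
  proof (rule L2_lim_dominated[OF L assms L2_integrable[OF assms]])
    show "AE x in M. (cmod (F n x - \<xi> x))\<^sup>2 \<le> (cmod (\<xi> x))\<^sup>2" for n
      by (auto simp: F_def indicator_def)
    have "(\<lambda>n. F n x) \<longlonglongrightarrow> \<xi> x" for x
    proof (rule tendsto_eventually, rule eventually_sequentiallyI[of "nat \<lceil>\<bar>x\<bar>\<rceil>"])
      fix n assume "nat \<lceil>\<bar>x\<bar>\<rceil> \<le> n"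
      then have "\<bar>x\<bar> \<le> real n" by linarith
      then show "F n x = \<xi> x" by (simp add: F_def)
    qed
    then show "AE x in M. (\<lambda>n. F n x) \<longlonglongrightarrow> \<xi> x" by simp
  qed
  moreover have "bsupp (F n)" for n using L by (auto simp: bsupp_def F_def intro!: exI[of _ n])
  ultimately show ?thesis by blast
qed

text \<open>
  Far apart translates of boundedly supported functions are orthogonal, so their correlation
  sequence is finite and its Fourier series is a trigonometric polynomial.
\<close>

lemma bsupp_spectral_density:
  assumes \<xi>: "bsupp \<xi>" and \<eta>: "bsupp \<eta>"
  shows "\<exists>h H. trig_op h H \<and> (\<forall>p A. trig_op p A \<longrightarrow> L2_inner M (A \<xi>) \<eta> = (LINT z|circle_haar. p z * h z))"
proof -
  obtain N1 N2 :: nat where N: "\<And>x. real N1 < \<bar>x\<bar> \<Longrightarrow> \<xi> x = 0" "\<And>x. real N2 < \<bar>x\<bar> \<Longrightarrow> \<eta> x = 0"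
    using \<xi> \<eta> unfolding bsupp_def by blast
  note L = bsupp_L2[OF \<xi>] bsupp_L2[OF \<eta>]
  define c where "c k = L2_inner M (\<lambda>x. \<xi> (x - of_int k)) \<eta>" for k :: int
  define J where "J = {- int (N1 + N2)..int (N1 + N2)}"
  define h where "h z = (\<Sum>j\<in>J. c j * z powi (- j))" for z :: complex
  have c0: "c k = 0" if "k \<notin> J" for k
  proof -
    have "(\<lambda>x. \<xi> (x - of_int k) * cnj (\<eta> x)) = (\<lambda>x. 0)"
    proof
      fix x
      have "real (N1 + N2) < \<bar>real_of_int k\<bar>" using that by (auto simp: J_def)
      then have "real N1 < \<bar>x - of_int k\<bar> \<or> real N2 < \<bar>x\<bar>" by auto
      then show "\<xi> (x - of_int k) * cnj (\<eta> x) = 0" using N by auto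
    qed
    then show ?thesis by (simp add: c_def L2_inner_def)
  qed
  obtain H where H: "trig_op h H" unfolding h_def using trig_op_sum[of J c uminus] by (auto simp: J_def)
  note int = trig_op_integrable[OF finite_measure_circle_haar sets_circle_haar]
  have "L2_inner M (A \<xi>) \<eta> = (LINT z|circle_haar. p z * h z)" if "trig_op p A" for p A
    using that
  proof (induction rule: trig_op.induct)
    case (trig_zero p)
    have "(LINT z|circle_haar. p z * h z) = (LINT z|circle_haar. 0)"
      by (rule Bochner_Integration.integral_cong) (auto simp: space_circle_haar trig_zero)
    then show ?case by (simp add: L2_inner_zero_left)
  next
    case (trig_step q B p a k)
    have pw: "z powi k * h z = (\<Sum>j\<in>J. c j * z powi (k - j))" if "cmod z = 1" for z
      unfolding h_def sum_distrib_left using powi_add_circle[OF that, of k "- _"]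
      by (intro sum.cong) auto
    have "(LINT z|circle_haar. z powi k * h z) = (LINT z|circle_haar. (\<Sum>j\<in>J. c j * z powi (k - j)))"
      by (rule Bochner_Integration.integral_cong) (auto simp: space_circle_haar pw)
    also have "\<dots> = (\<Sum>j\<in>J. c j * (LINT z|circle_haar. z powi (k - j)))"
      using int[OF trig_op_monom[of 1]] by (subst Bochner_Integration.integral_sum) auto
    also have "\<dots> = (\<Sum>j\<in>J. if j = k then c j else 0)"
      by (intro sum.cong) (auto simp: integral_circle_haar_powi)
    also have "\<dots> = c k" using c0 by (auto simp: J_def)
    finally have k: "(LINT z|circle_haar. z powi k * h z) = c k" .
    have "(LINT z|circle_haar. p z * h z) = (LINT z|circle_haar. a * (z powi k * h z) + q z * h z)"
      by (rule Bochner_Integration.integral_cong) (auto simp: space_circle_haar trig_step.hyps algebra_simps)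
    also have "\<dots> = a * c k + L2_inner M (B \<xi>) \<eta>"
      using int[OF trig_op_mult[OF trig_op_monom[of 1 k] H]] int[OF trig_op_mult[OF trig_step.hyps(1) H]]
      by (subst Bochner_Integration.integral_add) (auto simp: k trig_step.IH)
    also have "\<dots> = L2_inner M (\<lambda>x. a * \<xi> (x - of_int k) + B \<xi> x) \<eta>"
      by (simp add: L2_inner_lincomb_left shift_L2 trig_op_L2[OF trig_step.hyps(1)] L c_def)
    finally show ?case by simp
  qed
  with H show ?thesis by blast
qed

text \<open>
  Since \<open>p(T)\<^sup>* p(T) = \<bar>p\<bar>\<^sup>2(T)\<close>, this is the spectral density of the pair \<open>(\<xi>, \<xi>)\<close> integrated against \<open>\<bar>p\<bar>\<^sup>2\<close>.
\<close>

lemma bsupp_norm_density: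
  assumes \<xi>: "bsupp \<xi>"
  shows "\<exists>h H. trig_op h H \<and> (\<forall>p A. trig_op p A \<longrightarrow>
    complex_of_real ((L2_norm M (A \<xi>))\<^sup>2) = (LINT z|circle_haar. of_real ((cmod (p z))\<^sup>2) * h z))"
proof -
  obtain h H where h: "trig_op h H"
    "\<And>p A. trig_op p A \<Longrightarrow> L2_inner M (A \<xi>) \<xi> = (LINT z|circle_haar. p z * h z)"
    using bsupp_spectral_density[OF \<xi> \<xi>] by blast
  note L = bsupp_L2[OF \<xi>]
  have "complex_of_real ((L2_norm M (A \<xi>))\<^sup>2) = (LINT z|circle_haar. of_real ((cmod (p z))\<^sup>2) * h z)"
    if p: "trig_op p A" for p A
  proof -
    obtain B where B: "trig_op (\<lambda>z. cnj (p z)) B"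
      "\<And>\<xi> \<eta>. \<xi> \<in> L2 M \<Longrightarrow> \<eta> \<in> L2 M \<Longrightarrow> L2_inner M (A \<xi>) \<eta> = L2_inner M \<xi> (B \<eta>)"
      using trig_op_adjoint[OF p] by blast
    have "complex_of_real ((L2_norm M (A \<xi>))\<^sup>2) = cnj (L2_inner M (A \<xi>) (A \<xi>))"
      by (simp add: L2_inner_self)
    also have "\<dots> = cnj (L2_inner M \<xi> (B (A \<xi>)))" by (simp add: B(2) L trig_op_L2[OF p])
    also have "\<dots> = L2_inner M (B (A \<xi>)) \<xi>" by (rule L2_inner_commute[symmetric])
    also have "\<dots> = (LINT z|circle_haar. cnj (p z) * p z * h z)"
      by (rule h(2)[OF trig_op_mult[OF B(1) p]])
    finally show ?thesis by (simp only: complex_norm_square mult.commute[of "cnj _"])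
  qed
  with h(1) show ?thesis by blast
qed

text \<open>
  The square root of \<open>s^2 - |p|^2\<close> is a uniform limit of trigonometric polynomials \<open>q\<close>, so
  \<open>s^2 |\<xi>|^2 - |p(T) \<xi>|^2\<close> is the limit of the nonnegative numbers \<open>|q(T) \<xi>|^2\<close>.
\<close>

lemma trig_op_norm_le_bsupp:
  assumes p: "trig_op p A" and s: "\<And>z. cmod z = 1 \<Longrightarrow> cmod (p z) \<le> s" "0 \<le> s" and \<xi>: "bsupp \<xi>"
  shows "L2_norm M (A \<xi>) \<le> s * L2_norm M \<xi>"
proof -
  interpret finite_measure circle_haar by (rule finite_measure_circle_haar)
  obtain h H where h: "trig_op h H"
    "\<And>p A. trig_op p A \<Longrightarrow> complex_of_real ((L2_norm M (A \<xi>))\<^sup>2) = (LINT z|circle_haar. of_real ((cmod (p z))\<^sup>2) * h z)"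
    using bsupp_norm_density[OF \<xi>] by blast
  obtain C where C: "C \<ge> 0" "\<And>z. cmod z = 1 \<Longrightarrow> cmod (h z) \<le> C" using trig_op_bounded[OF h(1)] by blast
  define f where "f z = complex_of_real (sqrt (s\<^sup>2 - (cmod (p z))\<^sup>2))" for z
  have fc: "continuous_on (sphere 0 1) f"
    unfolding f_def by (intro continuous_intros trig_op_continuous[OF p])
  have fn: "(cmod (f z))\<^sup>2 = s\<^sup>2 - (cmod (p z))\<^sup>2" if "cmod z = 1" for z
    using power_mono[OF s(1)[OF that], of 2] by (simp add: f_def)
  have fs: "cmod (f z) \<le> s" if "cmod z = 1" for z
    by (rule power2_le_imp_le[OF _ s(2)]) (simp add: fn[OF that])
  have i: "integrable circle_haar (\<lambda>z. of_real ((cmod (q z))\<^sup>2) * h z)" if q: "trig_op q B" for q B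
  proof -
    obtain B' where "trig_op (\<lambda>z. cnj (q z)) B'" using trig_op_cnj[OF q] by blast
    from trig_op_integrable[OF finite_measure_circle_haar sets_circle_haar trig_op_mult[OF trig_op_mult[OF q this] h(1)]]
    show ?thesis by (simp only: complex_norm_square)
  qed
  have one: "trig_op (\<lambda>z. of_real s) (\<lambda>\<xi> x. of_real s * \<xi> x)" using trig_op_monom[of "of_real s" 0] by simp
  have "(L2_norm M (A \<xi>))\<^sup>2 \<le> (s * L2_norm M \<xi>)\<^sup>2"
  proof (rule field_le_epsilon)
    fix e :: real assume e: "e > 0"
    \<comment> \<open>| |q|^2 - |f|^2 | is at most d (2 s + 1), and the density h is bounded by C\<close>
    define d where "d = min 1 (e / ((2 * s + 1) * (C + 1)))"
    have d: "0 < d" "d \<le> 1" "d * ((2 * s + 1) * C) \<le> e"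
    proof -
      have pos: "(2 * s + 1) * (C + 1) > 0" using s C by (intro mult_pos_pos) auto
      then show "0 < d" "d \<le> 1" using e by (auto simp: d_def)
      have "d * ((2 * s + 1) * C) \<le> d * ((2 * s + 1) * (C + 1))" using \<open>0 < d\<close> s by (intro mult_left_mono) auto
      also have "\<dots> \<le> (e / ((2 * s + 1) * (C + 1))) * ((2 * s + 1) * (C + 1))"
        using pos by (intro mult_right_mono) (auto simp: d_def)
      also have "\<dots> = e" using pos by (metis less_irrefl nonzero_eq_divide_eq)
      finally show "d * ((2 * s + 1) * C) \<le> e" .
    qed
    obtain q B where q: "trig_op q B" "\<And>z. cmod z = 1 \<Longrightarrow> cmod (q z - f z) < d"
      using trig_op_dense[OF fc d(1)] by blast
    have pt: "norm (of_real ((cmod (q z))\<^sup>2) * h z - (of_real ((cmod (of_real s :: complex))\<^sup>2) * h z - of_real ((cmod (p z))\<^sup>2) * h z)) \<le> e"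
      if z: "cmod z = 1" for z
    proof -
      have "\<bar>(cmod (q z))\<^sup>2 - (cmod (f z))\<^sup>2\<bar> = \<bar>cmod (q z) - cmod (f z)\<bar> * (cmod (q z) + cmod (f z))"
        by (simp add: power2_eq_square square_diff_square_factored abs_mult mult.commute)
      also have "\<dots> \<le> d * (2 * s + 1)"
      proof (rule mult_mono)
        have n: "\<bar>cmod (q z) - cmod (f z)\<bar> \<le> cmod (q z - f z)" by (rule norm_triangle_ineq3)
        then show "\<bar>cmod (q z) - cmod (f z)\<bar> \<le> d" using q(2)[OF z] by simp
        then show "cmod (q z) + cmod (f z) \<le> 2 * s + 1" using fs[OF z] d(2) by linarith
      qed (use d s in auto)
      finally have b: "\<bar>(cmod (q z))\<^sup>2 - (cmod (f z))\<^sup>2\<bar> \<le> d * (2 * s + 1)" .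
      have "of_real ((cmod (q z))\<^sup>2) * h z - (of_real ((cmod (of_real s :: complex))\<^sup>2) * h z - of_real ((cmod (p z))\<^sup>2) * h z)
        = of_real ((cmod (q z))\<^sup>2 - (cmod (f z))\<^sup>2) * h z"
        using s(2) by (simp add: fn[OF z] algebra_simps)
      then have "norm (of_real ((cmod (q z))\<^sup>2) * h z - (of_real ((cmod (of_real s :: complex))\<^sup>2) * h z - of_real ((cmod (p z))\<^sup>2) * h z))
        = \<bar>(cmod (q z))\<^sup>2 - (cmod (f z))\<^sup>2\<bar> * cmod (h z)" by (simp only: norm_mult norm_of_real)
      also have "\<dots> \<le> (d * (2 * s + 1)) * C" using b C(2)[OF z] d s by (intro mult_mono) auto
      also have "\<dots> \<le> e" using d(3) by (simp add: mult.assoc)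
      finally show ?thesis .
    qed
    have "complex_of_real ((L2_norm M (B \<xi>))\<^sup>2 - ((s * L2_norm M \<xi>)\<^sup>2 - (L2_norm M (A \<xi>))\<^sup>2))
      = (LINT z|circle_haar. of_real ((cmod (q z))\<^sup>2) * h z - (of_real ((cmod (of_real s :: complex))\<^sup>2) * h z - of_real ((cmod (p z))\<^sup>2) * h z))"
    proof -
      have "s * L2_norm M \<xi> = L2_norm M (\<lambda>x. of_real s * \<xi> x)" using s(2) by (simp add: L2_norm_scale)
      then show ?thesis
        by (simp only: of_real_diff h(2)[OF q(1)] h(2)[OF p] h(2)[OF one]
            Bochner_Integration.integral_diff[OF i[OF q(1)] Bochner_Integration.integrable_diff[OF i[OF one] i[OF p]]]
            Bochner_Integration.integral_diff[OF i[OF one] i[OF p]])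
    qed
    also have "norm \<dots> \<le> (LINT z|circle_haar. e)"
      by (rule order_trans[OF integral_norm_bound], rule integral_mono_AE[OF integrable_norm[OF
            Bochner_Integration.integrable_diff[OF i[OF q(1)] Bochner_Integration.integrable_diff[OF i[OF one] i[OF p]]]]])
         (use pt in \<open>auto simp: space_circle_haar simp del: norm_of_real\<close>)
    also have "\<dots> = e" by (simp add: space_circle_haar measure_circle_haar)
    finally have "\<bar>(L2_norm M (B \<xi>))\<^sup>2 - ((s * L2_norm M \<xi>)\<^sup>2 - (L2_norm M (A \<xi>))\<^sup>2)\<bar> \<le> e"
      by (simp only: norm_of_real)
    then show "(L2_norm M (A \<xi>))\<^sup>2 \<le> (s * L2_norm M \<xi>)\<^sup>2 + e" using zero_le_power2[of "L2_norm M (B \<xi>)"] by linarith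
  qed
  then show ?thesis by (rule power2_le_imp_le[OF _ mult_nonneg_nonneg[OF s(2) L2_norm_nonneg]])
qed

lemma trig_op_norm_le:
  assumes p: "trig_op p A" and s: "\<And>z. cmod z = 1 \<Longrightarrow> cmod (p z) \<le> s" "0 \<le> s" and \<xi>: "\<xi> \<in> L2 M"
  shows "L2_norm M (A \<xi>) \<le> s * L2_norm M \<xi>"
proof -
  obtain F where F: "\<And>n. bsupp (F n)" "L2_lim M F \<xi>" using bsupp_dense[OF \<xi>] by blast
  note FL = bsupp_L2[OF F(1)]
  have "L2_lim M (\<lambda>n. A (F n)) (A \<xi>)" by (rule L2_operator_lim[OF trig_op_operator[OF p] FL \<xi> F(2)])
  then have "(\<lambda>n. L2_norm M (A (F n))) \<longlonglongrightarrow> L2_norm M (A \<xi>)"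
    by (intro L2_lim_norm trig_op_L2[OF p] FL \<xi>)
  moreover have "(\<lambda>n. s * L2_norm M (F n)) \<longlonglongrightarrow> s * L2_norm M \<xi>"
    by (intro tendsto_intros L2_lim_norm FL \<xi> F(2))
  ultimately show ?thesis
    by (rule LIMSEQ_le) (use trig_op_norm_le_bsupp[OF p s F(1)] in auto)
qed

text \<open>
  On a boundedly supported \<open>\<eta>\<close> near \<open>\<xi>\<close> the norm of \<open>p(T) \<eta>\<close> is controlled by the \<open>L\<^sup>2\<close> norm of \<open>p\<close>, since
  the spectral density is bounded; the remainder \<open>p(T) (\<xi> - \<eta>)\<close> is controlled by the uniform bound of \<open>p\<close>.
\<close>

lemma trig_op_norm_small:
  assumes \<xi>: "\<xi> \<in> L2 M" and C: "C \<ge> 0" and e: "e > 0"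
  shows "\<exists>\<delta>>0. \<forall>p A. trig_op p A \<longrightarrow> (\<forall>z. cmod z = 1 \<longrightarrow> cmod (p z) \<le> C) \<longrightarrow>
     L2_norm circle_haar p < \<delta> \<longrightarrow> L2_norm M (A \<xi>) < e"
proof -
  obtain F where F: "\<And>n. bsupp (F n)" "L2_lim M F \<xi>" using bsupp_dense[OF \<xi>] by blast
  have "e / (2 * (C + 1)) > 0" using e C by simp
  then have "\<forall>\<^sub>F n in sequentially. L2_norm M (\<lambda>x. F n x - \<xi> x) < e / (2 * (C + 1))"
    by (rule order_tendstoD(2)[OF F(2)[unfolded L2_lim_def]])
  then obtain n where n: "L2_norm M (\<lambda>x. F n x - \<xi> x) < e / (2 * (C + 1))" by (auto simp: eventually_sequentially)
  define \<eta> where "\<eta> = F n"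
  have \<eta>: "bsupp \<eta>" "\<eta> \<in> L2 M" using F(1) bsupp_L2 by (auto simp: \<eta>_def)
  obtain h H where h: "trig_op h H"
    "\<And>p A. trig_op p A \<Longrightarrow> complex_of_real ((L2_norm M (A \<eta>))\<^sup>2) = (LINT z|circle_haar. of_real ((cmod (p z))\<^sup>2) * h z)"
    using bsupp_norm_density[OF \<eta>(1)] by blast
  obtain K where K: "K \<ge> 0" "\<And>z. cmod z = 1 \<Longrightarrow> cmod (h z) \<le> K" using trig_op_bounded[OF h(1)] by blast
  define \<delta> where "\<delta> = e / (2 * sqrt (K + 1))"
  have \<delta>: "\<delta> > 0" using e K by (simp add: \<delta>_def)
  have "L2_norm M (A \<xi>) < e" if p: "trig_op p A" "\<And>z. cmod z = 1 \<Longrightarrow> cmod (p z) \<le> C" "L2_norm circle_haar p < \<delta>" for p A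
  proof -
    note pL = circle_Linf_L2[OF trig_op_Linf[OF p(1)]]
    have "(L2_norm M (A \<eta>))\<^sup>2 = norm (LINT z|circle_haar. of_real ((cmod (p z))\<^sup>2) * h z)"
      by (simp only: h(2)[OF p(1), symmetric] norm_of_real) simp
    also have "\<dots> \<le> (LINT z|circle_haar. norm (of_real ((cmod (p z))\<^sup>2) * h z))" by (rule integral_norm_bound)
    also have "\<dots> \<le> (LINT z|circle_haar. K * (cmod (p z))\<^sup>2)"
    proof (rule integral_mono_AE')
      show "integrable circle_haar (\<lambda>z. K * (cmod (p z))\<^sup>2)" using L2_integrable[OF pL] by simp
      have "norm (of_real ((cmod (p z))\<^sup>2) * h z) \<le> K * (cmod (p z))\<^sup>2" if "cmod z = 1" for z
        using mult_left_mono[OF K(2)[OF that], of "(cmod (p z))\<^sup>2"] by (simp add: norm_mult norm_power mult.commute)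
      then show "AE z in circle_haar. norm (of_real ((cmod (p z))\<^sup>2) * h z) \<le> K * (cmod (p z))\<^sup>2"
        by (intro AE_I2) (simp add: space_circle_haar)
    qed (use K in auto)
    also have "\<dots> = K * (L2_norm circle_haar p)\<^sup>2" by (simp add: L2_norm_power2)
    also have "\<dots> \<le> (K + 1) * \<delta>\<^sup>2" using p(3) K L2_norm_nonneg[of circle_haar p] by (intro mult_mono power_mono) auto
    also have "\<dots> = (e / 2)\<^sup>2"
    proof -
      have d2: "\<delta>\<^sup>2 = e\<^sup>2 / (4 * (K + 1))" using K(1) by (simp add: \<delta>_def power_divide power_mult_distrib)
      have "K + 1 \<noteq> 0" using K(1) by linarith
      then have "(K + 1) * \<delta>\<^sup>2 = ((K + 1) * e\<^sup>2) / ((K + 1) * 4)" by (simp add: d2 mult.commute)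
      also have "\<dots> = e\<^sup>2 / 4" by (rule nonzero_mult_divide_mult_cancel_left) fact
      finally show ?thesis by (simp add: power_divide)
    qed
    finally have "L2_norm M (A \<eta>) \<le> e / 2" by (rule power2_le_imp_le) (use e in simp)
    moreover have "L2_norm M (\<lambda>x. A \<xi> x - A \<eta> x) < e / 2"
    proof -
      have "L2_norm M (\<lambda>x. A \<xi> x - A \<eta> x) = L2_norm M (A (\<lambda>x. \<xi> x - \<eta> x))"
        by (rule L2_operator_norm_diff[OF trig_op_operator[OF p(1)] \<xi> \<eta>(2)])
      also have "\<dots> \<le> C * L2_norm M (\<lambda>x. \<xi> x - \<eta> x)"
        by (rule trig_op_norm_le[OF p(1,2) C L2_diff[OF \<xi> \<eta>(2)]])
      also have "\<dots> \<le> (C + 1) * L2_norm M (\<lambda>x. \<xi> x - \<eta> x)" by (intro mult_right_mono L2_norm_nonneg) auto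
      also have "\<dots> < (C + 1) * (e / (2 * (C + 1)))"
        using n C by (intro mult_strict_left_mono) (auto simp: \<eta>_def L2_norm_minus_commute[of M \<xi>])
      also have "\<dots> = ((C + 1) * e) / ((C + 1) * 2)" by (simp add: mult.commute)
      also have "\<dots> = e / 2" by (rule nonzero_mult_divide_mult_cancel_left) (use C in simp)
      finally show ?thesis .
    qed
    ultimately show ?thesis
      using L2_norm_le_diff[OF trig_op_L2[OF p(1) \<xi>] trig_op_L2[OF p(1) \<eta>(2)]] by simp
  qed
  with \<delta> show ?thesis by blast
qed

text \<open>
  The mode of convergence that determines \<open>f(T)\<close>: uniform bounds alone or convergence in \<open>L\<^sup>2\<close> alone would not
  carry over to \<open>p(T) \<xi>\<close> for all \<open>\<xi>\<close>.
\<close>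

definition trig_approx :: "(complex \<Rightarrow> complex) \<Rightarrow> (nat \<Rightarrow> complex \<Rightarrow> complex) \<Rightarrow> (nat \<Rightarrow> real L2_map) \<Rightarrow> bool" where
  "trig_approx f p A \<longleftrightarrow> (\<forall>n. trig_op (p n) (A n)) \<and> (\<exists>C\<ge>0. \<forall>n z. cmod z = 1 \<longrightarrow> cmod (p n z) \<le> C) \<and>
     L2_lim circle_haar p f"

lemma trig_approxD:
  assumes "trig_approx f p A"
  shows "trig_op (p n) (A n)" "\<exists>C\<ge>0. \<forall>n z. cmod z = 1 \<longrightarrow> cmod (p n z) \<le> C" "L2_lim circle_haar p f"
    "p n \<in> L2 circle_haar" "\<xi> \<in> L2 M \<Longrightarrow> A n \<xi> \<in> L2 M"
  using assms circle_Linf_L2[OF trig_op_Linf] trig_op_L2 unfolding trig_approx_def by blast+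

lemma trig_approx_ex_bound:
  assumes f: "f \<in> circle_Linf" and c: "AE z in circle_haar. cmod (f z) \<le> c" "c \<ge> 0"
  shows "\<exists>p A. trig_approx f p A \<and> (\<forall>n z. cmod z = 1 \<longrightarrow> cmod (p n z) \<le> c + 1)"
proof -
  have "\<forall>n. \<exists>p A. trig_op p A \<and> (\<forall>z. cmod z = 1 \<longrightarrow> cmod (p z) \<le> c + 1) \<and> L2_norm circle_haar (\<lambda>z. p z - f z) < inverse (real (Suc n))"
    using circle_trig_dense[OF f c] by simp
  then obtain p A where pA: "\<And>n. trig_op (p n) (A n)" "\<And>n z. cmod z = 1 \<Longrightarrow> cmod (p n z) \<le> c + 1"
    "\<And>n. L2_norm circle_haar (\<lambda>z. p n z - f z) < inverse (real (Suc n))"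
    by metis
  have "L2_lim circle_haar p f"
    by (rule L2_lim_sandwich[OF less_imp_le[OF pA(3)] LIMSEQ_inverse_real_of_nat])
  moreover have "\<exists>C\<ge>0. \<forall>n z. cmod z = 1 \<longrightarrow> cmod (p n z) \<le> C"
    using pA(2) c(2) by (intro exI[of _ "c + 1"]) auto
  ultimately show ?thesis using pA unfolding trig_approx_def by blast
qed

lemma trig_approx_ex: "f \<in> circle_Linf \<Longrightarrow> \<exists>p A. trig_approx f p A"
  using trig_approx_ex_bound circle_Linf_bound by blast

lemma trig_approx_null:
  assumes p: "\<And>n. trig_op (p n) (A n)" and C: "C \<ge> 0" "\<And>n z. cmod z = 1 \<Longrightarrow> cmod (p n z) \<le> C"
    and lim: "(\<lambda>n. L2_norm circle_haar (p n)) \<longlonglongrightarrow> 0" and \<xi>: "\<xi> \<in> L2 M"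
  shows "(\<lambda>n. L2_norm M (A n \<xi>)) \<longlonglongrightarrow> 0"
proof (rule order_tendstoI)
  fix e :: real assume "0 < e"
  then obtain \<delta> where \<delta>: "\<delta> > 0" "\<And>p A. trig_op p A \<Longrightarrow> (\<forall>z. cmod z = 1 \<longrightarrow> cmod (p z) \<le> C) \<Longrightarrow>
     L2_norm circle_haar p < \<delta> \<Longrightarrow> L2_norm M (A \<xi>) < e"
    using trig_op_norm_small[OF \<xi> C(1)] by blast
  have "\<forall>\<^sub>F n in sequentially. L2_norm circle_haar (p n) < \<delta>" using lim \<delta>(1) by (rule order_tendstoD)
  then show "\<forall>\<^sub>F n in sequentially. L2_norm M (A n \<xi>) < e"
    by eventually_elim (use \<delta>(2) p C(2) in blast)
next
  fix e :: real assume "e < 0"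
  then show "\<forall>\<^sub>F n in sequentially. e < L2_norm M (A n \<xi>)"
    using L2_norm_nonneg less_le_trans by (intro always_eventually) blast
qed

lemma trig_approx_unique:
  assumes pA: "trig_approx f p A" and qB: "trig_approx g q B" and fg: "f \<in> circle_Linf" "g \<in> circle_Linf"
    and eq: "AE z in circle_haar. f z = g z" and \<xi>: "\<xi> \<in> L2 M"
  shows "(\<lambda>n. L2_norm M (\<lambda>x. A n \<xi> x - B n \<xi> x)) \<longlonglongrightarrow> 0"
proof -
  obtain C D where C: "C \<ge> 0" "\<And>n z. cmod z = 1 \<Longrightarrow> cmod (p n z) \<le> C" and D: "D \<ge> 0" "\<And>n z. cmod z = 1 \<Longrightarrow> cmod (q n z) \<le> D"
    using trig_approxD(2)[OF pA] trig_approxD(2)[OF qB] by blast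
  note fL = circle_Linf_L2[OF fg(1)] and gL = circle_Linf_L2[OF fg(2)]
  have "L2_lim circle_haar q f"
  proof -
    have "L2_norm circle_haar (\<lambda>x. q n x - g x) = L2_norm circle_haar (\<lambda>x. q n x - f x)" for n
      using eq by (intro L2_norm_cong L2_diff trig_approxD(4)[OF qB] fL gL L2_eq_diff L2_eq_refl) (simp add: L2_eq_def eq_commute)
    then show ?thesis using trig_approxD(3)[OF qB] by (simp add: L2_lim_def)
  qed
  from L2_lim_lincomb[OF trig_approxD(4)[OF qB] fL this trig_approxD(4)[OF pA] fL trig_approxD(3)[OF pA], of "-1"]
  have "(\<lambda>n. L2_norm circle_haar (\<lambda>z. p n z - q n z)) \<longlonglongrightarrow> 0"
    by (simp add: L2_lim_def)
  then show ?thesis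
    using norm_triangle_ineq4 C D
    by (intro trig_approx_null[of "\<lambda>n z. p n z - q n z" "\<lambda>n \<xi> x. A n \<xi> x - B n \<xi> x" "C + D", OF _ _ _ _ \<xi>]
        trig_op_diff trig_approxD(1)[OF pA] trig_approxD(1)[OF qB])
       (auto intro: order_trans[OF norm_triangle_ineq4 add_mono])
qed

lemma trig_approx_converges:
  assumes pA: "trig_approx f p A" and f: "f \<in> circle_Linf" and \<xi>: "\<xi> \<in> L2 M"
  shows "\<exists>\<eta>\<in>L2 M. L2_lim M (\<lambda>n. A n \<xi>) \<eta>"
proof (rule L2_complete)
  show "A n \<xi> \<in> L2 M" for n by (rule trig_approxD(5)[OF pA \<xi>])
  fix e :: real assume e: "e > 0"
  obtain C where C: "C \<ge> 0" "\<And>n z. cmod z = 1 \<Longrightarrow> cmod (p n z) \<le> C" using trig_approxD(2)[OF pA] by blast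
  obtain \<delta> where \<delta>: "\<delta> > 0" "\<And>p A. trig_op p A \<Longrightarrow> (\<forall>z. cmod z = 1 \<longrightarrow> cmod (p z) \<le> C + C) \<Longrightarrow>
     L2_norm circle_haar p < \<delta> \<Longrightarrow> L2_norm M (A \<xi>) < e"
    using trig_op_norm_small[OF \<xi> _ e, of "C + C"] C(1) by auto
  have "\<forall>\<^sub>F n in sequentially. L2_norm circle_haar (\<lambda>z. p n z - f z) < \<delta> / 2"
    by (rule order_tendstoD(2)[OF trig_approxD(3)[OF pA, unfolded L2_lim_def]]) (use \<delta> in simp)
  then obtain N where N: "\<And>n. n \<ge> N \<Longrightarrow> L2_norm circle_haar (\<lambda>z. p n z - f z) < \<delta> / 2"
    by (auto simp: eventually_sequentially)
  have "L2_norm M (\<lambda>x. A m \<xi> x - A n \<xi> x) < e" if mn: "m \<ge> N" "n \<ge> N" for m n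
  proof (rule \<delta>(2)[OF trig_op_diff[OF trig_approxD(1)[OF pA] trig_approxD(1)[OF pA]]])
    show "\<forall>z. cmod z = 1 \<longrightarrow> cmod (p m z - p n z) \<le> C + C"
      by (intro allI impI order_trans[OF norm_triangle_ineq4 add_mono[OF C(2) C(2)]])
    show "L2_norm circle_haar (\<lambda>z. p m z - p n z) < \<delta>"
      using L2_norm_triangle_diff[OF trig_approxD(4)[OF pA] circle_Linf_L2[OF f] trig_approxD(4)[OF pA], of m n]
        N[OF mn(1)] N[OF mn(2)] by (simp add: L2_norm_minus_commute[of _ f])
  qed
  then show "\<exists>N. \<forall>m\<ge>N. \<forall>n\<ge>N. L2_norm M (\<lambda>x. A m \<xi> x - A n \<xi> x) < e" by blast
qed

text \<open>
  The operator \<open>f(T)\<close>. Almost everywhere equal limits are different functions, hence the choice; by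
  \<open>calc_lim\<close> the approximating sequence does not matter.
\<close>

definition calc :: "(complex \<Rightarrow> complex) \<Rightarrow> real L2_map" where
  "calc f \<xi> = (SOME \<eta>. \<eta> \<in> L2 M \<and> (\<exists>p A. trig_approx f p A \<and> L2_lim M (\<lambda>n. A n \<xi>) \<eta>))"

lemma calc_L2: "f \<in> circle_Linf \<Longrightarrow> \<xi> \<in> L2 M \<Longrightarrow> calc f \<xi> \<in> L2 M"
  and calc_ex: "f \<in> circle_Linf \<Longrightarrow> \<xi> \<in> L2 M \<Longrightarrow> \<exists>p A. trig_approx f p A \<and> L2_lim M (\<lambda>n. A n \<xi>) (calc f \<xi>)"
proof -
  assume f: "f \<in> circle_Linf" and \<xi>: "\<xi> \<in> L2 M"
  obtain p A where pA: "trig_approx f p A" using trig_approx_ex[OF f] by blast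
  obtain \<eta> where "\<eta> \<in> L2 M" "L2_lim M (\<lambda>n. A n \<xi>) \<eta>" using trig_approx_converges[OF pA f \<xi>] by blast
  then have "\<exists>\<eta>. \<eta> \<in> L2 M \<and> (\<exists>p A. trig_approx f p A \<and> L2_lim M (\<lambda>n. A n \<xi>) \<eta>)" using pA by blast
  from someI_ex[OF this] show "calc f \<xi> \<in> L2 M" "\<exists>p A. trig_approx f p A \<and> L2_lim M (\<lambda>n. A n \<xi>) (calc f \<xi>)"
    unfolding calc_def[symmetric] by auto
qed

lemma calc_lim_AE:
  assumes f: "f \<in> circle_Linf" "g \<in> circle_Linf" "AE z in circle_haar. f z = g z"
    and \<xi>: "\<xi> \<in> L2 M" and pA: "trig_approx g p A"
  shows "L2_lim M (\<lambda>n. A n \<xi>) (calc f \<xi>)"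
proof -
  obtain q B where qB: "trig_approx f q B" "L2_lim M (\<lambda>n. B n \<xi>) (calc f \<xi>)" using calc_ex[OF f(1) \<xi>] by blast
  have "AE z in circle_haar. g z = f z" using f(3) by eventually_elim simp
  note lim = trig_approx_unique[OF pA qB(1) f(2,1) this \<xi>]
  show ?thesis
  proof (rule L2_lim_sandwich)
    show "L2_norm M (\<lambda>x. A n \<xi> x - calc f \<xi> x) \<le> L2_norm M (\<lambda>x. A n \<xi> x - B n \<xi> x) + L2_norm M (\<lambda>x. B n \<xi> x - calc f \<xi> x)" for n
      by (intro L2_norm_triangle_diff trig_approxD(5)[OF pA \<xi>] trig_approxD(5)[OF qB(1) \<xi>] calc_L2 f \<xi>)
    show "(\<lambda>n. L2_norm M (\<lambda>x. A n \<xi> x - B n \<xi> x) + L2_norm M (\<lambda>x. B n \<xi> x - calc f \<xi> x)) \<longlonglongrightarrow> 0"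
      using tendsto_add[OF lim qB(2)[unfolded L2_lim_def]] by simp
  qed
qed

lemma calc_lim:
  "f \<in> circle_Linf \<Longrightarrow> \<xi> \<in> L2 M \<Longrightarrow> trig_approx f p A \<Longrightarrow> L2_lim M (\<lambda>n. A n \<xi>) (calc f \<xi>)"
  by (rule calc_lim_AE[of f f]) auto

lemma calc_cong_AE:
  assumes f: "f \<in> circle_Linf" "g \<in> circle_Linf" "AE z in circle_haar. f z = g z" and \<xi>: "\<xi> \<in> L2 M"
  shows "L2_eq M (calc f \<xi>) (calc g \<xi>)"
proof -
  obtain p A where pA: "trig_approx g p A" using trig_approx_ex[OF f(2)] by blast
  show ?thesis
    by (rule L2_lim_unique[OF trig_approxD(5)[OF pA \<xi>] calc_L2[OF f(1) \<xi>] calc_L2[OF f(2) \<xi>]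
        calc_lim_AE[OF f \<xi> pA] calc_lim[OF f(2) \<xi> pA]])
qed

lemma calc_norm_le:
  assumes f: "f \<in> circle_Linf" and c: "AE z in circle_haar. cmod (f z) \<le> c" "c \<ge> 0" and \<xi>: "\<xi> \<in> L2 M"
  shows "L2_norm M (calc f \<xi>) \<le> (c + 1) * L2_norm M \<xi>"
proof -
  obtain p A where pA: "trig_approx f p A" "\<And>n z. cmod z = 1 \<Longrightarrow> cmod (p n z) \<le> c + 1"
    using trig_approx_ex_bound[OF f c] by blast
  have "(\<lambda>n. L2_norm M (A n \<xi>)) \<longlonglongrightarrow> L2_norm M (calc f \<xi>)"
    by (intro L2_lim_norm trig_approxD(5)[OF pA(1) \<xi>] calc_L2 calc_lim[OF f \<xi> pA(1)] f \<xi>)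
  then show ?thesis
    by (rule LIMSEQ_le_const2) (use trig_op_norm_le[OF trig_approxD(1)[OF pA(1)] pA(2) _ \<xi>] c in auto)
qed

lemma calc_operator:
  assumes f: "f \<in> circle_Linf" shows "L2_operator M (calc f)"
  unfolding L2_operator_def
proof (intro conjI ballI allI)
  show "calc f \<xi> \<in> L2 M" if "\<xi> \<in> L2 M" for \<xi> using calc_L2[OF f that] .
  obtain p A where pA: "trig_approx f p A" using trig_approx_ex[OF f] by blast
  show "L2_eq M (calc f (\<lambda>x. a * \<xi> x + \<eta> x)) (\<lambda>x. a * calc f \<xi> x + calc f \<eta> x)"
    if m: "\<xi> \<in> L2 M" "\<eta> \<in> L2 M" for \<xi> \<eta> a
  proof (rule L2_lim_unique)
    note l = L2_lincomb[OF m, of a]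
    show "L2_lim M (\<lambda>n. A n (\<lambda>x. a * \<xi> x + \<eta> x)) (calc f (\<lambda>x. a * \<xi> x + \<eta> x))"
      by (rule calc_lim[OF f l pA])
    show "L2_lim M (\<lambda>n. A n (\<lambda>x. a * \<xi> x + \<eta> x)) (\<lambda>x. a * calc f \<xi> x + calc f \<eta> x)"
      unfolding trig_op_linear[OF trig_approxD(1)[OF pA]]
      by (intro L2_lim_lincomb trig_approxD(5)[OF pA] calc_L2 calc_lim[OF f _ pA] f m)
    show "A n (\<lambda>x. a * \<xi> x + \<eta> x) \<in> L2 M" for n by (rule trig_approxD(5)[OF pA l])
    show "calc f (\<lambda>x. a * \<xi> x + \<eta> x) \<in> L2 M" "(\<lambda>x. a * calc f \<xi> x + calc f \<eta> x) \<in> L2 M"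
      by (intro calc_L2 f l, intro L2_lincomb calc_L2 f m)
  qed
  obtain c where c: "c \<ge> 0" "AE z in circle_haar. cmod (f z) \<le> c" using circle_Linf_bound[OF f] by blast
  show "\<exists>K. \<forall>\<xi>\<in>L2 M. L2_norm M (calc f \<xi>) \<le> K * L2_norm M \<xi>"
    using calc_norm_le[OF f c(2,1)] by blast
qed

lemma calc_eqI:
  assumes f: "f \<in> circle_Linf" and \<xi>: "\<xi> \<in> L2 M" and pA: "trig_approx f p A"
    and \<eta>: "\<eta> \<in> L2 M" "L2_lim M (\<lambda>n. A n \<xi>) \<eta>"
  shows "L2_eq M (calc f \<xi>) \<eta>"
  by (rule L2_lim_unique[OF trig_approxD(5)[OF pA \<xi>] calc_L2[OF f \<xi>] \<eta>(1) calc_lim[OF f \<xi> pA] \<eta>(2)])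

lemma calc_trig:
  assumes p: "trig_op p A" and \<xi>: "\<xi> \<in> L2 M"
  shows "L2_eq M (calc p \<xi>) (A \<xi>)"
proof (rule calc_eqI[OF trig_op_Linf[OF p] \<xi>, of "\<lambda>n. p" "\<lambda>n. A"])
  show "trig_approx p (\<lambda>n. p) (\<lambda>n. A)"
    unfolding trig_approx_def using p trig_op_bounded[OF p] L2_lim_const by blast
qed (auto intro: trig_op_L2[OF p \<xi>] L2_lim_const)

lemma circle_Linf_lincomb:
  assumes "f \<in> circle_Linf" "g \<in> circle_Linf" shows "(\<lambda>z. a * f z + g z) \<in> circle_Linf"
proof -
  note [measurable] = circle_Linf_measurable[OF assms(1)] circle_Linf_measurable[OF assms(2)]
  obtain c d where "AE z in circle_haar. cmod (f z) \<le> c" "AE z in circle_haar. cmod (g z) \<le> d"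
    using assms by (auto simp: circle_Linf_def)
  then have "AE z in circle_haar. cmod (a * f z + g z) \<le> cmod a * c + d"
    by eventually_elim (auto simp: norm_mult intro!: order_trans[OF norm_triangle_ineq] add_mono mult_left_mono)
  then show ?thesis by (auto simp: circle_Linf_def)
qed

lemma circle_Linf_mult:
  assumes "f \<in> circle_Linf" "g \<in> circle_Linf" shows "(\<lambda>z. f z * g z) \<in> circle_Linf"
proof -
  note [measurable] = circle_Linf_measurable[OF assms(1)] circle_Linf_measurable[OF assms(2)]
  obtain c d where "c \<ge> 0" "AE z in circle_haar. cmod (f z) \<le> c" "AE z in circle_haar. cmod (g z) \<le> d"
    using circle_Linf_bound[OF assms(1)] circle_Linf_bound[OF assms(2)] by blast
  then have "AE z in circle_haar. cmod (f z * g z) \<le> c * d"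
    by (auto simp: norm_mult elim!: eventually_elim2 intro!: mult_mono)
  then show ?thesis by (auto simp: circle_Linf_def)
qed

lemma circle_Linf_cnj:
  assumes "f \<in> circle_Linf" shows "(\<lambda>z. cnj (f z)) \<in> circle_Linf"
proof -
  have "(\<lambda>z. cnj (f z)) \<in> borel_measurable circle_haar"
    by (rule measurable_compose[OF circle_Linf_measurable[OF assms]])
       (intro borel_measurable_continuous_onI continuous_intros)
  then show ?thesis using assms by (auto simp: circle_Linf_def)
qed

lemma calc_lincomb:
  assumes fg: "f \<in> circle_Linf" "g \<in> circle_Linf" and \<xi>: "\<xi> \<in> L2 M"
  shows "L2_eq M (calc (\<lambda>z. a * f z + g z) \<xi>) (\<lambda>x. a * calc f \<xi> x + calc g \<xi> x)"
proof -
  obtain p A where pA: "trig_approx f p A" using trig_approx_ex[OF fg(1)] by blast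
  obtain q B where qB: "trig_approx g q B" using trig_approx_ex[OF fg(2)] by blast
  show ?thesis
  proof (rule calc_eqI[OF circle_Linf_lincomb[OF fg] \<xi>, where p="\<lambda>n z. a * p n z + q n z" and A="\<lambda>n \<xi> x. a * A n \<xi> x + B n \<xi> x"])
    obtain C D where C: "C \<ge> 0" "\<And>n z. cmod z = 1 \<Longrightarrow> cmod (p n z) \<le> C" and D: "D \<ge> 0" "\<And>n z. cmod z = 1 \<Longrightarrow> cmod (q n z) \<le> D"
      using trig_approxD(2)[OF pA] trig_approxD(2)[OF qB] by blast
    have "cmod (a * p n z + q n z) \<le> cmod a * C + D" if "cmod z = 1" for n z
      using C(2)[OF that] D(2)[OF that] by (auto simp: norm_mult intro!: order_trans[OF norm_triangle_ineq] add_mono mult_left_mono)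
    moreover have "cmod a * C + D \<ge> 0" using C D by auto
    moreover have "L2_lim circle_haar (\<lambda>n z. a * p n z + q n z) (\<lambda>z. a * f z + g z)"
      by (intro L2_lim_lincomb trig_approxD(4)[OF pA] trig_approxD(4)[OF qB] trig_approxD(3)[OF pA] trig_approxD(3)[OF qB] circle_Linf_L2 fg)
    ultimately show "trig_approx (\<lambda>z. a * f z + g z) (\<lambda>n z. a * p n z + q n z) (\<lambda>n \<xi> x. a * A n \<xi> x + B n \<xi> x)"
      unfolding trig_approx_def using trig_op_lincomb[OF trig_approxD(1)[OF pA] trig_approxD(1)[OF qB]] by blast
    show "(\<lambda>x. a * calc f \<xi> x + calc g \<xi> x) \<in> L2 M" by (intro L2_lincomb calc_L2 fg \<xi>)
    show "L2_lim M (\<lambda>n x. a * A n \<xi> x + B n \<xi> x) (\<lambda>x. a * calc f \<xi> x + calc g \<xi> x)"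
      by (intro L2_lim_lincomb trig_approxD(5)[OF pA \<xi>] trig_approxD(5)[OF qB \<xi>] calc_L2 fg \<xi> calc_lim[OF _ \<xi> pA] calc_lim[OF _ \<xi> qB])
  qed
qed

lemma L2_norm_mult_bound:
  assumes "f \<in> borel_measurable N" "AE x in N. cmod (f x) \<le> c" "c \<ge> 0" "g \<in> L2 N"
  shows "(\<lambda>x. f x * g x) \<in> L2 N" "L2_norm N (\<lambda>x. f x * g x) \<le> c * L2_norm N g"
proof -
  note [measurable] = assms(1) L2_measurable[OF assms(4)]
  have b: "AE x in N. (cmod (f x * g x))\<^sup>2 \<le> c\<^sup>2 * (cmod (g x))\<^sup>2"
    using assms(2) by eventually_elim (simp add: norm_mult power_mult_distrib mult_right_mono power_mono)
  have i: "integrable N (\<lambda>x. c\<^sup>2 * (cmod (g x))\<^sup>2)" using L2_integrable[OF assms(4)] by simp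
  have j: "integrable N (\<lambda>x. (cmod (f x * g x))\<^sup>2)"
    by (rule Bochner_Integration.integrable_bound[OF i]) (use b in \<open>auto elim: eventually_mono\<close>)
  then show "(\<lambda>x. f x * g x) \<in> L2 N" by (simp add: L2_def)
  have "(LINT x|N. (cmod (f x * g x))\<^sup>2) \<le> (LINT x|N. c\<^sup>2 * (cmod (g x))\<^sup>2)"
    by (rule integral_mono_AE[OF j i b])
  then have "L2_norm N (\<lambda>x. f x * g x) \<le> sqrt (c\<^sup>2 * (LINT x|N. (cmod (g x))\<^sup>2))"
    by (simp add: L2_norm_def)
  then show "L2_norm N (\<lambda>x. f x * g x) \<le> c * L2_norm N g"
    using assms(3) by (simp add: real_sqrt_mult L2_norm_def)
qed

text \<open>
  Both sides are limits of \<open>p\<^sub>n(T) q\<^sub>n(T) \<xi>\<close>, since the operators \<open>p\<^sub>n(T)\<close> are uniformly bounded.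
\<close>

lemma calc_mult:
  assumes fg: "f \<in> circle_Linf" "g \<in> circle_Linf" and \<xi>: "\<xi> \<in> L2 M"
  shows "L2_eq M (calc (\<lambda>z. f z * g z) \<xi>) (calc f (calc g \<xi>))"
proof -
  obtain p A where pA: "trig_approx f p A" using trig_approx_ex[OF fg(1)] by blast
  obtain q B where qB: "trig_approx g q B" using trig_approx_ex[OF fg(2)] by blast
  obtain C D where C: "C \<ge> 0" "\<And>n z. cmod z = 1 \<Longrightarrow> cmod (p n z) \<le> C" and D: "D \<ge> 0" "\<And>n z. cmod z = 1 \<Longrightarrow> cmod (q n z) \<le> D"
    using trig_approxD(2)[OF pA] trig_approxD(2)[OF qB] by blast
  note fL = circle_Linf_L2[OF fg(1)] and gL = circle_Linf_L2[OF fg(2)]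
  have bL: "calc g \<xi> \<in> L2 M" by (rule calc_L2[OF fg(2) \<xi>])
  show ?thesis
  proof (rule calc_eqI[OF circle_Linf_mult[OF fg] \<xi>, where p="\<lambda>n z. p n z * q n z" and A="\<lambda>n \<xi> x. A n (B n \<xi>) x"])
    have "cmod (p n z * q n z) \<le> C * D" if "cmod z = 1" for n z
      using C(2)[OF that] D(2)[OF that] C(1) by (auto simp: norm_mult intro!: mult_mono)
    moreover have "C * D \<ge> 0" using C D by auto
    moreover have "L2_lim circle_haar (\<lambda>n z. p n z * q n z) (\<lambda>z. f z * g z)"
    proof -
      obtain d where d: "d \<ge> 0" "AE z in circle_haar. cmod (g z) \<le> d" using circle_Linf_bound[OF fg(2)] by blast
      have pC: "AE z in circle_haar. cmod (p n z) \<le> C" for n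
        using C(2) by (intro AE_I2) (simp add: space_circle_haar)
      have 1: "(\<lambda>z. p n z * (q n z - g z)) \<in> L2 circle_haar"
        "L2_norm circle_haar (\<lambda>z. p n z * (q n z - g z)) \<le> C * L2_norm circle_haar (\<lambda>z. q n z - g z)" for n
        by (rule L2_norm_mult_bound[OF L2_measurable[OF trig_approxD(4)[OF pA]] pC C(1) L2_diff[OF trig_approxD(4)[OF qB] gL]])+
      have 2: "(\<lambda>z. g z * (p n z - f z)) \<in> L2 circle_haar"
        "L2_norm circle_haar (\<lambda>z. g z * (p n z - f z)) \<le> d * L2_norm circle_haar (\<lambda>z. p n z - f z)" for n
        by (rule L2_norm_mult_bound[OF L2_measurable[OF gL] d(2,1) L2_diff[OF trig_approxD(4)[OF pA] fL]])+
      show ?thesis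
      proof (rule L2_lim_sandwich)
        fix n
        have "(\<lambda>z. p n z * q n z - f z * g z) = (\<lambda>z. p n z * (q n z - g z) + g z * (p n z - f z))"
          by (auto simp: algebra_simps)
        then show "L2_norm circle_haar (\<lambda>z. p n z * q n z - f z * g z)
            \<le> C * L2_norm circle_haar (\<lambda>z. q n z - g z) + d * L2_norm circle_haar (\<lambda>z. p n z - f z)"
          using L2_norm_triangle[OF 1(1)[of n] 2(1)[of n]] 1(2)[of n] 2(2)[of n] by simp
      next
        have "(\<lambda>n. C * L2_norm circle_haar (\<lambda>z. q n z - g z) + d * L2_norm circle_haar (\<lambda>z. p n z - f z)) \<longlonglongrightarrow> C * 0 + d * 0"
          by (intro tendsto_intros trig_approxD(3)[OF pA, unfolded L2_lim_def] trig_approxD(3)[OF qB, unfolded L2_lim_def])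
        then show "(\<lambda>n. C * L2_norm circle_haar (\<lambda>z. q n z - g z) + d * L2_norm circle_haar (\<lambda>z. p n z - f z)) \<longlonglongrightarrow> 0" by simp
      qed
    qed
    ultimately show "trig_approx (\<lambda>z. f z * g z) (\<lambda>n z. p n z * q n z) (\<lambda>n \<xi> x. A n (B n \<xi>) x)"
      unfolding trig_approx_def using trig_op_mult[OF trig_approxD(1)[OF pA] trig_approxD(1)[OF qB]] by blast
    show "calc f (calc g \<xi>) \<in> L2 M" by (intro calc_L2 fg bL)
    show "L2_lim M (\<lambda>n x. A n (B n \<xi>) x) (calc f (calc g \<xi>))"
    proof (rule L2_lim_sandwich)
      fix n
      note BL = trig_approxD(5)[OF qB \<xi>, of n]
      have "L2_norm M (\<lambda>x. A n (B n \<xi>) x - A n (calc g \<xi>) x) = L2_norm M (A n (\<lambda>x. B n \<xi> x - calc g \<xi> x))"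
        by (rule L2_operator_norm_diff[OF trig_op_operator[OF trig_approxD(1)[OF pA]] BL bL])
      also have "\<dots> \<le> C * L2_norm M (\<lambda>x. B n \<xi> x - calc g \<xi> x)"
        by (rule trig_op_norm_le[OF trig_approxD(1)[OF pA] C(2) C(1) L2_diff[OF BL bL]])
      finally show "L2_norm M (\<lambda>x. A n (B n \<xi>) x - calc f (calc g \<xi>) x)
          \<le> C * L2_norm M (\<lambda>x. B n \<xi> x - calc g \<xi> x) + L2_norm M (\<lambda>x. A n (calc g \<xi>) x - calc f (calc g \<xi>) x)"
        using L2_norm_triangle_diff[OF trig_approxD(5)[OF pA BL] trig_approxD(5)[OF pA bL] calc_L2[OF fg(1) bL], of n n] by linarith
    next
      have "(\<lambda>n. C * L2_norm M (\<lambda>x. B n \<xi> x - calc g \<xi> x) + L2_norm M (\<lambda>x. A n (calc g \<xi>) x - calc f (calc g \<xi>) x)) \<longlonglongrightarrow> C * 0 + 0"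
        by (intro tendsto_intros calc_lim[OF fg(2) \<xi> qB, unfolded L2_lim_def] calc_lim[OF fg(1) bL pA, unfolded L2_lim_def])
      then show "(\<lambda>n. C * L2_norm M (\<lambda>x. B n \<xi> x - calc g \<xi> x) + L2_norm M (\<lambda>x. A n (calc g \<xi>) x - calc f (calc g \<xi>) x)) \<longlonglongrightarrow> 0" by simp
    qed
  qed
qed

lemma calc_adjoint:
  assumes f: "f \<in> circle_Linf" and m: "\<xi> \<in> L2 M" "\<eta> \<in> L2 M"
  shows "L2_inner M (calc f \<xi>) \<eta> = L2_inner M \<xi> (calc (\<lambda>z. cnj (f z)) \<eta>)"
proof -
  obtain p A where pA: "trig_approx f p A" using trig_approx_ex[OF f] by blast
  obtain B where B: "\<And>n. trig_op (\<lambda>z. cnj (p n z)) (B n)"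
    "\<And>n \<xi> \<eta>. \<xi> \<in> L2 M \<Longrightarrow> \<eta> \<in> L2 M \<Longrightarrow> L2_inner M (A n \<xi>) \<eta> = L2_inner M \<xi> (B n \<eta>)"
    using trig_op_adjoint[OF trig_approxD(1)[OF pA]] by metis
  have qB: "trig_approx (\<lambda>z. cnj (f z)) (\<lambda>n z. cnj (p n z)) B"
    unfolding trig_approx_def
  proof (intro conjI allI B)
    show "\<exists>C\<ge>0. \<forall>n z. cmod z = 1 \<longrightarrow> cmod (cnj (p n z)) \<le> C" using trig_approxD(2)[OF pA] by simp
    have "L2_norm circle_haar (\<lambda>z. cnj (p n z) - cnj (f z)) = L2_norm circle_haar (\<lambda>z. p n z - f z)" for n
      by (simp add: L2_norm_def flip: complex_cnj_diff)
    then show "L2_lim circle_haar (\<lambda>n z. cnj (p n z)) (\<lambda>z. cnj (f z))"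
      using trig_approxD(3)[OF pA] by (simp add: L2_lim_def)
  qed
  note cf = circle_Linf_cnj[OF f]
  have "(\<lambda>n. L2_inner M (A n \<xi>) \<eta>) \<longlonglongrightarrow> L2_inner M (calc f \<xi>) \<eta>"
    by (intro L2_lim_inner trig_approxD(5)[OF pA] calc_L2 calc_lim[OF f _ pA] L2_lim_const f m)
  moreover have "(\<lambda>n. L2_inner M \<xi> (B n \<eta>)) \<longlonglongrightarrow> L2_inner M \<xi> (calc (\<lambda>z. cnj (f z)) \<eta>)"
    by (intro L2_lim_inner trig_approxD(5)[OF qB] calc_L2 calc_lim[OF cf _ qB] L2_lim_const cf m)
  ultimately show ?thesis by (simp only: B(2)[OF m]) (rule LIMSEQ_unique)
qed

text \<open>
  Choosing a trigonometric polynomial close to each member of a sequence makes the calculus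
  continuous for bounded convergence in quadratic mean.
\<close>

lemma calc_continuous:
  assumes f: "\<And>n. f n \<in> circle_Linf" "g \<in> circle_Linf" and C: "C \<ge> 0" "\<And>n. AE z in circle_haar. cmod (f n z) \<le> C"
    and lim: "L2_lim circle_haar f g" and \<xi>: "\<xi> \<in> L2 M"
  shows "L2_lim M (\<lambda>n. calc (f n) \<xi>) (calc g \<xi>)"
proof -
  \<comment> \<open>p is close to f n on the circle and p(T) is close to f n (T) at the given vector\<close>
  define Q where "Q n p A \<longleftrightarrow> trig_op p A \<and> (\<forall>z. cmod z = 1 \<longrightarrow> cmod (p z) \<le> C + 1) \<and>
      L2_norm circle_haar (\<lambda>z. p z - f n z) < inverse (real (Suc n)) \<and>
      L2_norm M (\<lambda>x. A \<xi> x - calc (f n) \<xi> x) < inverse (real (Suc n))" for n p A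
  have "\<forall>n. \<exists>p A. Q n p A"
  proof
    fix n
    obtain p A where pA: "trig_approx (f n) p A" "\<And>m z. cmod z = 1 \<Longrightarrow> cmod (p m z) \<le> C + 1"
      using trig_approx_ex_bound[OF f(1) C(2,1)] by blast
    have "\<forall>\<^sub>F m in sequentially. L2_norm circle_haar (\<lambda>z. p m z - f n z) < inverse (real (Suc n))"
      by (rule order_tendstoD(2)[OF trig_approxD(3)[OF pA(1), unfolded L2_lim_def]]) simp
    moreover have "\<forall>\<^sub>F m in sequentially. L2_norm M (\<lambda>x. A m \<xi> x - calc (f n) \<xi> x) < inverse (real (Suc n))"
      by (rule order_tendstoD(2)[OF calc_lim[OF f(1) \<xi> pA(1), unfolded L2_lim_def]]) simp
    ultimately have "\<forall>\<^sub>F m in sequentially. L2_norm circle_haar (\<lambda>z. p m z - f n z) < inverse (real (Suc n)) \<and> L2_norm M (\<lambda>x. A m \<xi> x - calc (f n) \<xi> x) < inverse (real (Suc n))"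
      by eventually_elim simp
    then obtain m where "L2_norm circle_haar (\<lambda>z. p m z - f n z) < inverse (real (Suc n))" "L2_norm M (\<lambda>x. A m \<xi> x - calc (f n) \<xi> x) < inverse (real (Suc n))"
      by (auto simp: eventually_sequentially)
    then show "\<exists>p A. Q n p A" unfolding Q_def using trig_approxD(1)[OF pA(1)] pA(2) by blast
  qed
  then obtain p A where "\<And>n. Q n (p n) (A n)" by metis
  then have p: "\<And>n. trig_op (p n) (A n)" "\<And>n z. cmod z = 1 \<Longrightarrow> cmod (p n z) \<le> C + 1"
    "\<And>n. L2_norm circle_haar (\<lambda>z. p n z - f n z) < inverse (real (Suc n))"
    "\<And>n. L2_norm M (\<lambda>x. A n \<xi> x - calc (f n) \<xi> x) < inverse (real (Suc n))"
    unfolding Q_def by blast+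
  have pA: "trig_approx g p A"
    unfolding trig_approx_def
  proof (intro conjI allI p)
    show "\<exists>C\<ge>0. \<forall>n z. cmod z = 1 \<longrightarrow> cmod (p n z) \<le> C" using p(2) C(1) by (intro exI[of _ "C + 1"]) auto
    show "L2_lim circle_haar p g"
    proof (rule L2_lim_sandwich)
      show "L2_norm circle_haar (\<lambda>z. p n z - g z) \<le> inverse (real (Suc n)) + L2_norm circle_haar (\<lambda>z. f n z - g z)" for n
        using L2_norm_triangle_diff[OF circle_Linf_L2[OF trig_op_Linf[OF p(1)]] circle_Linf_L2[OF f(1)] circle_Linf_L2[OF f(2)], of n n] p(3)[of n] by linarith
      show "(\<lambda>n. inverse (real (Suc n)) + L2_norm circle_haar (\<lambda>z. f n z - g z)) \<longlonglongrightarrow> 0"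
        using tendsto_add[OF LIMSEQ_inverse_real_of_nat lim[unfolded L2_lim_def]] by simp
    qed
  qed
  show ?thesis
  proof (rule L2_lim_sandwich)
    show "L2_norm M (\<lambda>x. calc (f n) \<xi> x - calc g \<xi> x) \<le> inverse (real (Suc n)) + L2_norm M (\<lambda>x. A n \<xi> x - calc g \<xi> x)" for n
      using L2_norm_triangle_diff[OF calc_L2[OF f(1) \<xi>] trig_op_L2[OF p(1) \<xi>] calc_L2[OF f(2) \<xi>], of n n] p(4)[of n]
        L2_norm_minus_commute[of M "A n \<xi>" "calc (f n) \<xi>"] by linarith
    show "(\<lambda>n. inverse (real (Suc n)) + L2_norm M (\<lambda>x. A n \<xi> x - calc g \<xi> x)) \<longlonglongrightarrow> 0"
      using tendsto_add[OF LIMSEQ_inverse_real_of_nat calc_lim[OF f(2) \<xi> pA, unfolded L2_lim_def]] by simp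
  qed
qed

end

section \<open>Spectral measures\<close>

context shift_measure begin

lemma calc_one: "\<xi> \<in> L2 M \<Longrightarrow> L2_eq M (calc (\<lambda>z. 1) \<xi>) \<xi>"
  using calc_trig[OF trig_op_monom[of 1 0], of \<xi>] by simp

lemma circle_Linf_indicator: "B \<in> sets circle_borel \<Longrightarrow> indicator B \<in> circle_Linf"
  by (rule circle_LinfI[of _ 1]) (auto simp: indicator_def sets_circle_haar intro!: borel_measurable_indicator)

definition spectral_mass :: "(real \<Rightarrow> complex) \<Rightarrow> complex set \<Rightarrow> real" where
  "spectral_mass \<xi> B = (L2_norm M (calc (indicator B) \<xi>))\<^sup>2"

text \<open>
  The operator \<open>1\<^sub>B(T)\<close> is idempotent and self-adjoint.
\<close>

lemma spectral_mass_inner: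
  assumes \<xi>: "\<xi> \<in> L2 M" and B: "B \<in> sets circle_borel"
  shows "L2_inner M (calc (indicator B) \<xi>) \<xi> = of_real (spectral_mass \<xi> B)"
proof -
  let ?i = "indicator B :: complex \<Rightarrow> complex"
  note i = circle_Linf_indicator[OF B]
  have iL: "calc ?i \<xi> \<in> L2 M" by (rule calc_L2[OF i \<xi>])
  have "of_real (spectral_mass \<xi> B) = L2_inner M (calc ?i \<xi>) (calc ?i \<xi>)" by (simp add: spectral_mass_def L2_inner_self)
  also have "\<dots> = L2_inner M \<xi> (calc (\<lambda>z. cnj (?i z)) (calc ?i \<xi>))" by (rule calc_adjoint[OF i \<xi> iL])
  also have "(\<lambda>z. cnj (?i z)) = ?i" by (auto simp: indicator_def)
  also have "L2_inner M \<xi> (calc ?i (calc ?i \<xi>)) = L2_inner M \<xi> (calc (\<lambda>z. ?i z * ?i z) \<xi>)"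
    by (intro L2_inner_cong calc_L2 circle_Linf_mult i \<xi> iL L2_eq_refl L2_eq_sym[OF calc_mult])
  also have "(\<lambda>z. ?i z * ?i z) = ?i" by (auto simp: indicator_def)
  finally have "L2_inner M \<xi> (calc ?i \<xi>) = of_real (spectral_mass \<xi> B)" by simp
  then show ?thesis by (subst L2_inner_commute) simp
qed

lemma calc_inner_lincomb:
  assumes "f \<in> circle_Linf" "g \<in> circle_Linf" "\<xi> \<in> L2 M"
  shows "L2_inner M (calc (\<lambda>z. a * f z + g z) \<xi>) \<xi> = a * L2_inner M (calc f \<xi>) \<xi> + L2_inner M (calc g \<xi>) \<xi>"
proof -
  have "L2_inner M (calc (\<lambda>z. a * f z + g z) \<xi>) \<xi> = L2_inner M (\<lambda>x. a * calc f \<xi> x + calc g \<xi> x) \<xi>"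
    by (intro L2_inner_cong calc_L2 circle_Linf_lincomb L2_lincomb calc_lincomb L2_eq_refl assms)
  then show ?thesis by (simp add: L2_inner_lincomb_left calc_L2 assms)
qed

lemma circle_Linf_zero: "(\<lambda>z. 0) \<in> circle_Linf"
  by (rule circle_LinfI[of _ 0]) auto

lemma calc_inner_zero: "\<xi> \<in> L2 M \<Longrightarrow> L2_inner M (calc (\<lambda>z. 0) \<xi>) \<xi> = 0"
  using calc_inner_lincomb[OF circle_Linf_zero circle_Linf_zero, of \<xi> 1] by simp

lemma calc_inner_sum:
  assumes "finite I" "\<And>i. i \<in> I \<Longrightarrow> f i \<in> circle_Linf" "\<xi> \<in> L2 M"
  shows "(\<lambda>z. \<Sum>i\<in>I. a i * f i z) \<in> circle_Linf \<and>
    L2_inner M (calc (\<lambda>z. \<Sum>i\<in>I. a i * f i z) \<xi>) \<xi> = (\<Sum>i\<in>I. a i * L2_inner M (calc (f i) \<xi>) \<xi>)"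
  using assms
proof (induction I rule: finite_induct)
  case empty
  then show ?case by (simp add: circle_Linf_zero calc_inner_zero)
next
  case (insert i I)
  then show ?case by (simp add: circle_Linf_lincomb calc_inner_lincomb)
qed

lemma calc_inner_continuous:
  assumes f: "\<And>n. f n \<in> circle_Linf" "g \<in> circle_Linf" and C: "\<And>n z. cmod z = 1 \<Longrightarrow> cmod (f n z) \<le> C" "\<And>z. cmod z = 1 \<Longrightarrow> cmod (g z) \<le> C"
    and lim: "\<And>z. cmod z = 1 \<Longrightarrow> (\<lambda>n. f n z) \<longlonglongrightarrow> g z" and \<xi>: "\<xi> \<in> L2 M"
  shows "(\<lambda>n. L2_inner M (calc (f n) \<xi>) \<xi>) \<longlonglongrightarrow> L2_inner M (calc g \<xi>) \<xi>"
proof -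
  interpret finite_measure circle_haar by (rule finite_measure_circle_haar)
  have C0: "C \<ge> 0" using order_trans[OF norm_ge_zero C(2)[of 1]] by simp
  have "L2_lim circle_haar f g"
  proof (rule L2_lim_dominated[where w="\<lambda>z. (C + C)\<^sup>2"])
    have "(cmod (f n z - g z))\<^sup>2 \<le> (C + C)\<^sup>2" if "cmod z = 1" for n z
      by (intro power_mono order_trans[OF norm_triangle_ineq4] add_mono C that) auto
    then show "AE z in circle_haar. (cmod (f n z - g z))\<^sup>2 \<le> (C + C)\<^sup>2" for n
      by (intro AE_I2) (simp add: space_circle_haar)
    show "AE z in circle_haar. (\<lambda>n. f n z) \<longlonglongrightarrow> g z" using lim by (intro AE_I2) (simp add: space_circle_haar)
  qed (auto intro: circle_Linf_L2 f)
  then have "L2_lim M (\<lambda>n. calc (f n) \<xi>) (calc g \<xi>)"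
    using C0 C(1) by (intro calc_continuous[OF f C0 _ _ \<xi>]) (auto intro!: AE_I2 simp: space_circle_haar)
  then show ?thesis by (intro L2_lim_inner calc_L2 f \<xi> L2_lim_const)
qed

definition spectral_measure :: "(real \<Rightarrow> complex) \<Rightarrow> complex measure" where
  "spectral_measure \<xi> = measure_of (sphere 0 1) (sets circle_borel) (\<lambda>B. ennreal (spectral_mass \<xi> B))"

lemma sets_spectral_measure: "sets (spectral_measure \<xi>) = sets circle_borel"
  unfolding spectral_measure_def
  by (metis sets.sigma_sets_eq sets.space_closed sets_measure_of space_circle_borel)

lemma space_spectral_measure: "space (spectral_measure \<xi>) = sphere 0 1"
  using sets_eq_imp_space_eq[OF sets_spectral_measure] space_circle_borel by metis

text \<open>
  Finite additivity comes from linearity of the calculus, countable additivity from its continuity.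
\<close>

lemma emeasure_spectral_measure:
  assumes \<xi>: "\<xi> \<in> L2 M" and B: "B \<in> sets circle_borel"
  shows "emeasure (spectral_measure \<xi>) B = ennreal (spectral_mass \<xi> B)"
proof -
  have add: "(\<Sum>i<n. spectral_mass \<xi> (A i)) = spectral_mass \<xi> (\<Union>i<n. A i)"
    if A: "\<And>i. A i \<in> sets circle_borel" "disjoint_family A" for A :: "nat \<Rightarrow> complex set" and n
  proof -
    have "complex_of_real (\<Sum>i<n. spectral_mass \<xi> (A i)) = (\<Sum>i<n. 1 * L2_inner M (calc (indicator (A i)) \<xi>) \<xi>)"
      by (simp add: spectral_mass_inner[OF \<xi> A(1)])
    also have "\<dots> = L2_inner M (calc (\<lambda>z. \<Sum>i<n. 1 * indicator (A i) z) \<xi>) \<xi>"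
      using calc_inner_sum[of "{..<n}" "\<lambda>i. indicator (A i)" \<xi> "\<lambda>i. 1"] circle_Linf_indicator[OF A(1)] \<xi> by simp
    also have "(\<lambda>z. \<Sum>i<n. 1 * indicator (A i) z) = (indicator (\<Union>i<n. A i) :: complex \<Rightarrow> complex)"
      using A(2) by (intro ext) (subst indicator_UN_disjoint, auto simp: disjoint_family_on_def)
    also have "L2_inner M (calc (indicator (\<Union>i<n. A i)) \<xi>) \<xi> = of_real (spectral_mass \<xi> (\<Union>i<n. A i))"
      using A(1) by (intro spectral_mass_inner[OF \<xi>]) auto
    finally show ?thesis using of_real_eq_iff by blast
  qed
  have ca: "countably_additive (sets circle_borel) (\<lambda>B. ennreal (spectral_mass \<xi> B))"
  proof (rule countably_additiveI)
    fix A :: "nat \<Rightarrow> complex set" assume A: "range A \<subseteq> sets circle_borel" "disjoint_family A" "(\<Union>i. A i) \<in> sets circle_borel"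
    then have As: "A i \<in> sets circle_borel" for i by auto
    have "(\<lambda>n. L2_inner M (calc (indicator (\<Union>i<n. A i)) \<xi>) \<xi>) \<longlonglongrightarrow> L2_inner M (calc (indicator (\<Union>i. A i)) \<xi>) \<xi>"
    proof (rule calc_inner_continuous[where C=1])
      show "(indicator (\<Union>i<n. A i) :: complex \<Rightarrow> complex) \<in> circle_Linf" for n
        using As by (intro circle_Linf_indicator) auto
      show "(\<lambda>n. indicator (\<Union>i<n. A i) z) \<longlonglongrightarrow> (indicator (\<Union>i. A i) z :: complex)" for z
        by (rule LIMSEQ_indicator_UN)
    qed (use A \<xi> in \<open>auto intro!: circle_Linf_indicator simp: indicator_def\<close>)
    moreover have "L2_inner M (calc (indicator (\<Union>i<n. A i)) \<xi>) \<xi> = of_real (\<Sum>i<n. spectral_mass \<xi> (A i))" for n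
      unfolding add[OF As A(2)] using As by (intro spectral_mass_inner[OF \<xi>]) auto
    ultimately have "(\<lambda>n. complex_of_real (\<Sum>i<n. spectral_mass \<xi> (A i))) \<longlonglongrightarrow> of_real (spectral_mass \<xi> (\<Union>i. A i))"
      using spectral_mass_inner[OF \<xi> A(3)] by simp
    then have "(\<lambda>i. spectral_mass \<xi> (A i)) sums spectral_mass \<xi> (\<Union>i. A i)"
      unfolding sums_def by (simp only: tendsto_of_real_iff)
    then show "(\<Sum>i. ennreal (spectral_mass \<xi> (A i))) = ennreal (spectral_mass \<xi> (\<Union>i. A i))"
      by (intro suminf_ennreal_eq) (auto simp: spectral_mass_def)
  qed
  have "spectral_mass \<xi> {} = 0"
  proof -
    have "indicator {} = (\<lambda>z::complex. 0::complex)" by auto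
    then have "complex_of_real (spectral_mass \<xi> {}) = 0"
      using spectral_mass_inner[OF \<xi>, of "{}"] calc_inner_zero[OF \<xi>] by simp
    then show ?thesis by simp
  qed
  then show ?thesis
    unfolding spectral_measure_def
    using ca B sets.sigma_algebra_axioms[of circle_borel]
    by (intro emeasure_measure_of_sigma) (auto simp: positive_def space_circle_borel)
qed

lemma finite_spectral_measure:
  assumes "\<xi> \<in> L2 M" shows "finite_measure (spectral_measure \<xi>)"
proof (rule finite_measureI)
  have "sphere 0 1 \<in> sets circle_borel" by (simp add: sets_circle_borel_iff)
  then show "emeasure (spectral_measure \<xi>) (space (spectral_measure \<xi>)) \<noteq> \<infinity>"
    by (simp add: space_spectral_measure emeasure_spectral_measure[OF assms])
qed

text \<open>
  A Haar null set has indicator zero in the calculus: spectral measures are absolutely continuous.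
\<close>

lemma spectral_measure_AE:
  assumes \<xi>: "\<xi> \<in> L2 M" and ae: "AE z in circle_haar. P z"
  shows "AE z in spectral_measure \<xi>. P z"
proof -
  obtain N where N: "{z \<in> space circle_haar. \<not> P z} \<subseteq> N" "N \<in> null_sets circle_haar"
    using ae by (auto elim!: AE_E simp: null_setsI)
  have Ns: "N \<in> sets circle_borel" using N(2) by (auto simp: null_sets_def sets_circle_haar)
  have "AE z in circle_haar. indicator N z = (0::complex)"
    using AE_not_in[OF N(2)] by eventually_elim simp
  then have "L2_eq M (calc (indicator N) \<xi>) (calc (\<lambda>z. 0) \<xi>)"
    by (intro calc_cong_AE circle_Linf_indicator Ns circle_Linf_zero \<xi>)
  then have "L2_inner M (calc (indicator N) \<xi>) \<xi> = L2_inner M (calc (\<lambda>z. 0) \<xi>) \<xi>"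
    by (intro L2_inner_cong calc_L2 circle_Linf_indicator Ns circle_Linf_zero \<xi> L2_eq_refl)
  then have "spectral_mass \<xi> N = 0" by (simp add: spectral_mass_inner[OF \<xi> Ns] calc_inner_zero[OF \<xi>])
  then have "N \<in> null_sets (spectral_measure \<xi>)"
    by (simp add: null_sets_def sets_spectral_measure Ns emeasure_spectral_measure[OF \<xi> Ns])
  then show ?thesis
    by (rule AE_I') (use N(1) in \<open>simp add: space_spectral_measure space_circle_haar\<close>)
qed

lemma spectral_measure_integral_bounded:
  assumes \<xi>: "\<xi> \<in> L2 M" and f: "f \<in> borel_measurable circle_borel" and c: "\<And>z. cmod z = 1 \<Longrightarrow> cmod (f z) \<le> c"
  shows "(LINT z|spectral_measure \<xi>. f z) = L2_inner M (calc f \<xi>) \<xi>"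
proof -
  let ?\<nu> = "spectral_measure \<xi>"
  interpret finite_measure ?\<nu> by (rule finite_spectral_measure[OF \<xi>])
  have c0: "c \<ge> 0" using order_trans[OF norm_ge_zero c[of 1]] by simp
  obtain s where "\<forall>i. simple_function circle_borel (s i)" "\<forall>z\<in>space circle_borel. (\<lambda>i. s i z) \<longlonglongrightarrow> f z"
    "\<forall>i. \<forall>z\<in>space circle_borel. dist (s i z) 0 \<le> 2 * dist (f z) 0"
    using borel_measurable_implies_sequence_metric[OF f, of 0] by blast
  then have s: "\<And>i. simple_function circle_borel (s i)" "\<And>z. cmod z = 1 \<Longrightarrow> (\<lambda>i. s i z) \<longlonglongrightarrow> f z"
    "\<And>i z. cmod z = 1 \<Longrightarrow> dist (s i z) 0 \<le> 2 * dist (f z) 0"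
    by (simp_all add: space_circle_borel)
  have sm: "s i \<in> borel_measurable circle_borel" for i using s(1) by (rule borel_measurable_simple_function)
  have sc: "cmod (s i z) \<le> 2 * c" if "cmod z = 1" for i z
    using s(3)[OF that, of i] c[OF that] by simp
  have fL: "f \<in> circle_Linf" using f c by (intro circle_LinfI) (simp_all cong: measurable_cong_sets add: sets_circle_haar)
  have sL: "s i \<in> circle_Linf" for i using sm sc by (intro circle_LinfI) (simp_all cong: measurable_cong_sets add: sets_circle_haar)
  have simple: "(LINT z|?\<nu>. s i z) = L2_inner M (calc (s i) \<xi>) \<xi>" for i
  proof -
    let ?V = "s i ` sphere 0 1" and ?S = "\<lambda>y. s i -` {y} \<inter> sphere 0 1"
    have fin: "finite ?V" and S: "?S y \<in> sets circle_borel" for y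
      using simple_functionD[OF s(1)[of i]] by (auto simp: space_circle_borel)
    have eq: "s i z = (\<Sum>y\<in>?V. y * indicator (?S y) z)" if "cmod z = 1" for z
      using fin that by (subst sum.remove[of _ "s i z"]) (auto simp: indicator_def intro!: sum.neutral)
    note sumL = calc_inner_sum[OF fin, of "\<lambda>y. indicator (?S y)" \<xi> "\<lambda>y. y", OF circle_Linf_indicator[OF S] \<xi>]
    have "(LINT z|?\<nu>. s i z) = (LINT z|?\<nu>. (\<Sum>y\<in>?V. y * indicator (?S y) z))"
      by (rule Bochner_Integration.integral_cong[OF refl eq]) (simp add: space_spectral_measure)
    also have "\<dots> = (\<Sum>y\<in>?V. y * of_real (measure ?\<nu> (?S y)))"
    proof (subst Bochner_Integration.integral_sum)
      have ind: "(indicator (?S y) z :: complex) = of_real (indicator (?S y) z)" for y z by (simp add: indicator_def)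
      have Sn: "?S y \<in> sets ?\<nu>" "?S y \<subseteq> space ?\<nu>" for y using S by (auto simp: sets_spectral_measure space_spectral_measure)
      show "integrable ?\<nu> (\<lambda>z. y * indicator (?S y) z)" if "y \<in> ?V" for y
        unfolding ind using Sn[of y] emeasure_finite[of "?S y"]
        by (intro integrable_mult_right integrable_of_real integrable_real_indicator) (auto simp: less_top[symmetric])
      show "(\<Sum>y\<in>?V. LINT z|?\<nu>. y * indicator (?S y) z) = (\<Sum>y\<in>?V. y * of_real (measure ?\<nu> (?S y)))"
        unfolding ind using Sn(2) by (intro sum.cong) (auto simp: Int_absorb2)
    qed
    also have "\<dots> = (\<Sum>y\<in>?V. y * L2_inner M (calc (indicator (?S y)) \<xi>) \<xi>)"
      using S by (intro sum.cong) (auto simp: spectral_mass_inner[OF \<xi>] measure_def emeasure_spectral_measure[OF \<xi>] spectral_mass_def)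
    also have "\<dots> = L2_inner M (calc (\<lambda>z. \<Sum>y\<in>?V. y * indicator (?S y) z) \<xi>) \<xi>" using sumL by simp
    also have "\<dots> = L2_inner M (calc (s i) \<xi>) \<xi>"
    proof (intro L2_inner_cong calc_L2 calc_cong_AE L2_eq_refl \<xi> sL conjunct1[OF sumL])
      show "AE z in circle_haar. (\<Sum>y\<in>?V. y * indicator (?S y) z) = s i z"
        by (intro AE_I2 eq[symmetric]) (simp add: space_circle_haar)
    qed
    finally show ?thesis .
  qed
  have "(\<lambda>i. LINT z|?\<nu>. s i z) \<longlonglongrightarrow> (LINT z|?\<nu>. f z)"
  proof (rule integral_dominated_convergence[where w="\<lambda>z. 2 * c"])
    show "f \<in> borel_measurable ?\<nu>" "s i \<in> borel_measurable ?\<nu>" for i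
      using f sm by (simp_all cong: measurable_cong_sets add: sets_spectral_measure)
  qed (use s(2) sc in \<open>auto simp: space_spectral_measure intro!: AE_I2\<close>)
  moreover have "(\<lambda>i. L2_inner M (calc (s i) \<xi>) \<xi>) \<longlonglongrightarrow> L2_inner M (calc f \<xi>) \<xi>"
  proof (rule calc_inner_continuous[OF sL fL])
    show "cmod (f z) \<le> 2 * c" if "cmod z = 1" for z using c[OF that] c0 by simp
  qed (use sc s(2) \<xi> in auto)
  ultimately show ?thesis using simple LIMSEQ_unique by simp
qed

lemma spectral_measure_integral:
  assumes \<xi>: "\<xi> \<in> L2 M" and f: "f \<in> circle_Linf"
  shows "integrable (spectral_measure \<xi>) f" "(LINT z|spectral_measure \<xi>. f z) = L2_inner M (calc f \<xi>) \<xi>"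
proof -
  obtain c where c: "c \<ge> 0" "AE z in circle_haar. cmod (f z) \<le> c" using circle_Linf_bound[OF f] by blast
  have fm: "f \<in> borel_measurable circle_borel"
    using circle_Linf_measurable[OF f] by (simp cong: measurable_cong_sets add: sets_circle_haar)
  define g where "g z = (if cmod (f z) \<le> c then f z else 0)" for z
  note [measurable] = fm
  have gm: "g \<in> borel_measurable circle_borel" unfolding g_def by measurable
  have gc: "cmod (g z) \<le> c" for z using c by (simp add: g_def)
  have gL: "g \<in> circle_Linf" using gm gc by (intro circle_LinfI) (simp_all cong: measurable_cong_sets add: sets_circle_haar)
  have eq: "AE z in circle_haar. f z = g z" using c(2) by eventually_elim (simp add: g_def)
  note eq' = spectral_measure_AE[OF \<xi> eq]
  have m: "f \<in> borel_measurable (spectral_measure \<xi>)" "g \<in> borel_measurable (spectral_measure \<xi>)"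
    using fm gm by (simp_all cong: measurable_cong_sets add: sets_spectral_measure)
  have "integrable (spectral_measure \<xi>) g"
    by (rule circle_bounded_integrable[OF finite_spectral_measure[OF \<xi>] sets_spectral_measure gm gc])
  then show "integrable (spectral_measure \<xi>) f" using integrable_cong_AE[OF m eq'] by simp
  have "(LINT z|spectral_measure \<xi>. f z) = (LINT z|spectral_measure \<xi>. g z)"
    by (rule integral_cong_AE[OF m eq'])
  also have "\<dots> = L2_inner M (calc g \<xi>) \<xi>" by (rule spectral_measure_integral_bounded[OF \<xi> gm gc])
  also have "\<dots> = L2_inner M (calc f \<xi>) \<xi>"
    by (intro L2_inner_cong calc_L2 L2_eq_sym[OF calc_cong_AE] eq f gL \<xi> L2_eq_refl)
  finally show "(LINT z|spectral_measure \<xi>. f z) = L2_inner M (calc f \<xi>) \<xi>" .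
qed

lemma cantor_T_funpow: "(cantor_T ^^ n) \<xi> = (\<lambda>x. \<xi> (x - of_nat n))"
  by (induction n) (auto simp: cantor_T_def algebra_simps)

lemma is_spectral_measure:
  assumes \<xi>: "\<xi> \<in> L2 M"
  shows "is_spectral_measure_at M cantor_T \<xi> (spectral_measure \<xi>)"
  unfolding is_spectral_measure_at_def
proof (intro conjI allI)
  fix n :: nat
  have t: "trig_op (\<lambda>z. z ^ n) (\<lambda>\<xi> x. \<xi> (x - of_nat n))"
    using trig_op_monom[of 1 "int n"] by simp
  have "(LINT z|spectral_measure \<xi>. z ^ n) = L2_inner M (calc (\<lambda>z. z ^ n) \<xi>) \<xi>"
    by (rule spectral_measure_integral[OF \<xi> trig_op_Linf[OF t]])
  also have "\<dots> = L2_inner M (\<lambda>x. \<xi> (x - of_nat n)) \<xi>"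
    using trig_op_L2[OF t \<xi>] by (intro L2_inner_cong calc_L2 trig_op_Linf[OF t] calc_trig[OF t] \<xi> L2_eq_refl)
  finally show "(LINT z|spectral_measure \<xi>. z ^ n) = L2_inner M ((cantor_T ^^ n) \<xi>) \<xi>"
    by (simp add: cantor_T_funpow)
qed (simp_all add: finite_spectral_measure[OF \<xi>] sets_spectral_measure)

lemma spectral_measure_unique:
  assumes "\<xi> \<in> L2 M" "is_spectral_measure_at M cantor_T \<xi> \<nu>"
  shows "\<nu> = spectral_measure \<xi>"
  using assms is_spectral_measure[OF assms(1)]
  by (intro circle_measure_eqI) (auto simp: is_spectral_measure_at_def)

lemma is_L2_calculus_calc:
  assumes "f \<in> circle_Linf" shows "is_L2_calculus M cantor_T f (calc f)"
  unfolding is_L2_calculus_def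
  using calc_operator[OF assms] is_spectral_measure spectral_measure_integral[OF _ assms] by metis

text \<open>
  The spectral measures determine the quadratic form of the operator, and polarisation determines the
  operator.
\<close>

lemma is_L2_calculus_eq_calc:
  assumes f: "f \<in> circle_Linf" and A: "is_L2_calculus M cantor_T f A" and \<xi>: "\<xi> \<in> L2 M"
  shows "L2_eq M (A \<xi>) (calc f \<xi>)"
proof (rule L2_operator_eqI[OF _ calc_operator[OF f] _ \<xi>])
  show "L2_operator M A" using A by (simp add: is_L2_calculus_def)
  fix \<xi> assume \<xi>: "\<xi> \<in> L2 M"
  then obtain \<nu> where "is_spectral_measure_at M cantor_T \<xi> \<nu>" "L2_inner M (A \<xi>) \<xi> = (LINT z|\<nu>. f z)"
    using A unfolding is_L2_calculus_def by blast
  then show "L2_inner M (A \<xi>) \<xi> = L2_inner M (calc f \<xi>) \<xi>"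
    using spectral_measure_unique[OF \<xi>] spectral_measure_integral(2)[OF \<xi> f] by simp
qed

end

interpretation C: shift_measure cantor_measure
proof
  show "(\<lambda>x. x) \<in> borel_measurable cantor_measure"
    by (rule measurable_cantor_measure_borel) simp
qed (fact measurable_cantor_measure_shift distr_cantor_measure_shift)+

abbreviation H where "H \<equiv> L2 cantor_measure"

lemma cantor_rep_calculus: "f \<in> circle_Linf \<Longrightarrow> is_L2_calculus cantor_measure cantor_T f (cantor_rep f)"
  unfolding cantor_rep_def L2_calculus_def 
  by (rule someI[of "is_L2_calculus cantor_measure cantor_T f" "C.calc f"]) (rule C.is_L2_calculus_calc)

lemma cantor_rep_eq_calc:
  "f \<in> circle_Linf \<Longrightarrow> \<xi> \<in> H \<Longrightarrow> L2_eq cantor_measure (cantor_rep f \<xi>) (C.calc f \<xi>)"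
  by (rule C.is_L2_calculus_eq_calc[OF _ cantor_rep_calculus])

lemma cantor_rep_operator: "f \<in> circle_Linf \<Longrightarrow> L2_operator cantor_measure (cantor_rep f)"
  using cantor_rep_calculus by (simp add: is_L2_calculus_def)

lemma cantor_rep_L2: "f \<in> circle_Linf \<Longrightarrow> \<xi> \<in> H \<Longrightarrow> cantor_rep f \<xi> \<in> H"
  by (rule L2_operator_mem[OF cantor_rep_operator])

lemma Linf_representation_cantor: "Linf_representation cantor_measure cantor_rep"
  unfolding Linf_representation_def
proof (intro conjI ballI allI impI)
  fix f assume f: "f \<in> circle_Linf"
  show "L2_operator cantor_measure (cantor_rep f)" by (rule cantor_rep_operator[OF f])
  fix \<xi> \<eta> assume m: "\<xi> \<in> H" "\<eta> \<in> H"
  note cf = C.circle_Linf_cnj[OF f]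
  have "L2_inner cantor_measure (cantor_rep f \<xi>) \<eta> = L2_inner cantor_measure (C.calc f \<xi>) \<eta>"
    by (intro L2_inner_cong cantor_rep_L2 C.calc_L2 cantor_rep_eq_calc f m L2_eq_refl)
  also have "\<dots> = L2_inner cantor_measure \<xi> (C.calc (\<lambda>z. cnj (f z)) \<eta>)" by (rule C.calc_adjoint[OF f m])
  also have "\<dots> = L2_inner cantor_measure \<xi> (cantor_rep (\<lambda>z. cnj (f z)) \<eta>)"
    by (intro L2_inner_cong cantor_rep_L2 C.calc_L2 L2_eq_sym[OF cantor_rep_eq_calc] cf m L2_eq_refl)
  finally show "L2_inner cantor_measure (cantor_rep f \<xi>) \<eta> = L2_inner cantor_measure \<xi> (cantor_rep (\<lambda>z. cnj (f z)) \<eta>)" .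
next
  fix f g \<xi> assume f: "f \<in> circle_Linf" and g: "g \<in> circle_Linf" and \<xi>: "\<xi> \<in> H"
  note ef = cantor_rep_eq_calc[OF f \<xi>] and eg = cantor_rep_eq_calc[OF g \<xi>]
  show "L2_eq cantor_measure (cantor_rep f \<xi>) (cantor_rep g \<xi>)" if "AE z in circle_haar. f z = g z"
    using L2_eq_trans[OF ef L2_eq_trans[OF C.calc_cong_AE[OF f g that \<xi>] L2_eq_sym[OF eg]]] .
  show "L2_eq cantor_measure (cantor_rep (\<lambda>z. a * f z + g z) \<xi>) (\<lambda>x. a * cantor_rep f \<xi> x + cantor_rep g \<xi> x)" for a
    by (rule L2_eq_trans[OF cantor_rep_eq_calc[OF C.circle_Linf_lincomb[OF f g] \<xi>]
          L2_eq_trans[OF C.calc_lincomb[OF f g \<xi>] L2_eq_lincomb[OF L2_eq_sym[OF ef] L2_eq_sym[OF eg]]]])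
  have "L2_eq cantor_measure (C.calc f (C.calc g \<xi>)) (C.calc f (cantor_rep g \<xi>))"
    by (intro L2_operator_cong[OF C.calc_operator[OF f]] C.calc_L2 cantor_rep_L2 g \<xi> L2_eq_sym[OF eg])
  also have "L2_eq cantor_measure \<dots> (cantor_rep f (cantor_rep g \<xi>))"
    by (intro L2_eq_sym[OF cantor_rep_eq_calc] f cantor_rep_L2 g \<xi>)
  finally (L2_eq_trans) show "L2_eq cantor_measure (cantor_rep (\<lambda>z. f z * g z) \<xi>) (cantor_rep f (cantor_rep g \<xi>))"
    using L2_eq_trans[OF cantor_rep_eq_calc[OF C.circle_Linf_mult[OF f g] \<xi>] L2_eq_trans[OF C.calc_mult[OF f g \<xi>]]] by blast
next
  fix \<xi> assume \<xi>: "\<xi> \<in> H"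
  have "(\<lambda>z. 1) \<in> circle_Linf" by (rule circle_LinfI[of _ 1]) auto
  from L2_eq_trans[OF cantor_rep_eq_calc[OF this \<xi>] C.calc_one[OF \<xi>]]
  show "L2_eq cantor_measure (cantor_rep (\<lambda>z. 1) \<xi>) \<xi>" .
qed

section \<open>The dilation operator\<close>

lemma third_integrable_iff:
  fixes f :: "real \<Rightarrow> 'b::{banach,second_countable_topology}"
  assumes f: "f \<in> borel_measurable cantor_measure"
  shows "integrable cantor_measure (\<lambda>x. f (x / 3)) \<longleftrightarrow> integrable cantor_measure f"
proof -
  have "integrable cantor_measure (\<lambda>x. f (x / 3)) \<longleftrightarrow> integrable (density cantor_measure (\<lambda>_. ennreal 2)) f"
    using integrable_distr_eq[OF measurable_cantor_measure_third f] by (simp add: distr_cantor_measure_third)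
  also have "\<dots> \<longleftrightarrow> integrable cantor_measure (\<lambda>x. 2 *\<^sub>R f x)" using f by (subst integrable_density) auto
  also have "\<dots> \<longleftrightarrow> integrable cantor_measure f"
    using integrable_scaleR_right[of 2 cantor_measure f] integrable_scaleR_right[of "1/2" cantor_measure "\<lambda>x. 2 *\<^sub>R f x"] by auto
  finally show ?thesis .
qed

lemma third_integral:
  fixes f :: "real \<Rightarrow> 'b::{banach,second_countable_topology}"
  assumes f: "f \<in> borel_measurable cantor_measure"
  shows "(LINT x|cantor_measure. f (x / 3)) = 2 *\<^sub>R (LINT x|cantor_measure. f x)"
proof -
  have "(LINT x|cantor_measure. f (x / 3)) = (LINT x|density cantor_measure (\<lambda>_. ennreal 2). f x)"
    using integral_distr[OF measurable_cantor_measure_third f] by (simp add: distr_cantor_measure_third)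
  also have "\<dots> = (LINT x|cantor_measure. 2 *\<^sub>R f x)" using f by (subst integral_density) auto
  finally show ?thesis by simp
qed

definition cantor_Uinv :: "real L2_map" where
  "cantor_Uinv f = (\<lambda>x. of_real (sqrt 2) * f (3 * x))"

lemma cantor_U_Uinv: "cantor_U (cantor_Uinv f) = f" and cantor_Uinv_U: "cantor_Uinv (cantor_U f) = f"
  by (simp_all add: cantor_U_def cantor_Uinv_def flip: of_real_mult mult.assoc)

lemma cantor_U_L2:
  assumes "f \<in> H" shows "cantor_U f \<in> H"
proof -
  note fm = L2_measurable[OF assms]
  have [measurable]: "(\<lambda>x. f (x / 3)) \<in> borel_measurable cantor_measure"
    using measurable_compose[OF measurable_cantor_measure_third fm] .
  have "integrable cantor_measure (\<lambda>x. (cmod (f (x/3)))\<^sup>2)"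
    using third_integrable_iff[of "\<lambda>x. (cmod (f x))\<^sup>2"] L2_integrable[OF assms] by auto
  then have "(\<lambda>x. f (x / 3)) \<in> H" by (simp add: L2_def)
  then show ?thesis unfolding cantor_U_def by (rule L2_scale)
qed

lemma cantor_Uinv_L2:
  assumes "f \<in> H" shows "cantor_Uinv f \<in> H"
proof -
  note fm = L2_measurable[OF assms]
  have [measurable]: "(\<lambda>x. f (3 * x)) \<in> borel_measurable cantor_measure"
    using measurable_compose[OF measurable_cantor_measure_triple fm] .
  have "integrable cantor_measure (\<lambda>x. (cmod (f (3*x)))\<^sup>2)"
    using third_integrable_iff[of "\<lambda>x. (cmod (f (3*x)))\<^sup>2"] L2_integrable[OF assms] by auto
  then have "(\<lambda>x. f (3 * x)) \<in> H" by (simp add: L2_def)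
  then show ?thesis unfolding cantor_Uinv_def by (rule L2_scale)
qed

lemma cantor_U_lincomb: "cantor_U (\<lambda>x. a * f x + g x) = (\<lambda>x. a * cantor_U f x + cantor_U g x)"
  and cantor_Uinv_lincomb: "cantor_Uinv (\<lambda>x. a * f x + g x) = (\<lambda>x. a * cantor_Uinv f x + cantor_Uinv g x)"
  by (auto simp: cantor_U_def cantor_Uinv_def algebra_simps)

lemma cantor_U_inner:
  assumes "f \<in> H" "g \<in> H"
  shows "L2_inner cantor_measure (cantor_U f) (cantor_U g) = L2_inner cantor_measure f g"
proof -
  have "complex_of_real (1 / sqrt 2) * cnj (of_real (1 / sqrt 2)) = of_real ((1 / sqrt 2) * (1 / sqrt 2))"
    by (simp only: complex_cnj_complex_of_real of_real_mult)
  also have "(1 / sqrt 2) * (1 / sqrt 2) = 1/2" by simp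
  finally have *: "complex_of_real (1 / sqrt 2) * cnj (of_real (1 / sqrt 2)) = of_real (1/2)" .
  have "L2_inner cantor_measure (cantor_U f) (cantor_U g)
      = (LINT x|cantor_measure. (complex_of_real (1 / sqrt 2) * cnj (of_real (1 / sqrt 2))) * (f (x/3) * cnj (g (x/3))))"
    by (simp only: L2_inner_def cantor_U_def complex_cnj_mult mult_ac)
  also have "\<dots> = of_real (1/2) * (LINT x|cantor_measure. f (x/3) * cnj (g (x/3)))"
    by (simp only: * integral_mult_right_zero)
  also have "\<dots> = L2_inner cantor_measure f g"
    using third_integral[OF borel_measurable_integrable[OF L2_mult_integrable[OF assms]]]
    by (simp add: L2_inner_def scaleR_conv_of_real)
  finally show ?thesis .
qed

lemma cantor_U_norm: "f \<in> H \<Longrightarrow> L2_norm cantor_measure (cantor_U f) = L2_norm cantor_measure f"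
proof -
  assume f: "f \<in> H"
  then have "(L2_norm cantor_measure (cantor_U f))\<^sup>2 = (L2_norm cantor_measure f)\<^sup>2"
    using cantor_U_inner[OF f f] by (simp only: L2_inner_self of_real_eq_iff)
  then show ?thesis by (simp add: L2_norm_nonneg)
qed

lemma cantor_Uinv_norm: "f \<in> H \<Longrightarrow> L2_norm cantor_measure (cantor_Uinv f) = L2_norm cantor_measure f"
  using cantor_U_norm[OF cantor_Uinv_L2[of f]] by (simp add: cantor_U_Uinv)

lemma L2_operator_cantor_U: "L2_operator cantor_measure cantor_U"
  unfolding L2_operator_def
  by (auto simp: cantor_U_L2 cantor_U_lincomb cantor_U_norm L2_eq_refl intro!: exI[of _ 1])

lemma L2_operator_cantor_Uinv: "L2_operator cantor_measure cantor_Uinv"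
  unfolding L2_operator_def
  by (auto simp: cantor_Uinv_L2 cantor_Uinv_lincomb cantor_Uinv_norm L2_eq_refl intro!: exI[of _ 1])

lemma L2_unitary_cantor_U: "L2_unitary cantor_measure cantor_U"
  unfolding L2_unitary_def
  using L2_operator_cantor_U cantor_U_inner cantor_Uinv_L2 cantor_U_Uinv L2_eq_refl by metis

lemma L2_unitary_cantor_T: "L2_unitary cantor_measure cantor_T"
proof -
  have t: "trig_op (\<lambda>z. 1 * z powi 1) (\<lambda>\<xi> x. 1 * \<xi> (x - of_int 1))" by (rule trig_op_monom)
  have "L2_operator cantor_measure cantor_T"
    using C.trig_op_operator[OF t] by (simp add: cantor_T_def[abs_def])
  moreover have "\<exists>f\<in>H. L2_eq cantor_measure (cantor_T f) g" if "g \<in> H" for g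
    using C.shift_L2[OF that, of "-1"] by (intro bexI[of _ "\<lambda>x. g (x + 1)"]) (auto simp: cantor_T_def L2_eq_refl)
  moreover have "L2_inner cantor_measure (cantor_T f) (cantor_T g) = L2_inner cantor_measure f g" if "f \<in> H" "g \<in> H" for f g
    using C.shift_inner[OF that, of 1] by (simp add: cantor_T_def)
  ultimately show ?thesis by (simp add: L2_unitary_def)
qed

lemma L2_inv_cantor_U:
  assumes \<xi>: "\<xi> \<in> H"
  shows "L2_inv cantor_measure cantor_U \<xi> \<in> H"
    "L2_eq cantor_measure (L2_inv cantor_measure cantor_U \<xi>) (cantor_Uinv \<xi>)"
proof -
  have "\<exists>f. f \<in> H \<and> L2_eq cantor_measure (cantor_U f) \<xi>"
    using cantor_Uinv_L2[OF \<xi>] cantor_U_Uinv L2_eq_refl by metis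
  from someI_ex[OF this] have *: "L2_inv cantor_measure cantor_U \<xi> \<in> H"
      "L2_eq cantor_measure (cantor_U (L2_inv cantor_measure cantor_U \<xi>)) \<xi>"
    unfolding L2_inv_def by auto
  then show "L2_inv cantor_measure cantor_U \<xi> \<in> H" by simp
  have "L2_eq cantor_measure (cantor_Uinv (cantor_U (L2_inv cantor_measure cantor_U \<xi>))) (cantor_Uinv \<xi>)"
    by (intro L2_operator_cong[OF L2_operator_cantor_Uinv] cantor_U_L2 * \<xi>)
  then show "L2_eq cantor_measure (L2_inv cantor_measure cantor_U \<xi>) (cantor_Uinv \<xi>)" by (simp add: cantor_Uinv_U)
qed

lemma cantor_U_funpow_L2: "\<xi> \<in> H \<Longrightarrow> (cantor_U ^^ n) \<xi> \<in> H"
  by (induction n) (auto intro: cantor_U_L2)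

lemma cantor_Uinv_funpow_L2: "\<xi> \<in> H \<Longrightarrow> (cantor_Uinv ^^ n) \<xi> \<in> H"
  by (induction n) (auto intro: cantor_Uinv_L2)

lemma L2_operator_cantor_Uinv_funpow: "L2_operator cantor_measure (cantor_Uinv ^^ n)"
proof (induction n)
  case 0
  show ?case unfolding L2_operator_def by (auto simp: L2_eq_refl intro: exI[of _ 1])
next
  case (Suc n)
  then show ?case using L2_operator_comp[OF L2_operator_cantor_Uinv Suc] by (simp add: comp_def)
qed

lemma L2_operator_cantor_U_funpow: "L2_operator cantor_measure (cantor_U ^^ n)"
proof (induction n)
  case 0
  show ?case unfolding L2_operator_def by (auto simp: L2_eq_refl intro: exI[of _ 1])
next
  case (Suc n)
  then show ?case using L2_operator_comp[OF L2_operator_cantor_U Suc] by (simp add: comp_def)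
qed

lemma cantor_Uinv_funpow_norm: "\<xi> \<in> H \<Longrightarrow> L2_norm cantor_measure ((cantor_Uinv ^^ n) \<xi>) = L2_norm cantor_measure \<xi>"
  by (induction n) (auto simp: cantor_Uinv_norm cantor_Uinv_funpow_L2)

lemma cantor_U_funpow_norm: "\<xi> \<in> H \<Longrightarrow> L2_norm cantor_measure ((cantor_U ^^ n) \<xi>) = L2_norm cantor_measure \<xi>"
  by (induction n) (auto simp: cantor_U_norm cantor_U_funpow_L2)

lemma cantor_Uinv_funpow_lincomb:
  "(cantor_Uinv ^^ n) (\<lambda>x. a * f x + g x) = (\<lambda>x. a * (cantor_Uinv ^^ n) f x + (cantor_Uinv ^^ n) g x)"
  by (induction n) (auto simp: cantor_Uinv_lincomb)

lemma cantor_U_funpow_lincomb: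
  "(cantor_U ^^ n) (\<lambda>x. a * f x + g x) = (\<lambda>x. a * (cantor_U ^^ n) f x + (cantor_U ^^ n) g x)"
  by (induction n) (auto simp: cantor_U_lincomb)

lemma cantor_U_Uinv_funpow: "(cantor_U ^^ n) ((cantor_Uinv ^^ n) f) = f"
proof (induction n arbitrary: f)
  case (Suc n)
  have "(cantor_U ^^ Suc n) ((cantor_Uinv ^^ Suc n) f) = (cantor_U ^^ n) (cantor_U (cantor_Uinv ((cantor_Uinv ^^ n) f)))"
    by (simp only: funpow_Suc_right[of n cantor_U] funpow.simps(2)[of n cantor_Uinv] comp_apply)
  then show ?case by (simp only: cantor_U_Uinv Suc)
qed simp

lemma cantor_Uinv_U_funpow: "(cantor_Uinv ^^ n) ((cantor_U ^^ n) f) = f"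
proof (induction n arbitrary: f)
  case (Suc n)
  have "(cantor_Uinv ^^ Suc n) ((cantor_U ^^ Suc n) f) = (cantor_Uinv ^^ n) (cantor_Uinv (cantor_U ((cantor_U ^^ n) f)))"
    by (simp only: funpow_Suc_right[of n cantor_Uinv] funpow.simps(2)[of n cantor_U] comp_apply)
  then show ?case by (simp only: cantor_Uinv_U Suc)
qed simp

lemma L2_inv_cantor_U_funpow:
  assumes \<xi>: "\<xi> \<in> H"
  shows "(L2_inv cantor_measure cantor_U ^^ n) \<xi> \<in> H \<and>
    L2_eq cantor_measure ((L2_inv cantor_measure cantor_U ^^ n) \<xi>) ((cantor_Uinv ^^ n) \<xi>)"
proof (induction n)
  case 0
  then show ?case using \<xi> by (simp add: L2_eq_refl)
next
  case (Suc n)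
  let ?V = "L2_inv cantor_measure cantor_U"
  have v: "(?V ^^ n) \<xi> \<in> H" and e: "L2_eq cantor_measure ((?V ^^ n) \<xi>) ((cantor_Uinv ^^ n) \<xi>)" using Suc by auto
  have "L2_eq cantor_measure (cantor_Uinv ((?V ^^ n) \<xi>)) (cantor_Uinv ((cantor_Uinv ^^ n) \<xi>))"
    by (intro L2_operator_cong[OF L2_operator_cantor_Uinv] v e cantor_Uinv_funpow_L2 \<xi>)
  then show ?case using L2_inv_cantor_U[OF v] by (auto intro: L2_eq_trans)
qed

section \<open>Covariance\<close>

lemma circle_power_meas: "(\<lambda>z. z ^ 3) \<in> measurable circle_borel circle_borel"
  unfolding circle_borel_def by (rule measurable_restrict_space3) (auto simp: norm_power)

text \<open>
  The cube map sends the moment of order \<open>n\<close> to the moment of order \<open>3n\<close>, and moments of nonzero order vanish.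
\<close>

lemma circle_haar_cube: "distr circle_haar circle_haar (\<lambda>z. z ^ 3) = circle_haar"
proof -
  have m: "(\<lambda>z. z ^ 3) \<in> measurable circle_haar circle_haar"
    using circle_power_meas by (simp cong: measurable_cong_sets add: sets_circle_haar)
  show ?thesis
  proof (rule circle_measure_eqI)
    show "finite_measure (distr circle_haar circle_haar (\<lambda>z. z ^ 3))"
      by (rule finite_measure.finite_measure_distr[OF finite_measure_circle_haar m])
    fix n :: nat
    have pm: "(\<lambda>z::complex. z ^ n) \<in> borel_measurable circle_haar"
      using measurable_circle_borel[of "\<lambda>z. z ^ n"] by (simp cong: measurable_cong_sets add: sets_circle_haar)
    have "(LINT z|distr circle_haar circle_haar (\<lambda>z. z ^ 3). z ^ n) = (LINT z|circle_haar. z powi int (3 * n))"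
      by (subst integral_distr[OF m pm]) (simp only: power_int_of_nat power_mult)
    also have "\<dots> = (LINT z|circle_haar. z powi int n)" by (simp only: integral_circle_haar_powi) simp
    finally show "(LINT z|distr circle_haar circle_haar (\<lambda>z. z ^ 3). z ^ n) = (LINT z|circle_haar. z ^ n)" by simp
  qed (auto simp: finite_measure_circle_haar sets_circle_haar)
qed

lemma measurable_circle_haar_cube: "(\<lambda>z. z ^ 3) \<in> measurable circle_haar circle_haar"
  using circle_power_meas by (simp cong: measurable_cong_sets add: sets_circle_haar)

lemma circle_haar_cube_integral:
  fixes f :: "complex \<Rightarrow> 'b::{banach,second_countable_topology}"
  assumes "f \<in> borel_measurable circle_haar"
  shows "(LINT z|circle_haar. f (z ^ 3)) = (LINT z|circle_haar. f z)"
  using integral_distr[OF measurable_circle_haar_cube assms] by (simp add: circle_haar_cube)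

lemma circle_Linf_cube:
  assumes "f \<in> circle_Linf" shows "(\<lambda>z. f (z ^ 3)) \<in> circle_Linf"
proof -
  obtain c where c: "AE z in circle_haar. cmod (f z) \<le> c" using assms by (auto simp: circle_Linf_def)
  then have "AE z in distr circle_haar circle_haar (\<lambda>z. z ^ 3). cmod (f z) \<le> c" by (simp only: circle_haar_cube)
  then have "AE z in circle_haar. cmod (f (z ^ 3)) \<le> c"
    by (rule AE_distrD[OF measurable_circle_haar_cube])
  then show ?thesis
    using measurable_compose[OF measurable_circle_haar_cube circle_Linf_measurable[OF assms]] by (auto simp: circle_Linf_def)
qed

text \<open>
  Conjugation by the dilation turns the translation by \<open>k\<close> into the translation by \<open>3 k\<close>.
\<close>

lemma trig_op_cube:
  assumes "trig_op p A"
  shows "trig_op (\<lambda>z. p (z ^ 3)) (\<lambda>\<xi>. cantor_U (A (cantor_Uinv \<xi>)))"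
  using assms
proof (induction rule: trig_op.induct)
  case (trig_zero p)
  then show ?case using trig_op.trig_zero[of "\<lambda>z. p (z ^ 3)"] by (simp add: norm_power cantor_U_def)
next
  case (trig_step q B p a k)
  have c: "complex_of_real (1 / sqrt 2) * (a * (complex_of_real (sqrt 2) * t)) = a * t" for a t
  proof -
    have "complex_of_real (1 / sqrt 2) * (a * (complex_of_real (sqrt 2) * t)) = (complex_of_real (1 / sqrt 2) * complex_of_real (sqrt 2)) * (a * t)"
      by (simp only: mult_ac)
    also have "complex_of_real (1 / sqrt 2) * complex_of_real (sqrt 2) = 1" by (simp flip: of_real_mult)
    finally show ?thesis by simp
  qed
  have "trig_op (\<lambda>z. p (z ^ 3)) (\<lambda>\<xi> x. a * \<xi> (x - of_int (3 * k)) + cantor_U (B (cantor_Uinv \<xi>)) x)"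
  proof (rule trig_op.trig_step[OF trig_step.IH])
    fix z :: complex assume "cmod z = 1"
    then show "p (z ^ 3) = a * z powi (3 * k) + q (z ^ 3)"
      using trig_step.hyps(2)[of "z ^ 3"] by (simp add: norm_power power_int_mult)
  qed
  moreover have "cantor_U (\<lambda>x. a * cantor_Uinv \<xi> (x - of_int k) + B (cantor_Uinv \<xi>) x)
     = (\<lambda>x. a * \<xi> (x - of_int (3 * k)) + cantor_U (B (cantor_Uinv \<xi>)) x)" for \<xi>
    unfolding cantor_U_def cantor_Uinv_def distrib_left c by (simp add: right_diff_distrib)
  ultimately show ?case by simp
qed

lemma calc_covariance:
  assumes f: "f \<in> circle_Linf" and \<xi>: "\<xi> \<in> H"
  shows "L2_eq cantor_measure (C.calc (\<lambda>z. f (z ^ 3)) \<xi>) (cantor_U (C.calc f (cantor_Uinv \<xi>)))"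
proof -
  obtain p A where pA: "C.trig_approx f p A" using C.trig_approx_ex[OF f] by blast
  note u\<xi> = cantor_Uinv_L2[OF \<xi>]
  show ?thesis
  proof (rule C.calc_eqI[OF circle_Linf_cube[OF f] \<xi>])
    show "C.trig_approx (\<lambda>z. f (z ^ 3)) (\<lambda>n z. p n (z ^ 3)) (\<lambda>n \<xi>. cantor_U (A n (cantor_Uinv \<xi>)))"
      unfolding C.trig_approx_def
    proof (intro conjI allI trig_op_cube C.trig_approxD(1)[OF pA])
      obtain c where "c \<ge> 0" "\<And>n z. cmod z = 1 \<Longrightarrow> cmod (p n z) \<le> c" using C.trig_approxD(2)[OF pA] by blast
      then show "\<exists>C\<ge>0. \<forall>n z. cmod z = 1 \<longrightarrow> cmod (p n (z ^ 3)) \<le> C" by (intro exI[of _ c]) (auto simp: norm_power)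
      have "L2_norm circle_haar (\<lambda>z. p n (z ^ 3) - f (z ^ 3)) = L2_norm circle_haar (\<lambda>z. p n z - f z)" for n
        using circle_haar_cube_integral[OF borel_measurable_integrable[OF L2_integrable[OF L2_diff[OF C.trig_approxD(4)[OF pA, of n] circle_Linf_L2[OF f]]]]]
        by (simp add: L2_norm_def)
      then show "L2_lim circle_haar (\<lambda>n z. p n (z ^ 3)) (\<lambda>z. f (z ^ 3))"
        using C.trig_approxD(3)[OF pA] by (simp add: L2_lim_def)
    qed
    show "cantor_U (C.calc f (cantor_Uinv \<xi>)) \<in> H" by (intro cantor_U_L2 C.calc_L2 f u\<xi>)
    show "L2_lim cantor_measure (\<lambda>n. cantor_U (A n (cantor_Uinv \<xi>))) (cantor_U (C.calc f (cantor_Uinv \<xi>)))"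
      by (intro L2_operator_lim[OF L2_operator_cantor_U] C.trig_approxD(5)[OF pA] C.calc_L2 C.calc_lim[OF f u\<xi> pA] f u\<xi>)
  qed
qed

lemma calc_U:
  assumes f: "f \<in> circle_Linf" and \<xi>: "\<xi> \<in> H"
  shows "L2_eq cantor_measure (cantor_U (C.calc f \<xi>)) (C.calc (\<lambda>z. f (z ^ 3)) (cantor_U \<xi>))"
  using L2_eq_sym[OF calc_covariance[OF f cantor_U_L2[OF \<xi>]]] by (simp add: cantor_Uinv_U)

section \<open>The filter and the scaling function\<close>

definition m0 :: "complex \<Rightarrow> complex" where "m0 z = (1 + z\<^sup>2) / of_real (sqrt 2)"

abbreviation \<phi> :: "real \<Rightarrow> complex" where "\<phi> \<equiv> indicator cantor_set"

lemma phi_L2: "\<phi> \<in> H"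
  by (rule L2_indicator) (simp_all add: cantor_set_sets emeasure_cantor_set)

lemma trig_op_m0: "trig_op m0 (\<lambda>\<xi> x. of_real (1 / sqrt 2) * \<xi> (x - of_int 0) + of_real (1 / sqrt 2) * \<xi> (x - of_int 2))"
  by (rule trig_op_cong[OF trig_op_add[OF trig_op_monom trig_op_monom]])
     (simp add: m0_def add_divide_distrib)

lemma m0_Linf: "m0 \<in> circle_Linf" by (rule trig_op_Linf[OF trig_op_m0])

lemma cantor_set_bounds: "x \<in> cantor_set \<Longrightarrow> 0 \<le> x \<and> x \<le> 1"
  using cantor_set_unit by auto

lemma indicator_cantor_third: "(indicator cantor_set (x / 3) :: complex) = indicator cantor_set x + indicator cantor_set (x - 2)"
proof -
  have "x / 3 \<in> cantor_set \<longleftrightarrow> x \<in> cantor_set \<or> x - 2 \<in> cantor_set" using cantor_set_iff[of "x / 3"] by simp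
  moreover have "\<not> (x \<in> cantor_set \<and> x - 2 \<in> cantor_set)" using cantor_set_bounds[of x] cantor_set_bounds[of "x - 2"] by auto
  ultimately show ?thesis by (auto simp: indicator_def)
qed

lemma cantor_U_phi: "L2_eq cantor_measure (cantor_U \<phi>) (C.calc m0 \<phi>)"
proof -
  have "cantor_U \<phi> = (\<lambda>x. of_real (1 / sqrt 2) * \<phi> (x - of_int 0) + of_real (1 / sqrt 2) * \<phi> (x - of_int 2))"
    by (auto simp: cantor_U_def indicator_cantor_third algebra_simps)
  then show ?thesis using L2_eq_sym[OF C.calc_trig[OF trig_op_m0 phi_L2]] by simp
qed

text \<open>
  Nontrivial integer translates of the Cantor set overlap at most in an endpoint, so the
  translates of \<open>\<phi>\<close> are orthonormal and its spectral measure has the moments of Haar measure.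
\<close>

lemma phi_spectral: "C.spectral_measure \<phi> = circle_haar"
proof (rule C.spectral_measure_unique[OF phi_L2, symmetric])
  show "is_spectral_measure_at cantor_measure cantor_T \<phi> circle_haar"
    unfolding is_spectral_measure_at_def
  proof (intro conjI allI finite_measure_circle_haar sets_circle_haar)
    fix n :: nat
    have "L2_inner cantor_measure (\<lambda>x. \<phi> (x - real n)) \<phi> = (if n = 0 then 1 else 0)"
    proof (cases "n = 0")
      case True
      have "L2_inner cantor_measure \<phi> \<phi> = (LINT x|cantor_measure. of_real (indicator cantor_set x))"
        unfolding L2_inner_def by (rule Bochner_Integration.integral_cong) (auto simp: indicator_def)
      also have "\<dots> = 1"
        using cantor_set_triadic by (simp add: Int_absorb2 space_cantor_measure measure_def emeasure_cantor_set)
      finally show ?thesis using True by simp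
    next
      case False
      have "L2_inner cantor_measure (\<lambda>x. \<phi> (x - real n)) \<phi> = (LINT x|cantor_measure. 0)"
        unfolding L2_inner_def
      proof (rule integral_cong_AE)
        show "AE x in cantor_measure. \<phi> (x - real n) * cnj (\<phi> x) = 0"
          using cantor_measure_AE_neq[of 1]
        proof eventually_elim
          fix x :: real assume x: "x \<noteq> 1"
          have "real n \<ge> 1" using False by simp
          then have "\<not> (x - real n \<in> cantor_set \<and> x \<in> cantor_set)" using x cantor_set_bounds[of x] cantor_set_bounds[of "x - real n"] by auto
          then show "\<phi> (x - real n) * cnj (\<phi> x) = 0" by (auto simp: indicator_def)
        qed
        show "(\<lambda>x. \<phi> (x - real n) * cnj (\<phi> x)) \<in> borel_measurable cantor_measure"
          using C.shift_L2[OF phi_L2, of "int n"] by (intro borel_measurable_integrable L2_mult_integrable phi_L2) simp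
      qed simp
      then show ?thesis using False by simp
    qed
    then show "(LINT z|circle_haar. z ^ n) = L2_inner cantor_measure ((cantor_T ^^ n) \<phi>) \<phi>"
      using integral_circle_haar_powi[of "int n"] by (simp add: C.cantor_T_funpow)
  qed
qed

lemma phi_integral: "f \<in> circle_Linf \<Longrightarrow> L2_inner cantor_measure (C.calc f \<phi>) \<phi> = (LINT z|circle_haar. f z)"
  using C.spectral_measure_integral(2)[OF phi_L2, of f] by (simp add: phi_spectral)

lemma m0_norm: "cmod z = 1 \<Longrightarrow> (cmod (m0 z))\<^sup>2 = 1 + Re (z\<^sup>2)"
proof -
  assume z: "cmod z = 1"
  define w where "w = z\<^sup>2"
  have w: "(Re w)\<^sup>2 + (Im w)\<^sup>2 = 1" using z cmod_power2[of w] by (simp add: w_def norm_power)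
  have "(cmod (m0 z))\<^sup>2 = (cmod (1 + w))\<^sup>2 / 2" by (simp add: m0_def w_def norm_divide power_divide)
  also have "(cmod (1 + w))\<^sup>2 = 2 + 2 * Re w" unfolding cmod_power2 using w by (simp add: power2_eq_square algebra_simps)
  finally show ?thesis by (simp add: w_def)
qed

lemma cube_roots_sum:
  fixes g :: "complex \<Rightarrow> 'b::comm_monoid_add"
  assumes "w0 ^ 3 = z" "z \<noteq> 0"
  shows "(\<Sum>w\<in>{w. w ^ 3 = z}. g w) = (\<Sum>k<3. g (w0 * cis (2 * pi * real k / 3)))"
proof -
  have w0: "w0 \<noteq> 0" using assms by auto
  have "bij_betw (\<lambda>u. w0 * u) {u. u ^ 3 = 1} {w. w ^ 3 = z}"
  proof (rule bij_betwI[of _ _ _ "\<lambda>w. w / w0"])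
  qed (use w0 assms in \<open>auto simp: power_mult_distrib power_divide\<close>)
  from bij_betw_trans[OF Complex.bij_betw_roots_unity[of 3] this]
  have "bij_betw (\<lambda>k. w0 * cis (2 * pi * real k / 3)) {..<3} {w. w ^ 3 = z}" by (simp add: comp_def)
  from sum.reindex_bij_betw[OF this, of g] show ?thesis by simp
qed

lemma cis_third: "cis (2 * pi / 3) ^ 3 = 1" "cis (2 * pi / 3) \<noteq> 1"
proof -
  show "cis (2 * pi / 3) ^ 3 = 1" by (simp add: Complex.DeMoivre)
  show "cis (2 * pi / 3) \<noteq> 1"
    by (simp add: complex_eq_iff cos_120)
qed

lemma qmf_filter_m0: "qmf_filter m0"
  unfolding qmf_filter_def
proof (intro conjI m0_Linf AE_I2)
  fix z assume "z \<in> space circle_haar"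
  then have z: "cmod z = 1" by (simp add: space_circle_haar)
  have zn: "z \<noteq> 0" using z by auto
  define w0 where "w0 = cis (Arg z / 3)"
  have w0: "w0 ^ 3 = z" "cmod w0 = 1" using z cis_Arg[of z] zn by (auto simp: w0_def Complex.DeMoivre sgn_div_norm)
  define u where "u = cis (2 * pi / 3)"
  have u: "u ^ 3 = 1" "u \<noteq> 1" using cis_third by (auto simp: u_def)
  have "(u - 1) * (1 + u + u\<^sup>2) = 0" using u(1) by (simp add: algebra_simps power2_eq_square power3_eq_cube)
  then have geo: "1 + u + u\<^sup>2 = 0" using u(2) by simp
  have "(\<Sum>w\<in>{w. w ^ 3 = z}. (cmod (m0 w))\<^sup>2) = (\<Sum>k<3. (cmod (m0 (w0 * cis (2 * pi * real k / 3))))\<^sup>2)"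
    by (rule cube_roots_sum[OF w0(1)]) (use z in auto)
  also have "\<dots> = (\<Sum>k<3. 1 + Re ((w0 * u ^ k)\<^sup>2))"
    by (rule sum.cong) (auto simp: m0_norm norm_mult w0 u_def Complex.DeMoivre mult_ac)
  also have "\<dots> = 3 + Re (w0\<^sup>2 * (1 + u\<^sup>2 + (u\<^sup>2)\<^sup>2))"
    by (simp add: numeral_3_eq_3 power_mult_distrib algebra_simps)
  also have "(u\<^sup>2)\<^sup>2 = u ^ 3 * u" by (simp add: power2_eq_square power3_eq_cube)
  also have "u ^ 3 * u = u" by (simp add: u(1))
  also have "1 + u\<^sup>2 + u = 0" using geo by (simp add: algebra_simps)
  finally show "1 / 3 * (\<Sum>w\<in>{w. w ^ 3 = z}. (cmod (m0 w))\<^sup>2) = 1" by simp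
qed

section \<open>Cyclicity of the scaling function\<close>

abbreviation L2_eqC (infix "\<doteq>" 50) where "f \<doteq> g \<equiv> L2_eq cantor_measure f g"

declare L2_eq_trans [trans]

text \<open>
  The scaling equation \<open>U \<phi> = m0(T) \<phi>\<close> moves a vector of one dilation level to the next.
\<close>

lemma calc_phi_raise_one:
  assumes f: "f \<in> circle_Linf"
  shows "C.calc f \<phi> \<doteq> cantor_Uinv (C.calc (\<lambda>z. f (z ^ 3) * m0 z) \<phi>)"
proof -
  note f3 = circle_Linf_cube[OF f]
  have "cantor_U (C.calc f \<phi>) \<doteq> C.calc (\<lambda>z. f (z ^ 3)) (cantor_U \<phi>)" by (rule calc_U[OF f phi_L2])
  also have "\<dots> \<doteq> C.calc (\<lambda>z. f (z ^ 3)) (C.calc m0 \<phi>)"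
    by (intro L2_operator_cong[OF C.calc_operator[OF f3]] cantor_U_L2 phi_L2 C.calc_L2 m0_Linf cantor_U_phi)
  also have "\<dots> \<doteq> C.calc (\<lambda>z. f (z ^ 3) * m0 z) \<phi>"
    by (rule L2_eq_sym[OF C.calc_mult[OF f3 m0_Linf phi_L2]])
  finally have "cantor_Uinv (cantor_U (C.calc f \<phi>)) \<doteq> cantor_Uinv (C.calc (\<lambda>z. f (z ^ 3) * m0 z) \<phi>)"
    by (intro L2_operator_cong[OF L2_operator_cantor_Uinv] cantor_U_L2 C.calc_L2 f phi_L2 C.circle_Linf_mult f3 m0_Linf)
  then show ?thesis by (simp add: cantor_Uinv_U)
qed

lemma Uinv_calc_raise:
  assumes "f \<in> circle_Linf"
  shows "\<exists>g\<in>circle_Linf. (cantor_Uinv ^^ n) (C.calc f \<phi>) \<doteq> (cantor_Uinv ^^ (n + k)) (C.calc g \<phi>)"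
proof (induction k)
  case 0
  show ?case using assms by (auto intro: L2_eq_refl)
next
  case (Suc k)
  then obtain g where g: "g \<in> circle_Linf" "(cantor_Uinv ^^ n) (C.calc f \<phi>) \<doteq> (cantor_Uinv ^^ (n + k)) (C.calc g \<phi>)" by blast
  let ?h = "\<lambda>z. g (z ^ 3) * m0 z"
  have h: "?h \<in> circle_Linf" by (intro C.circle_Linf_mult circle_Linf_cube g m0_Linf)
  have "(cantor_Uinv ^^ (n + k)) (C.calc g \<phi>) \<doteq> (cantor_Uinv ^^ (n + k)) (cantor_Uinv (C.calc ?h \<phi>))"
    by (intro L2_operator_cong[OF L2_operator_cantor_Uinv_funpow] calc_phi_raise_one g C.calc_L2 cantor_Uinv_L2 h phi_L2)
  then have "(cantor_Uinv ^^ n) (C.calc f \<phi>) \<doteq> (cantor_Uinv ^^ (n + Suc k)) (C.calc ?h \<phi>)"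
    using L2_eq_trans[OF g(2)] by (simp add: funpow_swap1)
  with h show ?case by blast
qed

text \<open>
  By \<open>Uinv_calc_raise\<close> the vectors of the form \<open>U\<^sup>-\<^sup>n f(T) \<phi>\<close> form an increasing union of spaces, so their
  closure is a subspace.
\<close>

definition cyclic_span :: "(real \<Rightarrow> complex) set" where
  "cyclic_span = {\<xi> \<in> H. \<forall>\<epsilon>>0. \<exists>n. \<exists>f\<in>circle_Linf.
     L2_norm cantor_measure (\<lambda>x. (cantor_Uinv ^^ n) (C.calc f \<phi>) x - \<xi> x) < \<epsilon>}"

lemma Uinv_calc_L2: "f \<in> circle_Linf \<Longrightarrow> (cantor_Uinv ^^ n) (C.calc f \<phi>) \<in> H"
  by (intro cantor_Uinv_funpow_L2 C.calc_L2 phi_L2)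

lemma cyclic_span_L2: "\<xi> \<in> cyclic_span \<Longrightarrow> \<xi> \<in> H" by (simp add: cyclic_span_def)

lemma cyclic_span_approx:
  assumes "\<xi> \<in> cyclic_span" "\<epsilon> > 0"
  shows "\<exists>n. \<exists>f\<in>circle_Linf. L2_norm cantor_measure (\<lambda>x. (cantor_Uinv ^^ n) (C.calc f \<phi>) x - \<xi> x) < \<epsilon>"
  using assms by (simp add: cyclic_span_def)

lemma Uinv_calc_norm_cong:
  assumes "f \<in> circle_Linf" "g \<in> circle_Linf" "(cantor_Uinv ^^ n) (C.calc f \<phi>) \<doteq> (cantor_Uinv ^^ m) (C.calc g \<phi>)" "\<xi> \<in> H"
  shows "L2_norm cantor_measure (\<lambda>x. (cantor_Uinv ^^ n) (C.calc f \<phi>) x - \<xi> x)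
    = L2_norm cantor_measure (\<lambda>x. (cantor_Uinv ^^ m) (C.calc g \<phi>) x - \<xi> x)"
  by (intro L2_norm_cong L2_diff Uinv_calc_L2 assms L2_eq_diff L2_eq_refl)

lemma cyclic_span_closed:
  assumes "\<xi> \<in> H" "\<And>\<epsilon>. \<epsilon> > 0 \<Longrightarrow> \<exists>\<eta>\<in>cyclic_span. L2_norm cantor_measure (\<lambda>x. \<eta> x - \<xi> x) < \<epsilon>"
  shows "\<xi> \<in> cyclic_span"
proof -
  have "\<exists>n. \<exists>f\<in>circle_Linf. L2_norm cantor_measure (\<lambda>x. (cantor_Uinv ^^ n) (C.calc f \<phi>) x - \<xi> x) < \<epsilon>" if e: "\<epsilon> > 0" for \<epsilon>
  proof -
    obtain \<eta> where \<eta>: "\<eta> \<in> cyclic_span" "L2_norm cantor_measure (\<lambda>x. \<eta> x - \<xi> x) < \<epsilon> / 2" using assms(2)[of "\<epsilon>/2"] e by auto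
    obtain n f where f: "f \<in> circle_Linf" "L2_norm cantor_measure (\<lambda>x. (cantor_Uinv ^^ n) (C.calc f \<phi>) x - \<eta> x) < \<epsilon> / 2"
      using cyclic_span_approx[OF \<eta>(1), of "\<epsilon>/2"] e by auto
    show ?thesis
      using L2_norm_triangle_diff[OF Uinv_calc_L2[OF f(1), of n] cyclic_span_L2[OF \<eta>(1)] assms(1)] f \<eta>(2)
      by (intro exI[of _ n] bexI[of _ f]) auto
  qed
  then show ?thesis using assms(1) by (simp add: cyclic_span_def)
qed

lemma cyclic_span_lincomb:
  assumes \<xi>: "\<xi> \<in> cyclic_span" and \<eta>: "\<eta> \<in> cyclic_span"
  shows "(\<lambda>x. a * \<xi> x + \<eta> x) \<in> cyclic_span"
proof -
  note L = cyclic_span_L2[OF \<xi>] cyclic_span_L2[OF \<eta>]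
  have "\<exists>n. \<exists>h\<in>circle_Linf. L2_norm cantor_measure (\<lambda>x. (cantor_Uinv ^^ n) (C.calc h \<phi>) x - (a * \<xi> x + \<eta> x)) < \<epsilon>" if e: "\<epsilon> > 0" for \<epsilon>
  proof -
    define d where "d = \<epsilon> / (cmod a + 1)"
    have c: "cmod a + 1 > 0" using norm_ge_zero[of a] by linarith
    have d: "d > 0" using e c by (simp add: d_def)
    obtain n f where f: "f \<in> circle_Linf" "L2_norm cantor_measure (\<lambda>x. (cantor_Uinv ^^ n) (C.calc f \<phi>) x - \<xi> x) < d"
      using cyclic_span_approx[OF \<xi> d] by blast
    obtain m g where g: "g \<in> circle_Linf" "L2_norm cantor_measure (\<lambda>x. (cantor_Uinv ^^ m) (C.calc g \<phi>) x - \<eta> x) < d"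
      using cyclic_span_approx[OF \<eta> d] by blast
    obtain f' where f': "f' \<in> circle_Linf" "(cantor_Uinv ^^ n) (C.calc f \<phi>) \<doteq> (cantor_Uinv ^^ (n + m)) (C.calc f' \<phi>)"
      using Uinv_calc_raise[OF f(1)] by blast
    obtain g' where g': "g' \<in> circle_Linf" "(cantor_Uinv ^^ m) (C.calc g \<phi>) \<doteq> (cantor_Uinv ^^ (m + n)) (C.calc g' \<phi>)"
      using Uinv_calc_raise[OF g(1)] by blast
    let ?F = "(cantor_Uinv ^^ (n + m)) (C.calc f' \<phi>)" and ?G = "(cantor_Uinv ^^ (n + m)) (C.calc g' \<phi>)"
    let ?h = "\<lambda>z. a * f' z + g' z"
    have h: "?h \<in> circle_Linf" by (intro C.circle_Linf_lincomb f' g')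
    have F: "?F \<in> H" "L2_norm cantor_measure (\<lambda>x. ?F x - \<xi> x) < d"
      using Uinv_calc_L2[OF f'(1)] f(2) Uinv_calc_norm_cong[OF f(1) f'(1) f'(2) L(1)] by auto
    have G: "?G \<in> H" "L2_norm cantor_measure (\<lambda>x. ?G x - \<eta> x) < d"
      using Uinv_calc_L2[OF g'(1)] g(2) Uinv_calc_norm_cong[OF g(1) g'(1) g'(2) L(2)] by (auto simp: add.commute)
    have "(cantor_Uinv ^^ (n + m)) (C.calc ?h \<phi>) \<doteq> (cantor_Uinv ^^ (n + m)) (\<lambda>x. a * C.calc f' \<phi> x + C.calc g' \<phi> x)"
      by (intro L2_operator_cong[OF L2_operator_cantor_Uinv_funpow] C.calc_L2 h phi_L2 L2_lincomb f' g' C.calc_lincomb)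
    then have eq: "(cantor_Uinv ^^ (n + m)) (C.calc ?h \<phi>) \<doteq> (\<lambda>x. a * ?F x + ?G x)"
      by (simp only: cantor_Uinv_funpow_lincomb)
    have "L2_norm cantor_measure (\<lambda>x. (cantor_Uinv ^^ (n + m)) (C.calc ?h \<phi>) x - (a * \<xi> x + \<eta> x))
       = L2_norm cantor_measure (\<lambda>x. (a * ?F x + ?G x) - (a * \<xi> x + \<eta> x))"
      by (intro L2_norm_cong L2_diff L2_eq_diff eq L2_eq_refl Uinv_calc_L2 h L2_lincomb F G L)
    also have "\<dots> = L2_norm cantor_measure (\<lambda>x. a * (?F x - \<xi> x) + (?G x - \<eta> x))" by (simp add: algebra_simps)
    also have "\<dots> \<le> cmod a * L2_norm cantor_measure (\<lambda>x. ?F x - \<xi> x) + L2_norm cantor_measure (\<lambda>x. ?G x - \<eta> x)"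
      by (intro L2_norm_lincomb L2_diff F G L)
    also have "\<dots> < cmod a * d + d" using F(2) G(2) by (intro add_le_less_mono mult_left_mono) auto
    also have "\<dots> = (cmod a + 1) * d" by (simp add: distrib_right)
    also have "\<dots> = \<epsilon>" using c by (simp add: d_def)
    finally show ?thesis using h by blast
  qed
  then show ?thesis using L by (simp add: cyclic_span_def L2_lincomb)
qed

lemma phi_cyclic: "\<phi> \<in> cyclic_span"
proof -
  have one: "(\<lambda>z. 1) \<in> circle_Linf" by (rule circle_LinfI[of _ 1]) auto
  have "L2_norm cantor_measure (\<lambda>x. (cantor_Uinv ^^ 0) (C.calc (\<lambda>z. 1) \<phi>) x - \<phi> x) = 0"
    using C.calc_one[OF phi_L2] by (simp add: L2_eq_iff_norm_diff C.calc_L2 one phi_L2)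
  then show ?thesis using one phi_L2 
    unfolding cyclic_span_def by (intro CollectI conjI allI impI exI[of _ 0] bexI[of _ "\<lambda>z. 1"]) simp_all
qed

lemma L2_closed_subspace_cyclic_span: "L2_closed_subspace cantor_measure cyclic_span"
  unfolding L2_closed_subspace_def
proof (intro conjI ballI allI impI)
  show "cyclic_span \<subseteq> H" by (auto simp: cyclic_span_def)
  have "(\<lambda>x. (-1) * \<phi> x + \<phi> x) \<in> cyclic_span" by (intro cyclic_span_lincomb phi_cyclic)
  then show "(\<lambda>x. 0) \<in> cyclic_span" by simp
  show "(\<lambda>x. a * f x + g x) \<in> cyclic_span" if "f \<in> cyclic_span" "g \<in> cyclic_span" for f g a
    using that by (rule cyclic_span_lincomb)
  fix F f assume F: "(\<forall>n. F n \<in> cyclic_span) \<and> f \<in> H \<and> (\<lambda>n. L2_norm cantor_measure (\<lambda>x. F n x - f x)) \<longlonglongrightarrow> 0"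
  show "f \<in> cyclic_span"
  proof (rule cyclic_span_closed)
    fix e :: real assume "e > 0"
    then have "\<forall>\<^sub>F n in sequentially. L2_norm cantor_measure (\<lambda>x. F n x - f x) < e"
      using order_tendstoD(2)[of "\<lambda>n. L2_norm cantor_measure (\<lambda>x. F n x - f x)" 0] F by blast
    then show "\<exists>\<eta>\<in>cyclic_span. L2_norm cantor_measure (\<lambda>x. \<eta> x - f x) < e" using F by (auto simp: eventually_sequentially)
  qed (use F in simp)
qed

lemma cyclic_span_Uinv:
  assumes "\<xi> \<in> cyclic_span" shows "cantor_Uinv \<xi> \<in> cyclic_span"
proof -
  note L = cyclic_span_L2[OF assms]
  have "\<exists>n. \<exists>f\<in>circle_Linf. L2_norm cantor_measure (\<lambda>x. (cantor_Uinv ^^ n) (C.calc f \<phi>) x - cantor_Uinv \<xi> x) < \<epsilon>" if e: "\<epsilon> > 0" for \<epsilon>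
  proof -
    obtain n f where f: "f \<in> circle_Linf" "L2_norm cantor_measure (\<lambda>x. (cantor_Uinv ^^ n) (C.calc f \<phi>) x - \<xi> x) < \<epsilon>"
      using cyclic_span_approx[OF assms e] by blast
    let ?F = "(cantor_Uinv ^^ n) (C.calc f \<phi>)"
    have "L2_norm cantor_measure (\<lambda>x. cantor_Uinv ?F x - cantor_Uinv \<xi> x) = L2_norm cantor_measure (\<lambda>x. ?F x - \<xi> x)"
      using L2_operator_norm_diff[OF L2_operator_cantor_Uinv Uinv_calc_L2[OF f(1), of n] L]
        cantor_Uinv_norm[OF L2_diff[OF Uinv_calc_L2[OF f(1), of n] L]] by simp
    then have "L2_norm cantor_measure (\<lambda>x. (cantor_Uinv ^^ Suc n) (C.calc f \<phi>) x - cantor_Uinv \<xi> x) < \<epsilon>" using f(2) by simp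
    then show ?thesis using f(1) by blast
  qed
  then show ?thesis using cantor_Uinv_L2[OF L] by (simp add: cyclic_span_def)
qed

lemma cantor_Uinv_funpow_eq: "(cantor_Uinv ^^ n) \<xi> x = of_real (sqrt 2) ^ n * \<xi> (3 ^ n * x)"
  by (induction n arbitrary: x) (auto simp: cantor_Uinv_def algebra_simps)

lemma cantor_U_funpow_eq: "(cantor_U ^^ n) \<xi> x = of_real (1 / sqrt 2) ^ n * \<xi> (x / 3 ^ n)"
  by (induction n arbitrary: x) (auto simp: cantor_U_def algebra_simps)

text \<open>
  The translation by \<open>k\<close> after \<open>n\<close> contractions is the translation by \<open>3^n * k\<close> before them.
\<close>

lemma cyclic_span_shift:
  assumes "\<xi> \<in> cyclic_span" shows "(\<lambda>x. \<xi> (x - of_int k)) \<in> cyclic_span"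
proof -
  note L = cyclic_span_L2[OF assms]
  have "\<exists>n. \<exists>g\<in>circle_Linf. L2_norm cantor_measure (\<lambda>x. (cantor_Uinv ^^ n) (C.calc g \<phi>) x - \<xi> (x - of_int k)) < \<epsilon>" if e: "\<epsilon> > 0" for \<epsilon>
  proof -
    obtain n f where f: "f \<in> circle_Linf" "L2_norm cantor_measure (\<lambda>x. (cantor_Uinv ^^ n) (C.calc f \<phi>) x - \<xi> x) < \<epsilon>"
      using cyclic_span_approx[OF assms e] by blast
    let ?F = "(cantor_Uinv ^^ n) (C.calc f \<phi>)"
    note FL = Uinv_calc_L2[OF f(1), of n]
    let ?k = "3 ^ n * k"
    have t: "trig_op (\<lambda>z. 1 * z powi ?k) (\<lambda>\<xi> x. 1 * \<xi> (x - of_int ?k))" by (rule trig_op_monom)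
    note tL = trig_op_Linf[OF t]
    let ?g = "\<lambda>z. 1 * z powi ?k * f z"
    have g: "?g \<in> circle_Linf" by (rule C.circle_Linf_mult[OF tL f(1)])
    note cL = C.calc_L2[OF f(1) phi_L2]
    have "C.calc ?g \<phi> \<doteq> C.calc (\<lambda>z. 1 * z powi ?k) (C.calc f \<phi>)" by (rule C.calc_mult[OF tL f(1) phi_L2])
    also have "\<dots> \<doteq> (\<lambda>x. 1 * C.calc f \<phi> (x - of_int ?k))" by (rule C.calc_trig[OF t cL])
    finally have "(cantor_Uinv ^^ n) (C.calc ?g \<phi>) \<doteq> (cantor_Uinv ^^ n) (\<lambda>x. 1 * C.calc f \<phi> (x - of_int ?k))"
      using C.trig_op_L2[OF t cL] by (intro L2_operator_cong[OF L2_operator_cantor_Uinv_funpow] C.calc_L2 g phi_L2)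
    also have "(cantor_Uinv ^^ n) (\<lambda>x. 1 * C.calc f \<phi> (x - of_int ?k)) = (\<lambda>x. ?F (x - of_int k))"
      by (rule ext) (simp add: cantor_Uinv_funpow_eq right_diff_distrib)
    finally have eq: "(cantor_Uinv ^^ n) (C.calc ?g \<phi>) \<doteq> (\<lambda>x. ?F (x - of_int k))" .
    have "L2_norm cantor_measure (\<lambda>x. (cantor_Uinv ^^ n) (C.calc ?g \<phi>) x - \<xi> (x - of_int k))
        = L2_norm cantor_measure (\<lambda>x. ?F (x - of_int k) - \<xi> (x - of_int k))"
      by (intro L2_norm_cong L2_diff L2_eq_diff eq L2_eq_refl Uinv_calc_L2 g C.shift_L2 FL L)
    also have "\<dots> = L2_norm cantor_measure (\<lambda>x. ?F x - \<xi> x)"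
      using C.shift_integral[of "\<lambda>x. (cmod (?F x - \<xi> x))\<^sup>2" k] L2_integrable[OF L2_diff[OF FL L]] by (simp add: L2_norm_def)
    finally show ?thesis using f(2) g by (intro exI[of _ n] bexI[of _ ?g]) simp_all
  qed
  then show ?thesis using C.shift_L2[OF L] by (simp add: cyclic_span_def)
qed

lemma cantor_set_cut_indicator:
  "(indicator (cantor_set \<inter> {..a}) x :: complex) =
    (if 3 * a < 2 then indicator (cantor_set \<inter> {..3 * a}) (3 * x)
     else indicator cantor_set (3 * x) + indicator (cantor_set \<inter> {..3 * a - 2}) (3 * x - 2))"
  using cantor_set_iff[of x] cantor_set_bounds[of "3 * x"] cantor_set_bounds[of "3 * x - 2"] cantor_set_bounds[of x]
  by (auto simp: indicator_def)

lemma cantor_set_cut_L2: "indicator (cantor_set \<inter> {..a}) \<in> H"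
proof (rule L2_indicator)
  show *: "cantor_set \<inter> {..a} \<in> sets cantor_measure"
    using cantor_set_triadic by (auto simp: sets_cantor_measure_iff)
  show "emeasure cantor_measure (cantor_set \<inter> {..a}) < \<infinity>"
    by (rule le_less_trans[OF emeasure_mono[OF _ cantor_set_sets]]) (auto simp: emeasure_cantor_set)
qed

text \<open>
  Self-similarity halves the square of the distance from \<open>\<chi>_{C \<inter> {..a}}\<close> to the span: one of the two
  copies of the Cantor set is cut by \<open>a\<close>, the other is contained in the half-line or disjoint from it.
\<close>

lemma cantor_set_cut_approx:
  "\<exists>d\<in>cyclic_span. (L2_norm cantor_measure (\<lambda>x. d x - indicator (cantor_set \<inter> {..a}) x))\<^sup>2 \<le> (1/2)^l"
proof (induction l arbitrary: a)
  case 0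
  let ?i = "indicator (cantor_set \<inter> {..a}) :: real \<Rightarrow> complex"
  have "(L2_norm cantor_measure (\<lambda>x. 0 - ?i x))\<^sup>2 = (LINT x|cantor_measure. (cmod (?i x))\<^sup>2)" by (simp add: L2_norm_power2)
  also have "\<dots> \<le> (LINT x|cantor_measure. (cmod (\<phi> x))\<^sup>2)"
    by (intro integral_mono L2_integrable cantor_set_cut_L2 phi_L2) (auto simp: indicator_def)
  also have "\<dots> = (LINT x|cantor_measure. indicator cantor_set x)"
    by (rule Bochner_Integration.integral_cong) (auto simp: indicator_def)
  also have "\<dots> = 1"
    using cantor_set_triadic by (simp add: Int_absorb2 space_cantor_measure measure_def emeasure_cantor_set)
  finally show ?case using L2_closed_subspaceD(2)[OF L2_closed_subspace_cyclic_span]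
    by (intro bexI[of _ "\<lambda>x. 0"]) auto
next
  case (Suc l)
  let ?i = "\<lambda>a. indicator (cantor_set \<inter> {..a}) :: real \<Rightarrow> complex"
  let ?r = "complex_of_real (1 / sqrt 2)"
  have r: "?r * cantor_Uinv \<eta> x = \<eta> (3 * x)" for \<eta> x
    by (simp add: cantor_Uinv_def flip: of_real_mult mult.assoc)
  \<comment> \<open>tripling the argument halves the square norm\<close>
  have key: "\<exists>d\<in>cyclic_span. (L2_norm cantor_measure (\<lambda>x. d x - \<eta> (3 * x)))\<^sup>2 \<le> (1/2) ^ Suc l"
    if \<eta>: "\<eta> \<in> H" "d \<in> cyclic_span" "(L2_norm cantor_measure (\<lambda>x. d x - \<eta> x))\<^sup>2 \<le> (1/2) ^ l" for \<eta> d
  proof (rule bexI)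
    note dL = cyclic_span_L2[OF \<eta>(2)]
    have "(\<lambda>x. ?r * cantor_Uinv d x + 0) \<in> cyclic_span"
      by (rule cyclic_span_lincomb[OF cyclic_span_Uinv[OF \<eta>(2)] L2_closed_subspaceD(2)[OF L2_closed_subspace_cyclic_span]])
    then show "(\<lambda>x. ?r * cantor_Uinv d x) \<in> cyclic_span" by simp
    have "(\<lambda>x. ?r * cantor_Uinv d x - \<eta> (3 * x)) = (\<lambda>x. ?r * cantor_Uinv (\<lambda>x. d x - \<eta> x) x)"
      by (simp only: r)
    then have "L2_norm cantor_measure (\<lambda>x. ?r * cantor_Uinv d x - \<eta> (3 * x)) = cmod ?r * L2_norm cantor_measure (\<lambda>x. d x - \<eta> x)"
      by (simp only: L2_norm_scale cantor_Uinv_norm[OF L2_diff[OF dL \<eta>(1)]])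
    also have "\<dots>\<^sup>2 = (1/2) * (L2_norm cantor_measure (\<lambda>x. d x - \<eta> x))\<^sup>2"
      by (simp add: power_mult_distrib power_divide norm_divide)
    finally show "(L2_norm cantor_measure (\<lambda>x. ?r * cantor_Uinv d x - \<eta> (3 * x)))\<^sup>2 \<le> (1/2) ^ Suc l"
      using \<eta>(3) by simp
  qed
  show ?case
  proof (cases "3 * a < 2")
    case True
    obtain d where "d \<in> cyclic_span" "(L2_norm cantor_measure (\<lambda>x. d x - ?i (3 * a) x))\<^sup>2 \<le> (1/2)^l" using Suc by blast
    from key[OF cantor_set_cut_L2 this] show ?thesis using True by (simp only: cantor_set_cut_indicator[of a] if_True)
  next
    case False
    obtain d where d: "d \<in> cyclic_span" "(L2_norm cantor_measure (\<lambda>x. d x - ?i (3 * a - 2) x))\<^sup>2 \<le> (1/2)^l" using Suc by blast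
    let ?\<eta> = "\<lambda>x. \<phi> x + ?i (3 * a - 2) (x - of_int 2)" and ?d = "\<lambda>x. 1 * \<phi> x + d (x - of_int 2)"
    have L: "?\<eta> \<in> H" by (intro L2_add phi_L2 C.shift_L2 cantor_set_cut_L2)
    have D: "?d \<in> cyclic_span" by (intro cyclic_span_lincomb phi_cyclic cyclic_span_shift d)
    note dL = L2_diff[OF cyclic_span_L2[OF d(1)] cantor_set_cut_L2[of "3 * a - 2"]]
    have "L2_norm cantor_measure (\<lambda>x. ?d x - ?\<eta> x) = L2_norm cantor_measure (\<lambda>x. d (x - of_int 2) - ?i (3 * a - 2) (x - of_int 2))" by simp
    also have "\<dots> = L2_norm cantor_measure (\<lambda>x. d x - ?i (3 * a - 2) x)"
      using C.shift_integral[OF borel_measurable_integrable[OF L2_integrable[OF dL]], of 2] by (simp add: L2_norm_def)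
    finally have "(L2_norm cantor_measure (\<lambda>x. ?d x - ?\<eta> x))\<^sup>2 \<le> (1/2)^l" using d(2) by simp
    from key[OF L D this] show ?thesis using False by (simp add: cantor_set_cut_indicator[of a])
  qed
qed

lemma cantor_set_cut_cyclic: "indicator (cantor_set \<inter> {..a}) \<in> cyclic_span"
proof (rule cyclic_span_closed[OF cantor_set_cut_L2])
  fix e :: real assume e: "e > 0"
  then obtain l where l: "(1/2)^l < e\<^sup>2" using real_arch_pow_inv[of "e\<^sup>2" "1/2"] by auto
  obtain d where d: "d \<in> cyclic_span" "(L2_norm cantor_measure (\<lambda>x. d x - indicator (cantor_set \<inter> {..a}) x))\<^sup>2 \<le> (1/2)^l"
    using cantor_set_cut_approx by blast
  have "L2_norm cantor_measure (\<lambda>x. d x - indicator (cantor_set \<inter> {..a}) x) < e"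
    by (rule power2_less_imp_less) (use d l e in auto)
  then show "\<exists>\<eta>\<in>cyclic_span. L2_norm cantor_measure (\<lambda>x. \<eta> x - indicator (cantor_set \<inter> {..a}) x) < e" using d(1) by blast
qed

text \<open>
  The half-lines form an intersection-stable generator of the Borel sets.
\<close>

lemma cyclic_span_cantor_set:
  assumes \<xi>: "\<xi> \<in> H" "\<And>x. x \<notin> cantor_set \<Longrightarrow> \<xi> x = 0"
  shows "\<xi> \<in> cyclic_span"
proof (rule L2_closed_subspace_full[OF L2_closed_subspace_cyclic_span cantor_set_sets, where G="(\<inter>) triadic_cantor ` range (\<lambda>a. {..a})"])
  show "emeasure cantor_measure cantor_set < \<infinity>" by (simp add: emeasure_cantor_set)
  show "Int_stable ((\<inter>) triadic_cantor ` range (\<lambda>a::real. {..a}))"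
  proof (rule Int_stableI)
    fix A B assume "A \<in> (\<inter>) triadic_cantor ` range (\<lambda>a::real. {..a})" "B \<in> (\<inter>) triadic_cantor ` range (\<lambda>a::real. {..a})"
    then obtain a b where "A = triadic_cantor \<inter> {..a}" "B = triadic_cantor \<inter> {..b}" by blast
    then have "A \<inter> B = triadic_cantor \<inter> {..min a b}" by auto
    then show "A \<inter> B \<in> (\<inter>) triadic_cantor ` range (\<lambda>a::real. {..a})" by blast
  qed
  have b: "sets (borel :: real measure) = sigma_sets UNIV (range (\<lambda>a. {..a}))" by (subst borel_eq_atMost) simp
  have "(\<inter>) triadic_cantor ` sigma_sets UNIV (range (\<lambda>a. {..a})) = sigma_sets triadic_cantor ((\<inter>) triadic_cantor ` range (\<lambda>a. {..a}))"
    by (rule sigma_sets_Int) (use triadic_cantor_borel b in auto)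
  then show "sets cantor_measure = sigma_sets (space cantor_measure) ((\<inter>) triadic_cantor ` range (\<lambda>a. {..a}))"
    by (simp add: sets_cantor_measure sets_restrict_space b space_cantor_measure)
  show "\<phi> \<in> cyclic_span" by (rule phi_cyclic)
  fix B assume "B \<in> (\<inter>) triadic_cantor ` range (\<lambda>a::real. {..a})"
  then obtain a where "B = triadic_cantor \<inter> {..a}" by blast
  then have "B \<inter> cantor_set = cantor_set \<inter> {..a}" using cantor_set_triadic by auto
  then show "indicator (B \<inter> cantor_set) \<in> cyclic_span" by (simp add: cantor_set_cut_cyclic)
qed (use \<xi> in \<open>auto simp: space_cantor_measure\<close>)

text \<open>
  A dilation followed by a translation carries the piece onto the Cantor set.
\<close>

lemma cyclic_span_piece:
  assumes \<xi>: "\<xi> \<in> H" "\<And>x. 3 ^ m * x - of_int k \<notin> cantor_set \<Longrightarrow> \<xi> x = 0"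
  shows "\<xi> \<in> cyclic_span"
proof -
  let ?\<eta> = "\<lambda>x. (cantor_U ^^ m) \<xi> (x - of_int (-k))"
  have "?\<eta> \<in> cyclic_span"
  proof (rule cyclic_span_cantor_set)
    show "?\<eta> \<in> H" by (intro C.shift_L2 cantor_U_funpow_L2 \<xi>)
    fix x assume "x \<notin> cantor_set"
    then show "?\<eta> x = 0" unfolding cantor_U_funpow_eq by (simp add: \<xi>(2))
  qed
  from cyclic_span_shift[OF this, of k] have "(cantor_U ^^ m) \<xi> \<in> cyclic_span" by simp
  moreover have "\<eta> \<in> cyclic_span \<Longrightarrow> (cantor_Uinv ^^ m) \<eta> \<in> cyclic_span" for \<eta>
    by (induction m) (auto intro: cyclic_span_Uinv)
  ultimately show ?thesis by (metis cantor_Uinv_U_funpow)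
qed

text \<open>
  The triadic pieces are countably many; cutting along their disjointification writes a
  vector as a limit of finite sums of vectors supported in single pieces.
\<close>

lemma cyclic_span_eq: "cyclic_span = H"
proof (intro equalityI subsetI)
  fix \<xi> assume \<xi>: "\<xi> \<in> H"
  define P where "P i = (case from_nat i of (m :: nat, k :: int) \<Rightarrow> {x :: real. 3 ^ m * x - of_int k \<in> cantor_set})" for i
  have P: "P i \<in> sets borel" for i
    unfolding P_def using affine_vimage_borel[OF cantor_set_borel, of "3 ^ _" "- of_int _"] by (auto split: prod.splits)
  have cut: "(\<lambda>x. indicator A x * \<xi> x) \<in> H" if "A \<in> sets borel" for A :: "real set"
    by (rule L2_cut[OF \<xi>]) (use that in \<open>auto intro!: measurable_cantor_measure_borel simp: indicator_def\<close>)
  define F where "F n x = indicator (\<Union>i<n. P i) x * \<xi> x" for n x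
  have FV: "F n \<in> cyclic_span" for n
  proof (induction n)
    case 0
    show ?case using L2_closed_subspaceD(2)[OF L2_closed_subspace_cyclic_span] by (simp add: F_def[abs_def])
  next
    case (Suc n)
    obtain m :: nat and k :: int where mk: "from_nat n = (m, k)" by fastforce
    let ?A = "P n - (\<Union>i<n. P i)"
    have "(\<lambda>x. indicator ?A x * \<xi> x) \<in> cyclic_span"
    proof (rule cyclic_span_piece[where m=m and k=k])
      show "(\<lambda>x. indicator ?A x * \<xi> x) \<in> H" using P by (intro cut) auto
      show "indicator ?A x * \<xi> x = 0" if "3 ^ m * x - of_int k \<notin> cantor_set" for x
        using that by (auto simp: P_def mk indicator_def)
    qed
    from cyclic_span_lincomb[OF this Suc, of 1]
    have "(\<lambda>x. indicator ?A x * \<xi> x + F n x) \<in> cyclic_span" by simp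
    moreover have "(\<lambda>x. indicator ?A x * \<xi> x + F n x) = F (Suc n)"
      by (auto simp: F_def indicator_def less_Suc_eq fun_eq_iff)
    ultimately show ?case by simp
  qed
  have lim: "L2_lim cantor_measure F \<xi>"
  proof (rule L2_lim_dominated[OF cyclic_span_L2[OF FV] \<xi> L2_integrable[OF \<xi>]])
    show "AE x in cantor_measure. (cmod (F n x - \<xi> x))\<^sup>2 \<le> (cmod (\<xi> x))\<^sup>2" for n
      by (auto simp: F_def indicator_def)
    show "AE x in cantor_measure. (\<lambda>n. F n x) \<longlonglongrightarrow> \<xi> x"
    proof (rule AE_I2)
      fix x assume "x \<in> space cantor_measure"
      then obtain m :: nat and k :: int where "3 ^ m * x - of_int k \<in> cantor_set"
        unfolding space_cantor_measure triadic_cantor_iff by blast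
      then have "x \<in> P (to_nat (m, k))" by (simp add: P_def)
      then have "\<forall>\<^sub>F n in sequentially. F n x = \<xi> x"
        by (intro eventually_sequentiallyI[of "Suc (to_nat (m, k))"]) (auto simp: F_def indicator_def)
      then show "(\<lambda>n. F n x) \<longlonglongrightarrow> \<xi> x" by (rule tendsto_eventually)
    qed
  qed
  show "\<xi> \<in> cyclic_span" by (rule L2_closed_subspaceD(4)[OF L2_closed_subspace_cyclic_span FV \<xi> lim])
qed (rule cyclic_span_L2)

lemma wavelet_representation_cantor:
  "wavelet_representation m0 cantor_measure cantor_U cantor_rep \<phi>"
  unfolding wavelet_representation_def
proof (intro conjI ballI allI impI)
  show "qmf_filter m0" by (rule qmf_filter_m0)
  show "L2_unitary cantor_measure cantor_U" by (rule L2_unitary_cantor_U)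
  show "Linf_representation cantor_measure cantor_rep" by (rule Linf_representation_cantor)
  show "\<phi> \<in> H" by (rule phi_L2)
  show "cantor_U \<phi> \<doteq> cantor_rep m0 \<phi>"
    by (rule L2_eq_trans[OF cantor_U_phi L2_eq_sym[OF cantor_rep_eq_calc[OF m0_Linf phi_L2]]])
next
  fix f \<xi> assume f: "f \<in> circle_Linf" and \<xi>: "\<xi> \<in> H"
  note i = L2_inv_cantor_U[OF \<xi>] and f3 = circle_Linf_cube[OF f]
  have "cantor_rep f (L2_inv cantor_measure cantor_U \<xi>) \<doteq> C.calc f (L2_inv cantor_measure cantor_U \<xi>)"
    by (rule cantor_rep_eq_calc[OF f i(1)])
  also have "\<dots> \<doteq> C.calc f (cantor_Uinv \<xi>)"
    by (intro L2_operator_cong[OF C.calc_operator[OF f]] i cantor_Uinv_L2 \<xi>)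
  finally have "cantor_U (cantor_rep f (L2_inv cantor_measure cantor_U \<xi>)) \<doteq> cantor_U (C.calc f (cantor_Uinv \<xi>))"
    by (intro L2_operator_cong[OF L2_operator_cantor_U] cantor_rep_L2 C.calc_L2 f i cantor_Uinv_L2 \<xi>)
  also have "\<dots> \<doteq> C.calc (\<lambda>z. f (z ^ 3)) \<xi>" by (rule L2_eq_sym[OF calc_covariance[OF f \<xi>]])
  also have "\<dots> \<doteq> cantor_rep (\<lambda>z. f (z ^ 3)) \<xi>" by (rule L2_eq_sym[OF cantor_rep_eq_calc[OF f3 \<xi>]])
  finally show "cantor_U (cantor_rep f (L2_inv cantor_measure cantor_U \<xi>)) \<doteq> cantor_rep (\<lambda>z. f (z ^ 3)) \<xi>" .
next
  fix f assume f: "f \<in> circle_Linf"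
  have "L2_inner cantor_measure (cantor_rep f \<phi>) \<phi> = L2_inner cantor_measure (C.calc f \<phi>) \<phi>"
    by (intro L2_inner_cong cantor_rep_L2 C.calc_L2 cantor_rep_eq_calc f phi_L2 L2_eq_refl)
  then show "L2_inner cantor_measure (cantor_rep f \<phi>) \<phi> = (LINT z|circle_haar. f z)" by (simp add: phi_integral[OF f])
next
  fix \<xi> and \<epsilon> :: real assume \<xi>: "\<xi> \<in> H" and e: "\<epsilon> > 0"
  then obtain n f where f: "f \<in> circle_Linf" "L2_norm cantor_measure (\<lambda>x. (cantor_Uinv ^^ n) (C.calc f \<phi>) x - \<xi> x) < \<epsilon>"
    using cyclic_span_approx[of \<xi> \<epsilon>] cyclic_span_eq by blast
  note rL = cantor_rep_L2[OF f(1) phi_L2] and cL = C.calc_L2[OF f(1) phi_L2]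
  note i = L2_inv_cantor_U_funpow[OF rL, of n]
  have "(L2_inv cantor_measure cantor_U ^^ n) (cantor_rep f \<phi>) \<doteq> (cantor_Uinv ^^ n) (C.calc f \<phi>)"
    using L2_eq_trans[OF conjunct2[OF i] L2_operator_cong[OF L2_operator_cantor_Uinv_funpow rL cL cantor_rep_eq_calc[OF f(1) phi_L2]]] .
  then have "L2_norm cantor_measure (\<lambda>x. (L2_inv cantor_measure cantor_U ^^ n) (cantor_rep f \<phi>) x - \<xi> x)
     = L2_norm cantor_measure (\<lambda>x. (cantor_Uinv ^^ n) (C.calc f \<phi>) x - \<xi> x)"
    by (intro L2_norm_cong L2_diff L2_eq_diff L2_eq_refl conjunct1[OF i] Uinv_calc_L2 f \<xi>)
  then show "\<exists>n. \<exists>f\<in>circle_Linf. L2_norm cantor_measure (\<lambda>x. (L2_inv cantor_measure cantor_U ^^ n) (cantor_rep f \<phi>) x - \<xi> x) < \<epsilon>"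
    using f by (intro exI[of _ n] bexI[of _ f]) simp_all
qed

section \<open>The Riesz product of the filter\<close>

text \<open>
  Real functions on the plane are used instead of classes in \<open>L\<^sup>\<infinity>\<close>, so that integrals, suprema and the
  symmetries \<open>z \<mapsto> z\<^sup>3\<close> and \<open>z \<mapsto> -z\<close> can be handled pointwise.
\<close>

definition bounded_borel :: "(complex \<Rightarrow> real) \<Rightarrow> bool" where
  "bounded_borel F \<longleftrightarrow> F \<in> borel_measurable borel \<and> (\<exists>c. \<forall>z. cmod z = 1 \<longrightarrow> \<bar>F z\<bar> \<le> c)"

lemma bounded_borel_measurable: "bounded_borel F \<Longrightarrow> F \<in> borel_measurable borel"
  by (simp add: bounded_borel_def)

lemma bounded_borelI: "F \<in> borel_measurable borel \<Longrightarrow> (\<And>z. cmod z = 1 \<Longrightarrow> \<bar>F z\<bar> \<le> c) \<Longrightarrow> bounded_borel F"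
  by (auto simp: bounded_borel_def)

lemma bounded_borel_const: "bounded_borel (\<lambda>z. c)" by (rule bounded_borelI[of _ "\<bar>c\<bar>"]) auto

lemma bounded_borel_mult:
  assumes "bounded_borel F" "bounded_borel G" shows "bounded_borel (\<lambda>z. F z * G z)"
proof -
  obtain c d where "\<And>z. cmod z = 1 \<Longrightarrow> \<bar>F z\<bar> \<le> c" "\<And>z. cmod z = 1 \<Longrightarrow> \<bar>G z\<bar> \<le> d"
    using assms unfolding bounded_borel_def by blast
  then show ?thesis using assms
    by (intro bounded_borelI[of _ "c * d"]) (auto simp: bounded_borel_def abs_mult intro!: mult_mono order_trans[OF abs_ge_zero])
qed

lemma bounded_borel_add:
  assumes "bounded_borel F" "bounded_borel G" shows "bounded_borel (\<lambda>z. F z + G z)"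
proof -
  obtain c d where "\<And>z. cmod z = 1 \<Longrightarrow> \<bar>F z\<bar> \<le> c" "\<And>z. cmod z = 1 \<Longrightarrow> \<bar>G z\<bar> \<le> d"
    using assms unfolding bounded_borel_def by blast
  then show ?thesis using assms
    by (intro bounded_borelI[of _ "c + d"]) (auto simp: bounded_borel_def intro!: order_trans[OF abs_triangle_ineq] add_mono)
qed

lemma bounded_borel_diff: "bounded_borel F \<Longrightarrow> bounded_borel G \<Longrightarrow> bounded_borel (\<lambda>z. F z - G z)"
  using bounded_borel_add[of F "\<lambda>z. (-1) * G z"] bounded_borel_mult[OF bounded_borel_const[of "-1"], of G] by simp

lemma bounded_borel_sum: "(\<And>i. i \<in> I \<Longrightarrow> bounded_borel (F i)) \<Longrightarrow> bounded_borel (\<lambda>z. \<Sum>i\<in>I. F i z)"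
  by (induction I rule: infinite_finite_induct) (auto intro: bounded_borel_const bounded_borel_add)

lemma bounded_borel_power_arg: "bounded_borel F \<Longrightarrow> bounded_borel (\<lambda>z. F (z ^ n))"
proof -
  assume F: "bounded_borel F"
  note [measurable] = bounded_borel_measurable[OF F]
  obtain c where "\<And>z. cmod z = 1 \<Longrightarrow> \<bar>F z\<bar> \<le> c" using F unfolding bounded_borel_def by blast
  then show ?thesis by (intro bounded_borelI[of _ c]) (measurable, simp add: norm_power)
qed

lemma borel_measurable_haar:
  fixes f :: "complex \<Rightarrow> 'b::topological_space"
  assumes "f \<in> borel_measurable borel" shows "f \<in> borel_measurable circle_haar"
  using measurable_circle_borel[OF assms] by (simp cong: measurable_cong_sets add: sets_circle_haar)

lemma bounded_borel_integrable:
  assumes F: "bounded_borel F" shows "integrable circle_haar F"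
proof -
  obtain c where c: "\<And>z. cmod z = 1 \<Longrightarrow> norm (F z) \<le> c" using F unfolding bounded_borel_def by auto
  show ?thesis
    by (rule circle_bounded_integrable[OF finite_measure_circle_haar sets_circle_haar measurable_circle_borel[OF bounded_borel_measurable[OF F]] c])
qed

lemma bounded_borel_Linf: "bounded_borel F \<Longrightarrow> (\<lambda>z. complex_of_real (F z)) \<in> circle_Linf"
proof -
  assume F: "bounded_borel F"
  then obtain c where "\<And>z. cmod z = 1 \<Longrightarrow> \<bar>F z\<bar> \<le> c" unfolding bounded_borel_def by blast
  moreover have "(\<lambda>z. complex_of_real (F z)) \<in> borel_measurable circle_haar"
    using bounded_borel_measurable[OF F] by (intro borel_measurable_haar) measurable
  ultimately show ?thesis by (intro circle_LinfI[of _ c]) auto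
qed

lemma integral_circle_mono:
  assumes "bounded_borel F" "bounded_borel G" "\<And>z. cmod z = 1 \<Longrightarrow> F z \<le> G z"
  shows "(LINT z|circle_haar. F z) \<le> (LINT z|circle_haar. G z)"
  by (rule integral_mono[OF bounded_borel_integrable[OF assms(1)] bounded_borel_integrable[OF assms(2)]]) (simp add: space_circle_haar assms(3))

lemma integral_circle_cong:
  assumes "\<And>z. cmod z = 1 \<Longrightarrow> F z = G z"
  shows "(LINT z|circle_haar. F z) = (LINT z|circle_haar. G z)"
  by (rule Bochner_Integration.integral_cong) (simp_all add: space_circle_haar assms)

lemma integral_circle_nonneg: "(\<And>z. cmod z = 1 \<Longrightarrow> 0 \<le> F z) \<Longrightarrow> 0 \<le> (LINT z|circle_haar. F z :: real)"
  by (rule integral_nonneg_AE, rule AE_I2) (simp add: space_circle_haar)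

text \<open>
  \<open>U\<^sup>n \<phi> = filter_prod n (T) \<phi>\<close>, see \<open>cantor_U_funpow_phi\<close>.
\<close>

definition filter_prod :: "nat \<Rightarrow> complex \<Rightarrow> complex" where "filter_prod n z = (\<Prod>i<n. m0 (z ^ 3 ^ i))"

definition abs_filter :: "nat \<Rightarrow> complex \<Rightarrow> real" where "abs_filter n z = cmod (filter_prod n z)"

text \<open>
  On the circle this is the Riesz product \<open>\<Prod>i<n. 1 + Re (z^(2 * 3^i))\<close>.
\<close>

definition riesz :: "nat \<Rightarrow> complex \<Rightarrow> real" where "riesz n z = (abs_filter n z)\<^sup>2"

lemma filter_prod_0: "filter_prod 0 z = 1" by (simp add: filter_prod_def)

lemma filter_prod_add: "filter_prod (l + k) z = filter_prod l z * filter_prod k (z ^ 3 ^ l)"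
proof (induction k)
  case 0
  show ?case by (simp add: filter_prod_def)
next
  case (Suc k)
  then show ?case by (simp add: filter_prod_def power_add flip: power_mult)
qed

lemma filter_prod_Suc: "filter_prod (Suc n) z = m0 z * filter_prod n (z ^ 3)"
  using filter_prod_add[of 1 n z] by (simp add: filter_prod_def)

lemma abs_filter_add: "abs_filter (l + k) z = abs_filter l z * abs_filter k (z ^ 3 ^ l)"
  by (simp add: abs_filter_def filter_prod_add norm_mult)

lemma abs_filter_nonneg: "0 \<le> abs_filter n z" by (simp add: abs_filter_def)

lemma riesz_add: "riesz (l + k) z = riesz l z * riesz k (z ^ 3 ^ l)"
  by (simp add: riesz_def abs_filter_add power_mult_distrib)

lemma riesz_nonneg: "0 \<le> riesz n z" by (simp add: riesz_def)

lemma filter_prod_Linf: "filter_prod n \<in> circle_Linf"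
  unfolding filter_prod_def m0_def by (intro continuous_circle_Linf continuous_intros) simp

lemma bounded_borel_abs_filter: "bounded_borel (abs_filter n)"
proof -
  have c: "continuous_on UNIV (filter_prod n)" unfolding filter_prod_def m0_def by (intro continuous_intros) simp
  then have "abs_filter n \<in> borel_measurable borel"
    unfolding abs_filter_def by (intro borel_measurable_continuous_onI continuous_intros)
  then show ?thesis using continuous_circle_bound[OF c] by (auto simp: bounded_borel_def abs_filter_def)
qed

lemma bounded_borel_riesz: "bounded_borel (riesz n)"
  unfolding riesz_def power2_eq_square by (intro bounded_borel_mult bounded_borel_abs_filter)

lemma calc_power_U:
  assumes f: "f \<in> circle_Linf" and \<xi>: "\<xi> \<in> H"
  shows "(\<lambda>z. f (z ^ 3 ^ n)) \<in> circle_Linf \<and> (cantor_U ^^ n) (C.calc f \<xi>) \<doteq> C.calc (\<lambda>z. f (z ^ 3 ^ n)) ((cantor_U ^^ n) \<xi>)"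
proof (induction n)
  case 0
  then show ?case using f by (simp add: L2_eq_refl)
next
  case (Suc n)
  let ?f = "\<lambda>z. f (z ^ 3 ^ n)"
  have f': "?f \<in> circle_Linf" and e: "(cantor_U ^^ n) (C.calc f \<xi>) \<doteq> C.calc ?f ((cantor_U ^^ n) \<xi>)" using Suc by auto
  note U\<xi> = cantor_U_funpow_L2[OF \<xi>, of n]
  have eq: "(\<lambda>z. ?f (z ^ 3)) = (\<lambda>z. f (z ^ 3 ^ Suc n))" by (simp flip: power_mult)
  have "cantor_U ((cantor_U ^^ n) (C.calc f \<xi>)) \<doteq> cantor_U (C.calc ?f ((cantor_U ^^ n) \<xi>))"
    by (intro L2_operator_cong[OF L2_operator_cantor_U] cantor_U_funpow_L2 C.calc_L2 f f' \<xi> e)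
  also have "\<dots> \<doteq> C.calc (\<lambda>z. ?f (z ^ 3)) (cantor_U ((cantor_U ^^ n) \<xi>))" by (rule calc_U[OF f' U\<xi>])
  finally show ?case using circle_Linf_cube[OF f'] by (simp add: eq)
qed

lemma cantor_U_funpow_phi: "(cantor_U ^^ n) \<phi> \<doteq> C.calc (filter_prod n) \<phi>"
proof (induction n)
  case 0
  have "filter_prod 0 = (\<lambda>z. 1)" by (simp add: filter_prod_0 fun_eq_iff)
  then show ?case using L2_eq_sym[OF C.calc_one[OF phi_L2]] by simp
next
  case (Suc n)
  note m3 = circle_Linf_cube[OF filter_prod_Linf[of n]]
  have "cantor_U ((cantor_U ^^ n) \<phi>) \<doteq> cantor_U (C.calc (filter_prod n) \<phi>)"
    by (intro L2_operator_cong[OF L2_operator_cantor_U] cantor_U_funpow_L2 C.calc_L2 filter_prod_Linf phi_L2 Suc)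
  also have "\<dots> \<doteq> C.calc (\<lambda>z. filter_prod n (z ^ 3)) (cantor_U \<phi>)" by (rule calc_U[OF filter_prod_Linf phi_L2])
  also have "\<dots> \<doteq> C.calc (\<lambda>z. filter_prod n (z ^ 3)) (C.calc m0 \<phi>)"
    by (intro L2_operator_cong[OF C.calc_operator[OF m3]] cantor_U_L2 C.calc_L2 m0_Linf phi_L2 cantor_U_phi)
  also have "\<dots> \<doteq> C.calc (\<lambda>z. filter_prod n (z ^ 3) * m0 z) \<phi>" by (rule L2_eq_sym[OF C.calc_mult[OF m3 m0_Linf phi_L2]])
  also have "(\<lambda>z. filter_prod n (z ^ 3) * m0 z) = filter_prod (Suc n)" by (simp add: filter_prod_Suc mult.commute fun_eq_iff)
  finally show ?case by simp
qed

lemma calc_phi_norm: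
  assumes g: "g \<in> circle_Linf"
  shows "(L2_norm cantor_measure (C.calc g \<phi>))\<^sup>2 = (LINT z|circle_haar. (cmod (g z))\<^sup>2)"
proof -
  note cg = C.circle_Linf_cnj[OF g] and L = C.calc_L2[OF g phi_L2]
  note gg = C.circle_Linf_mult[OF cg g]
  have "complex_of_real ((L2_norm cantor_measure (C.calc g \<phi>))\<^sup>2) = L2_inner cantor_measure (C.calc g \<phi>) (C.calc g \<phi>)"
    by (rule L2_inner_self[symmetric])
  also have "\<dots> = L2_inner cantor_measure \<phi> (C.calc (\<lambda>z. cnj (g z)) (C.calc g \<phi>))" by (rule C.calc_adjoint[OF g phi_L2 L])
  also have "\<dots> = L2_inner cantor_measure \<phi> (C.calc (\<lambda>z. cnj (g z) * g z) \<phi>)"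
    by (intro L2_inner_cong C.calc_L2 cg gg L phi_L2 L2_eq_refl L2_eq_sym[OF C.calc_mult] g)
  also have "\<dots> = cnj (LINT z|circle_haar. cnj (g z) * g z)"
    by (subst L2_inner_commute) (simp only: phi_integral[OF gg])
  also have "(LINT z|circle_haar. cnj (g z) * g z) = (LINT z|circle_haar. of_real ((cmod (g z))\<^sup>2))"
    by (simp only: complex_norm_square mult.commute)
  also have "cnj \<dots> = of_real (LINT z|circle_haar. (cmod (g z))\<^sup>2)"
    by (simp only: integral_complex_of_real complex_cnj_complex_of_real)
  finally show ?thesis using of_real_eq_iff by blast
qed

lemma calc_U_phi_norm:
  assumes f: "f \<in> circle_Linf"
  shows "(L2_norm cantor_measure (C.calc f ((cantor_U ^^ n) \<phi>)))\<^sup>2 = (LINT z|circle_haar. (cmod (f z))\<^sup>2 * riesz n z)"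
proof -
  note fm = C.circle_Linf_mult[OF f filter_prod_Linf[of n]]
  have "C.calc f ((cantor_U ^^ n) \<phi>) \<doteq> C.calc f (C.calc (filter_prod n) \<phi>)"
    by (intro L2_operator_cong[OF C.calc_operator[OF f]] cantor_U_funpow_L2 C.calc_L2 filter_prod_Linf phi_L2 cantor_U_funpow_phi)
  also have "\<dots> \<doteq> C.calc (\<lambda>z. f z * filter_prod n z) \<phi>" by (rule L2_eq_sym[OF C.calc_mult[OF f filter_prod_Linf phi_L2]])
  finally have "L2_norm cantor_measure (C.calc f ((cantor_U ^^ n) \<phi>)) = L2_norm cantor_measure (C.calc (\<lambda>z. f z * filter_prod n z) \<phi>)"
    by (intro L2_norm_cong C.calc_L2 cantor_U_funpow_L2 fm f phi_L2)
  then show ?thesis by (simp add: calc_phi_norm[OF fm] norm_mult power_mult_distrib riesz_def abs_filter_def)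
qed

text \<open>
  Both sides are square norms, of \<open>U\<^sup>n f(T) \<phi>\<close> and of \<open>f(T) \<phi>\<close> with \<open>f = sqrt F\<close>.
\<close>

lemma riesz_transfer:
  assumes F: "bounded_borel F" "\<And>z. 0 \<le> F z"
  shows "(LINT z|circle_haar. F (z ^ 3 ^ n) * riesz n z) = (LINT z|circle_haar. F z)"
proof -
  define f where "f z = complex_of_real (sqrt (F z))" for z
  obtain c where c: "\<And>z. cmod z = 1 \<Longrightarrow> \<bar>F z\<bar> \<le> c" using F(1) unfolding bounded_borel_def by blast
  have "bounded_borel (\<lambda>z. sqrt (F z))"
  proof (rule bounded_borelI[of _ "sqrt c"])
    note [measurable] = bounded_borel_measurable[OF F(1)]
    show "(\<lambda>z. sqrt (F z)) \<in> borel_measurable borel" by measurable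
    show "\<bar>sqrt (F z)\<bar> \<le> sqrt c" if "cmod z = 1" for z using c[OF that] F(2)[of z] by simp
  qed
  then have f: "f \<in> circle_Linf" unfolding f_def by (rule bounded_borel_Linf)
  have fF: "(cmod (f z))\<^sup>2 = F z" for z using F(2) by (simp add: f_def)
  note p = calc_power_U[OF f phi_L2, of n]
  have "L2_norm cantor_measure (C.calc (\<lambda>z. f (z ^ 3 ^ n)) ((cantor_U ^^ n) \<phi>)) = L2_norm cantor_measure ((cantor_U ^^ n) (C.calc f \<phi>))"
    by (intro L2_norm_cong C.calc_L2 cantor_U_funpow_L2 phi_L2 f conjunct1[OF p] L2_eq_sym[OF conjunct2[OF p]])
  also have "\<dots> = L2_norm cantor_measure (C.calc f \<phi>)" by (rule cantor_U_funpow_norm[OF C.calc_L2[OF f phi_L2]])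
  finally show ?thesis
    using calc_U_phi_norm[OF conjunct1[OF p], of n] calc_phi_norm[OF f] by (simp add: fF)
qed

lemma riesz_integral: "(LINT z|circle_haar. riesz n z) = 1"
  using riesz_transfer[OF bounded_borel_const[of 1], of n] by (simp add: space_circle_haar measure_circle_haar)

lemma circle_haar_rotate:
  assumes u: "cmod u = 1" and f: "f \<in> borel_measurable circle_haar"
  shows "(LINT z|circle_haar. f (u * z)) = (LINT z|circle_haar. f z :: 'b::{banach,second_countable_topology})"
proof -
  have "(\<lambda>z. u * z) \<in> measurable circle_borel circle_borel"
    unfolding circle_borel_def using u by (intro measurable_restrict_space3) (auto simp: norm_mult)
  then have m: "(\<lambda>z. u * z) \<in> measurable circle_haar circle_haar"
    by (simp cong: measurable_cong_sets add: sets_circle_haar)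
  have "distr circle_haar circle_haar (\<lambda>z. u * z) = circle_haar"
  proof (rule circle_measure_eqI)
    show "finite_measure (distr circle_haar circle_haar (\<lambda>z. u * z))"
      by (rule finite_measure.finite_measure_distr[OF finite_measure_circle_haar m])
    fix n :: nat
    have pm: "(\<lambda>z::complex. z ^ n) \<in> borel_measurable circle_haar" by (intro borel_measurable_haar) measurable
    show "(LINT z|distr circle_haar circle_haar (\<lambda>z. u * z). z ^ n) = (LINT z|circle_haar. z ^ n)"
      using integral_circle_haar_powi[of "int n"]
      by (subst integral_distr[OF m pm]) (cases "n = 0", auto simp: power_mult_distrib)
  qed (auto simp: finite_measure_circle_haar sets_circle_haar)
  then show ?thesis using integral_distr[OF m f] by simp
qed

text \<open>
  Rotation by a cube root of unity leaves \<open>G (z^3)\<close> unchanged and multiplies \<open>z^k\<close> by a nontrivial root.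
\<close>

lemma integral_cube_orthogonal:
  assumes G: "bounded_borel G" and k: "k = 2 \<or> k = 4"
  shows "(LINT z|circle_haar. Re (z ^ k) * G (z ^ 3)) = 0"
proof -
  define u where "u = cis (2 * pi / 3)"
  have u: "u ^ 3 = 1" "u \<noteq> 1" "cmod u = 1" using cis_third by (auto simp: u_def)
  have u2: "u ^ k \<noteq> 1"
  proof
    assume "u ^ k = 1"
    moreover have "u ^ 4 = u ^ 3 * u" "u ^ 3 = u ^ 2 * u" by (simp_all add: eval_nat_numeral)
    ultimately have "u = 1" using k u(1) by auto
    then show False using u(2) by simp
  qed
  note [measurable] = bounded_borel_measurable[OF G]
  let ?f = "\<lambda>z. z ^ k * complex_of_real (G (z ^ 3))"
  have m: "?f \<in> borel_measurable circle_haar" by (intro borel_measurable_haar) measurable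
  have "(LINT z|circle_haar. ?f z) = (LINT z|circle_haar. ?f (u * z))" by (rule circle_haar_rotate[OF u(3) m, symmetric])
  also have "\<dots> = u ^ k * (LINT z|circle_haar. ?f z)" by (simp add: power_mult_distrib u(1) mult.assoc)
  finally have "(1 - u ^ k) * (LINT z|circle_haar. ?f z) = 0" by (simp add: left_diff_distrib)
  then have "(LINT z|circle_haar. ?f z) = 0" using u2 by simp
  moreover have "integrable circle_haar ?f"
  proof -
    obtain c where "\<And>z. cmod z = 1 \<Longrightarrow> \<bar>G z\<bar> \<le> c" using G unfolding bounded_borel_def by blast
    then show ?thesis
      by (intro circle_bounded_integrable[OF finite_measure_circle_haar sets_circle_haar, of _ c] measurable_circle_borel)
         (auto simp: norm_mult norm_power)
  qed
  ultimately have "(LINT z|circle_haar. Re (?f z)) = 0" by (simp only: integral_Re zero_complex.sel)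
  then show ?thesis by simp
qed

text \<open>
  Pulling out the first factor, with \<open>c = Re (z\<^sup>2)\<close>, costs \<open>sqrt (1 + c) \<le> 1 + c/2 - c\<^sup>2/12\<close>. Since
  \<open>c\<^sup>2 = (1 + Re (z\<^sup>4)) / 2\<close>, the right side is \<open>23/24\<close> plus a combination of \<open>Re (z\<^sup>2)\<close> and \<open>Re (z\<^sup>4)\<close>, and these
  are orthogonal to functions of \<open>z\<^sup>3\<close>.
\<close>

lemma abs_filter_decay: "(LINT z|circle_haar. abs_filter n z) \<le> (23/24) ^ n"
proof (induction n)
  case 0
  show ?case by (simp add: abs_filter_def filter_prod_0 space_circle_haar measure_circle_haar)
next
  case (Suc n)
  let ?G = "abs_filter n"
  have bG: "bounded_borel (\<lambda>z. ?G (z ^ 3))" by (intro bounded_borel_power_arg bounded_borel_abs_filter)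
  have bR: "bounded_borel (\<lambda>z. Re (z ^ k))" for k
    using complex_Re_le_cmod abs_Re_le_cmod by (intro bounded_borelI[of _ 1] borel_measurable_Re) (auto intro: order_trans[OF abs_Re_le_cmod] simp: norm_power)
  have pt: "abs_filter (Suc n) z \<le> (23/24) * ?G (z ^ 3) + ((1/2) * (Re (z ^ 2) * ?G (z ^ 3)) + (-1/24) * (Re (z ^ 4) * ?G (z ^ 3)))"
    if z: "cmod z = 1" for z
  proof -
    define c where "c = Re (z\<^sup>2)"
    have w: "c\<^sup>2 + (Im (z\<^sup>2))\<^sup>2 = 1" using z cmod_power2[of "z\<^sup>2"] by (simp add: c_def norm_power)
    then have "c\<^sup>2 \<le> 1" by (metis le_add_same_cancel1 zero_le_power2)
    then have c1: "-1 \<le> c" "c \<le> 1" by (simp_all add: abs_square_le_1 abs_le_iff)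
    have "Re (z ^ 4) = Re (z\<^sup>2 * z\<^sup>2)" by (simp flip: power_add)
    also have "\<dots> = 2 * c\<^sup>2 - 1" using w by (simp add: c_def power2_eq_square)
    finally have z4: "Re (z ^ 4) = 2 * c\<^sup>2 - 1" .
    have "cmod (m0 z) \<le> 1 + c / 2 - c\<^sup>2 / 12"
    proof (rule power2_le_imp_le)
      have "(1 + c / 2 - c\<^sup>2 / 12)\<^sup>2 = 1 + c + c\<^sup>2 * (1 - c) / 12 + (c\<^sup>2)\<^sup>2 / 144"
        by (simp add: power2_eq_square field_simps)
      \<comment> \<open>the excess of the square over 1 + c = |m0 z|^2 is nonnegative because c lies between -1 and
          1\<close>
      moreover have "0 \<le> c\<^sup>2 * (1 - c)" using c1 by simp
      ultimately show "(cmod (m0 z))\<^sup>2 \<le> (1 + c / 2 - c\<^sup>2 / 12)\<^sup>2" using m0_norm[OF z] by (simp add: c_def)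
      show "0 \<le> 1 + c / 2 - c\<^sup>2 / 12" using c1 \<open>c\<^sup>2 \<le> 1\<close> by linarith
    qed
    then have "abs_filter (Suc n) z \<le> (1 + c / 2 - c\<^sup>2 / 12) * ?G (z ^ 3)"
      using abs_filter_nonneg[of n "z ^ 3"] by (simp add: abs_filter_def filter_prod_Suc norm_mult mult_right_mono)
    also have "1 + c / 2 - c\<^sup>2 / 12 = 23/24 + ((1/2) * c + (-1/24) * Re (z ^ 4))" unfolding z4 by (simp add: field_simps)
    finally show ?thesis by (simp add: c_def algebra_simps)
  qed
  have "(LINT z|circle_haar. abs_filter (Suc n) z) \<le> (LINT z|circle_haar. (23/24) * ?G (z ^ 3) + ((1/2) * (Re (z ^ 2) * ?G (z ^ 3)) + (-1/24) * (Re (z ^ 4) * ?G (z ^ 3))))"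
    by (intro integral_circle_mono bounded_borel_abs_filter bounded_borel_add bounded_borel_mult[OF bounded_borel_const] bounded_borel_mult[OF bR] bG pt)
  also have "\<dots> = (LINT z|circle_haar. (23/24) * ?G (z ^ 3)) + ((LINT z|circle_haar. (1/2) * (Re (z ^ 2) * ?G (z ^ 3))) + (LINT z|circle_haar. (-1/24) * (Re (z ^ 4) * ?G (z ^ 3))))"
    by (intro Bochner_Integration.integral_add[THEN trans] arg_cong2[of _ _ _ _ "(+)"] refl bounded_borel_integrable bounded_borel_add bounded_borel_mult[OF bounded_borel_const] bounded_borel_mult[OF bR] bG)
  also have "\<dots> = (23/24) * (LINT z|circle_haar. ?G (z ^ 3))"
    using integral_cube_orthogonal[OF bounded_borel_abs_filter, of 2 n] integral_cube_orthogonal[OF bounded_borel_abs_filter, of 4 n] by simp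
  also have "(LINT z|circle_haar. ?G (z ^ 3)) = (LINT z|circle_haar. ?G z)"
    by (rule circle_haar_cube_integral[OF borel_measurable_integrable[OF bounded_borel_integrable[OF bounded_borel_abs_filter]]])
  also have "(23/24) * \<dots> \<le> (23/24) ^ Suc n" using Suc by simp
  finally show ?case by simp
qed

text \<open>
  The product is \<open>riesz i\<close> times the pullback of \<open>abs_filter (j - i)\<close> along \<open>z \<mapsto> z^(3^i)\<close>.
\<close>

lemma abs_filter_overlap:
  assumes "i \<le> j"
  shows "(LINT z|circle_haar. abs_filter i z * abs_filter j z) \<le> (23/24) ^ (j - i)"
proof -
  have "abs_filter i z * abs_filter j z = abs_filter (j - i) (z ^ 3 ^ i) * riesz i z" for z
    using abs_filter_add[of i "j - i" z] assms by (simp add: riesz_def power2_eq_square)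
  then have "(LINT z|circle_haar. abs_filter i z * abs_filter j z) = (LINT z|circle_haar. abs_filter (j - i) z)"
    by (simp only: riesz_transfer[OF bounded_borel_abs_filter abs_filter_nonneg])
  then show ?thesis using abs_filter_decay[of "j - i"] by simp
qed

section \<open>Peaks of the Riesz product\<close>

text \<open>
  Multiplying all values by \<open>riesz l\<close>, one sees that \<open>peak N\<close> at \<open>z^(3^l)\<close> means that \<open>n \<mapsto> riesz n z\<close> has a
  maximum at \<open>l + N\<close> over the window of radius \<open>N\<close>. Strictness on the left makes two peaks closer than
  the radius impossible.
\<close>

definition peak :: "nat \<Rightarrow> complex \<Rightarrow> bool" where
  "peak N z \<longleftrightarrow> (\<forall>j\<in>{1..N}. riesz (N + j) z \<le> riesz N z \<and> riesz (N - j) z < riesz N z)"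

definition first_max :: "nat \<Rightarrow> nat \<Rightarrow> complex \<Rightarrow> bool" where
  "first_max M n z \<longleftrightarrow> (\<forall>j<M. riesz j z \<le> riesz n z) \<and> (\<forall>j<n. riesz j z < riesz n z)"

lemma riesz_borel [measurable]: "riesz n \<in> borel_measurable borel"
  by (rule bounded_borel_measurable[OF bounded_borel_riesz])

lemma peak_measurable [measurable]: "Measurable.pred borel (peak N)"
  unfolding peak_def by measurable

lemma first_max_measurable [measurable]: "Measurable.pred borel (first_max M n)"
  unfolding first_max_def by measurable

lemma bounded_borel_of_bool: "Measurable.pred borel P \<Longrightarrow> bounded_borel (\<lambda>z. of_bool (P z))"
proof (rule bounded_borelI[of _ 1])
  assume [measurable]: "Measurable.pred borel P"
  have "(\<lambda>z. if P z then 1 else 0 :: real) \<in> borel_measurable borel" by measurable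
  then show "(\<lambda>z. of_bool (P z) :: real) \<in> borel_measurable borel" by (simp add: of_bool_def)
qed auto

lemma first_max_ex:
  assumes "M > 0" shows "\<exists>n<M. first_max M n z"
proof -
  have "finite ((\<lambda>j. riesz j z) ` {..<M})" "(\<lambda>j. riesz j z) ` {..<M} \<noteq> {}" using assms by auto
  then obtain k where k: "k < M" "\<And>j. j < M \<Longrightarrow> riesz j z \<le> riesz k z"
    using Max_in[of "(\<lambda>j. riesz j z) ` {..<M}"] Max_ge[of "(\<lambda>j. riesz j z) ` {..<M}"] by (smt (verit, best) imageE imageI lessThan_iff)
  define P where "P n \<longleftrightarrow> n < M \<and> riesz n z = riesz k z" for n
  define n where "n = (LEAST n. P n)"
  have n: "P n" unfolding n_def by (rule LeastI[of P k]) (simp add: P_def k)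
  have "riesz j z < riesz n z" if "j < n" for j
  proof -
    have "\<not> P j" using not_less_Least[of j P] that by (simp add: n_def)
    then show ?thesis using k(2)[of j] n that by (auto simp: P_def)
  qed
  then show ?thesis using n k by (auto simp: P_def first_max_def)
qed

text \<open>
  Applied to nearly disjoint functions: if the mixed products have small integrals, the integral of the
  maximum of their squares is almost as large as the sum of the integrals of the squares.
\<close>

lemma sum_squares_le_max:
  fixes a :: "nat \<Rightarrow> real"
  assumes "\<And>i. i < n \<Longrightarrow> 0 \<le> a i" "\<And>i. i < n \<Longrightarrow> a i \<le> m"
  shows "(\<Sum>i<n. (a i)\<^sup>2 - (\<Sum>j<i. a j * a i)) \<le> m\<^sup>2"
  using assms
proof (induction n arbitrary: m)
  case (Suc n)
  show ?case
  proof (cases "n = 0")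
    case True
    then show ?thesis using Suc.prems[of 0] by (simp add: power_mono)
  next
    case False
    have "finite (a ` {..<n})" "a ` {..<n} \<noteq> {}" using False by auto
    then obtain k where k: "k < n" "\<And>j. j < n \<Longrightarrow> a j \<le> a k"
      using Max_in[of "a ` {..<n}"] Max_ge[of "a ` {..<n}"] by (smt (verit, best) imageE imageI lessThan_iff)
    have IH: "(\<Sum>i<n. (a i)\<^sup>2 - (\<Sum>j<i. a j * a i)) \<le> (a k)\<^sup>2"
      using k Suc.prems by (intro Suc.IH) auto
    have ak: "0 \<le> a k" "a k \<le> m" "0 \<le> a n" "a n \<le> m" using Suc.prems k by auto
    have "a k * a n \<le> (\<Sum>j<n. a j * a n)"
      using k Suc.prems by (intro member_le_sum[of k "{..<n}" "\<lambda>j. a j * a n"]) auto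
    then have "(\<Sum>i<Suc n. (a i)\<^sup>2 - (\<Sum>j<i. a j * a i)) \<le> (a k)\<^sup>2 + (a n)\<^sup>2 - a k * a n"
      using IH by simp
    also have "\<dots> \<le> m\<^sup>2"
    proof (cases "a k \<le> a n")
      case True
      then have "(a k)\<^sup>2 \<le> a k * a n" using ak by (simp add: power2_eq_square mult_left_mono)
      moreover have "(a n)\<^sup>2 \<le> m\<^sup>2" using ak by (intro power_mono) auto
      ultimately show ?thesis by linarith
    next
      case False
      then have "(a n)\<^sup>2 \<le> a k * a n" using ak by (simp add: power2_eq_square mult_right_mono)
      moreover have "(a k)\<^sup>2 \<le> m\<^sup>2" using ak by (intro power_mono) auto
      ultimately show ?thesis by linarith
    qed
    finally show ?thesis .
  qed
qed simp

lemma geometric_tail: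
  fixes \<mu> :: real assumes "0 \<le> \<mu>" "\<mu> \<le> 1/5"
  shows "(\<Sum>j<i. \<mu> ^ (i - j)) \<le> 1/4"
proof (induction i)
  case (Suc i)
  have "(\<Sum>j<Suc i. \<mu> ^ (Suc i - j)) = \<mu> * (1 + (\<Sum>j<i. \<mu> ^ (i - j)))"
    by (simp add: Suc_diff_le sum_distrib_left distrib_left)
  also have "\<dots> \<le> (1/5) * (1 + 1/4)" using assms Suc
    by (intro mult_mono add_mono add_nonneg_nonneg sum_nonneg) auto
  finally show ?case by simp
qed simp

definition peak_mass :: "nat \<Rightarrow> real" where
  "peak_mass N = (LINT z|circle_haar. of_bool (peak N z) * riesz N z)"

lemma bounded_borel_peak: "bounded_borel (\<lambda>z. of_bool (peak N z) * riesz N z)"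
  by (intro bounded_borel_mult bounded_borel_of_bool bounded_borel_riesz) measurable

text \<open>
  A first maximum at \<open>n\<close> over \<open>{..<M}\<close> is in particular a maximum over a window of radius \<open>K\<close> when that
  window fits, so \<open>z^(3^(n-K))\<close> lies in \<open>peak K\<close>.
\<close>

lemma first_max_mass:
  assumes "K \<le> n" "n + K < M"
  shows "(LINT z|circle_haar. of_bool (first_max M n z) * riesz n z) \<le> peak_mass K"
proof -
  define l where "l = n - K"
  have n: "n = l + K" using assms by (simp add: l_def)
  have le: "of_bool (first_max M n z) * riesz n z \<le> of_bool (peak K (z ^ 3 ^ l)) * riesz K (z ^ 3 ^ l) * riesz l z" for z
  proof (cases "first_max M n z \<and> riesz n z \<noteq> 0")
    case True
    let ?y = "z ^ 3 ^ l"
    have f: "riesz (l + (K + j)) z \<le> riesz (l + K) z" "j \<ge> 1 \<Longrightarrow> riesz (l + (K - j)) z < riesz (l + K) z" if "j \<le> K" for j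
      using True that assms unfolding first_max_def n by auto
    have pos: "riesz l z > 0" using True riesz_nonneg[of l z] unfolding n riesz_add by (cases "riesz l z = 0") auto
    have "peak K ?y"
      unfolding peak_def
    proof (intro ballI conjI)
      fix j assume j: "j \<in> {1..K}"
      show "riesz (K + j) ?y \<le> riesz K ?y" using f(1)[of j] j pos unfolding riesz_add[of l] by simp
      show "riesz (K - j) ?y < riesz K ?y" using f(2)[of j] j pos unfolding riesz_add[of l] by simp
    qed
    then show ?thesis using True by (simp add: n riesz_add[of l K])
  qed (auto simp: riesz_nonneg)
  have "(LINT z|circle_haar. of_bool (first_max M n z) * riesz n z)
      \<le> (LINT z|circle_haar. of_bool (peak K (z ^ 3 ^ l)) * riesz K (z ^ 3 ^ l) * riesz l z)"
  proof (intro integral_circle_mono le)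
    show "bounded_borel (\<lambda>z. of_bool (first_max M n z) * riesz n z)" by (intro bounded_borel_mult bounded_borel_of_bool bounded_borel_riesz) measurable
    show "bounded_borel (\<lambda>z. of_bool (peak K (z ^ 3 ^ l)) * riesz K (z ^ 3 ^ l) * riesz l z)"
      using bounded_borel_mult[OF bounded_borel_power_arg[OF bounded_borel_peak] bounded_borel_riesz] by simp
  qed
  also have "\<dots> = peak_mass K"
    unfolding peak_mass_def by (rule riesz_transfer[OF bounded_borel_peak]) (simp add: riesz_nonneg)
  finally show ?thesis .
qed

text \<open>
  The right side is the integral of the maximum of the functions \<open>riesz n\<close>, \<open>n < L * M'\<close>. Those with index a
  multiple of \<open>L\<close> have integral one and are nearly disjoint; after subtracting the overlaps
  with its predecessors, each of them still contributes \<open>1 - 1/4\<close>.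
\<close>

lemma max_mass_lower:
  assumes L: "L > 0" "(23/24 :: real) ^ L \<le> 1/5" and M: "M' > 0"
  shows "3/4 * real M' \<le> (\<Sum>n<L * M'. LINT z|circle_haar. of_bool (first_max (L * M') n z) * riesz n z)"
proof -
  let ?M = "L * M'"
  let ?\<mu> = "(23/24 :: real) ^ L"
  have bT: "bounded_borel (\<lambda>z. abs_filter (L * j) z * abs_filter (L * i) z)" for i j by (intro bounded_borel_mult bounded_borel_abs_filter)
  have bI: "bounded_borel (\<lambda>z. riesz (L * i) z - (\<Sum>j<i. abs_filter (L * j) z * abs_filter (L * i) z))" for i
    by (intro bounded_borel_diff bounded_borel_riesz bounded_borel_sum bT)
  have bF: "bounded_borel (\<lambda>z. of_bool (first_max ?M n z) * riesz n z)" for n by (intro bounded_borel_mult bounded_borel_of_bool bounded_borel_riesz) measurable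
  have "3/4 * real M' = (\<Sum>i<M'. 3/4)" by simp
  also have "\<dots> \<le> (\<Sum>i<M'. LINT z|circle_haar. riesz (L * i) z - (\<Sum>j<i. abs_filter (L * j) z * abs_filter (L * i) z))"
  proof (rule sum_mono)
    fix i
    have "(\<Sum>j<i. LINT z|circle_haar. abs_filter (L * j) z * abs_filter (L * i) z) \<le> (\<Sum>j<i. ?\<mu> ^ (i - j))"
      using abs_filter_overlap[of "L * _" "L * i"] by (intro sum_mono) (simp add: diff_mult_distrib2 flip: power_mult)
    also have "\<dots> \<le> 1/4" using L by (intro geometric_tail) auto
    finally have "(\<Sum>j<i. LINT z|circle_haar. abs_filter (L * j) z * abs_filter (L * i) z) \<le> 1/4" .
    moreover have "(LINT z|circle_haar. riesz (L * i) z - (\<Sum>j<i. abs_filter (L * j) z * abs_filter (L * i) z))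
       = 1 - (\<Sum>j<i. LINT z|circle_haar. abs_filter (L * j) z * abs_filter (L * i) z)"
      by (subst Bochner_Integration.integral_diff[OF bounded_borel_integrable[OF bounded_borel_riesz] bounded_borel_integrable[OF bounded_borel_sum[OF bT]]],
          subst Bochner_Integration.integral_sum[OF bounded_borel_integrable[OF bT]]) (simp add: riesz_integral)
    ultimately show "3/4 \<le> (LINT z|circle_haar. riesz (L * i) z - (\<Sum>j<i. abs_filter (L * j) z * abs_filter (L * i) z))" by simp
  qed
  also have "\<dots> = (LINT z|circle_haar. (\<Sum>i<M'. riesz (L * i) z - (\<Sum>j<i. abs_filter (L * j) z * abs_filter (L * i) z)))"
    by (rule Bochner_Integration.integral_sum[OF bounded_borel_integrable[OF bI], symmetric])
  also have "\<dots> \<le> (LINT z|circle_haar. (\<Sum>n<?M. of_bool (first_max ?M n z) * riesz n z))"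
  proof (rule integral_circle_mono[OF bounded_borel_sum[OF bI] bounded_borel_sum[OF bF]])
    fix z :: complex
    have "?M > 0" using L M by simp
    then obtain n where n: "n < ?M" "first_max ?M n z" using first_max_ex by blast
    have "(\<Sum>i<M'. (abs_filter (L * i) z)\<^sup>2 - (\<Sum>j<i. abs_filter (L * j) z * abs_filter (L * i) z)) \<le> (abs_filter n z)\<^sup>2"
    proof (rule sum_squares_le_max)
      fix i assume "i < M'"
      then have "riesz (L * i) z \<le> riesz n z" using n(2) L by (simp add: first_max_def)
      then show "abs_filter (L * i) z \<le> abs_filter n z" unfolding riesz_def by (rule power2_le_imp_le) (rule abs_filter_nonneg)
    qed (rule abs_filter_nonneg)
    also have "(abs_filter n z)\<^sup>2 = of_bool (first_max ?M n z) * riesz n z" using n by (simp add: riesz_def)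
    also have "\<dots> \<le> (\<Sum>n<?M. of_bool (first_max ?M n z) * riesz n z)"
      using n(1) by (intro member_le_sum[of n "{..<?M}" "\<lambda>n. of_bool (first_max ?M n z) * riesz n z"]) (auto simp: riesz_nonneg)
    finally show "(\<Sum>i<M'. riesz (L * i) z - (\<Sum>j<i. abs_filter (L * j) z * abs_filter (L * i) z)) \<le> (\<Sum>n<?M. of_bool (first_max ?M n z) * riesz n z)"
      by (simp add: riesz_def)
  qed
  also have "\<dots> = (\<Sum>n<?M. LINT z|circle_haar. of_bool (first_max ?M n z) * riesz n z)"
    by (rule Bochner_Integration.integral_sum[OF bounded_borel_integrable[OF bF]])
  finally show ?thesis .
qed

text \<open>
  All but \<open>2 K\<close> of the \<open>L * M'\<close> terms in \<open>max_mass_lower\<close> are at most \<open>peak_mass K\<close>, while the sum grows at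
  least like \<open>3/4 * M'\<close>; for \<open>M' \<rightarrow> \<infinity>\<close> this forces \<open>L * peak_mass K \<ge> 3/4\<close>, where \<open>L\<close> is independent of \<open>K\<close>.
\<close>

lemma peak_mass_lower: "\<exists>c>0. \<forall>K. c \<le> peak_mass K"
proof -
  obtain L where L0: "(23/24 :: real) ^ L < 1/5" using real_arch_pow_inv[of "1/5" "23/24"] by auto
  then have L: "L > 0" "(23/24 :: real) ^ L \<le> 1/5" by (cases "L = 0", simp, simp) (rule less_imp_le[OF L0])
  have "3/4 \<le> real L * peak_mass K" for K
  proof (rule ccontr)
    assume neg: "\<not> 3/4 \<le> real L * peak_mass K"
    define d where "d = 3/4 - real L * peak_mass K"
    have d: "d > 0" using neg by (simp add: d_def)
    \<comment> \<open>large enough for the defect d per block to outweigh the bad positions\<close>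
    obtain M' :: nat where M': "2 * real K / d < real M'" using reals_Archimedean2 by blast
    then have M: "M' > 0" using d by (cases "M' = 0") (auto simp: field_simps)
    let ?M = "L * M'"
    let ?g = "\<lambda>n. LINT z|circle_haar. of_bool (first_max ?M n z) * riesz n z"
    \<comment> \<open>positions whose window of radius K leaves the range\<close>
    let ?bad = "{..<K} \<union> {?M - K..<?M}"
    have p0: "0 \<le> peak_mass K" unfolding peak_mass_def by (intro integral_circle_nonneg) (simp add: riesz_nonneg)
    have g: "?g n \<le> peak_mass K + (if n \<in> ?bad then 1 else 0)" if n: "n < ?M" for n
    proof (cases "n \<in> ?bad")
      case True
      have "?g n \<le> (LINT z|circle_haar. riesz n z)"
        by (intro integral_circle_mono bounded_borel_mult bounded_borel_of_bool bounded_borel_riesz) (measurable, simp add: riesz_nonneg)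
      then show ?thesis using True p0 by (simp add: riesz_integral)
    next
      case False
      then show ?thesis using n first_max_mass[of K n ?M] by auto
    qed
    have "3/4 * real M' \<le> (\<Sum>n<?M. ?g n)" by (rule max_mass_lower[OF L M])
    also have "\<dots> \<le> (\<Sum>n<?M. peak_mass K + (if n \<in> ?bad then 1 else 0))" by (intro sum_mono g) simp
    also have "\<dots> = real ?M * peak_mass K + real (card ({..<?M} \<inter> ?bad))"
    proof -
      have "(\<Sum>n<?M. if n \<in> ?bad then 1 else (0::real)) = (\<Sum>n\<in>{..<?M} \<inter> ?bad. 1)"
        by (rule sum.inter_restrict[symmetric]) simp
      then show ?thesis by (simp only: sum.distrib) simp
    qed
    also have "real (card ({..<?M} \<inter> ?bad)) \<le> 2 * real K"
    proof -
      have "card ({..<?M} \<inter> ?bad) \<le> card ?bad" by (intro card_mono) auto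
      also have "\<dots> \<le> card {..<K} + card {?M - K..<?M}" by (rule card_Un_le)
      also have "\<dots> \<le> 2 * K" by auto
      finally show ?thesis by linarith
    qed
    finally have "d * real M' \<le> 2 * real K" by (simp add: d_def algebra_simps)
    then show False using M' d by (simp add: field_simps)
  qed
  then have "3 / (4 * real L) \<le> peak_mass K" for K using L(1) by (simp add: field_simps)
  then show ?thesis using L(1) by (intro exI[of _ "3 / (4 * real L)"]) auto
qed

text \<open>
  The half circle and its complement are exchanged by \<open>z \<mapsto> -z\<close>, which commutes with odd powers and
  under which the filter, a function of \<open>z^2\<close>, is invariant.
\<close>

definition half :: "complex \<Rightarrow> bool" where
  "half z \<longleftrightarrow> Re z > 0 \<or> (Re z = 0 \<and> Im z > 0)"

lemma half_uminus: "z \<noteq> 0 \<Longrightarrow> half (- z) \<longleftrightarrow> \<not> half z"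
  by (auto simp: half_def complex_eq_iff)

lemma half_measurable [measurable]: "Measurable.pred borel half"
  unfolding half_def by measurable

text \<open>
  The half is decided at time \<open>N\<close>, where the peak is attained, so that it depends only on the point
  of the orbit and not on the time at which the orbit is entered.
\<close>

definition half_peak :: "bool \<Rightarrow> nat \<Rightarrow> complex \<Rightarrow> real" where
  "half_peak b N z = of_bool (peak N z \<and> (half (z ^ 3 ^ N) \<longleftrightarrow> b))"

lemma bounded_borel_half_peak: "bounded_borel (half_peak b N)"
  unfolding half_peak_def by (rule bounded_borel_of_bool) measurable

lemma half_peak_square: "(half_peak b N z)\<^sup>2 = half_peak b N z" by (simp add: half_peak_def)

lemma riesz_uminus: "riesz n (- z) = riesz n z"
proof -
  have "(- z) ^ 3 ^ i = - (z ^ 3 ^ i)" for i by (intro power_minus_odd) simp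
  then have "filter_prod n (- z) = filter_prod n z" by (simp add: filter_prod_def m0_def)
  then show ?thesis by (simp add: riesz_def abs_filter_def)
qed

definition half_peak_mass :: "bool \<Rightarrow> nat \<Rightarrow> real" where
  "half_peak_mass b N = (LINT z|circle_haar. half_peak b N z * riesz N z)"

lemma bounded_borel_half_peak_riesz: "bounded_borel (\<lambda>z. half_peak b N z * riesz N z)"
  by (intro bounded_borel_mult bounded_borel_half_peak bounded_borel_riesz)

text \<open>
  The map \<open>z \<mapsto> -z\<close> preserves Haar measure, the Riesz products and \<open>peak N\<close>, and exchanges the halves.
\<close>

lemma half_peak_mass_eq: "half_peak_mass b N = peak_mass N / 2"
proof -
  have "half_peak_mass b N = (LINT z|circle_haar. half_peak b N ((-1) * z) * riesz N ((-1) * z))"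
    unfolding half_peak_mass_def
    by (rule circle_haar_rotate[symmetric]) (auto intro: borel_measurable_integrable bounded_borel_integrable bounded_borel_half_peak_riesz)
  also have "\<dots> = half_peak_mass (\<not> b) N"
    unfolding half_peak_mass_def
  proof (rule integral_circle_cong)
    fix z :: complex assume "cmod z = 1"
    then have "z \<noteq> 0" by (metis norm_zero zero_neq_one)
    moreover have "(- z) ^ 3 ^ N = - (z ^ 3 ^ N)" by (intro power_minus_odd) simp
    ultimately have "half ((- z) ^ 3 ^ N) \<longleftrightarrow> \<not> half (z ^ 3 ^ N)" using half_uminus[of "z ^ 3 ^ N"] by auto
    then show "half_peak b N ((-1) * z) * riesz N ((-1) * z) = half_peak (\<not> b) N z * riesz N z"
      by (auto simp: half_peak_def peak_def riesz_uminus)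
  qed
  finally have eq: "half_peak_mass b N = half_peak_mass (\<not> b) N" .
  have "half_peak_mass b N + half_peak_mass (\<not> b) N = (LINT z|circle_haar. half_peak b N z * riesz N z + half_peak (\<not> b) N z * riesz N z)"
    unfolding half_peak_mass_def by (rule Bochner_Integration.integral_add[symmetric]) (intro bounded_borel_integrable bounded_borel_half_peak_riesz)+
  also have "\<dots> = peak_mass N"
    unfolding peak_mass_def by (rule integral_circle_cong) (auto simp: half_peak_def)
  finally show ?thesis using eq by simp
qed

text \<open>
  A peak of radius \<open>l + N\<close> is also a peak of radius \<open>N\<close> at the same position. Dividing by \<open>riesz l z\<close> is
  possible where \<open>riesz (l + N) z\<close> does not vanish.
\<close>

lemma half_peak_pullback:
  assumes "riesz (l + N) z \<noteq> 0" "half_peak b (l + N) z = 1"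
  shows "half_peak b N (z ^ 3 ^ l) = 1"
proof -
  let ?y = "z ^ 3 ^ l"
  have p: "peak (l + N) z" "half (z ^ 3 ^ (l + N)) \<longleftrightarrow> b" using assms(2) by (auto simp: half_peak_def split: if_splits)
  have pos: "riesz l z > 0" using assms(1) riesz_nonneg[of l z] unfolding riesz_add by (cases "riesz l z = 0") auto
  have f: "riesz (l + (N + j)) z \<le> riesz (l + N) z" "riesz (l + (N - j)) z < riesz (l + N) z" if "j \<in> {1..N}" for j
    using p(1) that unfolding peak_def by (auto simp: add.assoc dest: bspec[of _ _ j])
  have "peak N ?y"
    unfolding peak_def
  proof (intro ballI conjI)
    fix j assume j: "j \<in> {1..N}"
    show "riesz (N + j) ?y \<le> riesz N ?y" using f(1)[OF j] pos unfolding riesz_add[of l] by simp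
    show "riesz (N - j) ?y < riesz N ?y" using f(2)[OF j] pos unfolding riesz_add[of l] by simp
  qed
  moreover have "?y ^ 3 ^ N = z ^ 3 ^ (l + N)" by (simp add: power_add power_mult)
  ultimately show ?thesis using p(2) by (simp add: half_peak_def)
qed

text \<open>
  Seen from \<open>z\<close> the two peaks are at the times \<open>l + (N + i)\<close> and \<open>l + (N + j)\<close> of the same orbit, and their distance
  is at most either radius. If \<open>i\<close> and \<open>j\<close> differ, the later peak demands a strict increase that the
  earlier one forbids; if they agree, the point in question is in only one of the halves.
\<close>

lemma half_peak_disjoint:
  assumes N: "i + j \<le> N" and m: "m = l + (N + j)"
  shows "half_peak True (N + i) (z ^ 3 ^ l) * half_peak False m z * riesz m z = 0"
proof (rule ccontr)
  assume "\<not> ?thesis"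
  then have nz: "half_peak True (N + i) (z ^ 3 ^ l) \<noteq> 0" "half_peak False m z \<noteq> 0" "riesz m z \<noteq> 0" by auto
  let ?y = "z ^ 3 ^ l"
  have py: "peak (N + i) ?y" "half (?y ^ 3 ^ (N + i))" using nz(1) by (auto simp: half_peak_def)
  have pz: "peak m z" "\<not> half (z ^ 3 ^ m)" using nz(2) by (auto simp: half_peak_def)
  have pos: "riesz l z > 0" using nz(3) riesz_nonneg[of l z] unfolding m riesz_add[of l] by (cases "riesz l z = 0") auto
  consider "i = j" | "j < i" | "i < j" by linarith
  then show False
  proof cases
    case 1
    then have "?y ^ 3 ^ (N + i) = z ^ 3 ^ m" by (simp add: m power_add power_mult mult_ac flip: power_mult)
    then show False using py pz by simp
  next
    case 2
    define d where "d = i - j"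
    have i: "i = j + d" "d \<ge> 1" using 2 by (auto simp: d_def)
    have "riesz (N + i - d) ?y < riesz (N + i) ?y"
      using py(1) N i unfolding peak_def by (auto dest: bspec[of _ _ d])
    then have "riesz (l + (N + j)) z < riesz (l + (N + j + d)) z"
      using pos unfolding riesz_add[of l] by (simp add: i add.assoc)
    moreover have "riesz (m + d) z \<le> riesz m z"
      using pz(1) N i unfolding peak_def by (auto dest: bspec[of _ _ d] simp: m)
    ultimately show False by (simp add: m add.assoc)
  next
    case 3
    define d where "d = j - i"
    have j: "j = i + d" "d \<ge> 1" using 3 by (auto simp: d_def)
    have "riesz (N + i + d) ?y \<le> riesz (N + i) ?y"
      using py(1) N j unfolding peak_def by (auto dest: bspec[of _ _ d])
    then have "riesz (l + (N + j)) z \<le> riesz (l + (N + i)) z"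
      using pos unfolding riesz_add[of l] by (simp add: j add.assoc)
    moreover have "riesz (m - d) z < riesz m z"
      using pz(1) N j unfolding peak_def by (auto dest: bspec[of _ _ d] simp: m)
    moreover have "m - d = l + (N + i)" by (simp add: m j)
    ultimately show False by (simp add: m)
  qed
qed

section \<open>A nontrivial invariant subspace\<close>

definition half_peak_symbol :: "bool \<Rightarrow> nat \<Rightarrow> complex \<Rightarrow> complex" where
  "half_peak_symbol b N z = of_real (half_peak b N z)"

lemma half_peak_symbol_Linf: "half_peak_symbol b N \<in> circle_Linf"
  unfolding half_peak_symbol_def[abs_def] by (rule bounded_borel_Linf[OF bounded_borel_half_peak])

lemma half_peak_symbol_norm_le:
  assumes "\<xi> \<in> H"
  shows "L2_norm cantor_measure (C.calc (half_peak_symbol b N) \<xi>) \<le> 2 * L2_norm cantor_measure \<xi>"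
  using C.calc_norm_le[OF half_peak_symbol_Linf _ _ assms, of b N 1] by (simp add: half_peak_symbol_def half_peak_def)

lemma half_peak_symbol_phi_norm: "(L2_norm cantor_measure (C.calc (half_peak_symbol b N) ((cantor_U ^^ N) \<phi>)))\<^sup>2 = half_peak_mass b N"
  by (simp add: calc_U_phi_norm[OF half_peak_symbol_Linf] half_peak_symbol_def half_peak_square half_peak_mass_def)

text \<open>
  The vectors that asymptotically have no component in the first halves of the peak sets. The index \<open>j\<close>
  makes the space invariant under \<open>U\<close>, the index \<open>i\<close> under the inverse of \<open>U\<close>.
\<close>

definition inv_space :: "(real \<Rightarrow> complex) set" where
  "inv_space = {\<xi> \<in> H. \<forall>i j. (\<lambda>N. L2_norm cantor_measure (C.calc (half_peak_symbol True (N + i)) ((cantor_U ^^ (N + j)) \<xi>))) \<longlonglongrightarrow> 0}"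

lemma inv_spaceD:
  "\<xi> \<in> inv_space \<Longrightarrow> (\<lambda>N. L2_norm cantor_measure (C.calc (half_peak_symbol True (N + i)) ((cantor_U ^^ (N + j)) \<xi>))) \<longlonglongrightarrow> 0"
  by (simp add: inv_space_def)

lemma inv_space_L2: "\<xi> \<in> inv_space \<Longrightarrow> \<xi> \<in> H" by (simp add: inv_space_def)

lemma calc_half_peak_symbol_L2: "\<xi> \<in> H \<Longrightarrow> C.calc (half_peak_symbol b n) ((cantor_U ^^ k) \<xi>) \<in> H"
  by (intro C.calc_L2 half_peak_symbol_Linf cantor_U_funpow_L2)

lemma real_tendsto_zero_bound:
  fixes f g :: "nat \<Rightarrow> real"
  assumes "\<And>n. 0 \<le> f n" "\<And>n. f n \<le> g n" "g \<longlonglongrightarrow> 0" shows "f \<longlonglongrightarrow> 0"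
  by (rule tendsto_sandwich[OF _ _ tendsto_const assms(3)]) (simp_all add: assms)

lemma L2_closed_subspace_inv_space: "L2_closed_subspace cantor_measure inv_space"
  unfolding L2_closed_subspace_def
proof (intro conjI ballI allI impI)
  show "inv_space \<subseteq> H" by (auto simp: inv_space_def)
  show "(\<lambda>x. 0) \<in> inv_space"
  proof -
    have "L2_norm cantor_measure (C.calc (half_peak_symbol True n) ((cantor_U ^^ k) (\<lambda>x. 0))) = 0" for n k
    proof -
      have "L2_norm cantor_measure (C.calc (half_peak_symbol True n) ((cantor_U ^^ k) (\<lambda>x. 0))) \<le> 2 * L2_norm cantor_measure ((cantor_U ^^ k) (\<lambda>x. 0))"
        by (intro half_peak_symbol_norm_le cantor_U_funpow_L2 L2_zero)
      then show ?thesis using L2_norm_nonneg[of cantor_measure "C.calc (half_peak_symbol True n) ((cantor_U ^^ k) (\<lambda>x. 0))"]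
        by (simp add: cantor_U_funpow_norm L2_zero L2_norm_zero)
    qed
    then show ?thesis by (simp add: inv_space_def L2_zero)
  qed
next
  fix f g a assume f: "f \<in> inv_space" and g: "g \<in> inv_space"
  note L = inv_space_L2[OF f] inv_space_L2[OF g]
  have "(\<lambda>N. L2_norm cantor_measure (C.calc (half_peak_symbol True (N + i)) ((cantor_U ^^ (N + j)) (\<lambda>x. a * f x + g x)))) \<longlonglongrightarrow> 0" for i j
  proof (rule real_tendsto_zero_bound)
    fix N
    let ?P = "C.calc (half_peak_symbol True (N + i))" and ?U = "cantor_U ^^ (N + j)"
    have "?P (?U (\<lambda>x. a * f x + g x)) \<doteq> (\<lambda>x. a * ?P (?U f) x + ?P (?U g) x)"
      unfolding cantor_U_funpow_lincomb
      by (intro L2_operator_lincomb[OF C.calc_operator[OF half_peak_symbol_Linf]] cantor_U_funpow_L2 L)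
    then have "L2_norm cantor_measure (?P (?U (\<lambda>x. a * f x + g x))) = L2_norm cantor_measure (\<lambda>x. a * ?P (?U f) x + ?P (?U g) x)"
      by (intro L2_norm_cong calc_half_peak_symbol_L2 L2_lincomb L)
    also have "\<dots> \<le> cmod a * L2_norm cantor_measure (?P (?U f)) + L2_norm cantor_measure (?P (?U g))"
      by (intro L2_norm_lincomb calc_half_peak_symbol_L2 L)
    finally show "L2_norm cantor_measure (?P (?U (\<lambda>x. a * f x + g x))) \<le> cmod a * L2_norm cantor_measure (?P (?U f)) + L2_norm cantor_measure (?P (?U g))" .
  next
    have "(\<lambda>N. cmod a * L2_norm cantor_measure (C.calc (half_peak_symbol True (N + i)) ((cantor_U ^^ (N + j)) f)) +
       L2_norm cantor_measure (C.calc (half_peak_symbol True (N + i)) ((cantor_U ^^ (N + j)) g))) \<longlonglongrightarrow> cmod a * 0 + 0"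
      by (intro tendsto_intros inv_spaceD f g)
    then show "(\<lambda>N. cmod a * L2_norm cantor_measure (C.calc (half_peak_symbol True (N + i)) ((cantor_U ^^ (N + j)) f)) +
       L2_norm cantor_measure (C.calc (half_peak_symbol True (N + i)) ((cantor_U ^^ (N + j)) g))) \<longlonglongrightarrow> 0" by simp
  qed (rule L2_norm_nonneg)
  then show "(\<lambda>x. a * f x + g x) \<in> inv_space" using L by (simp add: inv_space_def L2_lincomb)
next
  fix F f assume "(\<forall>n. F n \<in> inv_space) \<and> f \<in> H \<and> (\<lambda>n. L2_norm cantor_measure (\<lambda>x. F n x - f x)) \<longlonglongrightarrow> 0"
  then have F: "\<And>n. F n \<in> inv_space" "f \<in> H" "(\<lambda>n. L2_norm cantor_measure (\<lambda>x. F n x - f x)) \<longlonglongrightarrow> 0" by auto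
  have "(\<lambda>N. L2_norm cantor_measure (C.calc (half_peak_symbol True (N + i)) ((cantor_U ^^ (N + j)) f))) \<longlonglongrightarrow> 0" for i j
  proof (rule order_tendstoI)
    fix e :: real assume e: "0 < e"
    have "\<forall>\<^sub>F n in sequentially. L2_norm cantor_measure (\<lambda>x. F n x - f x) < e / 4"
      by (rule order_tendstoD(2)[OF F(3)]) (use e in simp)
    then obtain n where n: "L2_norm cantor_measure (\<lambda>x. F n x - f x) < e / 4" by (auto simp: eventually_sequentially)
    note Fn = inv_space_L2[OF F(1)[of n]]
    have le: "L2_norm cantor_measure (C.calc (half_peak_symbol True k) ((cantor_U ^^ m) f))
      \<le> L2_norm cantor_measure (C.calc (half_peak_symbol True k) ((cantor_U ^^ m) (F n))) + e / 2" for k m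
    proof -
      let ?P = "C.calc (half_peak_symbol True k)" and ?U = "cantor_U ^^ m"
      have "L2_norm cantor_measure (\<lambda>x. ?P (?U f) x - ?P (?U (F n)) x) = L2_norm cantor_measure (?P (\<lambda>x. ?U f x - ?U (F n) x))"
        by (intro L2_operator_norm_diff C.calc_operator half_peak_symbol_Linf cantor_U_funpow_L2 F Fn)
      also have "\<dots> \<le> 2 * L2_norm cantor_measure (\<lambda>x. ?U f x - ?U (F n) x)"
        by (intro half_peak_symbol_norm_le L2_diff cantor_U_funpow_L2 F Fn)
      also have "L2_norm cantor_measure (\<lambda>x. ?U f x - ?U (F n) x) = L2_norm cantor_measure (\<lambda>x. f x - F n x)"
        by (simp only: L2_operator_norm_diff[OF L2_operator_cantor_U_funpow F(2) Fn] cantor_U_funpow_norm[OF L2_diff[OF F(2) Fn]])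
      finally have "L2_norm cantor_measure (\<lambda>x. ?P (?U f) x - ?P (?U (F n)) x) \<le> e / 2"
        using n by (simp add: L2_norm_minus_commute[of cantor_measure f])
      then show ?thesis using L2_norm_le_diff[OF calc_half_peak_symbol_L2[OF F(2), of True k m] calc_half_peak_symbol_L2[OF Fn, of True k m]] by simp
    qed
    have "\<forall>\<^sub>F N in sequentially. L2_norm cantor_measure (C.calc (half_peak_symbol True (N + i)) ((cantor_U ^^ (N + j)) (F n))) < e / 2"
      by (rule order_tendstoD(2)[OF inv_spaceD[OF F(1)]]) (use e in simp)
    then show "\<forall>\<^sub>F N in sequentially. L2_norm cantor_measure (C.calc (half_peak_symbol True (N + i)) ((cantor_U ^^ (N + j)) f)) < e"
      by eventually_elim (use le in \<open>smt (verit) field_sum_of_halves\<close>)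
  next
    fix e :: real assume "e < 0"
    then show "\<forall>\<^sub>F N in sequentially. e < L2_norm cantor_measure (C.calc (half_peak_symbol True (N + i)) ((cantor_U ^^ (N + j)) f))"
      using L2_norm_nonneg less_le_trans by (intro always_eventually) blast
  qed
  then show "f \<in> inv_space" using F(2) by (simp add: inv_space_def)
qed

lemma inv_space_U:
  assumes "\<xi> \<in> inv_space" shows "cantor_U \<xi> \<in> inv_space"
proof -
  have "(cantor_U ^^ n) (cantor_U \<xi>) = (cantor_U ^^ Suc n) \<xi>" for n by (simp add: funpow_swap1)
  then show ?thesis using inv_spaceD[OF assms, of _ "Suc _"] cantor_U_L2[OF inv_space_L2[OF assms]]
    by (simp add: inv_space_def)
qed

lemma inv_space_Uinv:
  assumes "\<xi> \<in> inv_space" shows "cantor_Uinv \<xi> \<in> inv_space"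
proof -
  have e: "(cantor_U ^^ Suc n) (cantor_Uinv \<xi>) = (cantor_U ^^ n) \<xi>" for n
    by (simp only: funpow_Suc_right comp_apply cantor_U_Uinv)
  have "(\<lambda>N. L2_norm cantor_measure (C.calc (half_peak_symbol True (N + i)) ((cantor_U ^^ (N + j)) (cantor_Uinv \<xi>)))) \<longlonglongrightarrow> 0" for i j
  proof (rule LIMSEQ_imp_Suc)
    show "(\<lambda>N. L2_norm cantor_measure (C.calc (half_peak_symbol True (Suc N + i)) ((cantor_U ^^ (Suc N + j)) (cantor_Uinv \<xi>)))) \<longlonglongrightarrow> 0"
      using inv_spaceD[OF assms, of "Suc i" j] by (simp only: add_Suc add_Suc_right e)
  qed
  then show ?thesis using cantor_Uinv_L2[OF inv_space_L2[OF assms]] by (simp add: inv_space_def)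
qed

text \<open>
  \<open>U\<^sup>n f(T) \<xi>\<close> equals \<open>f(z^(3^n))(T) U\<^sup>n \<xi>\<close>, and bounded functions of \<open>T\<close> commute with each other.
\<close>

lemma inv_space_calc:
  assumes \<xi>: "\<xi> \<in> inv_space" and f: "f \<in> circle_Linf" shows "C.calc f \<xi> \<in> inv_space"
proof -
  note L = inv_space_L2[OF \<xi>]
  obtain c where c: "c \<ge> 0" "AE z in circle_haar. cmod (f z) \<le> c" using circle_Linf_bound[OF f] by blast
  have ae: "AE z in circle_haar. cmod (f (z ^ 3 ^ n)) \<le> c" for n
  proof (induction n)
    case (Suc n)
    then have "AE z in distr circle_haar circle_haar (\<lambda>z. z ^ 3). cmod (f (z ^ 3 ^ n)) \<le> c" by (simp only: circle_haar_cube)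
    from AE_distrD[OF measurable_circle_haar_cube this] show ?case by (simp flip: power_mult)
  qed (use c in simp)
  have le: "L2_norm cantor_measure (C.calc (half_peak_symbol True k) ((cantor_U ^^ n) (C.calc f \<xi>)))
      \<le> (c + 1) * L2_norm cantor_measure (C.calc (half_peak_symbol True k) ((cantor_U ^^ n) \<xi>))" for k n
  proof -
    let ?f = "\<lambda>z. f (z ^ 3 ^ n)" and ?P = "C.calc (half_peak_symbol True k)" and ?U = "cantor_U ^^ n"
    note p = calc_power_U[OF f L, of n]
    note f' = conjunct1[OF p] and UL = cantor_U_funpow_L2[OF L, of n]
    have "?P (?U (C.calc f \<xi>)) \<doteq> ?P (C.calc ?f (?U \<xi>))"
      by (intro L2_operator_cong[OF C.calc_operator[OF half_peak_symbol_Linf]] conjunct2[OF p] cantor_U_funpow_L2 C.calc_L2 f f' L)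
    also have "\<dots> \<doteq> C.calc (\<lambda>z. half_peak_symbol True k z * ?f z) (?U \<xi>)"
      by (rule L2_eq_sym[OF C.calc_mult[OF half_peak_symbol_Linf f' UL]])
    also have "(\<lambda>z. half_peak_symbol True k z * ?f z) = (\<lambda>z. ?f z * half_peak_symbol True k z)" by (simp add: mult.commute)
    also have "C.calc \<dots> (?U \<xi>) \<doteq> C.calc ?f (?P (?U \<xi>))" by (rule C.calc_mult[OF f' half_peak_symbol_Linf UL])
    finally have "L2_norm cantor_measure (?P (?U (C.calc f \<xi>))) = L2_norm cantor_measure (C.calc ?f (?P (?U \<xi>)))"
      by (intro L2_norm_cong C.calc_L2 half_peak_symbol_Linf cantor_U_funpow_L2 f f' L)
    also have "\<dots> \<le> (c + 1) * L2_norm cantor_measure (?P (?U \<xi>))"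
      by (rule C.calc_norm_le[OF f' ae c(1) calc_half_peak_symbol_L2[OF L]])
    finally show ?thesis .
  qed
  have "(\<lambda>N. L2_norm cantor_measure (C.calc (half_peak_symbol True (N + i)) ((cantor_U ^^ (N + j)) (C.calc f \<xi>)))) \<longlonglongrightarrow> 0" for i j
  proof (rule real_tendsto_zero_bound[OF L2_norm_nonneg le])
    have "(\<lambda>N. (c + 1) * L2_norm cantor_measure (C.calc (half_peak_symbol True (N + i)) ((cantor_U ^^ (N + j)) \<xi>))) \<longlonglongrightarrow> (c + 1) * 0"
      by (intro tendsto_intros inv_spaceD \<xi>)
    then show "(\<lambda>N. (c + 1) * L2_norm cantor_measure (C.calc (half_peak_symbol True (N + i)) ((cantor_U ^^ (N + j)) \<xi>))) \<longlonglongrightarrow> 0" by simp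
  qed
  then show ?thesis using C.calc_L2[OF f L] by (simp add: inv_space_def)
qed

lemma phi_not_inv_space: "\<phi> \<notin> inv_space"
proof
  assume "\<phi> \<in> inv_space"
  from inv_spaceD[OF this, of 0 0]
  have "(\<lambda>N. (L2_norm cantor_measure (C.calc (half_peak_symbol True N) ((cantor_U ^^ N) \<phi>)))\<^sup>2) \<longlonglongrightarrow> 0\<^sup>2"
    by (intro tendsto_power) simp
  then have lim: "(\<lambda>N. peak_mass N / 2) \<longlonglongrightarrow> 0" by (simp add: half_peak_symbol_phi_norm half_peak_mass_eq)
  obtain c where c: "c > 0" "\<And>K. c \<le> peak_mass K" using peak_mass_lower by blast
  have "c / 2 \<le> 0" by (rule LIMSEQ_le_const[OF lim]) (use c in auto)
  then show False using c by simp
qed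

text \<open>
  The component of \<open>\<phi>\<close> in the second half of the peak set at time \<open>N\<close>.
\<close>

definition peak_vec :: "nat \<Rightarrow> real \<Rightarrow> complex" where
  "peak_vec N = (cantor_Uinv ^^ N) (C.calc (half_peak_symbol False N) ((cantor_U ^^ N) \<phi>))"

lemma peak_vec_L2: "peak_vec N \<in> H"
  unfolding peak_vec_def by (intro cantor_Uinv_funpow_L2 calc_half_peak_symbol_L2 phi_L2)

lemma peak_vec_norm: "(L2_norm cantor_measure (peak_vec N))\<^sup>2 = half_peak_mass False N"
  unfolding peak_vec_def by (simp add: cantor_Uinv_funpow_norm calc_half_peak_symbol_L2 phi_L2 half_peak_symbol_phi_norm)

lemma U_funpow_peak_vec:
  "(cantor_U ^^ (l + k)) (peak_vec k) \<doteq> C.calc (\<lambda>z. half_peak_symbol False k (z ^ 3 ^ l)) ((cantor_U ^^ (l + k)) \<phi>)"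
proof -
  note L = cantor_U_funpow_L2[OF phi_L2, of k]
  have "(cantor_U ^^ (l + k)) (peak_vec k) = (cantor_U ^^ l) (C.calc (half_peak_symbol False k) ((cantor_U ^^ k) \<phi>))"
    unfolding peak_vec_def by (simp only: funpow_add comp_apply cantor_U_Uinv_funpow)
  then show ?thesis using conjunct2[OF calc_power_U[OF half_peak_symbol_Linf L, of False k l]] by (simp only: funpow_add comp_apply)
qed

text \<open>
  The vectors are obtained from \<open>\<phi>\<close> by decreasing projections (\<open>half_peak_pullback\<close>), so the square norm of
  a difference is the difference of the square norms; in particular they converge.
\<close>

lemma peak_vec_diff:
  "(L2_norm cantor_measure (\<lambda>x. peak_vec N x - peak_vec (l + N) x))\<^sup>2 = half_peak_mass False N - half_peak_mass False (l + N)"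
proof -
  let ?M = "l + N"
  let ?g = "\<lambda>z. (-1) * half_peak_symbol False ?M z + half_peak_symbol False N (z ^ 3 ^ l)"
  note pL = conjunct1[OF calc_power_U[OF half_peak_symbol_Linf phi_L2, of False N l]]
  note gL = C.circle_Linf_lincomb[OF half_peak_symbol_Linf pL, of "-1" False ?M]
  note UL = cantor_U_funpow_L2[OF phi_L2, of ?M]
  have "(cantor_U ^^ ?M) (\<lambda>x. (-1) * peak_vec ?M x + peak_vec N x)
      \<doteq> (\<lambda>x. (-1) * C.calc (half_peak_symbol False ?M) ((cantor_U ^^ ?M) \<phi>) x + C.calc (\<lambda>z. half_peak_symbol False N (z ^ 3 ^ l)) ((cantor_U ^^ ?M) \<phi>) x)"
    unfolding cantor_U_funpow_lincomb
    using U_funpow_peak_vec[of 0 ?M] U_funpow_peak_vec[of l N] by (intro L2_eq_lincomb) simp_all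
  also have "\<dots> \<doteq> C.calc ?g ((cantor_U ^^ ?M) \<phi>)"
    by (rule L2_eq_sym[OF C.calc_lincomb[OF half_peak_symbol_Linf pL UL]])
  finally have eq: "(cantor_U ^^ ?M) (\<lambda>x. (-1) * peak_vec ?M x + peak_vec N x) \<doteq> C.calc ?g ((cantor_U ^^ ?M) \<phi>)" .
  have dL: "(\<lambda>x. (-1) * peak_vec ?M x + peak_vec N x) \<in> H" by (intro L2_lincomb peak_vec_L2)
  have "L2_norm cantor_measure (\<lambda>x. peak_vec N x - peak_vec ?M x) = L2_norm cantor_measure (\<lambda>x. (-1) * peak_vec ?M x + peak_vec N x)"
    by simp
  also have "\<dots> = L2_norm cantor_measure ((cantor_U ^^ ?M) (\<lambda>x. (-1) * peak_vec ?M x + peak_vec N x))"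
    by (rule cantor_U_funpow_norm[OF dL, symmetric])
  also have "\<dots> = L2_norm cantor_measure (C.calc ?g ((cantor_U ^^ ?M) \<phi>))"
    by (intro L2_norm_cong eq C.calc_L2 gL UL cantor_U_funpow_L2 dL)
  finally have "(L2_norm cantor_measure (\<lambda>x. peak_vec N x - peak_vec ?M x))\<^sup>2 = (LINT z|circle_haar. (cmod (?g z))\<^sup>2 * riesz ?M z)"
    by (simp only: calc_U_phi_norm[OF gL])
  also have "\<dots> = (LINT z|circle_haar. half_peak False N (z ^ 3 ^ l) * riesz N (z ^ 3 ^ l) * riesz l z - half_peak False ?M z * riesz ?M z)"
  proof (rule integral_circle_cong)
    fix z :: complex
    have b: "half_peak b k y = 0 \<or> half_peak b k y = 1" for b k y by (auto simp: half_peak_def)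
    have "(cmod (?g z))\<^sup>2 = (half_peak False N (z ^ 3 ^ l) - half_peak False ?M z)\<^sup>2"
    proof -
      have "?g z = of_real (half_peak False N (z ^ 3 ^ l) - half_peak False ?M z)" by (simp add: half_peak_symbol_def)
      then show ?thesis by (simp only: norm_of_real power2_abs)
    qed
    \<comment> \<open>where the Riesz product does not vanish, half_peak_pullback makes the difference of the
        indicators equal to 0 or 1, hence equal to its square\<close>
    also have "\<dots> * riesz ?M z = (half_peak False N (z ^ 3 ^ l) - half_peak False ?M z) * riesz ?M z"
      using half_peak_pullback[of l N z False] b[of False N "z ^ 3 ^ l"] b[of False ?M z] by (cases "riesz ?M z = 0") auto
    also have "\<dots> = half_peak False N (z ^ 3 ^ l) * riesz N (z ^ 3 ^ l) * riesz l z - half_peak False ?M z * riesz ?M z"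
      unfolding riesz_add[of l N z] by (simp add: left_diff_distrib right_diff_distrib mult_ac)
    finally show "(cmod (?g z))\<^sup>2 * riesz ?M z = half_peak False N (z ^ 3 ^ l) * riesz N (z ^ 3 ^ l) * riesz l z - half_peak False ?M z * riesz ?M z" .
  qed
  also have "\<dots> = (LINT z|circle_haar. half_peak False N (z ^ 3 ^ l) * riesz N (z ^ 3 ^ l) * riesz l z) - half_peak_mass False ?M"
    unfolding half_peak_mass_def
    by (intro Bochner_Integration.integral_diff bounded_borel_integrable bounded_borel_half_peak_riesz)
       (use bounded_borel_mult[OF bounded_borel_power_arg[OF bounded_borel_half_peak_riesz] bounded_borel_riesz] in simp)
  also have "(LINT z|circle_haar. half_peak False N (z ^ 3 ^ l) * riesz N (z ^ 3 ^ l) * riesz l z) = half_peak_mass False N"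
    unfolding half_peak_mass_def by (rule riesz_transfer[OF bounded_borel_half_peak_riesz]) (simp add: riesz_nonneg half_peak_def)
  finally show ?thesis .
qed

lemma peak_vec_limit: "\<exists>\<xi>\<in>H. L2_lim cantor_measure peak_vec \<xi>"
proof (rule L2_complete[OF peak_vec_L2])
  fix e :: real assume e: "e > 0"
  have mono: "half_peak_mass False (l + N) \<le> half_peak_mass False N" for l N
    using peak_vec_diff[of N l] zero_le_power2[of "L2_norm cantor_measure (\<lambda>x. peak_vec N x - peak_vec (l + N) x)"] by linarith
  have dec: "decseq (half_peak_mass False)" using mono[of 1] by (intro decseq_SucI) simp
  have "0 \<le> half_peak_mass False N" for N
    unfolding half_peak_mass_def by (intro integral_circle_nonneg) (simp add: half_peak_def riesz_nonneg)
  then obtain q where "half_peak_mass False \<longlonglongrightarrow> q" using decseq_convergent[OF dec, of 0] by metis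
  then have "Cauchy (half_peak_mass False)" by (rule LIMSEQ_imp_Cauchy)
  then obtain K where K: "\<And>m n. m \<ge> K \<Longrightarrow> n \<ge> K \<Longrightarrow> \<bar>half_peak_mass False m - half_peak_mass False n\<bar> < e\<^sup>2"
    using e by (metis CauchyD real_norm_def zero_less_power)
  have "L2_norm cantor_measure (\<lambda>x. peak_vec m x - peak_vec n x) < e" if mn: "m \<ge> K" "m \<le> n" for m n
  proof (rule power2_less_imp_less)
    obtain l where l: "n = l + m" using le_add_diff_inverse2[OF mn(2)] by metis
    show "(L2_norm cantor_measure (\<lambda>x. peak_vec m x - peak_vec n x))\<^sup>2 < e\<^sup>2"
      using K[of m n] mn unfolding l peak_vec_diff by auto
  qed (use e in simp)
  then have "L2_norm cantor_measure (\<lambda>x. peak_vec m x - peak_vec n x) < e" if "m \<ge> K" "n \<ge> K" for m n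
    using that L2_norm_minus_commute[of cantor_measure "peak_vec m" "peak_vec n"] by (cases "m \<le> n") (metis nat_le_linear)+
  then show "\<exists>N. \<forall>m\<ge>N. \<forall>n\<ge>N. L2_norm cantor_measure (\<lambda>x. peak_vec m x - peak_vec n x) < e" by blast
qed

text \<open>
  Applying \<open>U\<^sup>l\<close> brings both symbols to the time \<open>m\<close>, where their product vanishes by \<open>half_peak_disjoint\<close>.
\<close>

lemma half_peak_symbol_peak_vec_zero:
  assumes N: "i + j \<le> N" and m: "m = l + (N + j)"
  shows "L2_norm cantor_measure (C.calc (half_peak_symbol True (N + i)) ((cantor_U ^^ (N + j)) (peak_vec m))) = 0"
proof -
  let ?x = "half_peak_symbol True (N + i)" and ?\<zeta> = "(cantor_U ^^ (N + j)) (peak_vec m)"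
  let ?xl = "\<lambda>z. ?x (z ^ 3 ^ l)"
  have \<zeta>: "?\<zeta> \<in> H" by (intro cantor_U_funpow_L2 peak_vec_L2)
  note p = calc_power_U[OF half_peak_symbol_Linf \<zeta>, of True "N + i" l]
  note xl = conjunct1[OF p]
  have xm: "(\<lambda>z. ?xl z * half_peak_symbol False m z) \<in> circle_Linf" by (intro C.circle_Linf_mult xl half_peak_symbol_Linf)
  note UL = cantor_U_funpow_L2[OF phi_L2, of m]
  have Um: "(cantor_U ^^ l) ?\<zeta> = C.calc (half_peak_symbol False m) ((cantor_U ^^ m) \<phi>)"
    unfolding peak_vec_def by (subst (1) m) (simp only: funpow_add[symmetric, THEN fun_cong, unfolded comp_apply] m[symmetric] cantor_U_Uinv_funpow)
  have "L2_norm cantor_measure (C.calc ?x ?\<zeta>) = L2_norm cantor_measure ((cantor_U ^^ l) (C.calc ?x ?\<zeta>))"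
    by (rule cantor_U_funpow_norm[OF C.calc_L2[OF half_peak_symbol_Linf \<zeta>], symmetric])
  also have "\<dots> = L2_norm cantor_measure (C.calc ?xl ((cantor_U ^^ l) ?\<zeta>))"
    by (intro L2_norm_cong conjunct2[OF p] cantor_U_funpow_L2 C.calc_L2 half_peak_symbol_Linf xl \<zeta>)
  also have "\<dots> = L2_norm cantor_measure (C.calc (\<lambda>z. ?xl z * half_peak_symbol False m z) ((cantor_U ^^ m) \<phi>))"
    unfolding Um by (intro L2_norm_cong L2_eq_sym[OF C.calc_mult] C.calc_L2 half_peak_symbol_Linf xl xm UL)
  finally have "(L2_norm cantor_measure (C.calc ?x ?\<zeta>))\<^sup>2 = (LINT z|circle_haar. (cmod (?xl z * half_peak_symbol False m z))\<^sup>2 * riesz m z)"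
    by (simp only: calc_U_phi_norm[OF xm])
  also have "\<dots> = (LINT z|circle_haar. 0)"
  proof (rule integral_circle_cong)
    fix z :: complex
    have "(cmod (?xl z * half_peak_symbol False m z))\<^sup>2 * riesz m z = half_peak True (N + i) (z ^ 3 ^ l) * half_peak False m z * riesz m z"
      by (simp add: half_peak_symbol_def norm_mult power_mult_distrib half_peak_square)
    then show "(cmod (?xl z * half_peak_symbol False m z))\<^sup>2 * riesz m z = 0" using half_peak_disjoint[OF N m] by simp
  qed
  finally show ?thesis by simp
qed

lemma inv_space_nontrivial: "\<exists>\<xi>\<in>inv_space. \<not> L2_eq cantor_measure \<xi> (\<lambda>x. 0)"
proof -
  obtain \<xi> where \<xi>: "\<xi> \<in> H" "L2_lim cantor_measure peak_vec \<xi>" using peak_vec_limit by blast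
  \<comment> \<open>the component is zero from N = i + j on, not only in the limit\<close>
  have zero: "L2_norm cantor_measure (C.calc (half_peak_symbol True (N + i)) ((cantor_U ^^ (N + j)) \<xi>)) = 0" if N: "i + j \<le> N" for i j N
  proof -
    let ?P = "\<lambda>\<eta>. C.calc (half_peak_symbol True (N + i)) ((cantor_U ^^ (N + j)) \<eta>)"
    have "L2_lim cantor_measure (\<lambda>m. (cantor_U ^^ (N + j)) (peak_vec m)) ((cantor_U ^^ (N + j)) \<xi>)"
      by (rule L2_operator_lim[OF L2_operator_cantor_U_funpow peak_vec_L2 \<xi>])
    then have "L2_lim cantor_measure (\<lambda>m. ?P (peak_vec m)) (?P \<xi>)"
      by (intro L2_operator_lim[OF C.calc_operator[OF half_peak_symbol_Linf]] cantor_U_funpow_L2 peak_vec_L2 \<xi>)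
    then have "(\<lambda>m. L2_norm cantor_measure (?P (peak_vec m))) \<longlonglongrightarrow> L2_norm cantor_measure (?P \<xi>)"
      by (intro L2_lim_norm calc_half_peak_symbol_L2 peak_vec_L2 \<xi>)
    moreover have "(\<lambda>m. L2_norm cantor_measure (?P (peak_vec m))) \<longlonglongrightarrow> 0"
    proof (rule tendsto_eventually, rule eventually_sequentiallyI)
      fix m assume "N + j \<le> m"
      then show "L2_norm cantor_measure (?P (peak_vec m)) = 0"
        using half_peak_symbol_peak_vec_zero[OF N, of m "m - (N + j)"] by simp
    qed
    ultimately show ?thesis by (rule LIMSEQ_unique)
  qed
  have "(\<lambda>N. L2_norm cantor_measure (C.calc (half_peak_symbol True (N + i)) ((cantor_U ^^ (N + j)) \<xi>))) \<longlonglongrightarrow> 0" for i j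
    by (rule tendsto_eventually, rule eventually_sequentiallyI[of "i + j"]) (rule zero)
  then have "\<xi> \<in> inv_space" using \<xi>(1) by (simp add: inv_space_def)
  moreover have "\<not> L2_eq cantor_measure \<xi> (\<lambda>x. 0)"
  proof
    assume "L2_eq cantor_measure \<xi> (\<lambda>x. 0)"
    then have "L2_norm cantor_measure \<xi> = 0" using \<xi>(1) by (simp add: L2_norm_eq_0_iff)
    then have "(\<lambda>N. (L2_norm cantor_measure (peak_vec N))\<^sup>2) \<longlonglongrightarrow> 0\<^sup>2"
      using L2_lim_norm[OF peak_vec_L2 \<xi>] by (intro tendsto_power) simp
    then have lim: "(\<lambda>N. peak_mass N / 2) \<longlonglongrightarrow> 0" by (simp add: peak_vec_norm half_peak_mass_eq)
    obtain c where c: "c > 0" "\<And>K. c \<le> peak_mass K" using peak_mass_lower by blast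
    have "c / 2 \<le> 0" by (rule LIMSEQ_le_const[OF lim]) (use c in auto)
    then show False using c by simp
  qed
  ultimately show ?thesis by blast
qed

lemma not_irreducible: "\<not> irreducible_representation cantor_measure cantor_U cantor_rep"
proof
  assume irr: "irreducible_representation cantor_measure cantor_U cantor_rep"
  note eq = L2_closed_subspace_eq[OF L2_closed_subspace_inv_space]
  have "cantor_U \<xi> \<in> inv_space \<and> L2_inv cantor_measure cantor_U \<xi> \<in> inv_space \<and> (\<forall>f\<in>circle_Linf. cantor_rep f \<xi> \<in> inv_space)"
    if \<xi>: "\<xi> \<in> inv_space" for \<xi>
  proof (intro conjI ballI)
    note L = inv_space_L2[OF \<xi>]
    show "cantor_U \<xi> \<in> inv_space" by (rule inv_space_U[OF \<xi>])
    show "L2_inv cantor_measure cantor_U \<xi> \<in> inv_space"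
      by (rule eq[OF inv_space_Uinv[OF \<xi>] L2_inv_cantor_U(1)[OF L] L2_eq_sym[OF L2_inv_cantor_U(2)[OF L]]])
    show "cantor_rep f \<xi> \<in> inv_space" if f: "f \<in> circle_Linf" for f
      by (rule eq[OF inv_space_calc[OF \<xi> f] cantor_rep_L2[OF f L] L2_eq_sym[OF cantor_rep_eq_calc[OF f L]]])
  qed
  then have "inv_space = {\<xi> \<in> H. L2_eq cantor_measure \<xi> (\<lambda>x. 0)} \<or> inv_space = H"
    using irr L2_closed_subspace_inv_space unfolding irreducible_representation_def by blast
  then show False using inv_space_nontrivial phi_not_inv_space phi_L2 by blast
qed

theorem mainTheorem2:
  shows "L2_unitary cantor_measure cantor_U
    \<and> L2_unitary cantor_measure cantor_T
    \<and> (\<forall>f\<in>circle_Linf. is_L2_calculus cantor_measure cantor_T f (cantor_rep f))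
    \<and> wavelet_representation (\<lambda>z. (1 + z\<^sup>2) / of_real (sqrt 2))
         cantor_measure cantor_U cantor_rep (indicator cantor_set)
    \<and> \<not> irreducible_representation cantor_measure cantor_U cantor_rep"
  using L2_unitary_cantor_U L2_unitary_cantor_T cantor_rep_calculus wavelet_representation_cantor not_irreducible
  unfolding m0_def[abs_def] by blast

end
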